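(* Let $D$ and $n$ be as in the context. Let $(\eta_m)_{m\in\mathbb{N}}$ be admissible conductivities (in the sense of the context) with $\|\eta_m\|_{L^\infty(\partial D)}\to0$, and for each $m$ let $(k_{\eta_m},u_{\eta_m})\in\mathbb{R}^+\times \big(H^2(D)\cap H^1_0(D)\big)$ be an eigenpair for $\eta_m$ with $\|u_{\eta_m}\|_{H^1(D)}=1$. If the sequence $(k_{\eta_m})_m$ is bounded, then there is a subsequence along which $k_{\eta_m}\to k_0$ and $u_{\eta_m}$ converges weakly to $u_0$ in $H^2(D)$, where $(k_0,u_0)\in\mathbb{R}^+\times H^2_0(D)$ is an eigenpair for $\eta=0$.
   Context: Let $d\in\{2,3\}$ and let $D\subset\mathbb{R}^d$ be a bounded simply connected open set with $\mathcal{C}^2$ boundary and unit outward normal $\nu$. The refractive index $n\in L^\infty(D)$ is real-valued with $n_{min}=\operatorname{ess\,inf}_D n>1$. An admissible conductivity is a real-valued $\eta\in L^\infty(\partial D)$ with $\operatorname{ess\,inf}_{\partial D}\eta>0$. $H^2(D)\cap H^1_0(D)=\{u\in H^2(D):u=0\text{ on }\partial D\}$ and $H^2_0(D)=\{u\in H^2(D):u=\partial_\nu u=0\text{ on }\partial D\}$, both with the $H^2(D)$ norm. $\mathbb{R}^+=(0,\infty)$. For $k>0$ define $$\mathcal{A}_{0,k}(u,\varphi)=\int_D\frac{1}{n-1}(\Delta u+k^2u)(\Delta\overline\varphi+k^2\overline\varphi)+k^4u\overline\varphi\,dx,\qquad \mathcal{B}(u,\varphi)=\int_D\nabla u\cdot\nabla\overline\varphi\,dx,$$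 and, for an admissible conductivity $\eta$, $$\mathcal{A}_{\eta,k}(u,\varphi)=\mathcal{A}_{0,k}(u,\varphi)+\int_{\partial D}\frac{k^2}{\eta}\frac{\partial u}{\partial\nu}\frac{\partial\overline\varphi}{\partial\nu}\,ds.$$ For an admissible $\eta$, $(k_\eta,u_\eta)\in\mathbb{R}^+\times (H^2(D)\cap H^1_0(D))$ with $u_\eta\ne0$ is an eigenpair for $\eta$ if $\mathcal{A}_{\eta,k_\eta}(u_\eta,\varphi)-k_\eta^2\mathcal{B}(u_\eta,\varphi)=0$ for all $\varphi\in H^2(D)\cap H^1_0(D)$. $(k_0,u_0)\in\mathbb{R}^+\times H^2_0(D)$ with $u_0\neq0$ is an eigenpair for $\eta=0$ if $\mathcal{A}_{0,k_0}(u_0,\varphi)-k_0^2\mathcal{B}(u_0,\varphi)=0$ for all $\varphi\in H^2_0(D)$. *)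

theory Defs
  imports "HOL-Analysis.Analysis" "HOL-Probability.Essential_Supremum"
begin

section \<open>Functions of class C^k on the whole space\<close>

primrec Ck :: "nat \<Rightarrow> ('a::euclidean_space \<Rightarrow> 'b::real_normed_vector) \<Rightarrow> bool" where
  "Ck 0 f \<longleftrightarrow> continuous_on UNIV f"
| "Ck (Suc k) f \<longleftrightarrow> (\<forall>x. f differentiable (at x)) \<and>
     (\<forall>b\<in>Basis. Ck k (\<lambda>x. frechet_derivative f (at x) b))"

definition smooth :: "('a::euclidean_space \<Rightarrow> 'b::real_normed_vector) \<Rightarrow> bool" where
  "smooth f \<longleftrightarrow> (\<forall>k. Ck k f)"

definition test_function :: "'a::euclidean_space set \<Rightarrow> ('a \<Rightarrow> real) \<Rightarrow> bool" where
  "test_function D \<phi> \<longleftrightarrow> smooth \<phi> \<and>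
     compact (closure {x. \<phi> x \<noteq> 0}) \<and> closure {x. \<phi> x \<noteq> 0} \<subseteq> D"


section \<open>Surface measure\<close>

text \<open>Hausdorff measure of integer dimension \<open>s > 0\<close>, normalised to agree with the
  \<open>s\<close>-dimensional Lebesgue measure on \<open>s\<close>-planes. (For \<open>s = 0\<close> the convention
  \<open>0 ^ 0 = 1\<close> charges empty covering sets; this case is not used.)\<close>

definition hausdorff_premeasure :: "nat \<Rightarrow> real \<Rightarrow> 'a::metric_space set \<Rightarrow> ennreal" where
  "hausdorff_premeasure s \<delta> A =
     (INF U \<in> {U :: nat \<Rightarrow> 'a set. A \<subseteq> (\<Union>i. U i) \<and> (\<forall>i. bounded (U i) \<and> diameter (U i) \<le> \<delta>)}.
        \<Sum>i. ennreal (unit_ball_vol (real s) * (diameter (U i) / 2) ^ s))"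

definition hausdorff_outer :: "nat \<Rightarrow> 'a::metric_space set \<Rightarrow> ennreal" where
  "hausdorff_outer s A = (SUP \<delta> \<in> {0<..}. hausdorff_premeasure s \<delta> A)"

definition hausdorff_measure :: "nat \<Rightarrow> 'a::metric_space measure" where
  "hausdorff_measure s =
     measure_of UNIV (lambda_system UNIV UNIV (hausdorff_outer s)) (hausdorff_outer s)"

text \<open>\<open>hausdorff_outer s\<close> is an outer measure, so by Caratheodory's theorem
  \<open>hausdorff_measure s\<close> takes the intended values.\<close>

lemma outer_measure_space_hausdorff_outer:
  assumes s: "s > 0"
  shows "outer_measure_space (UNIV :: 'a::metric_space set set) (hausdorff_outer s)"
proof -
  define f where "f = (\<lambda>U::'a set. ennreal (unit_ball_vol (real s) * (diameter U / 2) ^ s))"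
  define Cov where "Cov = (\<lambda>\<delta> (A::'a set). {U :: nat \<Rightarrow> 'a set. A \<subseteq> (\<Union>i. U i) \<and>
    (\<forall>i. bounded (U i) \<and> diameter (U i) \<le> \<delta>)})"
  have pre: "hausdorff_premeasure s \<delta> A = (INF U \<in> Cov \<delta> A. \<Sum>i. f (U i))" for \<delta> and A :: "'a set"
    by (simp add: hausdorff_premeasure_def f_def Cov_def)
  have empty: "hausdorff_premeasure s \<delta> ({}::'a set) = 0" if "\<delta> > 0" for \<delta>
  proof -
    have "hausdorff_premeasure s \<delta> ({}::'a set) \<le> (\<Sum>i. f {})"
      unfolding pre using that by (intro INF_lower2[of "\<lambda>_. {}"]) (auto simp: Cov_def)
    also have "\<dots> = 0" using s by (simp add: f_def power_0_left)
    finally show ?thesis by simp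
  qed
  have mono: "hausdorff_premeasure s \<delta> A \<le> hausdorff_premeasure s \<delta> B"
    if "A \<subseteq> B" for \<delta> and A B :: "'a set"
    unfolding pre using that by (intro INF_superset_mono) (auto simp: Cov_def)
  have sub: "hausdorff_premeasure s \<delta> (\<Union>i. A i) \<le> (\<Sum>n. hausdorff_premeasure s \<delta> (A n))"
    for \<delta> and A :: "nat \<Rightarrow> 'a set"
  proof (rule ennreal_le_epsilon)
    fix e :: real
    assume e: "0 < e" and fin: "(\<Sum>n. hausdorff_premeasure s \<delta> (A n)) < top"
    have "hausdorff_premeasure s \<delta> (A n) < hausdorff_premeasure s \<delta> (A n) + e * (1/2) ^ Suc n" for n
      using e fin by (auto simp: less_top dest!: ennreal_suminf_lessD)
    then have "\<exists>U \<in> Cov \<delta> (A n).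
        (\<Sum>i. f (U i)) < hausdorff_premeasure s \<delta> (A n) + e * (1/2) ^ Suc n" for n
      unfolding pre INF_less_iff by simp
    then obtain B where B: "\<And>n. B n \<in> Cov \<delta> (A n)"
      and B': "\<And>n. (\<Sum>i. f (B n i)) < hausdorff_premeasure s \<delta> (A n) + e * (1/2) ^ Suc n"
      by metis
    define C where "C = case_prod B \<circ> prod_decode"
    have "C \<in> Cov \<delta> (\<Union>i. A i)"
    proof -
      have "x \<in> (\<Union>i. C i)" if x: "x \<in> A n" for x n
      proof -
        obtain i where "x \<in> B n i" using B[of n] x by (auto simp: Cov_def)
        then have "x \<in> C (prod_encode (n, i))" by (simp add: C_def)
        then show ?thesis by blast
      qed
      moreover have "bounded (C i) \<and> diameter (C i) \<le> \<delta>" for i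
        using B[of "fst (prod_decode i)"] by (simp add: Cov_def C_def case_prod_beta)
      ultimately show ?thesis by (auto simp: Cov_def)
    qed
    then have "hausdorff_premeasure s \<delta> (\<Union>i. A i) \<le> (\<Sum>i. f (C i))"
      unfolding pre by (rule INF_lower)
    also have "\<dots> = (\<Sum>n. \<Sum>i. f (B n i))"
    proof -
      have "(\<lambda>i. f (C i)) = (\<lambda>(n, i). f (B n i)) \<circ> prod_decode"
        by (simp add: C_def fun_eq_iff case_prod_beta)
      then show ?thesis
        using suminf_ennreal_2dimen[of "\<lambda>n. \<Sum>i. f (B n i)" "case_prod (\<lambda>n i. f (B n i))"]
        by (simp only: o_def split_conv)
    qed
    also have "\<dots> \<le> (\<Sum>n. hausdorff_premeasure s \<delta> (A n) + e * (1/2) ^ Suc n)"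
      by (intro suminf_le less_imp_le B' summableI)
    also have "\<dots> = (\<Sum>n. hausdorff_premeasure s \<delta> (A n)) + (\<Sum>n. ennreal (e * (1/2) ^ Suc n))"
      by (intro suminf_add[symmetric] summableI)
    also have "(\<Sum>n. ennreal (e * (1/2) ^ Suc n)) = ennreal e"
      using e sums_mult[OF power_half_series, of e]
      by (intro suminf_ennreal_eq) simp_all
    finally show "hausdorff_premeasure s \<delta> (\<Union>i. A i) \<le> (\<Sum>n. hausdorff_premeasure s \<delta> (A n)) + ennreal e" .
  qed
  show ?thesis
    unfolding outer_measure_space_def positive_def increasing_def countably_subadditive_def
      hausdorff_outer_def
  proof (intro conjI ballI allI impI)
    show "(SUP \<delta>\<in>{0<..}. hausdorff_premeasure s \<delta> ({}::'a set)) = 0"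
      by (auto simp: empty intro!: antisym SUP_least)
  next
    fix A B :: "'a set" assume "A \<subseteq> B"
    then show "(SUP \<delta>\<in>{0<..}. hausdorff_premeasure s \<delta> A)
      \<le> (SUP \<delta>\<in>{0<..}. hausdorff_premeasure s \<delta> B)"
      by (intro SUP_mono) (auto intro: mono)
  next
    fix A :: "nat \<Rightarrow> 'a set"
    show "(SUP \<delta>\<in>{0<..}. hausdorff_premeasure s \<delta> (\<Union>i. A i))
      \<le> (\<Sum>i. SUP \<delta>\<in>{0<..}. hausdorff_premeasure s \<delta> (A i))"
    proof (rule SUP_least)
      fix \<delta> :: real assume "\<delta> \<in> {0<..}"
      then show "hausdorff_premeasure s \<delta> (\<Union>i. A i)
        \<le> (\<Sum>i. SUP \<delta>\<in>{0<..}. hausdorff_premeasure s \<delta> (A i))"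
        by (intro order_trans[OF sub] suminf_le summableI SUP_upper)
    qed
  qed
qed

lemma
  assumes "s > 0"
  shows sets_hausdorff_measure:
      "sets (hausdorff_measure s :: 'a::metric_space measure)
         = lambda_system UNIV UNIV (hausdorff_outer s)"
    and emeasure_hausdorff_measure:
      "A \<in> lambda_system UNIV UNIV (hausdorff_outer s)
         \<Longrightarrow> emeasure (hausdorff_measure s) (A :: 'a set) = hausdorff_outer s A"
proof -
  interpret sigma_algebra UNIV "UNIV :: 'a set set"
    using sigma_algebra_Pow[of "UNIV :: 'a set"] by simp
  have ms: "measure_space UNIV (lambda_system UNIV UNIV (hausdorff_outer s))
      (hausdorff_outer s :: 'a set \<Rightarrow> ennreal)"
    by (rule caratheodory_lemma[OF outer_measure_space_hausdorff_outer[OF assms]])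
  then interpret L: sigma_algebra UNIV
    "lambda_system UNIV UNIV (hausdorff_outer s :: 'a set \<Rightarrow> ennreal)"
    by (simp add: measure_space_def)
  show "sets (hausdorff_measure s :: 'a measure) = lambda_system UNIV UNIV (hausdorff_outer s)"
    by (simp add: hausdorff_measure_def L.sigma_sets_eq)
  show "emeasure (hausdorff_measure s) A = hausdorff_outer s A"
    if "A \<in> lambda_system UNIV UNIV (hausdorff_outer s)" for A :: "'a set"
    using ms that emeasure_measure_of_sigma[of UNIV _ "hausdorff_outer s" A]
    by (simp add: hausdorff_measure_def measure_space_def)
qed

definition surface_measure :: "'a::euclidean_space set \<Rightarrow> 'a measure" where
  "surface_measure D = restrict_space (hausdorff_measure (DIM('a) - 1)) (frontier D)"


section \<open>C^2 boundary and outward normal\<close>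

text \<open>Near \<open>x\<close> the set \<open>D\<close> is the subgraph of a C^2 function in the unit direction \<open>e\<close>. A function
  on the hyperplane orthogonal to \<open>e\<close> is given by a function \<open>\<gamma>\<close> on the whole space, evaluated
  at the orthogonal projection onto that hyperplane.\<close>

definition height_above_graph :: "'a::euclidean_space \<Rightarrow> ('a \<Rightarrow> real) \<Rightarrow> 'a \<Rightarrow> real" where
  "height_above_graph e \<gamma> y = y \<bullet> e - \<gamma> (y - (y \<bullet> e) *\<^sub>R e)"

definition C2_graph_near ::
    "'a::euclidean_space set \<Rightarrow> 'a \<Rightarrow> 'a \<Rightarrow> ('a \<Rightarrow> real) \<Rightarrow> bool" where
  "C2_graph_near D x e \<gamma> \<longleftrightarrow> norm e = 1 \<and> Ck 2 \<gamma> \<and>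
     (\<exists>r>0. D \<inter> ball x r = {y \<in> ball x r. height_above_graph e \<gamma> y < 0})"

definition C2_boundary :: "'a::euclidean_space set \<Rightarrow> bool" where
  "C2_boundary D \<longleftrightarrow> (\<forall>x\<in>frontier D. \<exists>e \<gamma>. C2_graph_near D x e \<gamma>)"

definition outward_normal :: "'a::euclidean_space set \<Rightarrow> 'a \<Rightarrow> 'a" where
  "outward_normal D x = (THE \<nu>. \<exists>e \<gamma> v. C2_graph_near D x e \<gamma> \<and>
     (GDERIV (height_above_graph e \<gamma>) x :> v) \<and> \<nu> = sgn v)"


section \<open>Lebesgue spaces\<close>

text \<open>Elements of function spaces are represented by functions, identified when equal almost
  everywhere; values outside the domain are irrelevant.\<close>

definition L2 :: "'a measure \<Rightarrow> ('a \<Rightarrow> complex) set" where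
  "L2 M = {u \<in> borel_measurable M. integrable M (\<lambda>x. (cmod (u x))\<^sup>2)}"

definition L2_nrm :: "'a measure \<Rightarrow> ('a \<Rightarrow> complex) \<Rightarrow> real" where
  "L2_nrm M u = sqrt (\<integral>x. (cmod (u x))\<^sup>2 \<partial>M)"

definition Linf_nrm :: "'a measure \<Rightarrow> ('a \<Rightarrow> real) \<Rightarrow> ereal" where
  "Linf_nrm M f = esssup M (\<lambda>x. ereal \<bar>f x\<bar>)"

definition Linf :: "'a measure \<Rightarrow> ('a \<Rightarrow> real) set" where
  "Linf M = {f \<in> borel_measurable M. Linf_nrm M f < \<infinity>}"

definition essinf :: "'a measure \<Rightarrow> ('a \<Rightarrow> real) \<Rightarrow> ereal" where
  "essinf M f = - esssup M (\<lambda>x. - ereal (f x))"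


section \<open>Sobolev spaces\<close>

definition has_weak_deriv ::
    "'a::euclidean_space set \<Rightarrow> 'a \<Rightarrow> ('a \<Rightarrow> complex) \<Rightarrow> ('a \<Rightarrow> complex) \<Rightarrow> bool" where
  "has_weak_deriv D b u v \<longleftrightarrow> u \<in> L2 (lebesgue_on D) \<and> v \<in> L2 (lebesgue_on D) \<and>
     (\<forall>\<phi>. test_function D \<phi> \<longrightarrow>
        (\<integral>x. u x * complex_of_real (frechet_derivative \<phi> (at x) b) \<partial>lebesgue_on D)
        = - (\<integral>x. v x * complex_of_real (\<phi> x) \<partial>lebesgue_on D))"

definition wderiv ::
    "'a::euclidean_space set \<Rightarrow> 'a \<Rightarrow> ('a \<Rightarrow> complex) \<Rightarrow> 'a \<Rightarrow> complex" where
  "wderiv D b u = (SOME v. has_weak_deriv D b u v)"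

definition H1 :: "'a::euclidean_space set \<Rightarrow> ('a \<Rightarrow> complex) set" where
  "H1 D = {u \<in> L2 (lebesgue_on D). \<forall>b\<in>Basis. \<exists>v. has_weak_deriv D b u v}"

definition H2 :: "'a::euclidean_space set \<Rightarrow> ('a \<Rightarrow> complex) set" where
  "H2 D = {u \<in> H1 D. \<forall>b\<in>Basis. wderiv D b u \<in> H1 D}"

definition H1_nrm :: "'a::euclidean_space set \<Rightarrow> ('a \<Rightarrow> complex) \<Rightarrow> real" where
  "H1_nrm D u = sqrt ((L2_nrm (lebesgue_on D) u)\<^sup>2
     + (\<Sum>b\<in>Basis. (L2_nrm (lebesgue_on D) (wderiv D b u))\<^sup>2))"

definition H2_nrm :: "'a::euclidean_space set \<Rightarrow> ('a \<Rightarrow> complex) \<Rightarrow> real" where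
  "H2_nrm D u = sqrt ((H1_nrm D u)\<^sup>2
     + (\<Sum>b\<in>Basis. \<Sum>c\<in>Basis. (L2_nrm (lebesgue_on D) (wderiv D c (wderiv D b u)))\<^sup>2))"

definition laplacian :: "'a::euclidean_space set \<Rightarrow> ('a \<Rightarrow> complex) \<Rightarrow> 'a \<Rightarrow> complex" where
  "laplacian D u x = (\<Sum>b\<in>Basis. wderiv D b (wderiv D b u) x)"

text \<open>The trace is the continuous extension to \<open>H1 D\<close> of the restriction of smooth functions
  to the boundary.\<close>

definition has_trace ::
    "'a::euclidean_space set \<Rightarrow> ('a \<Rightarrow> complex) \<Rightarrow> ('a \<Rightarrow> complex) \<Rightarrow> bool" where
  "has_trace D u g \<longleftrightarrow> u \<in> H1 D \<and> g \<in> L2 (surface_measure D) \<and>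
     (\<exists>w :: nat \<Rightarrow> 'a \<Rightarrow> complex. (\<forall>j. smooth (w j)) \<and>
        (\<lambda>j. H1_nrm D (\<lambda>x. w j x - u x)) \<longlonglongrightarrow> 0 \<and>
        (\<lambda>j. L2_nrm (surface_measure D) (\<lambda>x. w j x - g x)) \<longlonglongrightarrow> 0)"

definition trace :: "'a::euclidean_space set \<Rightarrow> ('a \<Rightarrow> complex) \<Rightarrow> 'a \<Rightarrow> complex" where
  "trace D u = (SOME g. has_trace D u g)"

definition normal_deriv :: "'a::euclidean_space set \<Rightarrow> ('a \<Rightarrow> complex) \<Rightarrow> 'a \<Rightarrow> complex" where
  "normal_deriv D u x =
     (\<Sum>b\<in>Basis. complex_of_real (outward_normal D x \<bullet> b) * trace D (wderiv D b u) x)"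

definition H2_cap_H10 :: "'a::euclidean_space set \<Rightarrow> ('a \<Rightarrow> complex) set" where
  "H2_cap_H10 D = {u \<in> H2 D. AE x in surface_measure D. trace D u x = 0}"

definition H20 :: "'a::euclidean_space set \<Rightarrow> ('a \<Rightarrow> complex) set" where
  "H20 D = {u \<in> H2 D. (AE x in surface_measure D. trace D u x = 0) \<and>
                      (AE x in surface_measure D. normal_deriv D u x = 0)}"

definition H2_functional ::
    "'a::euclidean_space set \<Rightarrow> (('a \<Rightarrow> complex) \<Rightarrow> complex) \<Rightarrow> bool" where
  "H2_functional D l \<longleftrightarrow>
     (\<forall>u\<in>H2 D. \<forall>v\<in>H2 D. l (\<lambda>x. u x + v x) = l u + l v) \<and>
     (\<forall>u\<in>H2 D. \<forall>c. l (\<lambda>x. c * u x) = c * l u) \<and>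
     (\<exists>C. \<forall>u\<in>H2 D. cmod (l u) \<le> C * H2_nrm D u)"

definition H2_weakly_converges ::
    "'a::euclidean_space set \<Rightarrow> (nat \<Rightarrow> 'a \<Rightarrow> complex) \<Rightarrow> ('a \<Rightarrow> complex) \<Rightarrow> bool" where
  "H2_weakly_converges D u v \<longleftrightarrow> (\<forall>m. u m \<in> H2 D) \<and> v \<in> H2 D \<and>
     (\<forall>l. H2_functional D l \<longrightarrow> (\<lambda>m. l (u m)) \<longlonglongrightarrow> l v)"


section \<open>The transmission eigenvalue problem\<close>

definition form_A0 ::
    "'a::euclidean_space set \<Rightarrow> ('a \<Rightarrow> real) \<Rightarrow> real \<Rightarrow> ('a \<Rightarrow> complex) \<Rightarrow> ('a \<Rightarrow> complex) \<Rightarrow> complex"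
  where
  "form_A0 D n k u \<phi> =
     (\<integral>x. complex_of_real (1 / (n x - 1))
            * (laplacian D u x + complex_of_real (k\<^sup>2) * u x)
            * (cnj (laplacian D \<phi> x) + complex_of_real (k\<^sup>2) * cnj (\<phi> x))
          + complex_of_real (k ^ 4) * u x * cnj (\<phi> x) \<partial>lebesgue_on D)"

definition form_B ::
    "'a::euclidean_space set \<Rightarrow> ('a \<Rightarrow> complex) \<Rightarrow> ('a \<Rightarrow> complex) \<Rightarrow> complex" where
  "form_B D u \<phi> =
     (\<integral>x. (\<Sum>b\<in>Basis. wderiv D b u x * cnj (wderiv D b \<phi> x)) \<partial>lebesgue_on D)"

definition form_A ::
    "'a::euclidean_space set \<Rightarrow> ('a \<Rightarrow> real) \<Rightarrow> ('a \<Rightarrow> real) \<Rightarrow> real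
      \<Rightarrow> ('a \<Rightarrow> complex) \<Rightarrow> ('a \<Rightarrow> complex) \<Rightarrow> complex" where
  "form_A D n \<eta> k u \<phi> = form_A0 D n k u \<phi>
     + (\<integral>x. complex_of_real (k\<^sup>2 / \<eta> x) * normal_deriv D u x * cnj (normal_deriv D \<phi> x)
          \<partial>surface_measure D)"

definition admissible :: "'a::euclidean_space set \<Rightarrow> ('a \<Rightarrow> real) \<Rightarrow> bool" where
  "admissible D \<eta> \<longleftrightarrow> \<eta> \<in> Linf (surface_measure D) \<and> essinf (surface_measure D) \<eta> > 0"

definition eigenpair ::
    "'a::euclidean_space set \<Rightarrow> ('a \<Rightarrow> real) \<Rightarrow> ('a \<Rightarrow> real) \<Rightarrow> real \<Rightarrow> ('a \<Rightarrow> complex) \<Rightarrow> bool" where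
  "eigenpair D n \<eta> k u \<longleftrightarrow> k > 0 \<and> u \<in> H2_cap_H10 D \<and>
     \<not> (AE x in lebesgue_on D. u x = 0) \<and>
     (\<forall>\<phi>\<in>H2_cap_H10 D. form_A D n \<eta> k u \<phi> - complex_of_real (k\<^sup>2) * form_B D u \<phi> = 0)"

definition eigenpair0 ::
    "'a::euclidean_space set \<Rightarrow> ('a \<Rightarrow> real) \<Rightarrow> real \<Rightarrow> ('a \<Rightarrow> complex) \<Rightarrow> bool" where
  "eigenpair0 D n k u \<longleftrightarrow> k > 0 \<and> u \<in> H20 D \<and>
     \<not> (AE x in lebesgue_on D. u x = 0) \<and>
     (\<forall>\<phi>\<in>H20 D. form_A0 D n k u \<phi> - complex_of_real (k\<^sup>2) * form_B D u \<phi> = 0)"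

end

theory Submission
  imports Defs "HOL-Library.Diagonal_Subsequence"
begin

text \<open>Testing the equation with \<open>u m\<close> itself gives an energy identity which bounds the Laplacian of \<open>u m\<close> in
 L2 and the squared L2 norm of its normal derivative by \<open>Linf_nrm (surface_measure D) (\<eta> m)\<close>, so the normal
 derivatives tend to 0. For functions with zero boundary values the Hessian is controlled by the
 Laplacian up to lower order terms: the difference consists of null Lagrangians, localized by a
 partition of unity, and at the boundary the gradient is parallel to the normal up to a field with zero
 boundary values. Hence \<open>u m\<close> is bounded in H2 and has a weakly convergent subsequence, along which it
 converges strongly in L2. As the squared L2 norm of the gradient is at most the product of those of \<open>u\<close> and
 its Laplacian, neither \<open>k m\<close> nor \<open>u m\<close> can tend to 0 while the H1 norm is 1. All statements about traces come from
 comparing the Hausdorff measure on a piece of a graph with the volume of thin layers below it.\<close>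

text \<open>Three obstacles shape the development. The boundary weight \<open>k^2 / \<eta>\<close>
  blows up. The limit problem does not see it, since test functions from \<open>H20\<close> have
  vanishing normal derivative; what remains is linear in \<open>u m\<close> against a fixed test
  function, so weak convergence suffices to pass to the limit. Next, the boundary is only C^2 and
  \<open>u\<close> only lies in H2: cutoffs built from the height of the graph are just C1, and
  smooth approximations of \<open>u\<close> would have to keep the zero boundary values. The second
  order estimate therefore works with weak derivatives of \<open>u\<close> directly, tested with C1
  functions. Finally, traces refer to Hausdorff measure, and two inequalities up to constants take
  the place of the divergence theorem: one bounds a surface integral by a gradient integral and
  makes traces exist; the other bounds the integral of a derivative by a surface integral and turns
  a zero trace into a weakly differentiable extension by zero. That extension property,
  \<open>H10\<close>, carries all the analysis inside \<open>D\<close>.\<close>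

notation LIMSEQ ("((_)/ ----> (_))" [60, 60] 60)

section \<open>Calculus of C^k functions in terms of partial derivatives\<close>

abbreviation pd :: "'a::euclidean_space => ('a => 'b::real_normed_vector) => 'a => 'b" where
 "pd b f \<equiv> %x. frechet_derivative f (at x) b"

lemma pd_eqI: "(f has_derivative f') (at x) ==> pd b f x = f' b"
 by (simp add: frechet_derivative_at[symmetric])

lemma CkI:
 assumes "!!x. (f has_derivative f' x) (at x)" "!!b. b : Basis ==> Ck k (%x. f' x b)"
 shows "Ck (Suc k) f"
 using assms by (auto simp: differentiable_def pd_eqI[OF assms(1)])

lemma Ck_SucD: "Ck (Suc k) f ==> (f has_derivative frechet_derivative f (at x)) (at x)"
 by (simp add: frechet_derivative_works)

lemma Ck_continuous: "Ck k f ==> continuous_on UNIV f"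
proof (cases k)
 case (Suc j)
 thus "Ck k f ==> ?thesis"
  by (auto intro!: differentiable_imp_continuous_on simp: differentiable_on_def)
qed simp

lemma Ck_Suc_imp: "Ck (Suc k) f ==> Ck k f"
proof (induction k arbitrary: f)
 case 0 thus ?case using Ck_continuous by fastforce
next
 case (Suc k) thus ?case by (metis Ck.simps(2))
qed

lemma Ck_antimono: "Ck k f ==> j <= k ==> Ck j f"
proof (induction k)
 case (Suc k)
 thus ?case using Ck_Suc_imp by (cases "j = Suc k") force+
qed simp

lemma Ck_pd: "Ck (Suc k) f ==> b : Basis ==> Ck k (pd b f)"
 by simp

lemma Ck_const [intro, simp]: "Ck k (%x. c)"
proof (induction k arbitrary: c)
 case (Suc k)
 show ?case by (rule CkI[where f'="%x b. 0"]) (auto simp: Suc.IH)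
qed simp

lemma Ck_linear:
 assumes "bounded_linear f" shows "Ck k f"
proof (cases k)
 case 0 thus ?thesis using assms by (simp add: linear_continuous_on)
next
 case (Suc j)
 show ?thesis unfolding Suc
  by (rule CkI[where f'="%x. f"]) (use assms in "auto intro: bounded_linear_imp_has_derivative")
qed

lemma Ck_linear_comp:
 assumes "bounded_linear T" "Ck k f" shows "Ck k (%x. T (f x))"
 using assms(2)
proof (induction k arbitrary: f)
 case 0 thus ?case using assms(1)
  by (auto intro!: bounded_linear.continuous_on[OF assms(1)])
next
 case (Suc k)
 have "((%x. T (f x)) has_derivative (%h. T (frechet_derivative f (at x) h))) (at x)" for x
  by (rule bounded_linear.has_derivative[OF assms(1) Ck_SucD[OF Suc.prems]])
 thus ?case
  by (rule CkI) (use Suc in auto)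
qed

lemma Ck_add [intro]: "Ck k f ==> Ck k g ==> Ck k (%x. f x + g x)"
proof (induction k arbitrary: f g)
 case 0 thus ?case by (auto intro!: continuous_intros)
next
 case (Suc k)
 show ?case
  by (rule CkI[OF has_derivative_add[OF Ck_SucD[OF Suc.prems(1)] Ck_SucD[OF Suc.prems(2)]]])
    (use Suc in auto)
qed

lemma Ck_bilinear:
 assumes "bounded_bilinear pr"
 shows "Ck k f ==> Ck k g ==> Ck k (%x. pr (f x) (g x))"
proof (induction k arbitrary: f g)
 case 0 thus ?case by (auto intro!: bounded_bilinear.continuous_on[OF assms])
next
 case (Suc k)
 have "Ck k f" "Ck k g" using Suc.prems by (auto simp del: Ck.simps intro: Ck_Suc_imp)
 thus ?case
  using Suc.prems
  by (intro CkI[OF bounded_bilinear.FDERIV[OF assms Ck_SucD[OF Suc.prems(1)] Ck_SucD[OF Suc.prems(2)]]]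
     Ck_add Suc.IH Ck_pd)
qed

lemmas Ck_mult = Ck_bilinear[OF bounded_bilinear_mult]
lemmas Ck_scaleR = Ck_bilinear[OF bounded_bilinear_scaleR]
lemmas Ck_inner = Ck_bilinear[OF bounded_bilinear_inner]

lemma Ck_minus: "Ck k f ==> Ck k (%x. - f x)"
 by (rule Ck_linear_comp[OF bounded_linear_minus[OF bounded_linear_ident]])

lemma Ck_diff: "Ck k f ==> Ck k g ==> Ck k (%x. f x - g x)"
 using Ck_add[OF _ Ck_minus, of k f g] by simp

lemma Ck_sum: "(!!i. i : I ==> Ck k (f i)) ==> Ck k (%x. SUM i:I. f i x)"
 by (induction I rule: infinite_finite_induct) auto

lemma Ck_ident: "Ck k (%x. x)"
 by (rule Ck_linear[OF bounded_linear_ident])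

lemma derivative_basis:
 assumes "bounded_linear (f' :: 'a::euclidean_space => 'b::real_normed_vector)"
 shows "f' h = (SUM b:Basis. (h \<bullet> b) *\<^sub>R f' b)"
proof -
 have "f' h = f' (SUM b:Basis. (h \<bullet> b) *\<^sub>R b)" by (simp add: euclidean_representation)
 also have "... = (SUM b:Basis. (h \<bullet> b) *\<^sub>R f' b)"
  using bounded_linear.linear[OF assms] by (simp add: linear_sum linear_scale)
 finally show ?thesis .
qed

lemma pd_basis:
 assumes "Ck (Suc k) f"
 shows "frechet_derivative f (at x) h = (SUM b:Basis. (h \<bullet> b) *\<^sub>R pd b f x)"
 by (rule derivative_basis) (rule has_derivative_bounded_linear[OF Ck_SucD[OF assms]])

text \<open>The inner maps that occur are affine: rescaled bumps, reflected kernels, and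
  \<open>gam\<close> after the projection along \<open>e\<close>.\<close>

lemma Ck_affine_comp:
 fixes A :: "'a::euclidean_space => 'c::euclidean_space" and f :: "'c => 'b::real_normed_vector"
 assumes "bounded_linear A"
 shows "Ck k f ==> Ck k (%x. f (A x + c))"
proof (induction k arbitrary: f)
 case 0
 have "continuous_on UNIV (%x. A x + c)"
  by (intro continuous_intros linear_continuous_on assms)
 thus ?case using 0 by (auto intro: continuous_on_compose2)
next
 case (Suc k)
 have "((%x. f (A x + c)) has_derivative (%h. frechet_derivative f (at (A x + c)) (A h))) (at x)" for x
 proof -
  have "((%x. A x + c) has_derivative A) (at x)"
   using bounded_linear_imp_has_derivative[OF assms] by (auto intro!: derivative_eq_intros)
  from diff_chain_at[OF this Ck_SucD[OF Suc.prems]] show ?thesis by (simp add: o_def)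
 qed
 \<comment> \<open>Written in the basis of the inner space so that only partial derivatives of
   \<open>f\<close> occur, to which the induction hypothesis applies.\<close>
 hence 1: "((%x. f (A x + c)) has_derivative
   (%h. SUM b:Basis. (A h \<bullet> b) *\<^sub>R pd b f (A x + c))) (at x)" for x
  by (subst (asm) pd_basis[OF Suc.prems])
 show ?case
  by (rule CkI[OF 1]) (use Suc in "auto intro!: Ck_sum Ck_scaleR")
qed

lemma Ck_real_comp:
 fixes g :: "real => real" and f :: "'a::euclidean_space => real"
 shows "Ck k g ==> Ck k f ==> Ck k (%x. g (f x))"
proof (induction k arbitrary: f g)
 case 0 thus ?case
  by (auto intro: continuous_on_compose2)
next
 case (Suc k)
 have lin: "frechet_derivative g (at y) h = h * pd 1 g y" for y h
  using pd_basis[OF Suc.prems(1), of y h] by simp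
 have "((%x. g (f x)) has_derivative (%h. frechet_derivative f (at x) h * pd 1 g (f x))) (at x)" for x
 proof -
  have "(%h. frechet_derivative f (at x) h * pd 1 g (f x))
    = frechet_derivative g (at (f x)) \<circ> frechet_derivative f (at x)"
   by (rule ext) (unfold o_def, rule lin[symmetric])
  thus ?thesis
   using diff_chain_at[OF Ck_SucD[OF Suc.prems(2)] Ck_SucD[OF Suc.prems(1)]] by (simp add: o_def)
 qed
 moreover have "Ck k (pd 1 g)" using Suc.prems(1) by simp
 moreover have "Ck k f" using Suc.prems(2) by (rule Ck_Suc_imp)
 ultimately show ?case
  using Suc.prems(2) by - (erule CkI, rule Ck_mult, erule (1) Ck_pd, rule Suc.IH)
qed

lemma smooth_imp_Ck: "smooth f ==> Ck k f" by (simp add: smooth_def)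

lemma smooth_pd: "smooth f ==> b : Basis ==> smooth (pd b f)"
 unfolding smooth_def using Ck_pd by blast

lemma smooth_has_derivative: "smooth f ==> (f has_derivative frechet_derivative f (at x)) (at x)"
 by (metis Ck_SucD smooth_def)

lemma smooth_mult:
 fixes f g :: "'a::euclidean_space => 'b::real_normed_algebra"
 shows "smooth f ==> smooth g ==> smooth (%x. f x * g x)"
 by (auto simp: smooth_def intro: Ck_mult)

subsection \<open>Symmetry of second derivatives\<close>

lemma has_real_derivative_along:
 fixes f :: "'a::euclidean_space => real"
 assumes "!!y. f differentiable (at y)"
 shows "((%t. f (x + t *\<^sub>R v)) has_real_derivative frechet_derivative f (at (x + t *\<^sub>R v)) v) (at t)"
proof -
 have 1: "((%t. x + t *\<^sub>R v) has_derivative (%t. t *\<^sub>R v)) (at t)"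
  by (auto intro!: derivative_eq_intros)
 have 2: "(f has_derivative frechet_derivative f (at (x + t *\<^sub>R v))) (at (x + t *\<^sub>R v))"
  using assms by (simp add: frechet_derivative_works)
 have "((%t. f (x + t *\<^sub>R v)) has_derivative
   (%s. frechet_derivative f (at (x + t *\<^sub>R v)) (s *\<^sub>R v))) (at t)"
  using diff_chain_at[OF 1 2] by (simp add: o_def)
 thus ?thesis
  by (simp add: has_field_derivative_def linear_scale[OF linear_frechet_derivative[OF assms]]
    mult.commute[of _ "frechet_derivative f (at (x + t *\<^sub>R v)) v"])
qed

text \<open>The second difference of \<open>f\<close> over a square of side \<open>t\<close> equals
  \<open>t * t\<close> times either mixed derivative at some nearby point, by the mean value theorem
  once in each direction. As \<open>t\<close> tends to 0 both points tend to \<open>x\<close>, and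
  the second derivatives are continuous.\<close>

lemma pd_commute_real:
 fixes f :: "'a::euclidean_space => real"
 assumes f: "Ck 2 f" and a: "a : Basis" and b: "b : Basis"
 shows "pd a (pd b f) x = pd b (pd a f) x"
proof -
 have f': "Ck (Suc (Suc 0)) f" using f by (simp add: numeral_2_eq_2)
 have main: "EX y. dist y x <= 2 * t &
   f (x + t *\<^sub>R a + t *\<^sub>R b) - f (x + t *\<^sub>R a) - f (x + t *\<^sub>R b) + f x = t * t * pd b (pd a f) y"
  if t: "t > 0" and a: "a : Basis" and b: "b : Basis" for t :: real and a b
 proof -
  have d: "f differentiable (at y)" "pd a f differentiable (at y)" for y
   using f' a by auto
  define g where "g = (%s. f ((x + t *\<^sub>R b) + s *\<^sub>R a) - f (x + s *\<^sub>R a))"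
  have "(g has_real_derivative (pd a f ((x + t *\<^sub>R b) + s *\<^sub>R a) - pd a f (x + s *\<^sub>R a))) (at s)" for s
   unfolding g_def by (intro DERIV_diff has_real_derivative_along d)
  then obtain s where s: "0 < s" "s < t"
   "g t - g 0 = (t - 0) * (pd a f ((x + t *\<^sub>R b) + s *\<^sub>R a) - pd a f (x + s *\<^sub>R a))"
   using MVT2[OF t, of g "%s. pd a f ((x + t *\<^sub>R b) + s *\<^sub>R a) - pd a f (x + s *\<^sub>R a)"] by auto
  have "((%r. pd a f ((x + s *\<^sub>R a) + r *\<^sub>R b)) has_real_derivative
    pd b (pd a f) ((x + s *\<^sub>R a) + r *\<^sub>R b)) (at r)" for r
   by (intro has_real_derivative_along d)
  then obtain r where r: "0 < r" "r < t"
   "pd a f ((x + s *\<^sub>R a) + t *\<^sub>R b) - pd a f ((x + s *\<^sub>R a) + 0 *\<^sub>R b)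
     = (t - 0) * pd b (pd a f) ((x + s *\<^sub>R a) + r *\<^sub>R b)"
   using MVT2[OF t, of "%r. pd a f ((x + s *\<^sub>R a) + r *\<^sub>R b)"
     "%r. pd b (pd a f) ((x + s *\<^sub>R a) + r *\<^sub>R b)"] by auto
  have "norm (s *\<^sub>R a + r *\<^sub>R b) <= s + r"
   using norm_triangle_ineq[of "s *\<^sub>R a" "r *\<^sub>R b"] s r a b by simp
  hence "dist (x + s *\<^sub>R a + r *\<^sub>R b) x <= 2 * t"
   using s r by (simp add: dist_norm algebra_simps)
  moreover have "f (x + t *\<^sub>R a + t *\<^sub>R b) - f (x + t *\<^sub>R a) - f (x + t *\<^sub>R b) + f x
    = t * t * pd b (pd a f) (x + s *\<^sub>R a + r *\<^sub>R b)"
  proof -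
   have "g t - g 0 = f (x + t *\<^sub>R a + t *\<^sub>R b) - f (x + t *\<^sub>R a) - f (x + t *\<^sub>R b) + f x"
    by (simp add: g_def algebra_simps)
   with s(3) r(3) show ?thesis by (simp add: algebra_simps)
  qed
  ultimately show ?thesis by blast
 qed
 have eq: "EX y z. dist y x <= 2 * t & dist z x <= 2 * t & pd b (pd a f) y = pd a (pd b f) z"
  if t: "t > 0" for t
  using main[OF t a b] main[OF t b a] t
  by (clarsimp simp: algebra_simps) (metis mult_left_cancel less_irrefl)
 define e where "e n = inverse (real (Suc n))" for n
 have "ALL n. EX y z. dist y x <= 2 * e n & dist z x <= 2 * e n & pd b (pd a f) y = pd a (pd b f) z"
  using eq by (simp add: e_def)
 then obtain y z where yz: "!!n. dist (y n) x <= 2 * e n" "!!n. dist (z n) x <= 2 * e n"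
   "!!n. pd b (pd a f) (y n) = pd a (pd b f) (z n)" by metis
 have e0: "(%n. 2 * e n) ----> 0"
  unfolding e_def using tendsto_mult_right_zero[OF LIMSEQ_inverse_real_of_nat] by auto
 have y: "y ----> x" and z: "z ----> x"
  by (auto simp: tendsto_dist_iff[of y] tendsto_dist_iff[of z]
    intro!: tendsto_sandwich[OF _ _ tendsto_const e0] always_eventually yz)
 have c: "continuous_on UNIV (pd b (pd a f))" "continuous_on UNIV (pd a (pd b f))"
  using f' a b by auto
 have "(%n. pd b (pd a f) (y n)) ----> pd b (pd a f) x"
  using continuous_on_tendsto_compose[OF c(1) y] by simp
 moreover have "(%n. pd a (pd b f) (z n)) ----> pd a (pd b f) x"
  using continuous_on_tendsto_compose[OF c(2) z] by simp
 ultimately show ?thesis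
  using yz(3) LIMSEQ_unique by fastforce
qed

subsection \<open>Smooth bumps\<close>

text \<open>For \<open>n = 0\<close> this is the classical flat function. The powers
  \<open>(1/t)^n\<close> make the family closed under differentiation up to linear combinations, so
  smoothness is an induction for all \<open>n\<close> at once.\<close>

definition expinv :: "nat => real => real" where
 "expinv n t = (if t > 0 then (1/t)^n * exp (- 1/t) else 0)"

lemma expinv_lim: "((%t. (1/t)^n * exp (- 1/t)) \<longlongrightarrow> (0::real)) (at_right 0)"
proof -
 have "((%x::real. x ^ n / exp x) \<longlongrightarrow> 0) at_top" by (rule tendsto_power_div_exp_0)
 hence "((%t. (inverse t) ^ n / exp (inverse t)) \<longlongrightarrow> (0::real)) (at_right 0)"
  using filterlim_compose filterlim_inverse_at_top_right by blast
 thus ?thesis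
  by (simp add: divide_inverse exp_minus)
qed

lemma expinv_deriv:
 "(expinv n has_real_derivative (- real n * expinv (n+1) t + expinv (n+2) t)) (at t)"
proof -
 consider "t > 0" | "t < 0" | "t = 0" by linarith
 thus ?thesis
 proof cases
  case 1
  have i: "((%t. 1/t) has_real_derivative - ((1/t)^2)) (at t)"
   using 1 by (auto intro!: derivative_eq_intros simp: power2_eq_square)
  have e: "((%t. exp (- 1/t)) has_real_derivative (1/t)^2 * exp (- 1/t)) (at t)"
   using 1 by (auto intro!: derivative_eq_intros simp: power2_eq_square)
  have "real n * ((1/t)^2 * (1/t)^(n - Suc 0)) = real n * (1/t)^(n+1)"
   by (cases n) (simp_all flip: power_add)
  hence p: "((%t. (1/t)^n) has_real_derivative - real n * (1/t)^(n+1)) (at t)"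
   using DERIV_power[OF i, of n] by (simp add: mult_ac)
  have "((%t. (1/t)^n * exp (- 1/t)) has_real_derivative
    (- real n * ((1/t)^(n+1) * exp (- 1/t)) + (1/t)^(n+2) * exp (- 1/t))) (at t)"
   using DERIV_mult[OF p e] by (simp add: power_add power2_eq_square mult_ac)
  hence "(expinv n has_real_derivative
    (- real n * ((1/t)^(n+1) * exp (- 1/t)) + (1/t)^(n+2) * exp (- 1/t))) (at t)"
   by (rule has_field_derivative_transform_within_open[of _ _ _ "{0<..}"])
     (use 1 in "auto simp: expinv_def")
  thus ?thesis using 1 by (simp add: expinv_def)
 next
  case 2
  have "((%t. 0) has_real_derivative 0) (at t)" by simp
  hence "(expinv n has_real_derivative 0) (at t)"
   by (rule has_field_derivative_transform_within_open[of _ _ _ "{..<0}"])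
     (use 2 in "auto simp: expinv_def")
  thus ?thesis using 2 by (simp add: expinv_def)
 next
  case 3
  \<comment> \<open>From the right the difference quotient at 0 is the function with exponent
    \<open>n + 1\<close>, from the left it is 0.\<close>
  have "((%h. expinv n h / h) \<longlongrightarrow> 0) (at 0)"
  proof (rule filterlim_split_at)
   have "((%t. (1/t)^(n+1) * exp (- 1/t)) \<longlongrightarrow> (0::real)) (at_right 0)" by (rule expinv_lim)
   thus "((%h. expinv n h / h) \<longlongrightarrow> 0) (at_right 0)"
    by (rule Lim_transform_eventually)
      (auto simp: eventually_at_right[of 0 1] expinv_def field_simps intro!: exI[of _ 1])
   have "((%t. 0) \<longlongrightarrow> (0::real)) (at_left 0)" by simp
   thus "((%h. expinv n h / h) \<longlongrightarrow> 0) (at_left 0)"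
    by (rule Lim_transform_eventually)
      (auto simp: eventually_at_left[of "-1" 0] expinv_def field_simps intro!: exI[of _ "-1"])
  qed
  thus ?thesis using 3 by (simp add: DERIV_def expinv_def)
 qed
qed

lemma Ck_expinv: "Ck k (expinv n)"
proof (induction k arbitrary: n)
 case 0
 show ?case using expinv_deriv DERIV_isCont by (force simp: continuous_on_eq_continuous_at)
next
 case (Suc k)
 have "(expinv n has_derivative (%h. h * (- real n * expinv (n+1) t + expinv (n+2) t))) (at t)" for t
  using expinv_deriv[of n t] unfolding has_field_derivative_def
  by (rule has_derivative_eq_rhs) (auto simp: mult.commute)
 thus ?case
  by (rule CkI) (intro Ck_mult Ck_add Ck_const Suc.IH)
qed

definition bump :: "'a::euclidean_space => real" where
 "bump x = expinv 0 (1 - x \<bullet> x)"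

lemma smooth_bump: "smooth (bump :: 'a::euclidean_space => real)"
 unfolding smooth_def bump_def
 by (rule allI, rule Ck_real_comp[OF Ck_expinv]) (intro Ck_diff Ck_inner Ck_ident Ck_const)

lemma bump_nonneg: "bump x >= 0" by (simp add: bump_def expinv_def)

lemma bump_pos_iff: "bump x > 0 \<longleftrightarrow> norm x < 1"
proof -
 have "(norm x)^2 < 1 \<longleftrightarrow> norm x < 1" by (simp add: power_less_one_iff abs_square_less_1)
 thus ?thesis
  by (auto simp: bump_def expinv_def power2_norm_eq_inner)
qed

subsection \<open>Translations and reflections\<close>

lemma lborel_distr_translate: "distr lborel borel (%x. x + c) = (lborel :: 'a::euclidean_space measure)"
 using lborel_distr_plus[of c] by (simp add: add.commute[of _ c])

lemma lborel_distr_reflect: "distr lborel borel (%x. c - x) = (lborel :: 'a::euclidean_space measure)"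
 using lborel_affine[of "-1" c] by (simp add: density_1)

lemma
 fixes f :: "'a::euclidean_space => 'b::{banach, second_countable_topology}"
 assumes [measurable]: "f : borel_measurable borel"
 shows lborel_integral_translate: "(LINT x|lborel. f (x + c)) = (LINT x|lborel. f x)"
  and lborel_integral_reflect: "(LINT x|lborel. f (c - x)) = (LINT x|lborel. f x)"
  and lborel_integrable_translate: "integrable lborel (%x. f (x + c)) \<longleftrightarrow> integrable lborel f"
  and lborel_integrable_reflect: "integrable lborel (%x. f (c - x)) \<longleftrightarrow> integrable lborel f"
 using integral_distr[of "%x. x + c" lborel borel f] integral_distr[of "%x. c - x" lborel borel f]
  integrable_distr_eq[of "%x. x + c" lborel borel f] integrable_distr_eq[of "%x. c - x" lborel borel f]
 by (simp_all add: lborel_distr_translate lborel_distr_reflect)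

lemma
 fixes f :: "'a::euclidean_space => ennreal"
 assumes [measurable]: "f : borel_measurable borel"
 shows lborel_nn_integral_translate: "nn_integral lborel (%x. f (x + c)) = nn_integral lborel f"
  and lborel_nn_integral_reflect: "nn_integral lborel (%x. f (c - x)) = nn_integral lborel f"
 using nn_integral_distr[of "%x. x + c" lborel borel f] nn_integral_distr[of "%x. c - x" lborel borel f]
 by (simp_all add: lborel_distr_translate lborel_distr_reflect)

subsection \<open>Compactly supported functions\<close>

lemma pd_outside_support:
 assumes "x ~: closure {x. f x ~= 0}"
 shows "pd b f x = 0"
proof -
 have "((%x. 0) has_derivative (%h. 0)) (at x)" by simp
 hence "(f has_derivative (%h. 0)) (at x)"
  by (rule has_derivative_transform_within_open[of _ _ _ _ "- closure {x. f x ~= 0}"])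
    (use assms closure_subset[of "{x. f x ~= 0}"] in auto)
 thus ?thesis by (rule pd_eqI)
qed

lemma closure_support_pd: "closure {x. pd b f x ~= 0} <= closure {x. f x ~= 0}"
 by (rule closure_minimal) (use pd_outside_support in blast, simp)

lemma bsupp_pd: "bounded {x. f x ~= 0} ==> bounded {x. pd b f x ~= 0}"
 by (rule bounded_subset[OF bounded_closure]) (use pd_outside_support in blast)+

lemma test_iff:
 "test_function D phi \<longleftrightarrow> smooth phi & bounded {x. phi x ~= 0} & closure {x. phi x ~= 0} <= D"
 unfolding test_function_def
 by (metis bounded_closure bounded_subset closed_closure closure_subset compact_eq_bounded_closed)

lemma test_pd: "test_function D phi ==> b : Basis ==> test_function D (pd b phi)"
 unfolding test_iff
 by (intro conjI smooth_pd bsupp_pd order_trans[OF closure_support_pd]) auto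

lemma test_mono: "test_function D phi ==> D <= E ==> test_function E phi"
 by (auto simp: test_function_def)

lemma test_mult:
 assumes "test_function D phi" "smooth psi" shows "test_function D (%x. phi x * psi x)"
proof -
 have s: "{x. phi x * psi x ~= 0} <= {x. phi x ~= 0}" by auto
 show ?thesis using assms bounded_subset[OF _ s] closure_mono[OF s]
  by (auto simp: test_iff intro: smooth_mult)
qed

lemma integrable_bsupp:
 fixes f :: "'a::euclidean_space => 'b::euclidean_space"
 assumes "continuous_on UNIV f" "bounded {x. f x ~= 0}"
 shows "integrable lborel f"
proof -
 have "compact (closure {x. f x ~= 0})" using assms(2) by simp
 hence "integrable lborel (%x. indicator (closure {x. f x ~= 0}) x *\<^sub>R f x)"
  by (rule borel_integrable_compact) (use assms continuous_on_subset in blast)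
 moreover have "(%x. indicator (closure {x. f x ~= 0}) x *\<^sub>R f x) = f"
  using closure_subset[of "{x. f x ~= 0}"] by (auto simp: indicator_def fun_eq_iff)
 ultimately show ?thesis by simp
qed

lemma bounded_support_bounded:
 fixes f :: "'a::euclidean_space => 'b::real_normed_vector"
 assumes "continuous_on UNIV f" "bounded {x. f x ~= 0}"
 obtains B where "B > 0" "!!x. norm (f x) <= B"
proof -
 let ?K = "closure {x. f x ~= 0}"
 have "compact (f ` ?K)"
  by (rule compact_continuous_image) (use assms continuous_on_subset in "auto")
 then obtain B where B: "B > 0" "!!y. y : f ` ?K ==> norm y <= B"
  using compact_imp_bounded bounded_pos by metis
 have "norm (f x) <= B" for x
  using B closure_subset[of "{x. f x ~= 0}"] by (cases "f x = 0") auto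
 with B show ?thesis by (intro that[of B])
qed

lemma bsupp_uniformly_continuous:
 fixes f :: "'a::euclidean_space => 'b::real_normed_vector"
 assumes "continuous_on UNIV f" "bounded {x. f x ~= 0}" and e: "e > 0"
 obtains d where "d > 0" "!!x y. dist x y < d ==> dist (f x) (f y) < e"
proof -
 obtain R where R: "!!x. f x ~= 0 ==> norm x <= R" using assms(2) by (auto simp: bounded_iff)
 have "uniformly_continuous_on (cball 0 (R + 1)) f"
  by (rule compact_uniformly_continuous) (use assms continuous_on_subset in auto)
 then obtain d where d: "d > 0"
  "!!x y. norm x <= R + 1 ==> norm y <= R + 1 ==> dist x y < d ==> dist (f x) (f y) < e"
  using e unfolding uniformly_continuous_on_def by (metis mem_cball_0 dist_commute)
 show ?thesis
 proof (rule that[of "min d 1"])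
  fix x y :: 'a assume xy: "dist x y < min d 1"
  show "dist (f x) (f y) < e"
  proof (cases "norm x <= R \<or> norm y <= R")
   case True
   have "\<bar>norm x - norm y\<bar> <= dist x y" by (simp add: dist_norm norm_triangle_ineq3)
   thus ?thesis using True xy by (intro d(2)) auto
  next
   case False
   thus ?thesis using R[of x] R[of y] e by (cases "f x = 0"; cases "f y = 0") auto
  qed
 qed (use d in auto)
qed

text \<open>Mean value theorem along the segment and uniform continuity of the partial derivatives.
  The error is uniform in the base point, so it can be integrated when a convolution is
  differentiated or a translation is estimated.\<close>

lemma uniform_expansion:
 fixes f :: "'a::euclidean_space => real"
 assumes f: "Ck 1 f" "bounded {x. f x ~= 0}" and e: "e > 0"
 obtains d where "d > 0"
  "!!z h. norm h < d ==> \<bar>f (z + h) - f z - (SUM b:Basis. (h \<bullet> b) * pd b f z)\<bar> <= e * norm h"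
proof -
 have f1: "Ck (Suc 0) f" using f by simp
 let ?e = "e / real DIM('a)"
 have "EX d>0. ALL x y. dist x y < d --> dist (pd b f x) (pd b f y) < ?e" if "b : Basis" for b
 proof -
  have "continuous_on UNIV (pd b f)" using f1 that by simp
  from bsupp_uniformly_continuous[OF this bsupp_pd[OF f(2)], of ?e] e
  show ?thesis by (metis divide_pos_pos DIM_positive of_nat_0_less_iff)
 qed
 then obtain d where d: "!!b. b : Basis ==> d b > 0"
  "!!b x y. b : Basis ==> dist x y < d b ==> dist (pd b f x) (pd b f y) < ?e" by metis
 show ?thesis
 proof (rule that[of "Min (d ` Basis)"])
  show "0 < Min (d ` Basis)" using d(1) by simp
  fix z h :: 'a assume h: "norm h < Min (d ` Basis)"
  have diff: "f differentiable (at y)" for y using f1 by simp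
  obtain t where t: "0 < t" "t < 1" "f (z + h) - f z = frechet_derivative f (at (z + t *\<^sub>R h)) h"
   using MVT2[of 0 1 "%t. f (z + t *\<^sub>R h)" "%t. frechet_derivative f (at (z + t *\<^sub>R h)) h",
     OF _ has_real_derivative_along[OF diff]] by auto
  have "f (z + h) - f z = (SUM b:Basis. (h \<bullet> b) * pd b f (z + t *\<^sub>R h))"
   using t(3) pd_basis[OF f1, of "z + t *\<^sub>R h" h] by simp
  hence "\<bar>f (z + h) - f z - (SUM b:Basis. (h \<bullet> b) * pd b f z)\<bar>
    = \<bar>SUM b:Basis. (h \<bullet> b) * (pd b f (z + t *\<^sub>R h) - pd b f z)\<bar>"
   by (simp add: sum_subtractf right_diff_distrib)
  also have "... <= (SUM b:(Basis::'a set). norm h * ?e)"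
  proof (rule order_trans[OF sum_abs sum_mono])
   fix b :: 'a assume b: "b : Basis"
   have "norm (t *\<^sub>R h) <= norm h" using t by (simp add: mult_left_le_one_le)
   hence "dist (z + t *\<^sub>R h) z < d b"
    using h b d(1) by (auto simp: dist_norm)
   from d(2)[OF b this] Basis_le_norm[OF b, of h]
   show "\<bar>h \<bullet> b * (pd b f (z + t *\<^sub>R h) - pd b f z)\<bar> <= norm h * ?e"
    unfolding abs_mult dist_real_def by (intro mult_mono) auto
  qed
  also have "... = e * norm h" by simp
  finally show "\<bar>f (z + h) - f z - (SUM b:Basis. (h \<bullet> b) * pd b f z)\<bar> <= e * norm h" .
 qed
qed

subsection \<open>Convolution and mollifiers\<close>

text \<open>All smoothness comes from the second argument; the first one only has to be
  integrable.\<close>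

definition conv :: "('a::euclidean_space => 'b::{banach, second_countable_topology}) => ('a => real) => 'a => 'b"
 where "conv F rho x = (LINT y|lborel. rho (x - y) *\<^sub>R F y)"

lemma conv_integrable:
 fixes F :: "'a::euclidean_space => 'b::{banach, second_countable_topology}"
 assumes F: "integrable lborel F" and rho: "continuous_on UNIV rho" "bounded {x. rho x ~= 0}"
 shows "integrable lborel (%y. rho (x - y) *\<^sub>R F y)"
proof -
 obtain B where B: "B > 0" "!!x. norm (rho x) <= B" using bounded_support_bounded[OF rho] by metis
 have [measurable]: "rho : borel_measurable borel" using rho(1) by (rule borel_measurable_continuous_onI)
 have [measurable]: "F : borel_measurable borel" using F by auto
 show ?thesis
 proof (rule Bochner_Integration.integrable_bound[of _ "%y. B *\<^sub>R F y"])
  show "integrable lborel (%y. B *\<^sub>R F y)" using F by simp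
  show "AE y in lborel. norm (rho (x - y) *\<^sub>R F y) <= norm (B *\<^sub>R F y)"
   using B by (auto intro!: mult_right_mono AE_I2 order_trans[OF B(2)])
 qed measurable
qed

lemma conv_commute:
 assumes F[measurable]: "F : borel_measurable borel" and rho: "continuous_on UNIV rho"
 shows "conv F rho x = (LINT y|lborel. rho y *\<^sub>R F (x - y))"
proof -
 have [measurable]: "rho : borel_measurable borel" using rho by (rule borel_measurable_continuous_onI)
 have "(LINT y|lborel. rho (x - (x - y)) *\<^sub>R F (x - y)) = conv F rho x"
  unfolding conv_def by (rule lborel_integral_reflect) measurable
 thus ?thesis by simp
qed

lemma conv_has_derivative:
 assumes F: "integrable lborel F" and rho: "Ck 1 rho" "bounded {x. rho x ~= 0}"
 shows "(conv F rho has_derivative (%h. SUM b:Basis. (h \<bullet> b) *\<^sub>R conv F (pd b rho) x)) (at x)"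
 unfolding has_derivative_at_alt
proof (intro conjI allI impI)
 show "bounded_linear (%h. SUM b:Basis. (h \<bullet> b) *\<^sub>R conv F (pd b rho) x)"
  by (intro bounded_linear_sum bounded_linear_scaleR_left[THEN bounded_linear_compose] bounded_linear_inner_left)
 fix e :: real assume e: "e > 0"
 have rhoc: "continuous_on UNIV rho" "!!b. b : Basis ==> continuous_on UNIV (pd b rho)"
  using rho(1) Ck_continuous[of 1 rho] by auto
 define I where "I = (LINT y|lborel. norm (F y))"
 have I: "I >= 0" by (simp add: I_def)
 \<comment> \<open>The tolerance is divided by the L1 norm \<open>I\<close> of \<open>F\<close>,
   plus 1 in case \<open>I\<close> is 0.\<close>
 obtain d where d: "d > 0"
  "!!z h. norm h < d ==> \<bar>rho (z + h) - rho z - (SUM b:Basis. (h \<bullet> b) * pd b rho z)\<bar> <= e / (I + 1) * norm h"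
  using uniform_expansion[OF rho, of "e / (I + 1)"] e I by (metis add_nonneg_pos divide_pos_pos zero_less_one)
 show "EX d>0. ALL y. norm (y - x) < d -->
   norm (conv F rho y - conv F rho x - (SUM b:Basis. ((y - x) \<bullet> b) *\<^sub>R conv F (pd b rho) x)) <= e * norm (y - x)"
 proof (intro exI[of _ d] conjI allI impI d)
  fix y assume y: "norm (y - x) < d"
  let ?D = "%w. rho (y - w) - rho (x - w) - (SUM b:Basis. ((y - x) \<bullet> b) * pd b rho (x - w))"
  let ?S = "SUM b:Basis. ((y - x) \<bullet> b) *\<^sub>R conv F (pd b rho) x"
  note int = conv_integrable[OF F rhoc(1) rho(2), of y] conv_integrable[OF F rhoc(1) rho(2), of x] conv_integrable[OF F rhoc(2) bsupp_pd[OF rho(2)]]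
  have eq: "conv F rho y - conv F rho x - ?S
    = (LINT w|lborel. ?D w *\<^sub>R F w)"
   (is "_ = ?R")
  proof -
   have "?R = (LINT w|lborel. rho (y - w) *\<^sub>R F w - rho (x - w) *\<^sub>R F w
     - (SUM b:Basis. ((y - x) \<bullet> b) *\<^sub>R (pd b rho (x - w) *\<^sub>R F w)))"
    by (simp add: scaleR_diff_left scaleR_sum_left)
   also have "... = (LINT w|lborel. rho (y - w) *\<^sub>R F w - rho (x - w) *\<^sub>R F w)
     - (LINT w|lborel. (SUM b:Basis. ((y - x) \<bullet> b) *\<^sub>R (pd b rho (x - w) *\<^sub>R F w)))"
    by (intro Bochner_Integration.integral_diff Bochner_Integration.integrable_diff
      Bochner_Integration.integrable_sum integrable_scaleR_right int)
   also have "(LINT w|lborel. (SUM b:Basis. ((y - x) \<bullet> b) *\<^sub>R (pd b rho (x - w) *\<^sub>R F w)))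
     = ?S"
    unfolding conv_def using int(3)
    by (subst Bochner_Integration.integral_sum) (auto intro!: integrable_scaleR_right simp del: scaleR_scaleR)
   also have "(LINT w|lborel. rho (y - w) *\<^sub>R F w - rho (x - w) *\<^sub>R F w) = conv F rho y - conv F rho x"
    unfolding conv_def by (intro Bochner_Integration.integral_diff int)
   finally show ?thesis by simp
  qed
  have "norm (LINT w|lborel. ?D w *\<^sub>R F w)
    <= (LINT w|lborel. (e / (I + 1) * norm (y - x)) * norm (F w))"
  proof (rule Bochner_Integration.integral_norm_bound_integral)
   show "integrable lborel (%w. ?D w *\<^sub>R F w)"
    unfolding scaleR_diff_left scaleR_sum_left scaleR_scaleR[symmetric]
    by (intro Bochner_Integration.integrable_diff Bochner_Integration.integrable_sum integrable_scaleR_right int)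
   show "integrable lborel (%w. (e / (I + 1) * norm (y - x)) * norm (F w))"
    using F by (intro integrable_mult_right integrable_norm)
   fix w
   show "norm (?D w *\<^sub>R F w)
     <= (e / (I + 1) * norm (y - x)) * norm (F w)"
    unfolding norm_scaleR using d(2)[OF y, of "x - w"]
    by (intro mult_right_mono) (simp_all add: algebra_simps)
  qed
  also have "... = (e * norm (y - x)) * (I / (I + 1))" by (simp add: I_def)
  also have "... <= e * norm (y - x)"
   using I e by (intro mult_right_le_one_le) auto
  finally show "norm (conv F rho y - conv F rho x - ?S) <= e * norm (y - x)"
   unfolding eq .
 qed
qed

lemma pd_conv:
 assumes "integrable lborel F" "Ck 1 rho" "bounded {x. rho x ~= 0}" "b : Basis"
 shows "pd b (conv F rho) x = conv F (pd b rho) x"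
 using pd_eqI[OF conv_has_derivative[OF assms(1-3)], of x b] assms(4)
 by (simp add: inner_Basis if_distrib[of "%c. c *\<^sub>R _"] sum.delta' cong: if_cong)

lemma Ck_conv:
 assumes "integrable lborel F"
 shows "Ck (Suc k) rho ==> bounded {x. rho x ~= 0} ==> Ck k (conv F rho)"
proof (induction k arbitrary: rho)
 case 0
 thus ?case
  using conv_has_derivative[OF assms, of rho]
  by (auto simp: continuous_on_eq_continuous_at simp del: Ck.simps(2) intro: has_derivative_continuous)
next
 case (Suc k)
 have 1: "Ck 1 rho" using Suc.prems(1) by (rule Ck_antimono) simp
 show ?case
  by (rule CkI[OF conv_has_derivative[OF assms 1 Suc.prems(2)]])
    (intro Ck_sum Ck_scaleR Ck_const Suc.IH Ck_pd[OF Suc.prems(1)] bsupp_pd Suc.prems(2))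
qed

lemma smooth_conv:
 "integrable lborel F ==> smooth rho ==> bounded {x. rho x ~= 0} ==> smooth (conv F rho)"
 by (simp add: smooth_def Ck_conv del: Ck.simps)

lemma conv_nonzeroD:
 assumes "conv F rho x ~= 0" obtains y where "F y ~= 0" "rho (x - y) ~= 0"
proof -
 have "~ (ALL y. rho (x - y) *\<^sub>R F y = 0)"
 proof
  assume "ALL y. rho (x - y) *\<^sub>R F y = 0"
  hence "conv F rho x = 0" unfolding conv_def by (simp only: Bochner_Integration.integral_zero)
  with assms show False ..
 qed
 thus ?thesis using that by auto
qed

text \<open>The centre \<open>a\<close> need not be 0: a kernel supported off the origin makes the
  mollification sample on one side only, which is how it stays inside \<open>D\<close> near the
  boundary.\<close>

definition mollifier :: "'a::euclidean_space => real => ('a => real) => bool" where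
 "mollifier a r rho \<longleftrightarrow> smooth rho & (ALL x. rho x >= 0) & (ALL x. rho x ~= 0 --> x : ball a r) &
   integrable lborel rho & (LINT x|lborel. rho x) = 1"

lemma
 assumes "mollifier a r rho"
 shows mollifier_smooth: "smooth rho" and mollifier_nonneg: "rho x >= 0"
  and mollifier_support: "rho x ~= 0 ==> x : ball a r"
  and mollifier_integrable: "integrable lborel rho" and mollifier_integral: "(LINT x|lborel. rho x) = 1"
  and mollifier_bounded: "bounded {x. rho x ~= 0}"
  and mollifier_cont: "continuous_on UNIV rho"
 using assms Ck_continuous[of 0 rho]
 by (auto simp: mollifier_def smooth_def simp del: Ck.simps intro: bounded_subset[of "ball a r"])

lemma mollifier_exists:
 fixes a :: "'a::euclidean_space"
 assumes r: "r > 0" obtains rho where "mollifier a r rho"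
proof -
 define f where "f = (%x. bump ((1/r) *\<^sub>R x + (- (1/r)) *\<^sub>R a))"
 have s: "smooth f"
  unfolding smooth_def f_def
  by (intro allI Ck_affine_comp smooth_imp_Ck[OF smooth_bump] bounded_linear_scaleR_right)
 have "norm ((1/r) *\<^sub>R x + (- (1/r)) *\<^sub>R a) = norm (x - a) / r" for x
 proof -
  have "(1/r) *\<^sub>R x + (- (1/r)) *\<^sub>R a = (1/r) *\<^sub>R (x - a)" by (simp add: algebra_simps)
  thus ?thesis using r by simp
 qed
 hence pos: "f x > 0 \<longleftrightarrow> x : ball a r" for x
  using r unfolding f_def bump_pos_iff by (simp only: mem_ball dist_norm norm_minus_commute[of a]) simp
 have nn: "f x >= 0" for x by (simp add: f_def bump_nonneg)
 have supp: "{x. f x ~= 0} = ball a r" using pos nn by (auto simp: less_le)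
 have c: "continuous_on UNIV f" using s smooth_imp_Ck Ck_continuous by blast
 have int: "integrable lborel f"
  by (rule integrable_bsupp[OF c]) (simp add: supp)
 have "(LINT x|lborel. f x) ~= 0"
 proof
  assume "(LINT x|lborel. f x) = 0"
  hence "AE x in lborel. f x = 0"
   using integral_nonneg_eq_0_iff_AE[OF int] nn by auto
  hence "emeasure lborel {x. f x ~= 0} = 0"
   by (subst (asm) AE_iff_measurable[of "{x. f x ~= 0}"]) (auto simp: supp)
  thus False using content_ball_pos[OF r, of a] by (simp add: supp measure_def)
 qed
 moreover have "(LINT x|lborel. f x) >= 0" using nn by (simp add: integral_nonneg_AE)
 ultimately have I: "(LINT x|lborel. f x) > 0" by linarith
 show ?thesis
 proof (rule that[of "%x. (1 / (LINT x|lborel. f x)) * f x"])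
  have "smooth (%x. (1 / (LINT x|lborel. f x)) * f x)"
   using s unfolding smooth_def by (intro allI Ck_mult Ck_const) auto
  thus "mollifier a r (%x. (1 / (LINT x|lborel. f x)) * f x)"
   unfolding mollifier_def using I nn int supp by auto
 qed
qed

lemma conv_close:
 assumes rho: "mollifier a r rho" and F: "integrable lborel F"
  and close: "!!y. y : ball a r ==> norm (F (x - y) - F x) <= e"
 shows "norm (conv F rho x - F x) <= e"
proof -
 have Fm[measurable]: "F : borel_measurable borel" using F by auto
 have rhom[measurable]: "rho : borel_measurable borel"
  using mollifier_cont[OF rho] by (rule borel_measurable_continuous_onI)
 have int1: "integrable lborel (%y. rho y *\<^sub>R F (x - y))"
 proof -
  have "integrable lborel (%y. rho (x - y) *\<^sub>R F y)"
   by (rule conv_integrable[OF F mollifier_cont[OF rho] mollifier_bounded[OF rho]])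
  hence "integrable lborel (%y. rho (x - (x - y)) *\<^sub>R F (x - y))"
   by (subst lborel_integrable_reflect[of "%y. rho (x - y) *\<^sub>R F y" x]) measurable
  thus ?thesis by simp
 qed
 have int2: "integrable lborel (%y. rho y *\<^sub>R F x)"
  using mollifier_integrable[OF rho] by simp
 have "conv F rho x - F x = (LINT y|lborel. rho y *\<^sub>R F (x - y)) - (LINT y|lborel. rho y *\<^sub>R F x)"
  using mollifier_integral[OF rho] mollifier_integrable[OF rho]
  by (simp add: conv_commute[OF Fm mollifier_cont[OF rho]])
 also have "... = (LINT y|lborel. rho y *\<^sub>R (F (x - y) - F x))"
  using int1 int2 by (simp add: scaleR_diff_right)
 also have "norm (LINT y|lborel. rho y *\<^sub>R (F (x - y) - F x)) <= (LINT y|lborel. rho y * e)"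
 proof (rule Bochner_Integration.integral_norm_bound_integral)
  show "integrable lborel (%y. rho y *\<^sub>R (F (x - y) - F x))"
   using int1 int2 by (simp add: scaleR_diff_right)
  show "integrable lborel (%y. rho y * e)" using mollifier_integrable[OF rho] by simp
  fix y
  show "norm (rho y *\<^sub>R (F (x - y) - F x)) <= rho y * e"
   using mollifier_nonneg[OF rho, of y] mollifier_support[OF rho, of y] close[of y]
   by (cases "rho y = 0") (auto intro!: mult_left_mono)
 qed
 also have "... = e" using mollifier_integral[OF rho] by simp
 finally show ?thesis .
qed

lemma conv_real_commute:
 fixes f rho :: "'a::euclidean_space => real"
 assumes "continuous_on UNIV f" "continuous_on UNIV rho"
 shows "conv f rho x = conv rho f x"
 by (subst conv_commute) (auto simp: conv_def mult.commute assms borel_measurable_continuous_onI)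

text \<open>Weak derivatives are defined with smooth test functions, but cutoffs built from the
  boundary are only C1. Mollification yields smooth approximations whose first derivatives converge
  uniformly, all supported in one compact subset of \<open>U\<close>.\<close>

lemma C1_approx_test_functions:
 fixes psi :: "'a::euclidean_space => real"
 assumes psi: "Ck 1 psi" "bounded {x. psi x ~= 0}" "closure {x. psi x ~= 0} <= U" and U: "open U"
 obtains psi' K where "!!n. test_function U (psi' n)" "compact K" "K <= U"
  "!!n::nat. !!x. x ~: K ==> psi' n x = 0" "!!x. x ~: K ==> psi x = 0"
  "uniform_limit UNIV psi' psi sequentially"
  "!!b. b : Basis ==> uniform_limit UNIV (%n. pd b (psi' n)) (pd b psi) sequentially"
proof -
 let ?S = "closure {x. psi x ~= 0}"
 have S: "compact ?S" using psi(2) by simp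
 obtain eps where eps: "eps > 0" "(UN x:?S. cball x eps) <= U"
  using compact_subset_open_imp_cball_epsilon_subset[OF S U psi(3)] by auto
 define r where "r n = eps / real (Suc (Suc n))" for n
 have r: "r n > 0" "r n < eps" for n using eps by (auto simp: r_def field_simps intro: add_pos_nonneg)
 have r0: "r ----> 0"
  unfolding r_def using LIMSEQ_Suc[OF lim_const_over_n[of eps], THEN LIMSEQ_Suc] by simp
 have "EX rho. mollifier (0::'a) (r n) rho" for n using mollifier_exists[OF r(1)] by metis
 then obtain rho where rho: "!!n. mollifier (0::'a) (r n) (rho n)" by metis
 define K where "K = {x + y |x y. x : ?S & y : cball 0 eps}"
 have K: "compact K" unfolding K_def by (rule compact_sums[OF S compact_cball])
 have KU: "K <= U" using eps(2) by (force simp: K_def dist_norm)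
 have c: "continuous_on UNIV psi" using Ck_continuous[OF psi(1)] .
 have int: "integrable lborel psi" by (rule integrable_bsupp[OF c psi(2)])
 have K0: "conv psi (rho n) x = 0" if "x ~: K" for n x
 proof (rule ccontr)
  assume "conv psi (rho n) x ~= 0"
  then obtain y where y: "psi y ~= 0" "rho n (x - y) ~= 0" by (rule conv_nonzeroD)
  hence "y : ?S" "x - y : cball 0 eps"
   using closure_subset[of "{x. psi x ~= 0}"] mollifier_support[OF rho y(2)] r(2)[of n] by auto
  hence "x : K" unfolding K_def by (intro CollectI exI[of _ y] exI[of _ "x - y"]) auto
  with that show False ..
 qed
 have psi0: "psi x = 0" if "x ~: K" for x
 proof (rule ccontr)
  assume "psi x ~= 0"
  hence "x : ?S" using closure_subset by fastforce
  hence "x : K" using eps(1) unfolding K_def by (intro CollectI exI[of _ x] exI[of _ 0]) auto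
  with that show False ..
 qed
 have ul: "uniform_limit UNIV (%n. conv f (rho n)) f sequentially"
  if f: "continuous_on UNIV f" "bounded {x. f x ~= 0}" for f :: "'a => real"
 proof (rule uniform_limitI)
  fix e :: real assume e: "e > 0"
  obtain d where d: "d > 0" "!!x y. dist x y < d ==> dist (f x) (f y) < e/2"
   using bsupp_uniformly_continuous[OF f, of "e/2"] e by auto
  have "\<forall>\<^sub>F n in sequentially. r n < d" using order_tendstoD(2)[OF r0 d(1)] .
  thus "\<forall>\<^sub>F n in sequentially. ALL x:UNIV. dist (conv f (rho n) x) (f x) < e"
  proof eventually_elim
   case (elim n)
   show ?case
   proof
    fix x :: 'a
    have "norm (conv f (rho n) x - f x) <= e/2"
    proof (rule conv_close[OF rho integrable_bsupp[OF f]])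
     fix y :: 'a assume "y : ball 0 (r n)"
     hence "dist (x - y) x < d" using elim by (simp add: dist_norm)
     thus "norm (f (x - y) - f x) <= e/2" using d(2) by (simp add: dist_norm less_imp_le)
    qed
    thus "dist (conv f (rho n) x) (f x) < e" using e by (simp add: dist_norm)
   qed
  qed
 qed
 show ?thesis
 proof (rule that[of "%n. conv psi (rho n)" K])
  fix n
  have "{x. conv psi (rho n) x ~= 0} <= K" using K0 by blast
  hence "closure {x. conv psi (rho n) x ~= 0} <= K" "bounded {x. conv psi (rho n) x ~= 0}"
   using K bounded_subset[OF compact_imp_bounded[OF K]] by (simp_all add: closure_minimal compact_imp_closed)
  thus "test_function U (conv psi (rho n))"
   using KU mollifier_smooth[OF rho] mollifier_bounded[OF rho]
   by (auto simp: test_iff intro!: smooth_conv int)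
 next
  fix b :: 'a assume b: "b : Basis"
  have cb: "continuous_on UNIV (pd b psi)" using psi(1) b by simp
  have "pd b (conv psi (rho n)) = conv (pd b psi) (rho n)" for n
  proof
   fix x
   \<comment> \<open>With the roles exchanged the derivative falls on \<open>psi\<close>, so that
     its partial derivatives get mollified in turn.\<close>
   have "conv psi (rho n) = conv (rho n) psi"
    by (rule ext) (rule conv_real_commute[OF c mollifier_cont[OF rho]])
   thus "pd b (conv psi (rho n)) x = conv (pd b psi) (rho n) x"
    using pd_conv[OF mollifier_integrable[OF rho] psi(1,2) b] conv_real_commute[OF cb mollifier_cont[OF rho]]
    by simp
  qed
  thus "uniform_limit UNIV (%n. pd b (conv psi (rho n))) (pd b psi) sequentially"
   using ul[OF cb bsupp_pd[OF psi(2)]] by simp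
 qed (use K KU K0 psi0 ul[OF c psi(2)] in auto)
qed

lemma cutoff_exists:
 fixes K :: "'a::euclidean_space set"
 assumes "compact K" "open U" "K <= U"
 obtains chi V where "test_function U chi" "!!x. 0 <= chi x" "!!x. chi x <= 1" "open V" "K <= V" "!!x. x : V ==> chi x = 1"
proof -
 obtain eps where eps: "eps > 0" "(UN x:K. cball x eps) <= U"
  using compact_subset_open_imp_cball_epsilon_subset[OF assms] by auto
 \<comment> \<open>Four radii add up to \<open>eps\<close>: the indicator lives within
   \<open>2 * r\<close> of \<open>K\<close>, mollifying adds \<open>r\<close>, and taking the
   closure of the support another \<open>r\<close>.\<close>
 define r where "r = eps / 4"
 have r: "r > 0" using eps by (simp add: r_def)
 define A where "A = (UN x:K. ball x (2 * r))"
 have A: "open A" "bounded A"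
 proof -
  obtain R where R: "!!x. x : K ==> norm x <= R" using compact_imp_bounded[OF assms(1)] by (auto simp: bounded_iff)
  have "norm y <= R + 2 * r" if "y : A" for y
  proof -
   obtain x where x: "x : K" "dist x y < 2 * r" using \<open>y : A\<close> by (auto simp: A_def)
   have "norm y <= norm x + dist x y" by (metis dist_norm norm_minus_commute norm_triangle_sub)
   with R[OF x(1)] x(2) show ?thesis by linarith
  qed
  thus "bounded A" by (auto simp: bounded_iff)
 qed (auto simp: A_def)
 have [measurable]: "A : sets borel" using A by simp
 have int: "integrable lborel (indicator A :: 'a => real)"
  using emeasure_bounded_finite[OF A(2)] by simp
 obtain rho :: "'a => real" where rho: "mollifier 0 r rho" using mollifier_exists[OF r] by metis
 define chi :: "'a => real" where "chi = conv (indicator A) rho"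
 have comm: "chi x = (LINT y|lborel. rho y * indicator A (x - y))" for x
  unfolding chi_def using conv_commute[OF _ mollifier_cont[OF rho], of "indicator A :: 'a => real"] by simp
 have 1: "chi x = 1" if "x : (UN x:K. ball x r)" for x
 proof -
  obtain z where z: "z : K" "dist z x < r" using \<open>x : _\<close> by auto
  have "norm (conv (indicator A) rho x - (indicator A x :: real)) <= 0"
  proof (rule conv_close[OF rho int])
   fix y :: 'a assume "y : ball 0 r"
   hence "dist z (x - y) < 2 * r" using z(2) dist_triangle[of z "x - y" x] by (simp add: dist_norm)
   thus "norm (indicator A (x - y) - (indicator A x :: real)) <= 0"
    using z r by (auto simp: A_def indicator_def intro!: bexI[of _ z])
  qed
  moreover have "x : A" using z r by (auto simp: A_def intro!: bexI[of _ z])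
  ultimately show ?thesis by (simp add: chi_def)
 qed
 have supp: "closure {x. chi x ~= 0} <= (UN x:K. cball x eps)"
 proof
  fix x assume "x : closure {x. chi x ~= 0}"
  then obtain x' where x': "chi x' ~= 0" "dist x' x < r" using r by (auto simp: closure_approachable)
  then obtain y where y: "(indicator A y :: real) ~= 0" "rho (x' - y) ~= 0"
   unfolding chi_def by (elim conv_nonzeroD)
  then obtain z where z: "z : K" "dist z y < 2 * r" by (auto simp: A_def indicator_def split: if_splits)
  have "dist x' y < r" using mollifier_support[OF rho y(2)] by (simp add: dist_norm norm_minus_commute)
  hence "dist z x <= eps"
   using z(2) x'(2) dist_triangle[of z x y] dist_triangle[of y x x'] by (simp add: r_def dist_commute)
  thus "x : (UN x:K. cball x eps)" using z by auto
 qed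
 show ?thesis
 proof (rule that[of chi "UN x:K. ball x r"])
  have "bounded {x. chi x ~= 0}"
  proof -
   obtain R where R: "!!x. x : K ==> norm x <= R" using compact_imp_bounded[OF assms(1)] by (auto simp: bounded_iff)
   have "norm y <= R + eps" if "chi y ~= 0" for y
   proof -
    have "y : closure {x. chi x ~= 0}" using that closure_subset by fastforce
    then obtain x where x: "x : K" "dist x y <= eps" using supp by auto
    have "norm y <= norm x + dist x y" by (metis dist_norm norm_minus_commute norm_triangle_sub)
    with R[OF x(1)] x(2) show ?thesis by linarith
   qed
   thus ?thesis by (auto simp: bounded_iff)
  qed
  thus "test_function U chi"
   unfolding test_iff using supp eps(2) mollifier_smooth[OF rho] mollifier_bounded[OF rho]
   by (auto simp: chi_def intro!: smooth_conv int)
  fix x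
  show "0 <= chi x" unfolding comm by (intro integral_nonneg_AE AE_I2 mult_nonneg_nonneg mollifier_nonneg[OF rho]) auto
  have "chi x <= (LINT y|lborel. rho y)"
   unfolding comm using mollifier_nonneg[OF rho]
   by (intro integral_mono_AE' AE_I2 mollifier_integrable[OF rho]) (auto simp: indicator_def)
  thus "chi x <= 1" using mollifier_integral[OF rho] by simp
 qed (use 1 r in auto)
qed

subsection \<open>Square integrable functions\<close>

lemma L2_measurable [measurable_dest]: "u : L2 M ==> u : borel_measurable M"
 and L2_integrable: "u : L2 M ==> integrable M (%x. (cmod (u x))^2)"
 by (auto simp: L2_def)

lemma L2I: "u : borel_measurable M ==> integrable M (%x. (cmod (u x))^2) ==> u : L2 M"
 by (auto simp: L2_def)

lemma L2_nrm_nonneg [simp]: "L2_nrm M u >= 0"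
 by (simp add: L2_nrm_def)

lemma L2_nrm_power2: "(L2_nrm M u)^2 = (LINT x|M. (cmod (u x))^2)"
 by (simp add: L2_nrm_def)

lemma L2_zero [simp]: "(%x. 0) : L2 M" "L2_nrm M (%x. 0) = 0"
 by (simp_all add: L2_def L2_nrm_def)

lemma L2_dominated:
 assumes v: "v : borel_measurable M" and w: "integrable M (%x. (w x)^2)" and le: "AE x in M. cmod (v x) <= w x"
 shows "v : L2 M"
proof (rule L2I[OF v])
 show "integrable M (%x. (cmod (v x))^2)"
  by (rule Bochner_Integration.integrable_bound[OF w])
    (use v le in "auto intro!: power_mono elim!: eventually_mono")
qed

lemma L2_cong_AE:
 assumes "u : L2 M" "v : borel_measurable M" "AE x in M. u x = v x"
 shows "v : L2 M"
 by (rule L2_dominated[OF assms(2) L2_integrable[OF assms(1)]]) (use assms(3) in "auto elim!: eventually_mono")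

lemma L2_nrm_cong_AE:
 assumes "AE x in M. u x = v x" "u : borel_measurable M" "v : borel_measurable M"
 shows "L2_nrm M u = L2_nrm M v"
 unfolding L2_nrm_def by (rule arg_cong[where f=sqrt], rule integral_cong_AE) (use assms in auto)

lemma L2_cmult: assumes "u : L2 M" shows "(%x. c * u x) : L2 M"
 using assms by (auto simp: L2_def norm_mult power_mult_distrib)

lemma L2_add:
 assumes u: "u : L2 M" and v: "v : L2 M" shows "(%x. u x + v x) : L2 M"
proof (rule L2I)
 show [measurable]: "(%x. u x + v x) : borel_measurable M" using u v by measurable
 show "integrable M (%x. (cmod (u x + v x))^2)"
 proof (rule Bochner_Integration.integrable_bound)
  show "integrable M (%x. 2 * (cmod (u x))^2 + 2 * (cmod (v x))^2)"
   using L2_integrable[OF u] L2_integrable[OF v] by simp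
  have "(cmod (u x + v x))^2 <= 2 * (cmod (u x))^2 + 2 * (cmod (v x))^2" for x
  proof -
   have "(cmod (u x + v x))^2 <= (cmod (u x) + cmod (v x))^2"
    by (intro power_mono norm_triangle_ineq) simp
   also have "... <= 2 * (cmod (u x))^2 + 2 * (cmod (v x))^2"
    using sum_squares_bound[of "cmod (u x)" "cmod (v x)"] by (simp add: power2_sum)
   finally show ?thesis .
  qed
  thus "AE x in M. norm ((cmod (u x + v x))^2) <= norm (2 * (cmod (u x))^2 + 2 * (cmod (v x))^2)"
   by (auto simp: abs_of_nonneg)
 qed measurable
qed

lemma L2_minus: "u : L2 M ==> (%x. - u x) : L2 M"
 using L2_cmult[of u M "-1"] by simp

lemma L2_diff: "u : L2 M ==> v : L2 M ==> (%x. u x - v x) : L2 M"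
 using L2_add[OF _ L2_minus, of u M v] by simp

lemma L2_cnj: "u : L2 M ==> (%x. cnj (u x)) : L2 M"
 by (auto simp: L2_def borel_measurable_complex_iff)

lemma L2_sum: "(!!i. i : I ==> u i : L2 M) ==> (%x. SUM i:I. u i x) : L2 M"
 by (induction I rule: infinite_finite_induct) (auto intro: L2_add)

lemma L2_nrm_cnj [simp]: "L2_nrm M (%x. cnj (u x)) = L2_nrm M u"
 by (simp add: L2_nrm_def)

lemma L2_nrm_cmult: "L2_nrm M (%x. c * u x) = cmod c * L2_nrm M u"
 by (simp add: L2_nrm_def norm_mult power_mult_distrib real_sqrt_mult)

lemma L2_nrm_minus_commute: "L2_nrm M (%x. u x - v x) = L2_nrm M (%x. v x - u x)"
 by (simp add: L2_nrm_def norm_minus_commute)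

lemma L2_mult_int_norm:
 assumes u: "u : L2 M" and v: "v : L2 M"
 shows "integrable M (%x. cmod (u x) * cmod (v x))"
proof (rule Bochner_Integration.integrable_bound)
 show "integrable M (%x. (cmod (u x))^2 + (cmod (v x))^2)"
  using L2_integrable[OF u] L2_integrable[OF v] by simp
 show "(%x. cmod (u x) * cmod (v x)) : borel_measurable M" using u v by measurable
 have "cmod (u x) * cmod (v x) <= (cmod (u x))^2 + (cmod (v x))^2" for x
  using sum_squares_bound[of "cmod (u x)" "cmod (v x)"] mult_nonneg_nonneg[OF norm_ge_zero[of "u x"] norm_ge_zero[of "v x"]]
  by linarith
 thus "AE x in M. norm (cmod (u x) * cmod (v x)) <= norm ((cmod (u x))^2 + (cmod (v x))^2)"
  by (auto simp: abs_of_nonneg)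
qed

lemma L2_mult_int:
 assumes u: "u : L2 M" and v: "v : L2 M"
 shows "integrable M (%x. u x * v x)"
 by (rule Bochner_Integration.integrable_bound[OF L2_mult_int_norm[OF assms]])
   (use u v in "auto simp: norm_mult L2_measurable intro!: borel_measurable_times")

lemma L2_nrm_eq_0_iff:
 assumes "u : L2 M" shows "L2_nrm M u = 0 \<longleftrightarrow> (AE x in M. u x = 0)"
 using integral_nonneg_eq_0_iff_AE[OF L2_integrable[OF assms]] by (simp add: L2_nrm_def)

lemma L2_Cauchy_Schwarz_norm:
 assumes u: "u : L2 M" and v: "v : L2 M"
 shows "(LINT x|M. cmod (u x) * cmod (v x)) <= L2_nrm M u * L2_nrm M v"
proof -
 define s where "s = L2_nrm M u" define t where "t = L2_nrm M v"
 let ?I = "LINT x|M. cmod (u x) * cmod (v x)"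
 consider "s = 0" | "t = 0" | "s > 0" "t > 0" using L2_nrm_nonneg[of M] by (auto simp: s_def t_def less_le)
 thus ?thesis
 proof cases
  case 1
  hence "AE x in M. u x = 0" using L2_nrm_eq_0_iff[OF u] by (simp add: s_def)
  hence "?I = (LINT x|M. 0)"
   by (intro integral_cong_AE) (use u v in "auto elim!: eventually_mono intro!: borel_measurable_times borel_measurable_norm L2_measurable")
  thus ?thesis by simp
 next
  case 2
  hence "AE x in M. v x = 0" using L2_nrm_eq_0_iff[OF v] by (simp add: t_def)
  hence "?I = (LINT x|M. 0)"
   by (intro integral_cong_AE) (use u v in "auto elim!: eventually_mono intro!: borel_measurable_times borel_measurable_norm L2_measurable")
  thus ?thesis by simp
 next
  case 3
  have "0 <= (LINT x|M. (t * cmod (u x) - s * cmod (v x))^2)" by (intro integral_nonneg_AE) auto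
  also have "... = (LINT x|M. t^2 * (cmod (u x))^2 + s^2 * (cmod (v x))^2 - 2 * s * t * (cmod (u x) * cmod (v x)))"
   by (simp add: power2_diff power_mult_distrib mult_ac)
  also have "... = t^2 * s^2 + s^2 * t^2 - 2 * s * t * ?I"
   using L2_integrable[OF u] L2_integrable[OF v] L2_mult_int_norm[OF u v]
   by (simp add: s_def t_def L2_nrm_power2)
  finally have "(2 * (s * t)) * ?I <= (2 * (s * t)) * (s * t)"
   by (simp add: power2_eq_square algebra_simps)
  thus ?thesis using 3 by (simp add: s_def t_def)
 qed
qed

lemma L2_Cauchy_Schwarz:
 assumes "u : L2 M" "v : L2 M"
 shows "cmod (LINT x|M. u x * v x) <= L2_nrm M u * L2_nrm M v"
 using integral_norm_bound[of M "%x. u x * v x"] L2_Cauchy_Schwarz_norm[OF assms]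
 by (simp add: norm_mult)

lemma L2_triangle:
 assumes u: "u : L2 M" and v: "v : L2 M"
 shows "L2_nrm M (%x. u x + v x) <= L2_nrm M u + L2_nrm M v"
proof (rule power2_le_imp_le)
 have "(L2_nrm M (%x. u x + v x))^2 <= (LINT x|M. (cmod (u x))^2 + (cmod (v x))^2 + 2 * (cmod (u x) * cmod (v x)))"
  unfolding L2_nrm_power2
 proof (intro integral_mono)
  show "integrable M (%x. (cmod (u x + v x))^2)" by (rule L2_integrable[OF L2_add[OF u v]])
  show "integrable M (%x. (cmod (u x))^2 + (cmod (v x))^2 + 2 * (cmod (u x) * cmod (v x)))"
   using L2_integrable[OF u] L2_integrable[OF v] L2_mult_int_norm[OF u v] by simp
  fix x
  have "(cmod (u x + v x))^2 <= (cmod (u x) + cmod (v x))^2"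
   by (intro power_mono norm_triangle_ineq) simp
  thus "(cmod (u x + v x))^2 <= (cmod (u x))^2 + (cmod (v x))^2 + 2 * (cmod (u x) * cmod (v x))"
   by (simp add: power2_sum)
 qed
 also have "... = (L2_nrm M u)^2 + (L2_nrm M v)^2 + 2 * (LINT x|M. cmod (u x) * cmod (v x))"
  using L2_integrable[OF u] L2_integrable[OF v] L2_mult_int_norm[OF u v] by (simp add: L2_nrm_power2)
 also have "... <= (L2_nrm M u + L2_nrm M v)^2"
  using L2_Cauchy_Schwarz_norm[OF u v] by (simp add: power2_sum)
 finally show "(L2_nrm M (%x. u x + v x))^2 <= (L2_nrm M u + L2_nrm M v)^2" .
qed simp

lemma L2_triangle_diff:
 assumes "u : L2 M" "v : L2 M" "w : L2 M"
 shows "L2_nrm M (%x. u x - w x) <= L2_nrm M (%x. u x - v x) + L2_nrm M (%x. v x - w x)"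
 using L2_triangle[OF L2_diff[OF assms(1,2)] L2_diff[OF assms(2,3)]] by simp

lemma L2_triangle_minus:
 assumes "u : L2 M" "v : L2 M"
 shows "L2_nrm M (%x. u x - v x) <= L2_nrm M u + L2_nrm M v"
 using L2_triangle[OF assms(1) L2_minus[OF assms(2)]] L2_nrm_cmult[of M "-1" v] by simp

lemma L2_triangle_abs:
 assumes "u : L2 M" "v : L2 M"
 shows "\<bar>L2_nrm M u - L2_nrm M v\<bar> <= L2_nrm M (%x. u x - v x)"
 using L2_triangle[OF L2_diff[OF assms] assms(2)] L2_triangle[OF L2_diff[OF assms(2,1)] assms(1)]
  L2_nrm_minus_commute[of M u v] by simp

lemma L2_triangle_sum:
 "(!!i. i : I ==> u i : L2 M) ==> L2_nrm M (%x. SUM i:I. u i x) <= (SUM i:I. L2_nrm M (u i))"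
proof (induction I rule: infinite_finite_induct)
 case (insert i I)
 thus ?case using L2_triangle[of "u i" M "%x. SUM i:I. u i x"] by (force intro: L2_sum)
qed auto

lemma
 assumes g: "g : borel_measurable M" and b: "AE x in M. cmod (g x) <= B" and u: "u : L2 M"
 shows L2_bounded_mult: "(%x. g x * u x) : L2 M"
  and L2_nrm_bounded_mult: "B >= 0 ==> L2_nrm M (%x. g x * u x) <= B * L2_nrm M u"
proof -
 have m: "(%x. g x * u x) : borel_measurable M" using g u by measurable
 have le: "AE x in M. cmod (g x * u x) <= B * cmod (u x)"
  using b by eventually_elim (simp add: norm_mult mult_right_mono)
 have le2: "AE x in M. (cmod (g x * u x))^2 <= (B * cmod (u x))^2"
  using le by eventually_elim (rule power_mono, auto)
 have int: "integrable M (%x. (B * cmod (u x))^2)"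
  using L2_integrable[OF u] by (simp add: power_mult_distrib)
 show *: "(%x. g x * u x) : L2 M" by (rule L2_dominated[OF m int le])
 assume B: "B >= 0"
 have "(L2_nrm M (%x. g x * u x))^2 <= (LINT x|M. (B * cmod (u x))^2)"
  unfolding L2_nrm_power2 using le2
  by (intro integral_mono_AE L2_integrable[OF *] int)
 also have "... = (B * L2_nrm M u)^2" by (simp add: power_mult_distrib L2_nrm_power2)
 finally show "L2_nrm M (%x. g x * u x) <= B * L2_nrm M u"
  by (rule power2_le_imp_le) (simp add: B)
qed

lemma L2_nn_integral:
 assumes "u : L2 M"
 shows "nn_integral M (%x. ennreal ((cmod (u x))^2)) = ennreal ((L2_nrm M u)^2)"
 unfolding L2_nrm_power2 by (rule nn_integral_eq_integral[OF L2_integrable[OF assms]]) auto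

lemma
 assumes m: "u : borel_measurable M" and le: "nn_integral M (%x. ennreal ((cmod (u x))^2)) <= ennreal (K^2)"
 shows L2_of_nn_integral: "u : L2 M"
  and L2_nrm_of_nn_integral: "K >= 0 ==> L2_nrm M u <= K"
proof -
 show *: "u : L2 M"
  using m le by (intro L2I integrableI_bounded) (auto simp: abs_of_nonneg intro: le_less_trans)
 assume "K >= 0"
 with le show "L2_nrm M u <= K"
  by (simp add: L2_nn_integral[OF *] abs_le_square_iff[symmetric])
qed

lemma L2_dominated_convergence:
 assumes m: "!!n. u n : borel_measurable M" "v : borel_measurable M"
  and w: "integrable M (%x. (w x)^2)" and lim: "AE x in M. (%n. u n x) ----> v x"
  and le: "!!n::nat. AE x in M. cmod (u n x) <= w x"
 shows "(%n. L2_nrm M (%x. u n x - v x)) ----> 0"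
proof -
 have v: "AE x in M. cmod (v x) <= w x"
 proof -
  have "AE x in M. ALL n. cmod (u n x) <= w x" using le by (simp add: AE_all_countable)
  with lim show ?thesis
   by eventually_elim (rule Lim_bounded[OF tendsto_norm], auto)
 qed
 have "(%n. LINT x|M. (cmod (u n x - v x))^2) ----> (LINT x|M. 0)"
 proof (rule integral_dominated_convergence[where w="%x. 4 * (w x)^2"])
  show "integrable M (%x. 4 * (w x)^2)" using w by simp
  show "AE x in M. (%n. (cmod (u n x - v x))^2) ----> 0"
   using lim by eventually_elim (auto intro!: tendsto_eq_intros simp: LIM_zero_iff)
  show "AE x in M. norm ((cmod (u n x - v x))^2) <= 4 * (w x)^2" for n
   using le[of n] v
  proof eventually_elim
   case (elim x)
   have "cmod (u n x - v x) <= 2 * w x" using elim norm_triangle_ineq4[of "u n x" "v x"] by linarith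
   hence "(cmod (u n x - v x))^2 <= (2 * w x)^2" by (intro power_mono) auto
   thus ?case by (simp add: power_mult_distrib)
  qed
 qed (use m in measurable)
 hence "(%n. sqrt (LINT x|M. (cmod (u n x - v x))^2)) ----> sqrt 0"
  by (intro tendsto_real_sqrt) simp
 thus ?thesis by (simp add: L2_nrm_def)
qed

lemma L2_tendsto_integral:
 assumes u: "!!n::nat. u n : L2 M" and v: "v : L2 M" and lim: "(%n. L2_nrm M (%x. u n x - v x)) ----> 0"
  and g: "g : L2 M"
 shows "(%n. LINT x|M. u n x * g x) ----> (LINT x|M. v x * g x)"
proof -
 have eq: "(LINT x|M. u n x * g x) - (LINT x|M. v x * g x) = (LINT x|M. (u n x - v x) * g x)" for n
  using L2_mult_int[OF u g] L2_mult_int[OF v g] by (simp add: left_diff_distrib)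
 have "(%n. L2_nrm M (%x. u n x - v x) * L2_nrm M g) ----> 0 * L2_nrm M g"
  by (intro tendsto_mult lim tendsto_const)
 moreover have "norm ((LINT x|M. u n x * g x) - (LINT x|M. v x * g x)) <= L2_nrm M (%x. u n x - v x) * L2_nrm M g" for n
  unfolding eq by (rule L2_Cauchy_Schwarz[OF L2_diff[OF u v] g])
 ultimately have "(%n. (LINT x|M. u n x * g x) - (LINT x|M. v x * g x)) ----> 0"
  using Lim_null_comparison[OF always_eventually] by (metis (no_types, lifting) mult_zero_left)
 thus ?thesis by (rule LIM_zero_cancel)
qed

lemma L2_tendsto_nrm:
 assumes "!!n::nat. u n : L2 M" "v : L2 M" "(%n. L2_nrm M (%x. u n x - v x)) ----> 0"
 shows "(%n. L2_nrm M (u n)) ----> L2_nrm M v"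
 by (rule LIM_zero_cancel)
   (rule Lim_null_comparison[OF always_eventually assms(3)],
   use L2_triangle_abs[OF assms(1,2)] in simp)

text \<open>Along a subsequence with geometrically small increments, the sum of the increments has
  finite integral, because on a finite measure space the L1 norm is bounded by the L2 norm; hence
  this subsequence converges almost everywhere. Fatou's lemma carries the Cauchy estimate over to
  the limit.\<close>

lemma L2_complete:
 assumes fin: "finite_measure M" and u: "!!n::nat. u n : L2 M"
  and Cauchy: "!!e. e > 0 ==> EX N. ALL m>=N. ALL n>=N. L2_nrm M (%x. u m x - u n x) < e"
 obtains v where "v : L2 M" "(%n. L2_nrm M (%x. u n x - v x)) ----> 0"
proof -
 interpret finite_measure M by (rule fin)
 note [measurable] = L2_measurable[OF u]
 have "ALL k. EX N. ALL m>=N. ALL n>=N. L2_nrm M (%x. u m x - u n x) < (1/2)^k"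
  using Cauchy by simp
 then obtain N where N: "!!k m n. m >= N k ==> n >= N k ==> L2_nrm M (%x. u m x - u n x) < (1/2)^k" by metis
 \<comment> \<open>Partial sums make \<open>r\<close> nondecreasing and keep
   \<open>r k >= N k\<close>.\<close>
 define r where "r k = (SUM j<=k. N j)" for k
 have rN: "r k >= N k" "r (Suc k) >= N k" "r (Suc k) >= r k" for k
  by (auto simp: r_def intro: member_le_sum trans_le_add1)
 have one: "(%x. 1) : L2 M" by (simp add: L2_def)
 define d where "d k x = cmod (u (r (Suc k)) x - u (r k) x)" for k x
 have dL: "nn_integral M (%x. ennreal (d k x)) <= ennreal ((1/2)^k * L2_nrm M (%x. 1))" for k
 proof -
  note L = L2_diff[OF u[of "r (Suc k)"] u[of "r k"]]
  have int: "integrable M (%x. d k x)"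
   using L2_mult_int_norm[OF L one] by (simp add: d_def)
  have "nn_integral M (%x. ennreal (d k x)) = ennreal (LINT x|M. d k x)"
   by (rule nn_integral_eq_integral[OF int]) (simp add: d_def)
  also have "(LINT x|M. d k x) <= L2_nrm M (%x. u (r (Suc k)) x - u (r k) x) * L2_nrm M (%x. 1)"
   using L2_Cauchy_Schwarz_norm[OF L one] by (simp add: d_def)
  also have "... <= (1/2)^k * L2_nrm M (%x. 1)"
   using N[of k "r (Suc k)" "r k"] rN by (intro mult_right_mono) (auto intro: less_imp_le)
  finally show ?thesis by (simp add: ennreal_leI)
 qed
 have "nn_integral M (%x. (\<Sum>k. ennreal (d k x))) = (\<Sum>k. \<integral>\<^sup>+x. ennreal (d k x) \<partial>M)"
  by (rule nn_integral_suminf) (simp add: d_def)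
 also have "... <= (\<Sum>k. ennreal ((1/2)^k * L2_nrm M (%x. 1)))"
  by (intro suminf_le dL) auto
 also have "... = ennreal (\<Sum>k. (1/2)^k * L2_nrm M (%x. 1))"
  by (intro suminf_ennreal2 summable_mult2) (auto intro: summable_geometric)
 also have "... < \<infinity>" by simp
 finally have "AE x in M. (\<Sum>k. ennreal (d k x)) ~= \<infinity>"
  by (intro nn_integral_PInf_AE) (auto simp: d_def)
 hence conv: "AE x in M. convergent (%k. u (r k) x)"
 proof eventually_elim
  case (elim x)
  hence "summable (%k. d k x)" by (intro summable_suminf_not_top) (auto simp: d_def)
  hence "summable (%k. u (r (Suc k)) x - u (r k) x)"
   by (intro summable_norm_cancel[of "%k. u (r (Suc k)) x - u (r k) x"]) (simp add: d_def)
  from tendsto_add[OF summable_LIMSEQ[OF this] tendsto_const[of "u (r 0) x"]]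
  show ?case by (auto simp: sum_lessThan_telescope[of "%k. u (r k) x"] intro: convergentI)
 qed
 define v where "v x = lim (%k. u (r k) x)" for x
 have [measurable]: "v : borel_measurable M" unfolding v_def by measurable
 have lim: "AE x in M. (%k. u (r k) x) ----> v x"
  using conv by eventually_elim (simp add: v_def convergent_LIMSEQ_iff)
 have est: "nn_integral M (%x. ennreal ((cmod (u n x - v x))^2)) <= ennreal (((1/2)^k)^2)" if n: "n >= N k" for n k
 proof -
  have "nn_integral M (%x. ennreal ((cmod (u n x - v x))^2))
    = nn_integral M (%x. liminf (%j. ennreal ((cmod (u n x - u (r j) x))^2)))"
  proof (intro nn_integral_cong_AE)
   show "AE x in M. ennreal ((cmod (u n x - v x))^2) = liminf (%j. ennreal ((cmod (u n x - u (r j) x))^2))"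
    using lim
   proof eventually_elim
    case (elim x)
    have "(%j. ennreal ((cmod (u n x - u (r j) x))^2)) ----> ennreal ((cmod (u n x - v x))^2)"
     by (intro tendsto_ennrealI tendsto_power tendsto_norm tendsto_diff tendsto_const elim)
    from lim_imp_Liminf[OF _ this] show ?case by simp
   qed
  qed
  also have "... <= liminf (%j. \<integral>\<^sup>+x. ennreal ((cmod (u n x - u (r j) x))^2) \<partial>M)"
   by (rule nn_integral_liminf) measurable
  also have "... <= ennreal (((1/2)^k)^2)"
  proof (rule Liminf_le)
   show "\<forall>\<^sub>F j in sequentially. (nn_integral M (%x. ennreal ((cmod (u n x - u (r j) x))^2))) <= ennreal (((1/2)^k)^2)"
    using eventually_ge_at_top[of k]
   proof eventually_elim
    case (elim j)
    have "r j >= N k" using elim by (auto simp: r_def intro: member_le_sum)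
    hence "L2_nrm M (%x. u n x - u (r j) x) <= (1/2)^k" using N n by (auto intro: less_imp_le)
    thus ?case
     unfolding L2_nn_integral[OF L2_diff[OF u u]] by (intro ennreal_leI power_mono) auto
   qed
  qed simp
  finally show ?thesis .
 qed
 have diff: "(%x. u n x - v x) : L2 M" "L2_nrm M (%x. u n x - v x) <= (1/2)^k" if "n >= N k" for n k
  using L2_of_nn_integral[OF _ est[OF that]] L2_nrm_of_nn_integral[OF _ est[OF that]] by auto
 have v: "v : L2 M" using L2_diff[OF u[of "N 0"] diff(1)[of 0 "N 0"]] by simp
 show ?thesis
 proof (rule that[OF v])
  show "(%n. L2_nrm M (%x. u n x - v x)) ----> 0"
  proof (rule LIMSEQ_I)
   fix e :: real assume "e > 0"
   then obtain k where k: "(1/2)^k < e" using real_arch_pow_inv[of e "1/2"] by auto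
   show "EX no. ALL n>=no. norm (L2_nrm M (%x. u n x - v x) - 0) < e"
    using diff(2) k by (intro exI[of _ "N k"]) (auto intro: le_less_trans)
  qed
 qed
qed

subsection \<open>Convergence of mollifications in L2\<close>

lemma L2_truncation:
 assumes F: "F : L2 M" and e: "e > 0"
 obtains N where "N > 0" "L2_nrm M (%x. (if cmod (F x) <= N then F x else 0) - F x) < e"
proof -
 have [measurable]: "F : borel_measurable M" using F by measurable
 have "(%n. L2_nrm M (%x. (if cmod (F x) <= real n then F x else 0) - F x)) ----> 0"
 proof (rule L2_dominated_convergence[where w="%x. cmod (F x)"])
  show "AE x in M. (%n. if cmod (F x) <= real n then F x else 0) ----> F x"
  proof (rule AE_I2, rule tendsto_eventually)
   fix x
   obtain n0 where "cmod (F x) <= real n0" using real_arch_simple by blast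
   thus "\<forall>\<^sub>F n in sequentially. (if cmod (F x) <= real n then F x else 0) = F x"
    by (intro eventually_sequentiallyI[of n0]) auto
  qed
 qed (use L2_integrable[OF F] in auto)
 hence "\<forall>\<^sub>F n in sequentially. L2_nrm M (%x. (if cmod (F x) <= real n then F x else 0) - F x) < e"
  using e by (rule order_tendstoD)
 then obtain n0 where "!!n. n >= n0 ==> L2_nrm M (%x. (if cmod (F x) <= real n then F x else 0) - F x) < e"
  by (auto simp: eventually_sequentially)
 from this[of "Suc n0"] show ?thesis using that[of "real (Suc n0)"] by simp
qed

text \<open>A truncation of \<open>F\<close> is bounded and almost everywhere a limit of continuous
  functions. Multiplying these by a cutoff and retracting their values to the disc of radius
  \<open>N\<close> keeps the limit and supplies a bound for dominated convergence.\<close>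

lemma L2_continuous_dense:
 fixes F :: "'a::euclidean_space => complex"
 assumes F: "F : L2 lborel" "bounded {x. F x ~= 0}" and e: "e > 0"
 obtains G where "continuous_on UNIV G" "bounded {x. G x ~= 0}" "L2_nrm lborel (%x. G x - F x) < e"
proof -
 obtain N where N: "N > 0" "L2_nrm lborel (%x. (if cmod (F x) <= N then F x else 0) - F x) < e/2"
  using L2_truncation[OF F(1), of "e/2"] e by auto
 define F' where "F' x = (if cmod (F x) <= N then F x else 0)" for x
 have Fm[measurable]: "F : borel_measurable borel" using L2_measurable[OF F(1)] by simp
 have F'm[measurable]: "F' : borel_measurable borel" unfolding F'_def by measurable
 have F'b: "cmod (F' x) <= N" for x using N by (simp add: F'_def)
 let ?K = "closure {x. F x ~= 0}"
 have K: "compact ?K" using F(2) by simp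
 obtain chi :: "'a => real" and V where chi: "test_function UNIV chi" "!!x. 0 <= chi x" "!!x. chi x <= 1"
   "?K <= V" "!!x. x : V ==> chi x = 1"
  using cutoff_exists[OF K open_UNIV] by (metis top_greatest)
 have chic: "continuous_on UNIV chi" using chi(1) Ck_continuous[of 0 chi] by (simp add: test_function_def smooth_def del: Ck.simps)
 have chib: "bounded {x. chi x ~= 0}" using chi(1) by (simp add: test_iff)
 have "F' measurable_on UNIV"
  by (rule lebesgue_measurable_imp_measurable_on) (auto intro: measurable_completion)
 then obtain S g where g: "negligible S" "!!n::nat. continuous_on UNIV (g n)"
   "!!x. x ~: S ==> (%n. g n x) ----> F' x"
  unfolding measurable_on_def by auto
 define P where "P = closest_point (cball (0::complex) N)"
 have P: "continuous_on UNIV P" "!!y. cmod (P y) <= N" "!!y. cmod y <= N ==> P y = y"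
  using N closest_point_in_set[of "cball (0::complex) N"]
  by (auto simp: P_def intro!: continuous_on_closest_point closest_point_self)
 define G where "G n x = of_real (chi x) * P (g n x)" for n x
 have Gc: "continuous_on UNIV (G n)" for n
  unfolding G_def by (intro continuous_intros chic continuous_on_compose2[OF P(1) g(2)]) auto
 have Gb: "bounded {x. G n x ~= 0}" for n
  by (rule bounded_subset[OF chib]) (auto simp: G_def)
 have "(%n. L2_nrm lborel (%x. G n x - F' x)) ----> 0"
 proof (rule L2_dominated_convergence[where w="%x. N * indicator (closure {x. chi x ~= 0}) x"])
  show "G n : borel_measurable lborel" for n
   using borel_measurable_continuous_onI[OF Gc] by simp
  show "F' : borel_measurable lborel" by measurable
  have "integrable lborel (%x. N^2 * indicator (closure {x. chi x ~= 0}) x :: real)"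
   using emeasure_bounded_finite[of "closure {x. chi x ~= 0}"] chib by (intro integrable_mult_right integrable_real_indicator) auto
  thus "integrable lborel (%x. (N * indicator (closure {x. chi x ~= 0}) x)^2 :: real)"
   by (rule back_subst[of "integrable lborel"]) (auto simp: indicator_def)
  have "S : null_sets lebesgue" using g(1) by (simp add: negligible_iff_null_sets)
  hence "AE x in lebesgue. x ~: S" by (rule AE_not_in)
  hence "AE x in lborel. x ~: S" by (simp add: AE_completion_iff)
  thus "AE x in lborel. (%n. G n x) ----> F' x"
  proof eventually_elim
   case (elim x)
   have "(%n. G n x) ----> of_real (chi x) * P (F' x)"
    unfolding G_def using continuous_on_tendsto_compose[OF P(1) g(3)[OF elim]] by (auto intro!: tendsto_intros)
   moreover have "of_real (chi x) * P (F' x) = F' x"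
   proof (cases "F x = 0")
    case False
    hence "x : ?K" using closure_subset[of "{x. F x ~= 0}"] by auto
    thus ?thesis using chi(4,5) P(3)[OF F'b] by auto
   qed (use P(3)[of 0] N in "simp add: F'_def")
   ultimately show ?case by simp
  qed
  show "AE x in lborel. cmod (G n x) <= N * indicator (closure {x. chi x ~= 0}) x" for n
  proof (rule AE_I2)
   fix x
   show "cmod (G n x) <= N * indicator (closure {x. chi x ~= 0}) x"
   proof (cases "chi x = 0")
    case False
    hence "x : closure {x. chi x ~= 0}" using closure_subset[of "{x. chi x ~= 0}"] by auto
    moreover have "chi x * cmod (P (g n x)) <= 1 * N" by (intro mult_mono chi P) auto
    ultimately show ?thesis using chi(2)[of x] by (simp add: G_def norm_mult)
   qed (use N in "simp add: G_def")
  qed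
 qed
 hence "\<forall>\<^sub>F n in sequentially. L2_nrm lborel (%x. G n x - F' x) < e/2"
  by (rule order_tendstoD) (use e in simp)
 then obtain n where n: "L2_nrm lborel (%x. G n x - F' x) < e/2"
  using eventually_happens'[of sequentially] by auto
 have L: "G n : L2 lborel" "F' : L2 lborel"
 proof -
  show "F' : L2 lborel"
   by (rule L2_dominated[OF _ L2_integrable[OF F(1)]]) (auto simp: F'_def)
  have "continuous_on UNIV (%x. (cmod (G n x))^2)" by (intro continuous_intros Gc)
  hence "integrable lborel (%x. (cmod (G n x))^2)"
   by (rule integrable_bsupp) (use Gb[of n] in simp)
  thus "G n : L2 lborel" using Gc by (auto intro!: L2I borel_measurable_continuous_onI)
 qed
 have "L2_nrm lborel (%x. G n x - F x) < e"
  using L2_triangle_diff[OF L F(1)] n N(2) by (simp add: F'_def)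
 thus ?thesis by (rule that[OF Gc Gb])
qed

lemma L2_continuous_bsupp:
 fixes G :: "'a::euclidean_space => complex"
 assumes "continuous_on UNIV G" "bounded {x. G x ~= 0}"
 shows "G : L2 lborel"
proof -
 have "continuous_on UNIV (%x. (cmod (G x))^2)" by (intro continuous_intros assms)
 hence "integrable lborel (%x. (cmod (G x))^2)"
  by (rule integrable_bsupp) (use assms in simp)
 thus ?thesis using assms by (auto intro!: L2I borel_measurable_continuous_onI)
qed

lemma
 fixes F :: "'a::euclidean_space => complex"
 assumes "F : L2 lborel"
 shows L2_translate: "(%x. F (x - z)) : L2 lborel"
  and L2_nrm_translate: "L2_nrm lborel (%x. F (x - z)) = L2_nrm lborel F"
proof -
 have [measurable]: "F : borel_measurable borel" using L2_measurable[OF assms] by simp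
 show "L2_nrm lborel (%x. F (x - z)) = L2_nrm lborel F"
  unfolding L2_nrm_def using lborel_integral_translate[of "%x. (cmod (F x))^2" "-z"] by simp
 show "(%x. F (x - z)) : L2 lborel"
  using lborel_integrable_translate[of "%x. (cmod (F x))^2" "-z"] L2_integrable[OF assms] by (auto intro!: L2I)
qed

lemma L2_translation_continuous:
 fixes F :: "'a::euclidean_space => complex"
 assumes F: "F : L2 lborel" "bounded {x. F x ~= 0}" and e: "e > 0"
 obtains d where "d > 0" "!!z. norm z < d ==> L2_nrm lborel (%x. F (x - z) - F x) < e"
proof -
 obtain G where G: "continuous_on UNIV G" "bounded {x. G x ~= 0}" "L2_nrm lborel (%x. G x - F x) < e/3"
  using L2_continuous_dense[OF F, of "e/3"] e by auto
 have GL: "G : L2 lborel" using G by (intro L2_continuous_bsupp)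
 obtain R where R: "!!x. G x ~= 0 ==> norm x <= R" using G(2) by (auto simp: bounded_iff)
 define m where "m = measure lborel (cball (0::'a) (R + 1))"
 have m: "m >= 0" by (simp add: m_def)
 define e' where "e' = e / (4 * sqrt (m + 1))"
 have e': "e' > 0" using e m by (simp add: e'_def)
 obtain d where d: "d > 0" "!!x y. dist x y < d ==> dist (G x) (G y) < e'"
  using bsupp_uniformly_continuous[OF G(1,2) e'] by metis
 show ?thesis
 proof (rule that[of "min d 1"])
  fix z :: 'a assume z: "norm z < min d 1"
  have "L2_nrm lborel (%x. G (x - z) - G x) <= sqrt (LINT x|lborel. e'^2 * indicator (cball (0::'a) (R + 1)) x)"
   unfolding L2_nrm_def
  proof (intro real_sqrt_le_mono integral_mono L2_integrable L2_diff L2_translate GL)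
   show "integrable lborel (%x. e'^2 * indicator (cball (0::'a) (R + 1)) x :: real)"
    by (intro integrable_mult_right integrable_real_indicator emeasure_lborel_cball_finite) simp
   fix x :: 'a
   show "(cmod (G (x - z) - G x))^2 <= e'^2 * indicator (cball 0 (R + 1)) x"
   proof (cases "norm x <= R + 1")
    case True
    have "dist (x - z) x < d" using z by (simp add: dist_norm)
    hence "cmod (G (x - z) - G x) <= e'" using d(2) by (simp add: dist_norm less_imp_le)
    thus ?thesis using True by (simp add: power_mono)
   next
    case False
    have "norm (x - z) > R" using False z norm_triangle_ineq2[of x z] by linarith
    hence "G (x - z) = 0" "G x = 0" using R[of "x - z"] R[of x] False by force+
    thus ?thesis by simp
   qed
  qed
  also have "... = e' * sqrt m" using e' by (simp add: m_def real_sqrt_mult)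
  also have "... <= e / 4"
  proof -
   have "sqrt m <= sqrt (m + 1)" by simp
   hence "e' * sqrt m <= e' * sqrt (m + 1)" using e' by (intro mult_left_mono) auto
   also have "... = e / 4" using m by (simp add: e'_def)
   finally show ?thesis .
  qed
  finally have 1: "L2_nrm lborel (%x. G (x - z) - G x) <= e / 4" .
  have 2: "L2_nrm lborel (%x. F (x - z) - G (x - z)) < e / 3"
   using L2_nrm_translate[OF L2_diff[OF F(1) GL], of z] G(3) L2_nrm_minus_commute[of lborel F G] by simp
  have "L2_nrm lborel (%x. F (x - z) - F x)
    <= L2_nrm lborel (%x. F (x - z) - G (x - z)) + (L2_nrm lborel (%x. G (x - z) - G x) + L2_nrm lborel (%x. G x - F x))"
   using L2_triangle_diff[OF L2_translate[OF F(1), of z] L2_translate[OF GL, of z] F(1)]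
    L2_triangle_diff[OF L2_translate[OF GL, of z] GL F(1)] by linarith
  thus "L2_nrm lborel (%x. F (x - z) - F x) < e" using 1 2 G(3) e by linarith
 qed (use d in auto)
qed

lemma L2_integrable_bounded_support:
 fixes F :: "'a::euclidean_space => complex"
 assumes F: "F : L2 lborel" and b: "bounded {x. F x ~= 0}"
 shows "integrable lborel F"
proof -
 let ?K = "closure {x. F x ~= 0}"
 have "emeasure lborel ?K < \<infinity>" using b by (intro emeasure_bounded_finite bounded_closure)
 hence "(%x. indicator ?K x) : L2 lborel"
  by (intro L2I) (auto simp: indicator_def of_bool_def if_distrib[of cmod] if_distrib[of "%x. x^2"]
    integrable_indicator_iff[unfolded indicator_def of_bool_def] cong: if_cong)
 from L2_mult_int[OF F this] show ?thesis
 proof (rule back_subst[of "integrable lborel"])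
  show "(%x. F x * indicator ?K x) = F"
   using closure_subset[of "{x. F x ~= 0}"] by (auto simp: fun_eq_iff indicator_def)
 qed
qed

text \<open>Cauchy-Schwarz with \<open>rho\<close> split into square roots bounds the squared
  difference at \<open>x\<close> by the \<open>rho\<close>-average of squared translation
  differences. Integrating in \<open>x\<close> and exchanging the integrals leaves only translations
  by vectors of the ball that supports \<open>rho\<close>.\<close>

lemma
 fixes F :: "'a::euclidean_space => complex"
 assumes rho: "mollifier a r rho" and F: "F : L2 lborel" "integrable lborel F" and K: "K >= 0"
  and tr: "!!z. z : ball a r ==> L2_nrm lborel (%x. F (x - z) - F x) <= K"
 shows L2_conv_diff: "(%x. conv F rho x - F x) : L2 lborel"
  and L2_nrm_conv_diff: "L2_nrm lborel (%x. conv F rho x - F x) <= K"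
proof -
 have Fm[measurable]: "F : borel_measurable borel" using F by auto
 have rhom[measurable]: "rho : borel_measurable borel"
  using mollifier_cont[OF rho] by (rule borel_measurable_continuous_onI)
 have cm[measurable]: "conv F rho : borel_measurable borel"
  using smooth_conv[OF F(2) mollifier_smooth[OF rho] mollifier_bounded[OF rho]]
  by (intro borel_measurable_continuous_onI) (meson Ck_continuous smooth_def)
 have nn1: "nn_integral lborel (%z. ennreal (rho z)) = 1"
  using nn_integral_eq_integral[OF mollifier_integrable[OF rho]] mollifier_nonneg[OF rho] mollifier_integral[OF rho] by simp
 have pt: "ennreal ((cmod (conv F rho x - F x))^2) <= nn_integral lborel (%z. ennreal (rho z) * ennreal ((cmod (F (x - z) - F x))^2))" for x
 proof -
  have int1: "integrable lborel (%y. rho y *\<^sub>R F (x - y))"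
  proof -
   have "integrable lborel (%y. rho (x - y) *\<^sub>R F y)"
    by (rule conv_integrable[OF F(2) mollifier_cont[OF rho] mollifier_bounded[OF rho]])
   hence "integrable lborel (%y. rho (x - (x - y)) *\<^sub>R F (x - y))"
    by (subst lborel_integrable_reflect[of "%y. rho (x - y) *\<^sub>R F y" x]) measurable
   thus ?thesis by simp
  qed
  have int2: "integrable lborel (%y. rho y *\<^sub>R F x)"
   using mollifier_integrable[OF rho] by simp
  have "conv F rho x - F x = (LINT y|lborel. rho y *\<^sub>R F (x - y)) - (LINT y|lborel. rho y *\<^sub>R F x)"
   using mollifier_integral[OF rho] mollifier_integrable[OF rho]
   by (simp add: conv_commute[OF Fm mollifier_cont[OF rho]])
  also have "... = (LINT y|lborel. rho y *\<^sub>R (F (x - y) - F x))"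
   using int1 int2 by (simp add: scaleR_diff_right)
  finally have eq: "conv F rho x - F x = (LINT y|lborel. rho y *\<^sub>R (F (x - y) - F x))" .
  have "ennreal (cmod (conv F rho x - F x)) <= nn_integral lborel (%y. ennreal (norm (rho y *\<^sub>R (F (x - y) - F x))))"
   unfolding eq by (rule integral_norm_bound_ennreal) (use int1 int2 in "simp add: scaleR_diff_right")
  also have "... = nn_integral lborel (%y. ennreal (sqrt (rho y)) * ennreal (sqrt (rho y) * cmod (F (x - y) - F x)))"
   using mollifier_nonneg[OF rho] by (intro nn_integral_cong) (simp flip: ennreal_mult add: mult.assoc[symmetric] real_sqrt_mult_self)
  finally have "(ennreal (cmod (conv F rho x - F x)))^2 <=
    (nn_integral lborel (%y. ennreal (sqrt (rho y)) * ennreal (sqrt (rho y) * cmod (F (x - y) - F x))))^2"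
   by (intro power_mono) auto
  also have "... <= nn_integral lborel (%y. (ennreal (sqrt (rho y)))^2)
     * nn_integral lborel (%y. (ennreal (sqrt (rho y) * cmod (F (x - y) - F x)))^2)"
   by (rule Cauchy_Schwarz_nn_integral) measurable
  also have "nn_integral lborel (%y. (ennreal (sqrt (rho y)))^2) = 1"
   using mollifier_nonneg[OF rho] nn1 by (simp add: ennreal_power)
  also have "nn_integral lborel (%y. (ennreal (sqrt (rho y) * cmod (F (x - y) - F x)))^2)
    = nn_integral lborel (%z. ennreal (rho z) * ennreal ((cmod (F (x - z) - F x))^2))"
   using mollifier_nonneg[OF rho]
   by (intro nn_integral_cong) (simp add: ennreal_power ennreal_mult power_mult_distrib)
  finally show ?thesis by (simp add: ennreal_power)
 qed
 have "nn_integral lborel (%x. ennreal ((cmod (conv F rho x - F x))^2))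
   <= nn_integral lborel (%x. (nn_integral lborel (%z. ennreal (rho z) * ennreal ((cmod (F (x - z) - F x))^2))))"
  by (intro nn_integral_mono pt)
 also have "... = nn_integral lborel (%z. (nn_integral lborel (%x. ennreal (rho z) * ennreal ((cmod (F (x - z) - F x))^2))))"
  by (rule lborel_pair.Fubini') measurable
 also have "... <= nn_integral lborel (%z. ennreal (rho z) * ennreal (K^2))"
 proof (rule nn_integral_mono)
  fix z
  have "ennreal (rho z) * nn_integral lborel (%x. ennreal ((cmod (F (x - z) - F x))^2)) <= ennreal (rho z) * ennreal (K^2)"
  proof (cases "rho z = 0")
   case False
   hence "L2_nrm lborel (%x. F (x - z) - F x) <= K" using mollifier_support[OF rho] tr by blast
   thus ?thesis
    unfolding L2_nn_integral[OF L2_diff[OF L2_translate[OF F(1)] F(1)]]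
    by (intro mult_left_mono ennreal_leI power_mono) auto
  qed simp
  thus "nn_integral lborel (%x. ennreal (rho z) * ennreal ((cmod (F (x - z) - F x))^2)) <= ennreal (rho z) * ennreal (K^2)"
   by (subst nn_integral_cmult) measurable
 qed
 also have "... = ennreal (K^2)" by (subst nn_integral_multc) (auto simp: nn1)
 finally have le: "nn_integral lborel (%x. ennreal ((cmod (conv F rho x - F x))^2)) <= ennreal (K^2)" .
 have m: "(%x. conv F rho x - F x) : borel_measurable lborel" by measurable
 show "(%x. conv F rho x - F x) : L2 lborel" by (rule L2_of_nn_integral[OF m le])
 show "L2_nrm lborel (%x. conv F rho x - F x) <= K" by (rule L2_nrm_of_nn_integral[OF m le K])
qed

lemma L2_conv:
 fixes F :: "'a::euclidean_space => complex"
 assumes rho: "mollifier a r rho" and F: "F : L2 lborel" "bounded {x. F x ~= 0}"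
 shows "conv F rho : L2 lborel"
proof -
 have "(%x. conv F rho x - F x) : L2 lborel"
 proof (rule L2_conv_diff[OF rho F(1) L2_integrable_bounded_support[OF F], of "2 * L2_nrm lborel F"])
  fix z show "L2_nrm lborel (%x. F (x - z) - F x) <= 2 * L2_nrm lborel F"
   using L2_triangle_minus[OF L2_translate[OF F(1), of z] F(1)] L2_nrm_translate[OF F(1), of z] by simp
 qed simp
 from L2_add[OF this F(1)] show ?thesis by simp
qed

text \<open>The centres may move as long as \<open>norm (a n) + r n\<close> tends to 0, since only
  translations by vectors of that size enter.\<close>

lemma L2_mollifier_tendsto:
 fixes F :: "'a::euclidean_space => complex"
 assumes rho: "!!n::nat. mollifier (a n) (r n) (rho n)" and lim: "(%n. norm (a n) + r n) ----> 0"
  and F: "F : L2 lborel" "bounded {x. F x ~= 0}"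
 shows "(%n. L2_nrm lborel (%x. conv F (rho n) x - F x)) ----> 0"
proof (rule LIMSEQ_I)
 fix e :: real assume e: "e > 0"
 obtain d where d: "d > 0" "!!z. norm z < d ==> L2_nrm lborel (%x. F (x - z) - F x) < e/2"
  using L2_translation_continuous[OF F, of "e/2"] e by (metis half_gt_zero)
 obtain N where N: "!!n. n >= N ==> norm (a n) + r n < d"
  using LIMSEQ_D[OF lim d(1)] by (metis abs_ge_self diff_zero le_less_trans real_norm_def)
 have "L2_nrm lborel (%x. conv F (rho n) x - F x) < e" if n: "n >= N" for n
 proof -
  have "L2_nrm lborel (%x. conv F (rho n) x - F x) <= e/2"
  proof (rule L2_nrm_conv_diff[OF rho F(1) L2_integrable_bounded_support[OF F]])
   fix z assume "z : ball (a n) (r n)"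
   hence "norm z < d" using N[OF n] norm_triangle_ineq2[of z "a n"] by (simp add: dist_norm norm_minus_commute)
   thus "L2_nrm lborel (%x. F (x - z) - F x) <= e/2" using d(2) by (simp add: less_imp_le)
  qed (use e in simp)
  thus ?thesis using e by simp
 qed
 thus "EX no. ALL n>=no. norm (L2_nrm lborel (%x. conv F (rho n) x - F x) - 0) < e"
  by (intro exI[of _ N]) auto
qed

section \<open>Integrals of partial derivatives over the whole space\<close>

text \<open>Near 0 the convolution of \<open>f\<close> with the indicator of a large ball is
  constant, equal to the integral of \<open>f\<close>. So its derivative at 0 vanishes; but this
  derivative is the convolution with \<open>pd b f\<close>, that is, the integral of
  \<open>pd b f\<close>.\<close>

lemma integral_pd_eq_0_real:
 fixes f :: "'a::euclidean_space => real"
 assumes f: "Ck 1 f" "bounded {x. f x ~= 0}" and b: "b : Basis"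
 shows "(LINT x|lborel. pd b f x) = 0"
proof -
 obtain R where R: "R > 0" "!!x. f x ~= 0 ==> norm x <= R" using f(2) by (auto simp: bounded_pos)
 define F where "F = (indicator (ball 0 (R + 2)) :: 'a => real)"
 have F: "integrable lborel F" unfolding F_def using emeasure_lborel_ball_finite by (intro integrable_real_indicator) auto
 have cf: "continuous_on UNIV f" "continuous_on UNIV (pd b f)" using Ck_continuous[OF f(1)] f(1) b by auto
 have [measurable]: "f : borel_measurable borel" "pd b f : borel_measurable borel"
  using cf by (auto intro: borel_measurable_continuous_onI)
 have F1: "F y = 1" if "f (x - y) ~= 0" "x : ball 0 1" for x y
 proof -
  have "norm y <= norm x + norm (x - y)" using norm_triangle_ineq4[of x "x - y"] by simp
  thus ?thesis using R(2)[OF that(1)] that(2) by (simp add: F_def)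
 qed
 have const: "conv F f x = (LINT x|lborel. f x)" if "x : ball 0 1" for x
 proof -
  have "conv F f x = (LINT y|lborel. f (x - y))"
   unfolding conv_def using F1[OF _ that] by (intro Bochner_Integration.integral_cong) force+
  thus ?thesis by (simp add: lborel_integral_reflect)
 qed
 have "(conv F f has_derivative (%h. 0)) (at 0)"
  by (rule has_derivative_transform_within_open[of "%x. LINT x|lborel. f x" _ _ _ "ball 0 1"])
    (use const in auto)
 hence "pd b (conv F f) 0 = 0" by (rule pd_eqI)
 hence "conv F (pd b f) 0 = 0" by (simp add: pd_conv[OF F f b])
 moreover have "conv F (pd b f) 0 = (LINT y|lborel. pd b f (0 - y))"
  unfolding conv_def
 proof (intro Bochner_Integration.integral_cong refl)
  fix y
  show "pd b f (0 - y) *\<^sub>R F y = pd b f (0 - y)"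
  proof (cases "pd b f (0 - y) = 0")
   case False
   hence "0 - y : closure {x. f x ~= 0}" using pd_outside_support by blast
   moreover have "closure {x. f x ~= 0} <= cball 0 R" by (rule closure_minimal) (use R in auto)
   ultimately have "norm y <= R" by auto
   thus ?thesis by (simp add: F_def)
  qed simp
 qed
 ultimately show ?thesis using lborel_integral_reflect[of "pd b f" 0] by simp
qed

lemma pd_linear_comp:
 assumes "bounded_linear T" "f differentiable (at x)"
 shows "pd b (%x. T (f x)) x = T (pd b f x)"
 by (rule pd_eqI, rule bounded_linear.has_derivative[OF assms(1)])
   (use assms(2) in "simp add: frechet_derivative_works")

lemma pd_mult:
 fixes f g :: "'a::euclidean_space => 'b::real_normed_algebra"
 assumes "f differentiable (at x)" "g differentiable (at x)"
 shows "pd b (%x. f x * g x) x = f x * pd b g x + pd b f x * g x"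
 using pd_eqI[OF has_derivative_mult[OF assms[unfolded frechet_derivative_works]], of b] by simp

lemma pd_add:
 assumes "f differentiable (at x)" "g differentiable (at x)"
 shows "pd b (%x. f x + g x) x = pd b f x + pd b g x"
 using pd_eqI[OF has_derivative_add[OF assms[unfolded frechet_derivative_works]], of b] by simp

lemma pd_of_real:
 "f differentiable (at x) ==> pd b (%x. complex_of_real (f x)) x = complex_of_real (pd b f x)"
 by (rule pd_linear_comp[OF bounded_linear_of_real])

lemma Ck1_diff: "Ck 1 f ==> f differentiable (at x)"
 and Ck1_pd: "Ck 1 f ==> b : Basis ==> continuous_on UNIV (pd b f)"
 and Ck1_continuous: "Ck 1 f ==> continuous_on UNIV f"
 using Ck_continuous[of 1 f] by auto

lemma integral_pd_eq_0:
 fixes f :: "'a::euclidean_space => complex"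
 assumes f: "Ck 1 f" "bounded {x. f x ~= 0}" and b: "b : Basis"
 shows "(LINT x|lborel. pd b f x) = 0"
proof -
 have int: "integrable lborel (pd b f)"
  by (rule integrable_bsupp[OF Ck1_pd[OF f(1) b] bsupp_pd[OF f(2)]])
 have "(LINT x|lborel. T (pd b f x)) = 0" if T: "bounded_linear T" for T :: "complex => real"
 proof -
  have "(LINT x|lborel. pd b (%x. T (f x)) x) = 0"
  proof (rule integral_pd_eq_0_real[OF Ck_linear_comp[OF T f(1)] _ b])
   show "bounded {x. T (f x) ~= 0}"
    by (rule bounded_subset[OF f(2)]) (use linear_0[OF bounded_linear.linear[OF T]] in auto)
  qed
  thus ?thesis by (simp add: pd_linear_comp[OF T Ck1_diff[OF f(1)]])
 qed
 from this[OF bounded_linear_Re] this[OF bounded_linear_Im] show ?thesis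
  using int by (simp add: complex_eq_iff)
qed

lemma test_Ck: "test_function D phi ==> Ck k phi"
 by (simp add: test_function_def smooth_def)

lemma test_cont: "test_function D phi ==> continuous_on UNIV phi"
 using test_Ck[of D phi 0] by simp

lemma test_pd_cont: "test_function D phi ==> b : Basis ==> continuous_on UNIV (pd b phi)"
 using test_Ck[of D phi 1] by simp

lemma test_diff: "test_function D phi ==> phi differentiable (at x)"
 using test_Ck[of D phi 1] by simp

lemma test_bounded: "test_function D phi ==> bounded {x. phi x ~= 0}"
 and test_support: "test_function D phi ==> closure {x. phi x ~= 0} <= D"
 and test_smooth: "test_function D phi ==> smooth phi"
 by (auto simp: test_iff)

lemma test_outside: "test_function D phi ==> x ~: D ==> phi x = 0"
 using test_support closure_subset[of "{x. phi x ~= 0}"] by blast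

subsection \<open>Weak derivatives on a bounded open set\<close>

locale bdd_open =
 fixes D :: "'a::euclidean_space set"
 assumes open_D: "open D" and bounded_D: "bounded D"
begin

abbreviation M where "M \<equiv> lebesgue_on D"

lemma D_sets: "D : sets lebesgue" "D : sets borel" "D : sets lborel"
 using open_D by auto

lemma finite_measure_M: "finite_measure M"
proof
 have "emeasure lborel D < \<infinity>" by (rule emeasure_bounded_finite[OF bounded_D])
 thus "emeasure M (space M) ~= \<infinity>"
  using D_sets by (simp add: emeasure_restrict_space)
qed

lemma AE_M_I: "(!!x. x : D ==> P x) ==> AE x in M. P x"
 by (rule AE_I2) simp

lemma continuous_measurable_M:
 fixes g :: "'a => 'b::topological_space"
 assumes "continuous_on UNIV g" shows "g : borel_measurable M"
 using borel_measurable_continuous_onI[OF assms] by (intro measurable_restrict_space1 measurable_completion) simp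

lemma borel_measurable_M:
 assumes "g : borel_measurable borel" shows "g : borel_measurable M"
 using assms by (intro measurable_restrict_space1 measurable_completion) simp

lemma continuous_bounded_on_D:
 fixes g :: "'a => 'b::real_normed_vector"
 assumes "continuous_on UNIV g"
 obtains B where "B > 0" "!!x. x : D ==> norm (g x) <= B"
proof -
 have "compact (g ` closure D)"
  using assms bounded_D by (intro compact_continuous_image) (auto intro: continuous_on_subset)
 then obtain B where "B > 0" "!!y. y : g ` closure D ==> norm y <= B"
  using compact_imp_bounded bounded_pos by metis
 thus ?thesis using closure_subset[of D] by (intro that[of B]) auto
qed

lemma one_L2: "(%x. 1) : L2 M"
proof -
 interpret finite_measure M by (rule finite_measure_M)
 show ?thesis by (simp add: L2_def)
qed

definition vol where "vol = L2_nrm M (%x. 1)"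

lemma vol_nonneg: "vol >= 0" by (simp add: vol_def)

lemma
 assumes "g : borel_measurable M" "AE x in M. cmod (g x) <= B"
 shows L2_bounded: "g : L2 M" and L2_nrm_bounded: "B >= 0 ==> L2_nrm M g <= B * vol"
 using L2_bounded_mult[OF assms one_L2] L2_nrm_bounded_mult[OF assms one_L2] by (simp_all add: vol_def)

lemma L2_continuous:
 assumes "continuous_on UNIV g" shows "g : L2 M"
proof -
 obtain B where "!!x. x : D ==> cmod (g x) <= B" using continuous_bounded_on_D[OF assms] by metis
 thus ?thesis
  by (intro L2_bounded[OF continuous_measurable_M[OF assms], of B] AE_M_I) auto
qed

lemma L2_test: "continuous_on UNIV phi ==> (%x. of_real (phi x)) : L2 M"
 by (rule L2_continuous) (intro continuous_intros)

lemma
 assumes "continuous_on UNIV a" "u : L2 M"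
 shows L2_continuous_mult: "(%x. of_real (a x) * u x) : L2 M"
  and L2_continuous_mult': "(%x. u x * of_real (a x)) : L2 M"
proof -
 obtain B where B: "!!x. x : D ==> norm (a x) <= B" using continuous_bounded_on_D[OF assms(1)] by metis
 show "(%x. of_real (a x) * u x) : L2 M"
  by (rule L2_bounded_mult[where B=B])
    (use assms B in "auto intro!: continuous_measurable_M continuous_intros AE_M_I")
 thus "(%x. u x * of_real (a x)) : L2 M" by (simp add: mult.commute)
qed

lemma L2_nrm_continuous_mult:
 assumes "continuous_on UNIV a"
 obtains B where "B > 0" "!!u. u : L2 M ==> L2_nrm M (%x. of_real (a x) * u x) <= B * L2_nrm M u"
proof -
 obtain B where B: "B > 0" "!!x. x : D ==> norm (a x) <= B" using continuous_bounded_on_D[OF assms(1)] by metis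
 show ?thesis
  by (rule that[OF B(1)], rule L2_nrm_bounded_mult)
    (use assms B in "auto intro!: continuous_measurable_M continuous_intros AE_M_I")
qed

lemma uniform_limit_L2:
 fixes f :: "'a => real"
 assumes "uniform_limit UNIV f' f sequentially" "!!n. continuous_on UNIV (f' n)" "continuous_on UNIV f"
 shows "(%n. L2_nrm M (%x. of_real (f' n x) - of_real (f x))) ----> 0"
proof (rule LIMSEQ_I)
 fix e :: real assume e: "e > 0"
 define e' where "e' = e / (2 * (vol + 1))"
 have e': "e' > 0" using e vol_nonneg by (simp add: e'_def)
 obtain N where N: "!!n x. n >= N ==> dist (f' n x) (f x) < e'"
  using uniform_limitD[OF assms(1) e'] by (auto simp: eventually_sequentially)
 show "EX no. ALL n>=no. norm (L2_nrm M (%x. of_real (f' n x) - of_real (f x)) - 0) < e"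
 proof (intro exI[of _ N] allI impI)
  fix n assume "n >= N"
  hence "cmod (of_real (f' n x) - of_real (f x)) <= e'" for x
   using N[of n x] by (simp add: dist_norm less_imp_le flip: of_real_diff)
  hence "L2_nrm M (%x. of_real (f' n x) - of_real (f x)) <= e' * vol"
   using assms e' by (intro L2_nrm_bounded continuous_measurable_M continuous_intros) auto
  also have "... <= e' * (vol + 1)" using e' by simp
  also have "... = e / 2" using vol_nonneg unfolding e'_def by (simp add: divide_simps)
  also have "... < e" using e by simp
  finally show "norm (L2_nrm M (%x. of_real (f' n x) - of_real (f x)) - 0) < e" by simp
 qed
qed

lemma integral_M_lborel:
 fixes h H :: "'a => complex"
 assumes "h : borel_measurable M" "H : borel_measurable borel" "!!x. x ~: D ==> H x = 0" "AE x in M. H x = h x"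
 shows "(LINT x|M. h x) = (LINT x|lborel. H x)"
proof -
 have "(LINT x|M. h x) = (LINT x|M. H x)"
  by (rule integral_cong_AE) (use assms borel_measurable_M in auto)
 also have "... = (LINT x|lebesgue. indicator D x *\<^sub>R H x)"
  using D_sets by (simp add: integral_restrict_space)
 also have "(%x. indicator D x *\<^sub>R H x) = H" using assms(3) by (auto simp: indicator_def fun_eq_iff)
 also have "(LINT x|lebesgue. H x) = (LINT x|lborel. H x)" using assms(2) by (simp add: integral_completion)
 finally show ?thesis .
qed

lemma
 assumes "F : L2 lborel"
 shows L2_M_lborel: "F : L2 M" and L2_nrm_M_le: "L2_nrm M F <= L2_nrm lborel F"
  and L2_nrm_M_eq: "(!!x. x ~: D ==> F x = 0) ==> L2_nrm lborel F = L2_nrm M F"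
proof -
 have Fm: "F : borel_measurable borel" using L2_measurable[OF assms] by simp
 have eq: "nn_integral M (%x. ennreal ((cmod (F x))^2)) = nn_integral lborel (%x. ennreal ((cmod (F x))^2) * indicator D x)"
  using Fm D_sets by (simp add: nn_integral_restrict_space nn_integral_completion)
 also have le: "... <= nn_integral lborel (%x. ennreal ((cmod (F x))^2))"
  by (intro nn_integral_mono) (auto simp: indicator_def)
 also have "... = ennreal ((L2_nrm lborel F)^2)" by (rule L2_nn_integral[OF assms])
 finally have *: "nn_integral M (%x. ennreal ((cmod (F x))^2)) <= ennreal ((L2_nrm lborel F)^2)" .
 show L: "F : L2 M" by (rule L2_of_nn_integral[OF borel_measurable_M[OF Fm] *])
 show "L2_nrm M F <= L2_nrm lborel F" by (rule L2_nrm_of_nn_integral[OF borel_measurable_M[OF Fm] *]) simp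
 assume 0: "!!x. x ~: D ==> F x = 0"
 hence "nn_integral lborel (%x. ennreal ((cmod (F x))^2) * indicator D x) = nn_integral lborel (%x. ennreal ((cmod (F x))^2))"
  by (intro nn_integral_cong) (auto simp: indicator_def)
 hence "ennreal ((L2_nrm M F)^2) = ennreal ((L2_nrm lborel F)^2)"
  using eq L2_nn_integral[OF L] L2_nn_integral[OF assms] by simp
 thus "L2_nrm lborel F = L2_nrm M F" by (simp add: power2_eq_iff_nonneg)
qed

text \<open>Convolutions are taken over \<open>lborel\<close>, whereas elements of
  \<open>L2 M\<close> are only Lebesgue measurable. So a Borel representative that vanishes outside
  \<open>D\<close> is chosen.\<close>

definition ext :: "('a => complex) => 'a => complex" where
 "ext u = (SOME F. F : L2 lborel & (ALL x. x ~: D --> F x = 0) & (AE x in M. F x = u x))"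

lemma
 assumes u: "u : L2 M"
 shows ext_L2: "ext u : L2 lborel" and ext_outside: "x ~: D ==> ext u x = 0" and ext_AE: "AE x in M. ext u x = u x"
proof -
 have m: "(%x. if x : D then Re (u x) else 0) : borel_measurable lebesgue"
  "(%x. if x : D then Im (u x) else 0) : borel_measurable lebesgue"
  using u D_sets by (auto simp: borel_measurable_if[OF D_sets(1)] L2_measurable intro!: borel_measurable_Re borel_measurable_Im)
 then obtain f g where fg: "f : borel_measurable lborel" "g : borel_measurable lborel"
  "AE x in lborel. (if x : D then Re (u x) else 0) = f x" "AE x in lborel. (if x : D then Im (u x) else 0) = g x"
  using completion_ex_borel_measurable_real[OF m(1)] completion_ex_borel_measurable_real[OF m(2)] by auto
 define F where "F x = (if x : D then Complex (f x) (g x) else 0)" for x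
 have Fm: "F : borel_measurable borel"
  unfolding F_def using fg(1,2) D_sets by (intro measurable_If_set) (auto simp: borel_measurable_complex_iff)
 have "AE x in lebesgue. x : D --> F x = u x"
  using AE_completion[OF fg(3)] AE_completion[OF fg(4)] by eventually_elim (auto simp: F_def complex_eq_iff)
 hence Fu: "AE x in M. F x = u x" by (simp add: AE_restrict_space_iff D_sets)
 have FM: "F : L2 M" by (rule L2_cong_AE[OF u borel_measurable_M[OF Fm]]) (use Fu in "auto elim: eventually_mono")
 have "nn_integral lborel (%x. ennreal ((cmod (F x))^2)) = nn_integral lborel (%x. ennreal ((cmod (F x))^2) * indicator D x)"
  by (intro nn_integral_cong) (auto simp: F_def)
 also have "... = nn_integral M (%x. ennreal ((cmod (F x))^2))"
  using Fm D_sets by (simp add: nn_integral_restrict_space nn_integral_completion)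
 also have "... = ennreal ((L2_nrm M F)^2)" by (rule L2_nn_integral[OF FM])
 finally have "F : L2 lborel" using Fm by (intro L2_of_nn_integral[where K="L2_nrm M F"]) auto
 hence "F : L2 lborel & (ALL x. x ~: D --> F x = 0) & (AE x in M. F x = u x)"
  using Fu by (simp add: F_def)
 from someI[of "%F. F : L2 lborel & (ALL x. x ~: D --> F x = 0) & (AE x in M. F x = u x)", OF this]
 show "ext u : L2 lborel" "x ~: D ==> ext u x = 0" "AE x in M. ext u x = u x"
  by (auto simp: ext_def)
qed

lemma ext_bounded: "u : L2 M ==> bounded {x. ext u x ~= 0}"
 by (rule bounded_subset[OF bounded_D]) (use ext_outside in blast)

lemma ext_integrable: "u : L2 M ==> integrable lborel (ext u)"
 by (rule L2_integrable_bounded_support[OF ext_L2 ext_bounded])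

lemma ext_measurable: "u : L2 M ==> ext u : borel_measurable borel"
 using ext_L2 L2_measurable by fastforce

lemma ext_nrm: assumes "u : L2 M" shows "L2_nrm lborel (ext u) = L2_nrm M u"
proof -
 have "L2_nrm lborel (ext u) = L2_nrm M (ext u)" by (rule L2_nrm_M_eq[OF ext_L2[OF assms] ext_outside[OF assms]])
 also have "... = L2_nrm M u"
  by (rule L2_nrm_cong_AE[OF ext_AE[OF assms] borel_measurable_M[OF ext_measurable[OF assms]]]) (use assms in measurable)
 finally show ?thesis .
qed

lemma conv_ext:
 assumes u: "u : L2 M" and rho: "continuous_on UNIV rho"
 shows "conv (ext u) rho x = (LINT y|M. u y * of_real (rho (x - y)))"
proof -
 have c: "continuous_on UNIV (%y. rho (x - y))"
  by (intro continuous_on_compose2[OF rho] continuous_intros) auto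
 have "(LINT y|M. u y * of_real (rho (x - y))) = (LINT y|lborel. ext u y * of_real (rho (x - y)))"
 proof (rule integral_M_lborel)
  show "(%y. u y * of_real (rho (x - y))) : borel_measurable M"
   using L2_measurable[OF u] continuous_measurable_M[OF c] by measurable
  show "(%y. ext u y * of_real (rho (x - y))) : borel_measurable borel"
   using ext_measurable[OF u] borel_measurable_continuous_onI[OF c] by measurable
  show "AE y in M. ext u y * of_real (rho (x - y)) = u y * of_real (rho (x - y))"
   using ext_AE[OF u] by eventually_elim simp
 qed (simp add: ext_outside[OF u])
 thus ?thesis by (simp add: conv_def scaleR_conv_of_real mult.commute)
qed

lemma mollifier_tendsto_M:
 assumes rho: "!!n::nat. mollifier (a n) (r n) (rho n)" and lim: "(%n. norm (a n) + r n) ----> 0" and u: "u : L2 M"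
 shows "(%n. L2_nrm M (%x. conv (ext u) (rho n) x - u x)) ----> 0"
proof (rule tendsto_sandwich[OF _ _ tendsto_const L2_mollifier_tendsto[OF rho lim ext_L2[OF u] ext_bounded[OF u]]])
 let ?d = "%n x. conv (ext u) (rho n) x - ext u x"
 let ?f = "%n x. conv (ext u) (rho n) x - u x"
 have L: "conv (ext u) (rho n) : L2 lborel" for n by (rule L2_conv[OF rho ext_L2[OF u] ext_bounded[OF u]])
 have "L2_nrm M (?f n) <= L2_nrm lborel (?d n)" for n
 proof -
  have d: "?d n : L2 lborel" by (rule L2_diff[OF L ext_L2[OF u]])
  have "L2_nrm M (?f n) = L2_nrm M (?d n)"
  proof (rule L2_nrm_cong_AE)
   show "AE x in M. conv (ext u) (rho n) x - u x = conv (ext u) (rho n) x - ext u x"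
    using ext_AE[OF u] by eventually_elim simp
   show "?f n : borel_measurable M"
    by (rule L2_measurable[OF L2_diff[OF L2_M_lborel[OF L] u]])
   show "?d n : borel_measurable M"
    by (rule L2_measurable[OF L2_M_lborel[OF d]])
  qed
  thus ?thesis using L2_nrm_M_le[OF d] by simp
 qed
 thus "\<forall>\<^sub>F n in sequentially. L2_nrm M (?f n)
   <= L2_nrm lborel (?d n)" by simp
qed simp

lemma smooth_reflect:
 assumes "smooth rho" shows "smooth (%y. rho (x - y))"
proof -
 have "Ck k (%y. rho (- y + x))" for k
  by (rule Ck_affine_comp[OF bounded_linear_minus[OF bounded_linear_ident] smooth_imp_Ck[OF assms]])
 thus ?thesis by (simp add: smooth_def)
qed

lemma test_reflect:
 assumes rho: "mollifier a r rho" and sub: "cball (x - a) r <= E"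
 shows "test_function E (%y. rho (x - y))"
proof -
 have s: "{y. rho (x - y) ~= 0} <= cball (x - a) r"
  using mollifier_support[OF rho] by (force simp: dist_norm norm_minus_commute algebra_simps)
 hence "closure {y. rho (x - y) ~= 0} <= cball (x - a) r" by (rule closure_minimal) simp
 thus ?thesis
  using sub bounded_subset[OF bounded_cball s] smooth_reflect[OF mollifier_smooth[OF rho]] by (auto simp: test_iff)
qed

lemma pd_reflect:
 assumes "smooth rho" shows "pd b (%y. rho (x - y)) y = - pd b rho (x - y)"
proof -
 have 1: "((%y. x - y) has_derivative (%h. - h)) (at y)" by (auto intro!: derivative_eq_intros)
 have "((%y. rho (x - y)) has_derivative (%h. frechet_derivative rho (at (x - y)) (- h))) (at y)"
  using diff_chain_at[OF 1 smooth_has_derivative[OF assms]] by (simp add: o_def)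
 from pd_eqI[OF this, of b] show ?thesis
  using linear_neg[OF bounded_linear.linear[OF has_derivative_bounded_linear[OF smooth_has_derivative[OF assms]]]]
  by simp
qed

text \<open>Mollify; the mollification vanishes eventually at every point of \<open>D\<close>.\<close>

lemma L2_test_function_zero:
 assumes v: "v : L2 M" and zero: "!!phi. test_function D phi ==> (LINT x|M. v x * of_real (phi x)) = 0"
 shows "AE x in M. v x = 0"
proof -
 define r where "r n = inverse (real (Suc n))" for n
 have r: "r n > 0" for n by (simp add: r_def)
 have r0: "r ----> 0" unfolding r_def by (rule LIMSEQ_inverse_real_of_nat)
 have "EX rho. mollifier (0::'a) (r n) rho" for n using mollifier_exists[OF r] by metis
 then obtain rho where rho: "!!n. mollifier (0::'a) (r n) (rho n)" by metis
 have ev: "\<forall>\<^sub>F n in sequentially. conv (ext v) (rho n) x = 0" if "x : D" for x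
 proof -
  obtain d where d: "d > 0" "cball x d <= D" using open_D \<open>x : D\<close> open_contains_cball by blast
  have "\<forall>\<^sub>F n in sequentially. r n < d" using order_tendstoD(2)[OF r0 d(1)] .
  thus ?thesis
  proof eventually_elim
   case (elim n)
   have "test_function D (%y. rho n (x - y))"
    by (rule test_reflect[OF rho]) (use elim d in auto)
   thus ?case using zero conv_ext[OF v mollifier_cont[OF rho]] by simp
  qed
 qed
 let ?c = "%n x. conv (ext v) (rho n) x"
 have cL: "?c n : L2 M" for n by (rule L2_M_lborel[OF L2_conv[OF rho ext_L2[OF v] ext_bounded[OF v]]])
 have lim: "(%n. L2_nrm M (%x. ?c n x - v x)) ----> 0"
  by (rule mollifier_tendsto_M[OF rho _ v]) (use r0 in simp)
 have [measurable]: "v : borel_measurable M" "!!n. ?c n : borel_measurable M" using v cL by (auto dest: L2_measurable)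
 have "nn_integral M (%x. ennreal ((cmod (v x))^2)) = nn_integral M (%x. liminf (%n. ennreal ((cmod (?c n x - v x))^2)))"
 proof (rule nn_integral_cong)
  fix x assume "x : space M"
  hence "x : D" by simp
  have "(%n. ennreal ((cmod (?c n x - v x))^2)) ----> ennreal ((cmod (v x))^2)"
   by (rule tendsto_eventually) (use ev[OF \<open>x : D\<close>] in "auto elim: eventually_mono")
  from lim_imp_Liminf[OF _ this] show "ennreal ((cmod (v x))^2) = liminf (%n. ennreal ((cmod (?c n x - v x))^2))"
   by simp
 qed
 also have "... <= liminf (%n. \<integral>\<^sup>+x. ennreal ((cmod (?c n x - v x))^2) \<partial>M)"
  by (rule nn_integral_liminf) measurable
 also have "(%n. \<integral>\<^sup>+x. ennreal ((cmod (?c n x - v x))^2) \<partial>M) = (%n. ennreal ((L2_nrm M (%x. ?c n x - v x))^2))"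
  using L2_nn_integral[OF L2_diff[OF cL v]] by simp
 also have "liminf ... = ennreal (0^2)"
  by (rule lim_imp_Liminf) (simp, intro tendsto_ennrealI tendsto_power lim)
 finally have "L2_nrm M v = 0"
  using L2_nn_integral[OF v] by simp
 thus ?thesis using L2_nrm_eq_0_iff[OF v] by simp
qed

lemma weak_deriv_L2: "has_weak_deriv D b u v ==> u : L2 M" "has_weak_deriv D b u v ==> v : L2 M"
 by (auto simp: has_weak_deriv_def)

lemma weak_derivD:
 "has_weak_deriv D b u v ==> test_function D phi ==>
  (LINT x|M. u x * of_real (pd b phi x)) = - (LINT x|M. v x * of_real (phi x))"
 by (auto simp: has_weak_deriv_def)

lemma weak_deriv_unique:
 assumes "has_weak_deriv D b u v" "has_weak_deriv D b u w"
 shows "AE x in M. v x = w x"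
proof -
 have L: "v : L2 M" "w : L2 M" using assms weak_deriv_L2 by auto
 have "AE x in M. v x - w x = 0"
 proof (rule L2_test_function_zero[OF L2_diff[OF L]])
  fix phi assume phi: "test_function D phi"
  note phiL = L2_test[OF test_cont[OF phi]]
  show "(LINT x|M. (v x - w x) * of_real (phi x)) = 0"
   using weak_derivD[OF assms(1) phi] weak_derivD[OF assms(2) phi] L2_mult_int[OF L(1) phiL] L2_mult_int[OF L(2) phiL]
   by (simp add: left_diff_distrib)
 qed
 thus ?thesis by simp
qed

lemma weak_deriv_cong:
 assumes "has_weak_deriv D b u v" "AE x in M. u x = u' x" "AE x in M. v x = v' x"
  "u' : borel_measurable M" "v' : borel_measurable M" and b: "b : Basis"
 shows "has_weak_deriv D b u' v'"
proof -
 have L: "u : L2 M" "v : L2 M" using assms(1) weak_deriv_L2 by auto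
 have L': "u' : L2 M" "v' : L2 M" using L2_cong_AE[OF L(1) assms(4,2)] L2_cong_AE[OF L(2) assms(5,3)] by auto
 show ?thesis
  unfolding has_weak_deriv_def
 proof (intro conjI allI impI L')
  fix phi assume phi: "test_function D phi"
  have m: "(%x. complex_of_real (phi x)) : borel_measurable M" "(%x. complex_of_real (pd b phi x)) : borel_measurable M"
   using L2_test[OF test_cont[OF phi]] L2_test[OF test_pd_cont[OF phi b]] by (auto dest: L2_measurable)
  have "(LINT x|M. u' x * of_real (pd b phi x)) = (LINT x|M. u x * of_real (pd b phi x))"
   using assms(2) m L L' by (intro integral_cong_AE) (auto dest: L2_measurable elim: eventually_mono)
  moreover have "(LINT x|M. v' x * of_real (phi x)) = (LINT x|M. v x * of_real (phi x))"
   using assms(3) m L L' by (intro integral_cong_AE) (auto dest: L2_measurable elim: eventually_mono)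
  ultimately show "(LINT x|M. u' x * of_real (pd b phi x)) = - (LINT x|M. v' x * of_real (phi x))"
   using weak_derivD[OF assms(1) phi] by simp
 qed
qed

lemma weak_deriv_add:
 assumes "has_weak_deriv D b u v" "has_weak_deriv D b u' v'" and b: "b : Basis"
 shows "has_weak_deriv D b (%x. u x + u' x) (%x. v x + v' x)"
proof -
 note L = weak_deriv_L2[OF assms(1)] weak_deriv_L2[OF assms(2)]
 show ?thesis
  unfolding has_weak_deriv_def
 proof (intro conjI allI impI L2_add L)
  fix phi assume phi: "test_function D phi"
  note P = L2_test[OF test_cont[OF phi]] L2_test[OF test_pd_cont[OF phi b]]
  show "(LINT x|M. (u x + u' x) * of_real (pd b phi x)) = - (LINT x|M. (v x + v' x) * of_real (phi x))"
   using weak_derivD[OF assms(1) phi] weak_derivD[OF assms(2) phi]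
    L2_mult_int[OF L(1) P(2)] L2_mult_int[OF L(2) P(1)] L2_mult_int[OF L(3) P(2)] L2_mult_int[OF L(4) P(1)]
   by (simp add: distrib_right)
 qed
qed

lemma weak_deriv_cmult:
 assumes "has_weak_deriv D b u v"
 shows "has_weak_deriv D b (%x. c * u x) (%x. c * v x)"
 using assms unfolding has_weak_deriv_def by (auto intro: L2_cmult simp: mult.assoc)

lemma weak_deriv_diff:
 assumes "has_weak_deriv D b u v" "has_weak_deriv D b u' v'" "b : Basis"
 shows "has_weak_deriv D b (%x. u x - u' x) (%x. v x - v' x)"
 using weak_deriv_add[OF assms(1) weak_deriv_cmult[OF assms(2), of "-1"] assms(3)] by simp

lemma weak_deriv_sum:
 assumes "!!i. i : I ==> has_weak_deriv D b (u i) (v i)" "b : Basis"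
 shows "has_weak_deriv D b (%x. SUM i:I. u i x) (%x. SUM i:I. v i x)"
 using assms(1)
proof (induction I rule: infinite_finite_induct)
 case (insert i I)
 thus ?case using weak_deriv_add[OF insert.prems[of i] insert.IH assms(2)] by simp
qed (auto simp: has_weak_deriv_def)

lemma weak_deriv_closed:
 assumes w: "!!n::nat. has_weak_deriv D b (u n) (v n)" and L: "u' : L2 M" "v' : L2 M"
  and lim: "(%n. L2_nrm M (%x. u n x - u' x)) ----> 0" "(%n. L2_nrm M (%x. v n x - v' x)) ----> 0" and b: "b : Basis"
 shows "has_weak_deriv D b u' v'"
 unfolding has_weak_deriv_def
proof (intro conjI allI impI L)
 fix phi assume phi: "test_function D phi"
 note P = L2_test[OF test_cont[OF phi]] L2_test[OF test_pd_cont[OF phi b]]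
 have "(%n. LINT x|M. u n x * of_real (pd b phi x)) ----> (LINT x|M. u' x * of_real (pd b phi x))"
  by (rule L2_tendsto_integral[OF weak_deriv_L2(1)[OF w] L(1) lim(1) P(2)])
 moreover have "(%n. - (LINT x|M. v n x * of_real (phi x))) ----> - (LINT x|M. v' x * of_real (phi x))"
  by (intro tendsto_minus L2_tendsto_integral[OF weak_deriv_L2(2)[OF w] L(2) lim(2) P(1)])
 ultimately show "(LINT x|M. u' x * of_real (pd b phi x)) = - (LINT x|M. v' x * of_real (phi x))"
  using weak_derivD[OF w phi] LIMSEQ_unique by simp
qed

lemma weak_derivD_C1:
 assumes w: "has_weak_deriv D b u v" and psi: "Ck 1 psi" "bounded {x. psi x ~= 0}" "closure {x. psi x ~= 0} <= D" and b: "b : Basis"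
 shows "(LINT x|M. u x * of_real (pd b psi x)) = - (LINT x|M. v x * of_real (psi x))"
proof -
 obtain psi' K where psi': "!!n. test_function D (psi' n)" "uniform_limit UNIV psi' psi sequentially"
  "!!b. b : Basis ==> uniform_limit UNIV (%n. pd b (psi' n)) (pd b psi) sequentially"
  by (rule C1_approx_test_functions[OF psi open_D]) blast
 note c = test_cont[OF psi'(1)] test_pd_cont[OF psi'(1) b] Ck1_continuous[OF psi(1)] Ck1_pd[OF psi(1) b]
 note L = weak_deriv_L2[OF w]
 have "(%n. LINT x|M. of_real (pd b (psi' n) x) * u x) ----> (LINT x|M. of_real (pd b psi x) * u x)"
  by (rule L2_tendsto_integral[OF L2_test[OF c(2)] L2_test[OF c(4)] uniform_limit_L2[OF psi'(3)[OF b] c(2,4)] L(1)])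
 moreover have "(%n. - (LINT x|M. of_real (psi' n x) * v x)) ----> - (LINT x|M. of_real (psi x) * v x)"
  by (intro tendsto_minus L2_tendsto_integral[OF L2_test[OF c(1)] L2_test[OF c(3)] uniform_limit_L2[OF psi'(2) c(1,3)] L(2)])
 ultimately show ?thesis
  using weak_derivD[OF w psi'(1)] LIMSEQ_unique by (simp add: mult.commute)
qed

text \<open>The product \<open>a * phi\<close> is itself used as a test function; it is only C1,
  which is the reason for \<open>weak_derivD_C1\<close>.\<close>

lemma weak_deriv_mult_C1:
 assumes w: "has_weak_deriv D b u v" and a: "Ck 1 a" and b: "b : Basis"
 shows "has_weak_deriv D b (%x. of_real (a x) * u x)
   (%x. of_real (a x) * v x + of_real (pd b a x) * u x)"
proof -
 note L = weak_deriv_L2[OF w]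
 note ca = Ck1_continuous[OF a] Ck1_pd[OF a b]
 note L' = L2_continuous_mult[OF ca(1) L(1)] L2_continuous_mult[OF ca(1) L(2)] L2_continuous_mult[OF ca(2) L(1)]
 show ?thesis
  unfolding has_weak_deriv_def
 proof (intro conjI allI impI L2_add L')
  fix phi assume phi: "test_function D phi"
  note P = L2_test[OF test_cont[OF phi]] L2_test[OF test_pd_cont[OF phi b]]
  define psi where "psi x = a x * phi x" for x
  have s: "{x. psi x ~= 0} <= {x. phi x ~= 0}" by (auto simp: psi_def)
  have psi: "Ck 1 psi" "bounded {x. psi x ~= 0}" "closure {x. psi x ~= 0} <= D"
   using Ck_mult[OF a test_Ck[OF phi]] bounded_subset[OF test_bounded[OF phi] s]
    closure_mono[OF s] test_support[OF phi] unfolding psi_def by (auto simp del: One_nat_def)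
  have pd: "pd b psi x = a x * pd b phi x + pd b a x * phi x" for x
   unfolding psi_def by (rule pd_mult[OF Ck1_diff[OF a] test_diff[OF phi]])
  have i: "integrable M (%x. of_real (a x) * u x * of_real (pd b phi x))"
   "integrable M (%x. of_real (pd b a x) * u x * of_real (phi x))"
   "integrable M (%x. of_real (a x) * v x * of_real (phi x))"
   by (intro L2_mult_int L' P)+
  have "(LINT x|M. of_real (a x) * u x * of_real (pd b phi x))
    + (LINT x|M. of_real (pd b a x) * u x * of_real (phi x))
    = (LINT x|M. u x * of_real (pd b psi x))"
   using i by (subst Bochner_Integration.integral_add[symmetric]) (auto simp: pd algebra_simps)
  also have "... = - (LINT x|M. of_real (a x) * v x * of_real (phi x))"
   unfolding weak_derivD_C1[OF w psi b] by (simp add: psi_def mult_ac)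
  finally show "(LINT x|M. of_real (a x) * u x * of_real (pd b phi x))
    = - (LINT x|M. (of_real (a x) * v x + of_real (pd b a x) * u x) * of_real (phi x))"
   using i by (simp add: distrib_right algebra_simps)
 qed
qed

lemma weak_deriv_C1:
 assumes f: "Ck 1 f" and b: "b : Basis"
 shows "has_weak_deriv D b f (pd b f)"
 unfolding has_weak_deriv_def
proof (intro conjI allI impI L2_continuous)
 show cf: "continuous_on UNIV f" "continuous_on UNIV (pd b f)"
  using f b by (auto intro: Ck1_continuous Ck1_pd)
 fix phi assume phi: "test_function D phi"
 note c = test_cont[OF phi] test_pd_cont[OF phi b]
 define g where "g x = f x * of_real (phi x)" for x
 have phi1: "Ck 1 (%x. complex_of_real (phi x))"
  by (rule Ck_linear_comp[OF bounded_linear_of_real test_Ck[OF phi]])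
 have g: "Ck 1 g" "bounded {x. g x ~= 0}"
  unfolding g_def by (rule Ck_mult[OF f phi1], rule bounded_subset[OF test_bounded[OF phi]]) auto
 have pd: "pd b g x = f x * of_real (pd b phi x) + pd b f x * of_real (phi x)" for x
  unfolding g_def using pd_mult[OF Ck1_diff[OF f] Ck1_diff[OF phi1]]
  by (simp add: pd_of_real[OF test_diff[OF phi]])
 have "closure {x. phi x ~= 0} <= D" by (rule test_support[OF phi])
 hence out: "pd b g x = 0" if "x ~: D" for x
  using that test_outside[OF phi] test_outside[OF test_pd[OF phi b]] by (simp add: pd)
 have gc: "continuous_on UNIV (pd b g)" by (rule Ck1_pd[OF g(1) b])
 have "0 = (LINT x|lborel. pd b g x)" using integral_pd_eq_0[OF g b] by simp
 also have "... = (LINT x|M. pd b g x)"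
  by (rule integral_M_lborel[symmetric]) (use out gc in "auto intro: continuous_measurable_M borel_measurable_continuous_onI")
 also have "... = (LINT x|M. f x * of_real (pd b phi x)) + (LINT x|M. pd b f x * of_real (phi x))"
  unfolding pd by (intro Bochner_Integration.integral_add L2_mult_int L2_continuous L2_test cf c)
 finally show "(LINT x|M. f x * of_real (pd b phi x)) = - (LINT x|M. pd b f x * of_real (phi x))"
  by (simp add: eq_neg_iff_add_eq_0)
qed

text \<open>The reflected kernel is the test function, so mollification commutes with weak
  differentiation exactly where that kernel is supported inside \<open>D\<close>.\<close>

lemma weak_deriv_conv:
 assumes w: "has_weak_deriv D b u v" and rho: "smooth rho" "test_function D (%y. rho (x - y))" and b: "b : Basis"
 shows "conv (ext u) (pd b rho) x = conv (ext v) rho x"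
proof -
 have c: "continuous_on UNIV rho" "continuous_on UNIV (pd b rho)"
  using smooth_imp_Ck[OF rho(1), of 1] b by (auto simp del: One_nat_def intro: Ck1_continuous Ck1_pd)
 show ?thesis
  using weak_derivD[OF w rho(2)]
  by (simp add: conv_ext[OF weak_deriv_L2(1)[OF w] c(2)] conv_ext[OF weak_deriv_L2(2)[OF w] c(1)] pd_reflect[OF rho(1)])
qed

section \<open>The spaces H1 and H2 and their chosen derivatives\<close>

lemma H1_L2: "u : H1 D ==> u : L2 M" by (simp add: H1_def)

lemma H1_wderiv: "u : H1 D ==> b : Basis ==> has_weak_deriv D b u (wderiv D b u)"
 unfolding wderiv_def by (rule someI_ex[of "has_weak_deriv D b u"]) (simp add: H1_def)

lemma wderiv_L2: "u : H1 D ==> b : Basis ==> wderiv D b u : L2 M"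
 using H1_wderiv weak_deriv_L2(2) by blast

lemma H1I: "(!!b. b : Basis ==> has_weak_deriv D b u (v b)) ==> u : H1 D"
 using SOME_Basis weak_deriv_L2(1) unfolding H1_def by blast

text \<open>\<open>wderiv\<close> is one representative picked by choice, so identities between such
  derivatives hold only almost everywhere.\<close>

lemma wderiv_AE: "has_weak_deriv D b u v ==> AE x in M. wderiv D b u x = v x"
 unfolding wderiv_def by (rule weak_deriv_unique[OF someI[of "has_weak_deriv D b u"]])

lemma wderiv_nrm:
 assumes "has_weak_deriv D b u v" shows "L2_nrm M (wderiv D b u) = L2_nrm M v"
proof (rule L2_nrm_cong_AE[OF wderiv_AE[OF assms]])
 show "wderiv D b u : borel_measurable M"
  using someI[of "has_weak_deriv D b u", OF assms] weak_deriv_L2(2) L2_measurable unfolding wderiv_def by blast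
 show "v : borel_measurable M" using assms weak_deriv_L2(2) L2_measurable by blast
qed

lemma H1_cong_AE:
 assumes u: "u : H1 D" and eq: "AE x in M. u x = v x" and v: "v : borel_measurable M"
 shows "v : H1 D" "b : Basis ==> AE x in M. wderiv D b v x = wderiv D b u x"
proof -
 have *: "has_weak_deriv D b v (wderiv D b u)" if "b : Basis" for b
  by (rule weak_deriv_cong[OF H1_wderiv[OF u that] eq _ v _ that]) (use L2_measurable[OF wderiv_L2[OF u that]] in auto)
 thus "v : H1 D" by (rule H1I)
 show "b : Basis ==> AE x in M. wderiv D b v x = wderiv D b u x" by (rule wderiv_AE[OF *])
qed

lemma H1_add: "u : H1 D ==> v : H1 D ==> (%x. u x + v x) : H1 D"
 by (rule H1I[OF weak_deriv_add[OF H1_wderiv H1_wderiv]])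

lemma H1_diff: "u : H1 D ==> v : H1 D ==> (%x. u x - v x) : H1 D"
 by (rule H1I[OF weak_deriv_diff[OF H1_wderiv H1_wderiv]])

lemma H1_cmult: "u : H1 D ==> (%x. c * u x) : H1 D"
 by (rule H1I[OF weak_deriv_cmult[OF H1_wderiv]])

lemma H1_C1: "Ck 1 f ==> f : H1 D"
 by (rule H1I[OF weak_deriv_C1])

lemma wderiv_diff: "u : H1 D ==> v : H1 D ==> b : Basis ==>
  AE x in M. wderiv D b (%x. u x - v x) x = wderiv D b u x - wderiv D b v x"
 by (rule wderiv_AE[OF weak_deriv_diff[OF H1_wderiv H1_wderiv]])

lemma H2_H1: "u : H2 D ==> u : H1 D" and H2_wderiv: "u : H2 D ==> b : Basis ==> wderiv D b u : H1 D"
 by (auto simp: H2_def)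

lemma wderiv_commute:
 assumes u: "u : H2 D" and b: "b : Basis" and c: "c : Basis"
 shows "AE x in M. wderiv D c (wderiv D b u) x = wderiv D b (wderiv D c u) x"
proof -
 note w = H1_wderiv[OF H2_H1[OF u]] and w2 = H1_wderiv[OF H2_wderiv[OF u]]
 have "AE x in M. wderiv D c (wderiv D b u) x - wderiv D b (wderiv D c u) x = 0"
 proof (rule L2_test_function_zero)
  show "(%x. wderiv D c (wderiv D b u) x - wderiv D b (wderiv D c u) x) : L2 M"
   by (intro L2_diff wderiv_L2 H2_wderiv u b c)
  fix phi assume phi: "test_function D phi"
  note phiL = L2_test[OF test_cont[OF phi]]
  have 1: "(LINT x|M. wderiv D c (wderiv D b u) x * of_real (phi x)) = (LINT x|M. u x * of_real (pd b (pd c phi) x))"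
   if b: "b : Basis" and c: "c : Basis" for b c
   using weak_derivD[OF w2[OF b c] phi] weak_derivD[OF w[OF b] test_pd[OF phi c]] by simp
  have "pd b (pd c phi) x = pd c (pd b phi) x" for x
   by (rule pd_commute_real[OF test_Ck[OF phi] b c])
  thus "(LINT x|M. (wderiv D c (wderiv D b u) x - wderiv D b (wderiv D c u) x) * of_real (phi x)) = 0"
   using 1[OF b c] 1[OF c b] L2_mult_int[OF wderiv_L2[OF H2_wderiv[OF u b] c] phiL]
    L2_mult_int[OF wderiv_L2[OF H2_wderiv[OF u c] b] phiL]
   by (simp add: left_diff_distrib)
 qed
 thus ?thesis by simp
qed

end

subsection \<open>A C1 step function\<close>

text \<open>A piecewise quadratic step from 0 to 1. Its derivative \<open>tent\<close> is explicit,
  with an upper bound everywhere and a lower bound on the middle half; both are used when layers are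
  compared with the surface.\<close>

definition step1 :: "real => real" where
 "step1 t = 2 * (max 0 t)^2 - 4 * (max 0 (t - 1/2))^2 + 2 * (max 0 (t - 1))^2"

definition tent :: "real => real" where
 "tent t = 4 * max 0 t - 8 * max 0 (t - 1/2) + 4 * max 0 (t - 1)"

lemma max0_square_derivative: "((%t::real. (max 0 t)^2) has_real_derivative 2 * max 0 t) (at t)"
proof -
 consider "t > 0" | "t < 0" | "t = 0" by linarith
 thus ?thesis
 proof cases
  case 1
  have "((%t::real. t^2) has_real_derivative 2 * t) (at t)" by (auto intro!: derivative_eq_intros)
  hence "((%t::real. (max 0 t)^2) has_real_derivative 2 * t) (at t)"
   by (rule has_field_derivative_transform_within_open[of _ _ _ "{0<..}"]) (use 1 in auto)
  thus ?thesis using 1 by simp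
 next
  case 2
  have "((%t::real. 0) has_real_derivative 0) (at t)" by simp
  hence "((%t::real. (max 0 t)^2) has_real_derivative 0) (at t)"
   by (rule has_field_derivative_transform_within_open[of _ _ _ "{..<0}"]) (use 2 in auto)
  thus ?thesis using 2 by simp
 next
  case 3
  have "((%h::real. (max 0 h)^2 / h) \<longlongrightarrow> 0) (at 0)"
  proof (rule Lim_null_comparison)
   show "\<forall>\<^sub>F h in at 0. norm ((max 0 h)^2 / h) <= \<bar>h\<bar>"
    by (intro always_eventually allI) (auto simp: max_def power2_eq_square)
   show "((%h::real. \<bar>h\<bar>) \<longlongrightarrow> 0) (at 0)" by (rule tendsto_eq_intros | simp)+
  qed
  thus ?thesis using 3 by (simp add: DERIV_def)
 qed
qed

lemma step1_derivative: "(step1 has_real_derivative tent t) (at t)"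
proof -
 have s: "((%t::real. (max 0 (t - c))^2) has_real_derivative 2 * max 0 (t - c)) (at t)" for c
 proof -
  have "((%t. t - c) has_real_derivative 1) (at t)" by (auto intro!: derivative_eq_intros)
  from DERIV_chain2[where f="%t::real. (max 0 t)^2" and g="%t. t - c", OF max0_square_derivative this]
  show ?thesis by simp
 qed
 show ?thesis
  unfolding step1_def[abs_def] tent_def
  by (rule DERIV_cong[OF DERIV_add[OF DERIV_diff[OF DERIV_cmult[OF max0_square_derivative] DERIV_cmult[OF s]] DERIV_cmult[OF s]]]) simp
qed

lemma step1_simps: "t <= 0 ==> step1 t = 0" "t >= 1 ==> step1 t = 1" "t <= 0 ==> tent t = 0" "t >= 1 ==> tent t = 0"
 by (auto simp: step1_def tent_def max_def power2_eq_square algebra_simps)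

lemma tent_bounds: "0 <= tent t" "tent t <= 2" "1/4 <= t ==> t <= 3/4 ==> 1 <= tent t"
 by (auto simp: tent_def max_def)

lemma continuous_tent: "continuous_on UNIV tent"
 unfolding tent_def[abs_def] by (intro continuous_intros)

lemma step1_bounds: "0 <= step1 t" "step1 t <= 1"
proof -
 have mono: "step1 a <= step1 b" if "a <= b" for a b
  by (rule DERIV_nonneg_imp_nondecreasing[OF that]) (use step1_derivative tent_bounds in blast)
 show "0 <= step1 t" using mono[of "min t 0" t] step1_simps(1)[of "min t 0"] by simp
 show "step1 t <= 1" using mono[of t "max t 1"] step1_simps(2)[of "max t 1"] by simp
qed

lemma Ck_step1: "Ck 1 step1"
proof -
 have "(step1 has_derivative (%h. h * tent t)) (at t)" for t
  using step1_derivative[of t] unfolding has_field_derivative_def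
  by (rule has_derivative_eq_rhs) (auto simp: mult.commute)
 hence "Ck (Suc 0) step1"
  by (rule CkI) (use continuous_tent in "auto intro: continuous_intros")
 thus ?thesis by simp
qed

lemma pd_real_comp:
 fixes g :: "real => real"
 assumes "(g has_real_derivative g') (at (f x))" "f differentiable (at x)"
 shows "pd b (%x. g (f x)) x = g' * pd b f x"
 using pd_eqI[OF diff_chain_at[OF assms(2)[unfolded frechet_derivative_works] assms(1)[unfolded has_field_derivative_def]], of b]
 by (simp add: o_def)

subsection \<open>Graph patches\<close>

locale graph_patch = bdd_open +
 fixes x0 :: 'a and e :: 'a and gam :: "'a => real" and r :: real
 assumes norm_e: "norm e = 1" and gam: "Ck 2 gam" and r: "r > 0"
  and D_patch: "D \<inter> ball x0 r = {y : ball x0 r. height_above_graph e gam y < 0}"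
begin

definition h where "h = height_above_graph e gam"

lemma D_iff: "y : ball x0 r ==> y : D \<longleftrightarrow> h y < 0"
 using D_patch unfolding h_def by blast

lemma Ck_h: "Ck 2 h"
proof -
 have A: "bounded_linear (%y. y - (y \<bullet> e) *\<^sub>R e)"
  by (intro bounded_linear_sub bounded_linear_ident bounded_linear_scaleR_left[THEN bounded_linear_compose] bounded_linear_inner_left)
 have "Ck 2 (%y. y \<bullet> e - gam ((y - (y \<bullet> e) *\<^sub>R e) + 0))"
  by (intro Ck_diff Ck_inner Ck_ident Ck_const Ck_affine_comp[OF A gam])
 thus ?thesis by (simp add: h_def height_above_graph_def[abs_def])
qed

lemma Ck1_h: "Ck 1 h" using Ck_h by (rule Ck_antimono) simp

lemma Ck1_pd_h: "b : Basis ==> Ck 1 (pd b h)"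
 using Ck_h Ck_pd[of 1 h b] by (simp add: numeral_2_eq_2 del: Ck.simps)

lemma h_translate: "h (x + t *\<^sub>R e) = h x + t"
proof -
 have "e \<bullet> e = 1" using norm_e by (simp add: norm_eq_sqrt_inner)
 hence "(x + t *\<^sub>R e) \<bullet> e = x \<bullet> e + t"
  and "x + t *\<^sub>R e - ((x + t *\<^sub>R e) \<bullet> e) *\<^sub>R e = x - (x \<bullet> e) *\<^sub>R e"
  by (auto simp: algebra_simps)
 thus ?thesis unfolding h_def height_above_graph_def by (simp only:)
qed

text \<open>\<open>h\<close> grows with unit speed along \<open>e\<close>. Contracting with
  \<open>e\<close> therefore recovers a quantity from its products with the partial derivatives of
  \<open>h\<close>; this serves the decomposition of the gradient as well as the layers.\<close>

lemma sum_e_pd_h: "(SUM b:Basis. (e \<bullet> b) * pd b h x) = 1"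
proof -
 have d: "h differentiable (at y)" for y by (rule Ck1_diff[OF Ck1_h])
 have "((%t. h (x + t *\<^sub>R e)) has_real_derivative frechet_derivative h (at (x + 0 *\<^sub>R e)) e) (at 0)"
  by (rule has_real_derivative_along[OF d])
 moreover have "((%t. h (x + t *\<^sub>R e)) has_real_derivative 1) (at 0)"
  unfolding h_translate by (auto intro!: derivative_eq_intros)
 ultimately have "frechet_derivative h (at x) e = 1" using DERIV_unique by fastforce
 thus ?thesis using pd_basis[of 0 h x e] Ck1_h by simp
qed

lemma pd_h_bounded: obtains B where "B > 0" "!!b x. b : Basis ==> x : cball x0 r ==> \<bar>pd b h x\<bar> <= B"
proof -
 have "EX B. ALL x:cball x0 r. \<bar>pd b h x\<bar> <= B" if "b : Basis" for b
 proof -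
  have "compact (pd b h ` cball x0 r)"
   using Ck1_pd[OF Ck1_h that] by (intro compact_continuous_image) (auto intro: continuous_on_subset)
  from compact_imp_bounded[OF this] show ?thesis unfolding bounded_iff by auto
 qed
 then obtain B where B: "!!b x. b : Basis ==> x : cball x0 r ==> \<bar>pd b h x\<bar> <= B b" by metis
 show ?thesis
 proof (rule that[of "Max (B ` Basis) + 1"])
  have "B b <= Max (B ` Basis)" if "b : Basis" for b using that by simp
  with B show "\<bar>pd b h x\<bar> <= Max (B ` Basis) + 1" if "b : Basis" "x : cball x0 r" for b x
   using that by (smt (verit))
  obtain b :: 'a where b: "b : Basis" using nonempty_Basis by blast
  have "0 <= B b" using B[OF b, of x0] r by simp
  also have "... <= Max (B ` Basis)" using b by simp
  finally show "0 < Max (B ` Basis) + 1" by simp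
 qed
qed

definition Lip where "Lip = (SOME L. L > 0 & (ALL x:ball x0 r. ALL y:ball x0 r. \<bar>h x - h y\<bar> <= L * dist x y))"

lemma Lip_pos: "Lip > 0" and h_Lipschitz: "x : ball x0 r ==> y : ball x0 r ==> \<bar>h x - h y\<bar> <= Lip * dist x y"
proof -
 obtain B where B: "B > 0" "!!b x. b : Basis ==> x : cball x0 r ==> \<bar>pd b h x\<bar> <= B" using pd_h_bounded by metis
 have d: "h differentiable (at y)" for y by (rule Ck1_diff[OF Ck1_h])
 have "\<bar>h x - h y\<bar> <= (real DIM('a) * B) * dist x y" if xy: "x : ball x0 r" "y : ball x0 r" for x y
 proof -
  obtain t where t: "0 < t" "t < 1" "h (y + (x - y)) - h y = frechet_derivative h (at (y + t *\<^sub>R (x - y))) (x - y)"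
   using MVT2[of 0 1 "%t. h (y + t *\<^sub>R (x - y))" "%t. frechet_derivative h (at (y + t *\<^sub>R (x - y))) (x - y)",
     OF _ has_real_derivative_along[OF d]] by auto
  have "(1 - t) *\<^sub>R y + t *\<^sub>R x : ball x0 r"
   using convexD_alt[OF convex_ball xy(2,1), of t] t by auto
  hence in_ball: "y + t *\<^sub>R (x - y) : cball x0 r"
   using ball_subset_cball by (auto simp: algebra_simps)
  have "h x - h y = (SUM b:Basis. ((x - y) \<bullet> b) * pd b h (y + t *\<^sub>R (x - y)))"
   using t(3) pd_basis[of 0 h "y + t *\<^sub>R (x - y)" "x - y"] Ck1_h by simp
  also have "\<bar>...\<bar> <= (SUM b:(Basis::'a set). dist x y * B)"
   using B(2)[OF _ in_ball] Basis_le_norm[of _ "x - y"]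
   by (intro order_trans[OF sum_abs sum_mono]) (auto simp: abs_mult dist_norm intro!: mult_mono)
  also have "... = (real DIM('a) * B) * dist x y" by simp
  finally show ?thesis .
 qed
 hence "real DIM('a) * B > 0 & (ALL x:ball x0 r. ALL y:ball x0 r. \<bar>h x - h y\<bar> <= (real DIM('a) * B) * dist x y)"
  using B(1) by simp
 from someI[of "%L. L > 0 & (ALL x:ball x0 r. ALL y:ball x0 r. \<bar>h x - h y\<bar> <= L * dist x y)", OF this]
 show "Lip > 0" "x : ball x0 r ==> y : ball x0 r ==> \<bar>h x - h y\<bar> <= Lip * dist x y"
  by (auto simp: Lip_def)
qed

text \<open>\<open>zeta d\<close> cuts off the layer \<open>- d < h < 0\<close> below the graph; its gradient is a negative multiple of that
 of \<open>h\<close>, of size \<open>1 / d\<close>.\<close>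

definition zeta :: "real => 'a => real" where "zeta d x = step1 (- h x / d - 1)"

lemma Ck_zeta: "Ck 1 (zeta d)"
proof -
 have "Ck 1 (%x. (- (1 / d)) * h x - 1)" by (intro Ck_diff Ck_mult Ck_const Ck1_h)
 hence "Ck 1 (%x. step1 ((- (1 / d)) * h x - 1))" by (rule Ck_real_comp[OF Ck_step1])
 thus ?thesis by (simp add: zeta_def[abs_def])
qed

lemma pd_zeta: "pd b (zeta d) x = - (1 / d) * tent (- h x / d - 1) * pd b h x"
proof -
 have d: "h differentiable (at x)" by (rule Ck1_diff[OF Ck1_h])
 have hd: "((%x. (- (1 / d)) * h x - 1) has_derivative (%v. (- (1 / d)) * frechet_derivative h (at x) v)) (at x)"
  by (rule has_derivative_eq_rhs[OF has_derivative_diff[OF has_derivative_mult_right[OF d[unfolded frechet_derivative_works]] has_derivative_const]]) simp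
 have eq: "zeta d = (%x. step1 ((- (1 / d)) * h x - 1))" by (simp add: zeta_def[abs_def])
 have "pd b (%x. step1 ((- (1 / d)) * h x - 1)) x = tent ((- (1 / d)) * h x - 1) * pd b (%x. (- (1 / d)) * h x - 1) x"
  by (rule pd_real_comp[where f="%x. (- (1 / d)) * h x - 1", OF step1_derivative differentiableI[OF hd]])
 also have "pd b (%x. (- (1 / d)) * h x - 1) x = (- (1 / d)) * pd b h x" by (rule pd_eqI[OF hd])
 finally show ?thesis unfolding eq by simp
qed

lemma zeta_bounds: "0 <= zeta d x" "zeta d x <= 1"
 by (auto simp: zeta_def step1_bounds)

text \<open>The support stays at depth at least \<open>d\<close> below the graph. Cutting off with
  \<open>zeta d\<close> thus makes functions supported in the patch admissible for testing weak
  derivatives on \<open>D\<close>.\<close>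

lemma zeta_support:
 assumes d: "d > 0" and phi: "closure {x. phi x ~= 0} <= ball x0 r"
 shows "closure {x. zeta d x * phi x ~= (0::real)} <= D"
proof -
 have s: "{x. zeta d x * phi x ~= 0} <= closure {x. phi x ~= 0} \<inter> {x. h x <= - d}"
 proof
  fix x assume "x : {x. zeta d x * phi x ~= 0}"
  hence x: "zeta d x ~= 0" "phi x ~= 0" by auto
  have "~ (- h x / d - 1 <= 0)" using x(1) step1_simps(1) by (auto simp: zeta_def)
  hence "h x <= - d" using d by (simp add: field_simps)
  thus "x : closure {x. phi x ~= 0} \<inter> {x. h x <= - d}" using x(2) closure_subset[of "{x. phi x ~= 0}"] by auto
 qed
 have "closed {x. h x <= - d}" by (intro closed_Collect_le Ck1_continuous[OF Ck1_h] continuous_on_const)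
 hence "closure {x. zeta d x * phi x ~= 0} <= closure {x. phi x ~= 0} \<inter> {x. h x <= - d}"
  by (intro closure_minimal s closed_Int) auto
 also have "... <= D" using phi D_iff d by force
 finally show ?thesis .
qed

lemma zeta_limit:
 assumes f: "integrable M f" and 0: "!!x. x ~: ball x0 r ==> f x = 0" and d: "!!n::nat. d n > 0" "d ----> 0"
 shows "(%n. LINT x|M. complex_of_real (zeta (d n) x) * f x) ----> (LINT x|M. f x)"
proof (rule integral_dominated_convergence[where w="%x. cmod (f x)"])
 show "(%x. of_real (zeta (d n) x) * f x) : borel_measurable M" for n
  using f continuous_measurable_M[OF Ck1_continuous[OF Ck_zeta]] by measurable
 show "AE x in M. (%n. of_real (zeta (d n) x) * f x) ----> f x"
 proof (rule AE_M_I)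
  fix x assume x: "x : D"
  show "(%n. of_real (zeta (d n) x) * f x) ----> f x"
  proof (cases "x : ball x0 r")
   case True
   hence hx: "h x < 0" using x D_iff by blast
   hence "\<forall>\<^sub>F n in sequentially. d n < - h x / 2" by (intro order_tendstoD(2)[OF d(2)]) simp
   hence "\<forall>\<^sub>F n in sequentially. of_real (zeta (d n) x) * f x = f x"
   proof eventually_elim
    case (elim n)
    hence "1 <= - h x / d n - 1" using d(1)[of n] by (simp add: field_simps)
    thus ?case by (simp add: zeta_def step1_simps)
   qed
   thus ?thesis by (rule tendsto_eventually)
  qed (simp add: 0)
 qed
 show "AE x in M. norm (of_real (zeta (d n) x) * f x) <= cmod (f x)" for n
  using zeta_bounds by (auto simp: norm_mult intro!: mult_left_le_one_le)
qed (use f in auto)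

end

subsection \<open>Functions with zero boundary values\<close>

text \<open>Zero boundary values in the weak sense: the extension by zero is weakly differentiable on the whole space.\<close>

definition (in bdd_open) H10 where
 "H10 = {u : H1 D. ALL b:Basis. ALL phi. test_function UNIV phi -->
   (LINT x|M. u x * of_real (pd b phi x)) = - (LINT x|M. wderiv D b u x * of_real (phi x))}"

context bdd_open begin

lemma H10_H1: "u : H10 ==> u : H1 D" by (simp add: H10_def)

lemma H10I:
 assumes w: "!!b. b : Basis ==> has_weak_deriv D b u (v b)"
  and eq: "!!b phi. b : Basis ==> test_function UNIV phi ==>
   (LINT x|M. u x * of_real (pd b phi x)) = - (LINT x|M. v b x * of_real (phi x))"
 shows "u : H10"
 unfolding H10_def
proof (intro CollectI conjI ballI allI impI)
 show u: "u : H1 D" by (rule H1I[OF w])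
 fix b :: 'a and phi :: "'a => real" assume b: "b : Basis" and phi: "test_function UNIV phi"
 have "(LINT x|M. wderiv D b u x * of_real (phi x)) = (LINT x|M. v b x * of_real (phi x))"
 proof (rule integral_cong_AE)
  show "AE x in M. wderiv D b u x * of_real (phi x) = v b x * of_real (phi x)"
   using wderiv_AE[OF w[OF b]] by eventually_elim simp
 qed (intro borel_measurable_times L2_measurable[OF wderiv_L2[OF u b]] L2_measurable[OF weak_deriv_L2(2)[OF w[OF b]]]
   L2_measurable[OF L2_test[OF test_cont[OF phi]]])+
 thus "(LINT x|M. u x * of_real (pd b phi x)) = - (LINT x|M. wderiv D b u x * of_real (phi x))"
  using eq[OF b phi] by simp
qed

lemma H10D: "u : H10 ==> b : Basis ==> test_function UNIV phi ==>
  (LINT x|M. u x * of_real (pd b phi x)) = - (LINT x|M. wderiv D b u x * of_real (phi x))"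
 by (simp add: H10_def)

lemma H10_add:
 assumes u: "u : H10" and v: "v : H10" shows "(%x. u x + v x) : H10"
proof (rule H10I[OF weak_deriv_add[OF H1_wderiv[OF H10_H1[OF u]] H1_wderiv[OF H10_H1[OF v]]]])
 fix b :: 'a and phi :: "'a => real" assume b: "b : Basis" and phi: "test_function UNIV phi"
 note P = L2_test[OF test_cont[OF phi]] L2_test[OF test_pd_cont[OF phi b]]
 note L = H1_L2[OF H10_H1[OF u]] H1_L2[OF H10_H1[OF v]] wderiv_L2[OF H10_H1[OF u] b] wderiv_L2[OF H10_H1[OF v] b]
 show "(LINT x|M. (u x + v x) * of_real (pd b phi x))
   = - (LINT x|M. (wderiv D b u x + wderiv D b v x) * of_real (phi x))"
  using H10D[OF u b phi] H10D[OF v b phi] L2_mult_int[OF L(1) P(2)] L2_mult_int[OF L(2) P(2)]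
   L2_mult_int[OF L(3) P(1)] L2_mult_int[OF L(4) P(1)]
  by (simp add: distrib_right)
qed

lemma H10_cmult:
 assumes u: "u : H10" shows "(%x. c * u x) : H10"
 by (rule H10I[OF weak_deriv_cmult[OF H1_wderiv[OF H10_H1[OF u]]]])
   (simp_all add: mult.assoc H10D[OF u])

lemma H10_zero: "(%x. 0) : H10"
 by (rule H10I[of _ "%b x. 0"]) (auto simp: has_weak_deriv_def)

lemma H10_sum: "(!!i. i : I ==> u i : H10) ==> (%x. SUM i:I. u i x) : H10"
 by (induction I rule: infinite_finite_induct) (auto intro: H10_add H10_zero)

lemma H10D_C1:
 assumes u: "u : H10" and psi: "Ck 1 psi" "bounded {x. psi x ~= 0}" and b: "b : Basis"
 shows "(LINT x|M. u x * of_real (pd b psi x)) = - (LINT x|M. wderiv D b u x * of_real (psi x))"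
proof -
 obtain psi' K where psi': "!!n. test_function UNIV (psi' n)" "uniform_limit UNIV psi' psi sequentially"
  "!!b. b : Basis ==> uniform_limit UNIV (%n. pd b (psi' n)) (pd b psi) sequentially"
  by (rule C1_approx_test_functions[OF psi subset_UNIV open_UNIV]) blast
 note c = test_cont[OF psi'(1)] test_pd_cont[OF psi'(1) b] Ck1_continuous[OF psi(1)] Ck1_pd[OF psi(1) b]
 note L = H1_L2[OF H10_H1[OF u]] wderiv_L2[OF H10_H1[OF u] b]
 have "(%n. LINT x|M. of_real (pd b (psi' n) x) * u x) ----> (LINT x|M. of_real (pd b psi x) * u x)"
  by (rule L2_tendsto_integral[OF L2_test[OF c(2)] L2_test[OF c(4)] uniform_limit_L2[OF psi'(3)[OF b] c(2,4)] L(1)])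
 moreover have "(%n. - (LINT x|M. of_real (psi' n x) * wderiv D b u x)) ----> - (LINT x|M. of_real (psi x) * wderiv D b u x)"
  by (intro tendsto_minus L2_tendsto_integral[OF L2_test[OF c(1)] L2_test[OF c(3)] uniform_limit_L2[OF psi'(2) c(1,3)] L(2)])
 ultimately show ?thesis
  using H10D[OF u b psi'(1)] LIMSEQ_unique by (simp add: mult.commute)
qed

lemma integrable_M_split:
 assumes "a : L2 M" "b : L2 M" "c : L2 M" "d : L2 M"
 shows "(LINT x|M. a x * b x + c x * d x) = (LINT x|M. a x * b x) + (LINT x|M. c x * d x)"
  and "(LINT x|M. a x * b x - c x * d x) = (LINT x|M. a x * b x) - (LINT x|M. c x * d x)"
 using L2_mult_int[OF assms(1,2)] L2_mult_int[OF assms(3,4)] by simp_all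

text \<open>Multiplying by \<open>chi\<close> amounts to testing with \<open>chi * phi\<close>.\<close>

lemma H10_mult_testI:
 assumes w: "!!b. b : Basis ==> has_weak_deriv D b u (v b)" and chi: "smooth chi"
  and eq: "!!b phi. b : Basis ==> test_function UNIV phi ==>
   (LINT x|M. u x * of_real (pd b (%x. chi x * phi x) x)) = - (LINT x|M. v b x * of_real (chi x * phi x))"
 shows "(%x. of_real (chi x) * u x) : H10"
proof (rule H10I[OF weak_deriv_mult_C1[OF w]])
 show chi1: "Ck 1 chi" by (rule smooth_imp_Ck[OF chi])
 fix b :: 'a and phi :: "'a => real" assume b: "b : Basis" and phi: "test_function UNIV phi"
 note L = weak_deriv_L2[OF w[OF b]]
 note c = Ck1_continuous[OF chi1] Ck1_pd[OF chi1 b]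
 note P = test_cont[OF phi] test_pd_cont[OF phi b]
 note L' = L2_continuous_mult[OF c(1) L(1)] L2_continuous_mult[OF c(1) L(2)] L2_continuous_mult[OF c(2) L(1)]
 have i: "integrable M (%x. of_real (chi x) * u x * of_real (pd b phi x))"
  "integrable M (%x. of_real (pd b chi x) * u x * of_real (phi x))"
  "integrable M (%x. of_real (chi x) * v b x * of_real (phi x))"
  by (intro L2_mult_int L' L2_test P)+
 have pd: "pd b (%x. chi x * phi x) x = chi x * pd b phi x + pd b chi x * phi x" for x
  by (rule pd_mult[OF Ck1_diff[OF chi1] test_diff[OF phi]])
 have "(LINT x|M. of_real (chi x) * u x * of_real (pd b phi x))
   + (LINT x|M. of_real (pd b chi x) * u x * of_real (phi x))
   = (LINT x|M. u x * of_real (pd b (%x. chi x * phi x) x))"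
  unfolding pd using i by (subst Bochner_Integration.integral_add[symmetric]) (auto simp: algebra_simps)
 also have "... = - (LINT x|M. of_real (chi x) * v b x * of_real (phi x))"
  unfolding eq[OF b phi] by (simp add: mult_ac)
 finally show "(LINT x|M. of_real (chi x) * u x * of_real (pd b phi x))
   = - (LINT x|M. (of_real (chi x) * v b x + of_real (pd b chi x) * u x) * of_real (phi x))"
  using i by (simp add: distrib_right algebra_simps)
qed

lemma H10_mult_test:
 assumes u: "u : H1 D" and chi: "test_function D chi"
 shows "(%x. of_real (chi x) * u x) : H10"
 by (rule H10_mult_testI[OF H1_wderiv[OF u] test_smooth[OF chi]])
   (assumption, rule weak_derivD[OF H1_wderiv[OF u] test_mult[OF chi test_smooth]])

end

section \<open>Sobolev norms and approximation by shifted mollifiers\<close>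

lemma tendsto_0_dominated:
 fixes f g :: "nat => real"
 assumes "g ----> 0" "!!n. 0 <= f n" "!!n. f n <= g n"
 shows "f ----> 0"
 by (rule tendsto_sandwich[OF _ _ tendsto_const assms(1)]) (use assms in auto)

context bdd_open begin

lemma H1_nrm_nonneg [simp]: "H1_nrm D u >= 0"
 by (simp add: H1_nrm_def sum_nonneg)

lemma H1_nrm_power2: "(H1_nrm D u)^2 = (L2_nrm M u)^2 + (SUM b:Basis. (L2_nrm M (wderiv D b u))^2)"
 by (simp add: H1_nrm_def sum_nonneg)

lemma L2_le_H1_nrm: "L2_nrm M u <= H1_nrm D u"
 by (rule power2_le_imp_le) (simp_all add: H1_nrm_power2 sum_nonneg)

lemma wderiv_le_H1_nrm: "b : Basis ==> L2_nrm M (wderiv D b u) <= H1_nrm D u"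
proof (rule power2_le_imp_le)
 assume b: "b : Basis"
 have "(L2_nrm M (wderiv D b u))^2 <= (SUM b:Basis. (L2_nrm M (wderiv D b u))^2)"
  by (rule member_le_sum[OF b]) auto
 thus "(L2_nrm M (wderiv D b u))^2 <= (H1_nrm D u)^2"
  unfolding H1_nrm_power2 using zero_le_power2[of "L2_nrm M u"] by linarith
qed simp

lemma H1_nrm_tendsto_0:
 assumes "(%n. L2_nrm M (f n)) ----> 0" "!!b. b : Basis ==> (%n. L2_nrm M (wderiv D b (f n))) ----> 0"
 shows "(%n. H1_nrm D (f n)) ----> 0"
proof -
 have "(%n. sqrt ((L2_nrm M (f n))^2 + (SUM b:Basis. (L2_nrm M (wderiv D b (f n)))^2))) ----> sqrt (0^2 + (SUM b:(Basis::'a set). 0^2))"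
  by (intro tendsto_real_sqrt tendsto_add tendsto_sum tendsto_power assms)
 thus ?thesis by (simp add: H1_nrm_def)
qed

lemma weak_deriv_cnj:
 assumes "has_weak_deriv D b u v" shows "has_weak_deriv D b (%x. cnj (u x)) (%x. cnj (v x))"
 unfolding has_weak_deriv_def
proof (intro conjI allI impI L2_cnj weak_deriv_L2[OF assms])
 fix phi assume phi: "test_function D phi"
 have "(LINT x|M. cnj (w x) * of_real (c x)) = cnj (LINT x|M. w x * of_real (c x))" for w c
  using integral_bounded_linear'[OF bounded_linear_cnj bounded_linear_cnj, of M "%x. w x * of_real (c x)"] by simp
 thus "(LINT x|M. cnj (u x) * of_real (pd b phi x)) = - (LINT x|M. cnj (v x) * of_real (phi x))"
  using weak_derivD[OF assms phi] by simp
qed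

lemma H1_cnj: "u : H1 D ==> (%x. cnj (u x)) : H1 D"
 by (rule H1I[OF weak_deriv_cnj[OF H1_wderiv]])

lemma wderiv_cnj: "u : H1 D ==> b : Basis ==> AE x in M. wderiv D b (%x. cnj (u x)) x = cnj (wderiv D b u x)"
 by (rule wderiv_AE[OF weak_deriv_cnj[OF H1_wderiv]])

text \<open>The kernels are supported in balls around \<open>s a\<close>, so that near the boundary the mollification only uses
 values from inside \<open>D\<close>.\<close>

lemma local_smooth_approx:
 assumes w: "!!b. b : Basis ==> has_weak_deriv D b f (fb b)"
  and out: "!!x. x ~: K ==> f x = 0" "!!x b. b : Basis ==> x ~: K ==> fb b x = 0"
  and s0: "s0 > 0" and shift: "!!s x. 0 < s ==> s < s0 ==> x : D ==> cball (x - s *\<^sub>R a) s <= D \<or> cball (x - s *\<^sub>R a) s \<inter> K = {}"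
 obtains g where "!!n::nat. smooth (g n)" "(%n. L2_nrm M (%x. g n x - f x)) ----> 0"
  "!!b. b : Basis ==> (%n. L2_nrm M (%x. pd b (g n) x - fb b x)) ----> 0"
proof -
 define s where "s n = s0 / real (Suc (Suc n))" for n
 have s: "s n > 0" "s n < s0" for n using s0 by (auto simp: s_def field_simps intro: add_pos_nonneg)
 have s_lim: "s ----> 0"
  unfolding s_def using LIMSEQ_Suc[OF lim_const_over_n[of s0], THEN LIMSEQ_Suc] by simp
 have "EX rho. mollifier (s n *\<^sub>R a) (s n) rho" for n using mollifier_exists[OF s(1)] by metis
 then obtain rho where rho: "!!n. mollifier (s n *\<^sub>R a) (s n) (rho n)" by metis
 have lim: "(%n. norm (s n *\<^sub>R a) + s n) ----> 0"
  using tendsto_add[OF tendsto_mult[OF s_lim tendsto_const[of "norm a"]] s_lim] s(1) by (simp add: abs_of_pos)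
 have f: "f : L2 M" using weak_deriv_L2(1)[OF w] SOME_Basis by blast
 have fb: "fb b : L2 M" if "b : Basis" for b using weak_deriv_L2(2)[OF w[OF that]] .
 define g where "g n = conv (ext f) (rho n)" for n
 have pd_g: "pd b (g n) x = conv (ext (fb b)) (rho n) x" if b: "b : Basis" and x: "x : D" for b n x
 proof -
  have sm: "smooth (rho n)" by (rule mollifier_smooth[OF rho])
  have "pd b (g n) x = conv (ext f) (pd b (rho n)) x"
   unfolding g_def by (rule pd_conv[OF ext_integrable[OF f] smooth_imp_Ck[OF sm] mollifier_bounded[OF rho] b])
  also have "... = conv (ext (fb b)) (rho n) x"
  proof (cases "cball (x - s n *\<^sub>R a) (s n) <= D")
   case True
   thus ?thesis
    by (intro weak_deriv_conv[OF w[OF b] sm _ b] test_reflect[OF rho])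
  next
   \<comment> \<open>The kernel only sees points off \<open>K\<close>, where \<open>f\<close> and
     its weak derivatives vanish, so both sides are 0.\<close>
   case False
   hence disj: "cball (x - s n *\<^sub>R a) (s n) \<inter> K = {}" using shift[OF s x] by blast
   have cl: "closure {z. rho n z ~= 0} <= cball (s n *\<^sub>R a) (s n)"
    by (rule closure_minimal) (use mollifier_support[OF rho] ball_subset_cball in blast, simp)
   have zero: "y ~: K" if "z = x - y" "z : closure {z. rho n z ~= 0}" for y z
   proof -
    have "dist (s n *\<^sub>R a) z <= s n" using that(2) cl by auto
    hence "y : cball (x - s n *\<^sub>R a) (s n)" by (simp add: that(1) dist_norm norm_minus_commute algebra_simps)
    thus ?thesis using disj by blast
   qed
   have z1: "f y * of_real (pd b (rho n) (x - y)) = 0" for y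
    using zero[OF refl, of y] out(1)[of y] pd_outside_support[of "x - y" "rho n" b] by auto
   have z2: "fb b y * of_real (rho n (x - y)) = 0" for y
    using zero[OF refl, of y] out(2)[OF b, of y] closure_subset[of "{z. rho n z ~= 0}"] by auto
   show ?thesis
    by (simp only: conv_ext[OF f Ck1_pd[OF smooth_imp_Ck[OF sm] b]] conv_ext[OF fb[OF b] mollifier_cont[OF rho]] z1 z2)
  qed
  finally show ?thesis .
 qed
 show ?thesis
 proof (rule that[of g])
  show "smooth (g n)" for n
   unfolding g_def by (rule smooth_conv[OF ext_integrable[OF f] mollifier_smooth[OF rho] mollifier_bounded[OF rho]])
  show "(%n. L2_nrm M (%x. g n x - f x)) ----> 0"
   unfolding g_def by (rule mollifier_tendsto_M[OF rho lim f])
  fix b :: 'a assume b: "b : Basis"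
  have "L2_nrm M (%x. pd b (g n) x - fb b x) = L2_nrm M (%x. conv (ext (fb b)) (rho n) x - fb b x)" for n
   unfolding L2_nrm_def by (rule arg_cong[where f=sqrt], rule Bochner_Integration.integral_cong) (simp_all add: pd_g[OF b])
  thus "(%n. L2_nrm M (%x. pd b (g n) x - fb b x)) ----> 0"
   using mollifier_tendsto_M[OF rho lim fb[OF b]] by simp
 qed
qed

lemma local_smooth_approx_test:
 assumes u: "u : H1 D" and chi: "smooth chi" "closure {x. chi x ~= 0} <= K"
  and s0: "s0 > 0" "!!s x. 0 < s ==> s < s0 ==> x : D ==> cball (x - s *\<^sub>R a) s <= D \<or> cball (x - s *\<^sub>R a) s \<inter> K = {}"
 obtains g where "!!n::nat. smooth (g n)" "(%n. L2_nrm M (%x. g n x - of_real (chi x) * u x)) ----> 0"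
  "!!b. b : Basis ==> (%n. L2_nrm M (%x. pd b (g n) x
    - (of_real (chi x) * wderiv D b u x + of_real (pd b chi x) * u x))) ----> 0"
proof (rule local_smooth_approx[OF weak_deriv_mult_C1[OF H1_wderiv[OF u] smooth_imp_Ck[OF chi(1)]] _ _ s0])
 have 0: "chi x = 0" "pd b chi x = 0" if "x ~: K" for x b
  using that chi(2) closure_subset[of "{x. chi x ~= 0}"] pd_outside_support[of x chi] by auto
 show "of_real (chi x) * u x = 0" if "x ~: K" for x using 0[OF that] by simp
 show "of_real (chi x) * wderiv D b u x + of_real (pd b chi x) * u x = 0" if "x ~: K" for x b
  using 0[OF that] by simp
qed (use that in blast)+

text \<open>Away from the boundary the shift can be 0: a ball of radius \<open>s\<close> that meets
  \<open>K\<close> stays within \<open>2 * s\<close> of a point of \<open>K\<close>.\<close>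

lemma shift_interior:
 assumes K: "compact K" "K <= D"
 obtains s0 where "s0 > 0" "!!s x. 0 < s ==> s < s0 ==> x : D ==> cball (x - s *\<^sub>R 0) s <= D \<or> cball (x - s *\<^sub>R 0) s \<inter> K = {}"
proof -
 obtain eps where eps: "eps > 0" "(UN x:K. cball x eps) <= D"
  using compact_subset_open_imp_cball_epsilon_subset[OF K(1) open_D K(2)] by auto
 show ?thesis
 proof (rule that[of "eps / 2"])
  fix s x assume s: "0 < s" "s < eps / 2"
  show "cball (x - s *\<^sub>R 0) s <= D \<or> cball (x - s *\<^sub>R 0) s \<inter> K = {}"
  proof (cases "cball (x - s *\<^sub>R 0) s \<inter> K = {}")
   case False
   then obtain k where k: "k : K" "dist x k <= s" by auto
   have "dist k y <= eps" if "dist x y <= s" for y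
    using dist_triangle[of k y x] that k(2) s by (simp add: dist_commute)
   hence "cball x s <= D" using eps(2) k(1) by fastforce
   thus ?thesis by simp
  qed simp
 qed (use eps in simp)
qed

end

context graph_patch begin

text \<open>Shifting by \<open>s * (Lip + 1)\<close> against \<open>e\<close> lowers
  \<open>h\<close> by that amount, and within a ball of radius \<open>s\<close> it rises by at most
  \<open>s * Lip\<close>: the shifted ball stays below the graph. The bound on \<open>s\<close>
  keeps all points in the patch, where \<open>h\<close> is Lipschitz and decides membership in
  \<open>D\<close>.\<close>

lemma shift_boundary:
 obtains s0 where "s0 > 0" "!!s x. 0 < s ==> s < s0 ==> x : D ==>
   cball (x - s *\<^sub>R ((Lip + 1) *\<^sub>R e)) s <= D \<or> cball (x - s *\<^sub>R ((Lip + 1) *\<^sub>R e)) s \<inter> cball x0 (r/2) = {}"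
proof (rule that[of "r / (8 * (Lip + 3))"])
 show "r / (8 * (Lip + 3)) > 0" using r Lip_pos by simp
 fix s x assume s: "0 < s" "s < r / (8 * (Lip + 3))" and x: "x : D"
 have s8: "s * (Lip + 3) < r / 8" using s Lip_pos by (simp add: field_simps)
 let ?b = "cball (x - s *\<^sub>R ((Lip + 1) *\<^sub>R e)) s"
 define z where "z = x - s *\<^sub>R ((Lip + 1) *\<^sub>R e)"
 define A where "A = s * Lip"
 have A: "A > 0" "A + 3 * s < r / 8" "s * (Lip + 1) = A + s" using s(1) s8 Lip_pos by (simp_all add: A_def algebra_simps)
 have zx: "dist z x = A + s" using s(1) A(1) norm_e by (simp add: z_def dist_norm A(3))
 show "?b <= D \<or> ?b \<inter> cball x0 (r/2) = {}"
  unfolding z_def[symmetric]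
 proof (cases "cball z s \<inter> cball x0 (r/2) = {}")
  case False
  then obtain k where k: "dist x0 k <= r/2" "dist z k <= s" by auto
  have z0: "dist x0 z <= r/2 + s" using dist_triangle[of x0 z k] k by (simp add: dist_commute)
  have x1: "x : ball x0 r" using dist_triangle[of x0 x z] z0 zx A s(1) r unfolding mem_ball by linarith
  have z1: "z : ball x0 r" using z0 A s(1) r unfolding mem_ball by linarith
  have hz: "h z = h x - (A + s)"
   using h_translate[of x "- (A + s)"] unfolding z_def scaleR_scaleR A(3) by (simp only: scaleR_minus_left diff_conv_add_uminus)
  have "y : D" if "dist z y <= s" for y
  proof -
   have y1: "y : ball x0 r" using dist_triangle[of x0 y z] z0 that A s(1) r unfolding mem_ball by linarith
   have "h y <= h z + Lip * dist z y" using h_Lipschitz[OF z1 y1] by linarith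
   also have "... <= h z + A" using that Lip_pos by (simp add: A_def mult.commute)
   also have "... < 0" using hz s(1) D_iff[OF x1] x by simp
   finally show ?thesis using D_iff[OF y1] by simp
  qed
  thus "cball z s <= D \<or> cball z s \<inter> cball x0 (r/2) = {}" by auto
 qed simp
qed

end

subsection \<open>Partition of unity, density of smooth functions\<close>

locale c2_domain = bdd_open +
 assumes C2: "C2_boundary D"
begin

lemma patch_exists:
 assumes "x : frontier D" shows "EX e gam r. graph_patch D x e gam r"
proof -
 obtain e gam where "C2_graph_near D x e gam" using C2 assms by (auto simp: C2_boundary_def)
 then obtain r where "norm e = 1" "Ck 2 gam" "r > 0" "D \<inter> ball x r = {y : ball x r. height_above_graph e gam y < 0}"
  by (auto simp: C2_graph_near_def)
 hence "graph_patch D x e gam r" by unfold_locales auto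
 thus ?thesis by blast
qed

text \<open>At the boundary the support is kept in half of the patch, so that shifted balls and thin
  layers near it remain where \<open>D\<close> is a subgraph.\<close>

definition localized :: "('a => real) => bool" where
 "localized phi \<longleftrightarrow> test_function D phi \<or>
  (EX x0 e gam r. x0 : frontier D & graph_patch D x0 e gam r & test_function (ball x0 (r/2)) phi)"

definition pou :: "nat => (nat => 'a => real) => bool" where
 "pou N chi \<longleftrightarrow> (ALL i<N. test_function UNIV (chi i) & (ALL x. 0 <= chi i x) & localized (chi i)) &
  (ALL x:closure D. (SUM i<N. chi i x) = 1)"

lemma pouD:
 assumes "pou N chi"
 shows "i < N ==> test_function UNIV (chi i)" "i < N ==> 0 <= chi i x"
  "x : closure D ==> (SUM i<N. chi i x) = 1" "i < N ==> localized (chi i)"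
 using assms unfolding pou_def by blast+

text \<open>\<open>chi i\<close> is the \<open>i\<close>-th bump times the product of one minus the
  earlier bumps, so the sum is one minus the product over all bumps. Every point of the closure lies
  where some bump equals 1, and there the product is 0.\<close>

lemma partition_of_unity: obtains N chi where "pou N chi"
proof -
 obtain e gam r where P: "!!x. x : frontier D ==> graph_patch D x (e x) (gam x) (r x)"
  using patch_exists by metis
 have rpos: "r x > 0" if "x : frontier D" for x using graph_patch.r[OF P[OF that]] .
 have fc: "compact (frontier D)" using bounded_D by (simp add: compact_frontier_bounded)
 obtain F where F: "F <= frontier D" "finite F" "frontier D <= (UN x:F. ball x (r x / 4))"
  by (rule compactE_image[OF fc, of "frontier D" "%x. ball x (r x / 4)"]) (use rpos in force)+
 define K0 where "K0 = closure D - (UN x:F. ball x (r x / 4))"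
 have K0: "compact K0" unfolding K0_def using bounded_D by (intro compact_diff) auto
 have K0D: "K0 <= D" using F(3) interior_open[OF open_D] unfolding K0_def frontier_def by blast
 obtain chi0 :: "'a => real" and V0 where chi0: "test_function D chi0" "!!x. 0 <= chi0 x" "!!x. chi0 x <= 1" "K0 <= V0" "!!x. x : V0 ==> chi0 x = 1"
  by (rule cutoff_exists[OF K0 open_D K0D]) blast
 have "EX phi. test_function (ball x (r x / 2)) phi & (ALL y. 0 <= phi y & phi y <= 1) & (ALL y:cball x (r x / 4). phi y = 1)" if "x : F" for x
 proof -
  have "cball x (r x / 4) <= ball x (r x / 2)" using rpos F(1) \<open>x : F\<close> by fastforce
  from cutoff_exists[OF compact_cball open_ball this] show ?thesis by (metis subsetD)
 qed
 then obtain phi where phi: "!!x. x : F ==> test_function (ball x (r x / 2)) (phi x)"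
  "!!x y. x : F ==> 0 <= phi x y & phi x y <= 1" "!!x y. x : F ==> y : cball x (r x / 4) ==> phi x y = 1" by metis
 obtain xs where xs: "set xs = F" using finite_list[OF F(2)] by blast
 define ts where "ts = chi0 # map phi xs"
 have ts: "localized t & (ALL y. 0 <= t y & t y <= 1)" if "t : set ts" for t
 proof (cases "t = chi0")
  case True thus ?thesis using chi0 by (simp add: localized_def)
 next
  case False
  then obtain x where x: "x : F" "t = phi x" using \<open>t : set ts\<close> xs by (auto simp: ts_def)
  have fx: "x : frontier D" using x(1) F(1) by blast
  show ?thesis unfolding localized_def x(2) using phi[OF x(1)] P[OF fx] fx by blast
 qed
 have cover: "EX t:set ts. t y = 1" if "y : closure D" for y
 proof (cases "y : K0")
  case True thus ?thesis using chi0 by (auto simp: ts_def)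
 next
  case False
  then obtain x where "x : F" "y : ball x (r x / 4)" using \<open>y : closure D\<close> by (auto simp: K0_def)
  thus ?thesis using phi(3)[of x y] xs by (auto simp: ts_def)
 qed
 define N where "N = length ts"
 define chi where "chi i x = (ts ! i) x * (\<Prod>j<i. 1 - (ts ! j) x)" for i x
 have sum: "(SUM i<k. chi i x) = 1 - (\<Prod>j<k. 1 - (ts ! j) x)" for k x
  by (induction k) (auto simp: chi_def algebra_simps)
 have prod: "smooth (%x. \<Prod>j<k. 1 - (ts ! j) x)" if "k <= N" for k
  using that
 proof (induction k)
  case 0 thus ?case by (simp add: smooth_def)
 next
  case (Suc k)
  have "localized (ts ! k)" using ts Suc.prems by (simp add: N_def)
  hence "smooth (ts ! k)" unfolding localized_def using test_smooth by blast
  hence "smooth (%x. 1 - (ts ! k) x)" by (auto simp: smooth_def intro: Ck_diff)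
  thus ?case using Suc by (simp add: smooth_mult mult.commute[of "1 - _"])
 qed
 have "localized (chi i) & test_function UNIV (chi i) & (ALL x. 0 <= chi i x)" if i: "i < N" for i
 proof -
  have g: "localized (ts ! i)" using ts i by (simp add: N_def)
  have tf: "test_function U (chi i)" if "test_function U (ts ! i)" for U
   unfolding chi_def using i by (intro test_mult[OF that] prod) simp
  have g': "localized (chi i)" using g tf unfolding localized_def by blast
  hence "test_function UNIV (chi i)" unfolding localized_def using test_mono[OF _ subset_UNIV] by blast
  moreover have "0 <= chi i x" for x unfolding chi_def using ts i by (intro mult_nonneg_nonneg prod_nonneg) (auto simp: N_def)
  ultimately show ?thesis using g' by blast
 qed
 moreover have "(SUM i<N. chi i x) = 1" if x: "x : closure D" for x
 proof -
  obtain t where "t : set ts" "t x = 1" using cover[OF x] by blast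
  then obtain j where "j < N" "(ts ! j) x = 1" by (auto simp: in_set_conv_nth N_def)
  thus ?thesis unfolding sum by (auto intro!: prod_zero bexI[of _ j])
 qed
 ultimately have "pou N chi" unfolding pou_def by blast
 thus ?thesis by (rule that)
qed

text \<open>Mollifiers shifted into the domain approximate up to the boundary; the pieces cut out by
  the partition of unity are approximated separately, each with its own shift, and added.\<close>

lemma H1_smooth_dense:
 assumes u: "u : H1 D"
 obtains w where "!!n::nat. smooth (w n)" "(%n. H1_nrm D (%x. w n x - u x)) ----> 0"
proof -
 obtain N chi where "pou N chi" by (rule partition_of_unity)
 note chi = pouD[OF this]
 define f where "f i x = of_real (chi i x) * u x" for i x
 define fb where "fb i b x = of_real (chi i x) * wderiv D b u x + of_real (pd b (chi i) x) * u x" for i b x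
 have wf: "has_weak_deriv D b (f i) (fb i b)" if "i < N" "b : Basis" for i b
  unfolding f_def[abs_def] fb_def[abs_def]
  by (rule weak_deriv_mult_C1[OF H1_wderiv[OF u that(2)] test_Ck[OF chi(1)[OF that(1)]] that(2)])
 define Q where "Q i g \<longleftrightarrow> (ALL n::nat. smooth (g n)) & (%n. L2_nrm M (%x. g n x - f i x)) ----> 0 &
  (ALL b:Basis. (%n. L2_nrm M (%x. pd b (g n) x - fb i b x)) ----> 0)" for i g
 have "EX g. Q i g" if i: "i < N" for i
  using chi(4)[OF i] unfolding localized_def
 proof (elim disjE exE conjE)
  assume t: "test_function D (chi i)"
  let ?K = "closure {x. chi i x ~= 0}"
  have "compact ?K" "?K <= D" using t by (auto simp: test_function_def)
  obtain s0 where s0: "s0 > 0" "!!s x. 0 < s ==> s < s0 ==> x : D ==> cball (x - s *\<^sub>R 0) s <= D \<or> cball (x - s *\<^sub>R 0) s \<inter> ?K = {}"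
   by (rule shift_interior[OF \<open>compact ?K\<close> \<open>?K <= D\<close>]) blast
  show ?thesis
   by (rule local_smooth_approx_test[OF u test_smooth[OF t] order_refl s0]) (auto simp: f_def fb_def Q_def)
 next
  fix x0 e gam r assume P: "graph_patch D x0 e gam r" and t: "test_function (ball x0 (r/2)) (chi i)"
  interpret graph_patch D x0 e gam r by (rule P)
  obtain s0 where s0: "s0 > 0" "!!s x. 0 < s ==> s < s0 ==> x : D ==>
   cball (x - s *\<^sub>R ((Lip + 1) *\<^sub>R e)) s <= D \<or> cball (x - s *\<^sub>R ((Lip + 1) *\<^sub>R e)) s \<inter> cball x0 (r/2) = {}"
   by (rule shift_boundary) blast
  have cl: "closure {x. chi i x ~= 0} <= cball x0 (r/2)" using test_support[OF t] ball_subset_cball by blast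
  show ?thesis
   by (rule local_smooth_approx_test[OF u test_smooth[OF t] cl s0]) (auto simp: f_def fb_def Q_def)
 qed
 hence "ALL i. EX g. i < N --> Q i g" by blast
 then obtain g where Q: "!!i. i < N ==> Q i (g i)" by metis
 hence g: "!!i n. i < N ==> smooth (g i (n::nat))" "!!i. i < N ==> (%n. L2_nrm M (%x. g i n x - f i x)) ----> 0"
  "!!i b. i < N ==> b : Basis ==> (%n. L2_nrm M (%x. pd b (g i n) x - fb i b x)) ----> 0" by (simp_all add: Q_def)
 define w where "w n x = (SUM i<N. g i n x)" for n x
 have wd: "has_weak_deriv D b (%x. g i n x - f i x) (%x. pd b (g i n) x - fb i b x)" if "i < N" "b : Basis" for i n b
  by (rule weak_deriv_diff[OF weak_deriv_C1[OF smooth_imp_Ck[OF g(1)[OF that(1)]] that(2)] wf[OF that] that(2)])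
 have eq: "AE x in M. (SUM i<N. g i n x - f i x) = w n x - u x" for n
 proof (rule AE_M_I)
  fix x assume "x : D"
  hence "(SUM i<N. chi i x) = 1" using chi(3) closure_subset by blast
  hence "(SUM i<N. f i x) = u x" by (simp add: f_def sum_distrib_right[symmetric] of_real_sum[symmetric] del: of_real_sum)
  thus "(SUM i<N. g i n x - f i x) = w n x - u x" by (simp add: sum_subtractf w_def)
 qed
 have sm: "smooth (w n)" for n unfolding w_def smooth_def using g(1) by (auto intro!: Ck_sum simp: smooth_def)
 have m: "(%x. w n x - u x) : borel_measurable M" for n
  by (rule L2_measurable[OF L2_diff[OF L2_continuous[OF Ck1_continuous[OF smooth_imp_Ck[OF sm]]] H1_L2[OF u]]])
 have wdL: "(%x. g i n x - f i x) : L2 M" if "i < N" for i n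
  using weak_deriv_L2(1)[OF wd[OF that]] SOME_Basis by blast
 have wdL2: "(%x. pd b (g i n) x - fb i b x) : L2 M" if "i < N" "b : Basis" for i n b
  using weak_deriv_L2(2)[OF wd[OF that]] .
 have wdw: "has_weak_deriv D b (%x. w n x - u x) (%x. SUM i<N. pd b (g i n) x - fb i b x)" if b: "b : Basis" for b n
  by (rule weak_deriv_cong[OF weak_deriv_sum[OF wd b] eq _ m _ b])
    (use b in "auto intro!: L2_measurable[OF L2_sum] wdL2")
 have nd: "L2_nrm M (wderiv D b (%x. w n x - u x)) <= (SUM i<N. L2_nrm M (%x. pd b (g i n) x - fb i b x))" if b: "b : Basis" for b n
  unfolding wderiv_nrm[OF wdw[OF b]] by (rule L2_triangle_sum) (use wdL2 b in auto)
 have n0: "L2_nrm M (%x. w n x - u x) <= (SUM i<N. L2_nrm M (%x. g i n x - f i x))" for n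
  using L2_nrm_cong_AE[OF eq L2_measurable[OF L2_sum[OF wdL]] m] L2_triangle_sum[of "{..<N}" "%i x. g i n x - f i x" M] wdL by simp
 show ?thesis
 proof (rule that[OF sm], rule H1_nrm_tendsto_0)
  have "(%n. SUM i<N. L2_nrm M (%x. g i n x - f i x)) ----> (SUM i<N. 0)" by (intro tendsto_sum g) simp
  thus "(%n. L2_nrm M (%x. w n x - u x)) ----> 0"
   by (rule tendsto_0_dominated[OF _ L2_nrm_nonneg n0, OF tendsto_eq_rhs]) simp
  fix b :: 'a assume b: "b : Basis"
  have "(%n. SUM i<N. L2_nrm M (%x. pd b (g i n) x - fb i b x)) ----> (SUM i<N. 0)" by (intro tendsto_sum g b) simp
  thus "(%n. L2_nrm M (wderiv D b (%x. w n x - u x))) ----> 0"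
   by (rule tendsto_0_dominated[OF _ L2_nrm_nonneg nd[OF b], OF tendsto_eq_rhs]) simp
 qed
qed

lemma H1_tendsto_components:
 assumes w: "!!n::nat. smooth (w n)" and u: "u : H1 D" and lim: "(%n. H1_nrm D (%x. w n x - u x)) ----> 0"
 shows "(%n. L2_nrm M (%x. w n x - u x)) ----> 0"
  and "b : Basis ==> (%n. L2_nrm M (%x. pd b (w n) x - wderiv D b u x)) ----> 0"
proof -
 show "(%n. L2_nrm M (%x. w n x - u x)) ----> 0"
  by (rule tendsto_0_dominated[OF lim L2_nrm_nonneg L2_le_H1_nrm])
 assume b: "b : Basis"
 have "L2_nrm M (%x. pd b (w n) x - wderiv D b u x) = L2_nrm M (wderiv D b (%x. w n x - u x))" for n
  by (rule wderiv_nrm[symmetric], rule weak_deriv_diff[OF weak_deriv_C1[OF smooth_imp_Ck[OF w] b] H1_wderiv[OF u b] b])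
 thus "(%n. L2_nrm M (%x. pd b (w n) x - wderiv D b u x)) ----> 0"
  by (intro tendsto_0_dominated[OF lim]) (auto intro!: wderiv_le_H1_nrm[OF b])
qed

end

subsection \<open>Integration by parts\<close>

context bdd_open begin

lemma H10_ibp_C1:
 assumes v: "v : H10" and g: "Ck 1 g" and b: "b : Basis"
 shows "(LINT x|M. v x * pd b g x) = - (LINT x|M. wderiv D b v x * g x)"
proof -
 have K: "compact (closure D)" using bounded_D by simp
 obtain chi :: "'a => real" and V where chi: "test_function UNIV chi" "open V" "closure D <= V" "!!x. x : V ==> chi x = 1"
  by (rule cutoff_exists[OF K open_UNIV subset_UNIV]) blast
 note L = H1_L2[OF H10_H1[OF v]] wderiv_L2[OF H10_H1[OF v] b]
 note c = Ck1_continuous[OF g] Ck1_pd[OF g b]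
 \<comment> \<open>Test functions are real-valued, so real and imaginary part of \<open>g\<close>
   are treated separately, each through a real linear map \<open>T\<close>. The cutoff gives bounded
   support without changing anything on \<open>D\<close>.\<close>
 have T: "(LINT x|M. v x * of_real (T (pd b g x))) = - (LINT x|M. wderiv D b v x * of_real (T (g x)))"
  if T: "bounded_linear T" for T :: "complex => real"
 proof -
  define psi where "psi x = chi x * T (g x)" for x
  have Tg: "Ck 1 (%x. T (g x))" by (rule Ck_linear_comp[OF T g])
  have psi: "Ck 1 psi" "bounded {x. psi x ~= 0}"
   unfolding psi_def[abs_def]
   by (rule Ck_mult[OF test_Ck[OF chi(1)] Tg], rule bounded_subset[OF test_bounded[OF chi(1)]]) auto
  have eq: "psi x = T (g x)" "pd b psi x = T (pd b g x)" if "x : D" for x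
  proof -
   have xV: "x : V" using that chi(3) closure_subset by blast
   thus "psi x = T (g x)" by (simp add: psi_def chi(4))
   have "((%x. T (g x)) has_derivative frechet_derivative (%x. T (g x)) (at x)) (at x)"
    using Ck1_diff[OF Tg] by (simp add: frechet_derivative_works)
   hence "(psi has_derivative frechet_derivative (%x. T (g x)) (at x)) (at x)"
    by (rule has_derivative_transform_within_open[OF _ chi(2) xV]) (simp add: psi_def chi(4))
   thus "pd b psi x = T (pd b g x)"
    using pd_linear_comp[OF T Ck1_diff[OF g]] by (simp add: pd_eqI)
  qed
  have "(LINT x|M. v x * of_real (T (pd b g x))) = (LINT x|M. v x * of_real (pd b psi x))"
   "(LINT x|M. wderiv D b v x * of_real (T (g x))) = (LINT x|M. wderiv D b v x * of_real (psi x))"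
   by (rule Bochner_Integration.integral_cong, use eq in simp_all)+
  thus ?thesis using H10D_C1[OF v psi b] by simp
 qed
 have split: "(LINT x|M. w x * f x) = (LINT x|M. w x * of_real (Re (f x))) + \<i> * (LINT x|M. w x * of_real (Im (f x)))"
  if w: "w : L2 M" and f: "continuous_on UNIV f" for w f
 proof -
  have P: "(%x. of_real (Re (f x))) : L2 M" "(%x. of_real (Im (f x))) : L2 M"
   by (intro L2_test continuous_intros f)+
  have "(LINT x|M. w x * f x) = (LINT x|M. w x * of_real (Re (f x)) + w x * of_real (Im (f x)) * \<i>)"
   by (intro Bochner_Integration.integral_cong refl) (metis complex_eq distrib_left mult.assoc mult.commute)
  thus ?thesis
   using L2_mult_int[OF w P(1)] L2_mult_int[OF w P(2)] by (simp add: mult.commute)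
 qed
 show ?thesis
  unfolding split[OF L(1) c(2)] split[OF L(2) c(1)] T[OF bounded_linear_Re] T[OF bounded_linear_Im] by (simp add: algebra_simps)
qed

lemma pd_commute:
 fixes f :: "'a => complex"
 assumes f: "Ck 2 f" and a: "a : Basis" and b: "b : Basis"
 shows "pd a (pd b f) x = pd b (pd a f) x"
proof -
 have f1: "Ck 1 f" using f by (rule Ck_antimono) simp
 have fp: "Ck 1 (pd c f)" if "c : Basis" for c using f that by (simp add: numeral_2_eq_2)
 have "T (pd a (pd b f) x) = T (pd b (pd a f) x)" if T: "bounded_linear T" for T :: "complex => real"
 proof -
  have e: "T (pd c (pd d f) x) = pd c (pd d (%x. T (f x))) x" if "c : Basis" "d : Basis" for c d
   using pd_linear_comp[OF T Ck1_diff[OF f1]] pd_linear_comp[OF T Ck1_diff[OF fp[OF that(2)]]] by simp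
  show ?thesis unfolding e[OF a b] e[OF b a] by (rule pd_commute_real[OF Ck_linear_comp[OF T f] a b])
 qed
 from this[OF bounded_linear_Re] this[OF bounded_linear_Im] show ?thesis by (simp add: complex_eq_iff)
qed

end

context c2_domain begin

text \<open>Smooth approximation is applied to \<open>g\<close> only, which is free of boundary
  conditions; \<open>v\<close> stays as it is.\<close>

lemma H10_ibp:
 assumes v: "v : H10" and g: "g : H1 D" and b: "b : Basis"
 shows "(LINT x|M. v x * wderiv D b g x) = - (LINT x|M. wderiv D b v x * g x)"
proof -
 obtain w where w: "!!n::nat. smooth (w n)" "(%n. H1_nrm D (%x. w n x - g x)) ----> 0"
  using H1_smooth_dense[OF g] by metis
 note lim = H1_tendsto_components[OF w(1) g w(2)]
 note c = Ck1_continuous[OF smooth_imp_Ck[OF w(1)]] Ck1_pd[OF smooth_imp_Ck[OF w(1)] b]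
 have "(%n. LINT x|M. pd b (w n) x * v x) ----> (LINT x|M. wderiv D b g x * v x)"
  by (rule L2_tendsto_integral[OF L2_continuous[OF c(2)] wderiv_L2[OF g b] lim(2)[OF b] H1_L2[OF H10_H1[OF v]]])
 moreover have "(%n. - (LINT x|M. w n x * wderiv D b v x)) ----> - (LINT x|M. g x * wderiv D b v x)"
  by (intro tendsto_minus L2_tendsto_integral[OF L2_continuous[OF c(1)] H1_L2[OF g] lim(1) wderiv_L2[OF H10_H1[OF v] b]])
 ultimately show ?thesis
  using H10_ibp_C1[OF v smooth_imp_Ck[OF w(1)] b] LIMSEQ_unique by (simp add: mult.commute)
qed

text \<open>The Jacobian determinant \<open>f\<^sub>i g\<^sub>j - f\<^sub>j g\<^sub>i\<close> is a null Lagrangian.\<close>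

lemma null_Lagrangian:
 assumes f: "f : H10" and g: "g : H1 D" and i: "i : Basis" and j: "j : Basis"
 shows "(LINT x|M. wderiv D i f x * wderiv D j g x) = (LINT x|M. wderiv D j f x * wderiv D i g x)"
proof -
 obtain w where w: "!!n::nat. smooth (w n)" "(%n. H1_nrm D (%x. w n x - g x)) ----> 0"
  using H1_smooth_dense[OF g] by metis
 note lim = H1_tendsto_components[OF w(1) g w(2)]
 have "(%n. LINT x|M. pd k (w n) x * wderiv D l f x) ----> (LINT x|M. wderiv D k g x * wderiv D l f x)"
  if "k : Basis" "l : Basis" for k l
  by (rule L2_tendsto_integral[OF L2_continuous[OF Ck1_pd[OF smooth_imp_Ck[OF w(1)] that(1)]]
     wderiv_L2[OF g that(1)] lim(2)[OF that(1)] wderiv_L2[OF H10_H1[OF f] that(2)]])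
 note lims = this[OF j i] this[OF i j]
 \<comment> \<open>Moving the derivative off \<open>f\<close> leaves second derivatives of the
   smooth \<open>w n\<close>, whose order is immaterial.\<close>
 have e: "(LINT x|M. pd k (w n) x * wderiv D l f x) = - (LINT x|M. f x * pd l (pd k (w n)) x)" if "k : Basis" "l : Basis" for k l n
  using H10_ibp_C1[OF f smooth_imp_Ck[OF smooth_pd[OF w(1) that(1)]] that(2)] by (simp add: mult.commute)
 have "(LINT x|M. pd j (w n) x * wderiv D i f x) = (LINT x|M. pd i (w n) x * wderiv D j f x)" for n
  unfolding e[OF j i] e[OF i j] using pd_commute[OF smooth_imp_Ck[OF w(1)] i j] by simp
 thus ?thesis using LIMSEQ_unique[OF lims(1)] lims(2) by (simp add: mult.commute)
qed

end

subsection \<open>The second order a priori estimate\<close>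

lemma L2_mult_cong_AE:
 assumes "f : L2 N" "g : L2 N" "g' : L2 N" and eq: "AE x in N. g x = g' x"
 shows "(LINT x|N. f x * g x) = (LINT x|N. f x * g' x)"
 by (rule integral_cong_AE) (use assms(1-3)[THEN L2_measurable] eq in "auto elim: eventually_mono")

context bdd_open begin

lemma H2_nrm_nonneg [simp]: "H2_nrm D u >= 0"
 by (simp add: H2_nrm_def sum_nonneg)

lemma H2_nrm_power2: "(H2_nrm D u)^2 = (H1_nrm D u)^2
  + (SUM b:Basis. SUM c:Basis. (L2_nrm M (wderiv D c (wderiv D b u)))^2)"
 by (simp add: H2_nrm_def sum_nonneg)

lemma H1_le_H2_nrm: "H1_nrm D u <= H2_nrm D u"
 by (rule power2_le_imp_le) (simp_all add: H2_nrm_power2 sum_nonneg)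

lemma wderiv2_le_H2_nrm:
 assumes b: "b : Basis" and c: "c : Basis" shows "L2_nrm M (wderiv D c (wderiv D b u)) <= H2_nrm D u"
proof (rule power2_le_imp_le)
 have "(L2_nrm M (wderiv D c (wderiv D b u)))^2 <= (SUM c:Basis. (L2_nrm M (wderiv D c (wderiv D b u)))^2)"
  by (rule member_le_sum[OF c]) auto
 also have "... <= (SUM b:Basis. SUM c:Basis. (L2_nrm M (wderiv D c (wderiv D b u)))^2)"
  by (rule member_le_sum[OF b]) (auto intro: sum_nonneg)
 finally show "(L2_nrm M (wderiv D c (wderiv D b u)))^2 <= (H2_nrm D u)^2"
  unfolding H2_nrm_power2 using zero_le_power2[of "H1_nrm D u"] by linarith
qed simp

section \<open>Localized minors of the Hessian and what counts as lower order\<close>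

text \<open>With \<open>f\<close> and \<open>g\<close> the derivatives of \<open>u\<close> in
  directions \<open>i\<close> and \<open>j\<close>, the integrand is a weighted 2 by 2 minor of the
  Hessian, up to conjugation. Summed over \<open>i\<close> and \<open>j\<close> it is the weighted
  difference of squared Laplacian and squared Hessian.\<close>

definition BF :: "('a => real) => 'a => 'a => ('a => complex) => ('a => complex) => complex" where
 "BF chi i j f g = (LINT x|M. of_real (chi x) *
   (wderiv D i f x * cnj (wderiv D j g x) - wderiv D j f x * cnj (wderiv D i g x)))"

lemma trilinear_int:
 assumes "continuous_on UNIV c" "f : L2 M" "g : L2 M"
 shows "integrable M (%x. of_real (c x) * (f x * g x))"
 using L2_mult_int[OF L2_continuous_mult[OF assms(1,2)] assms(3)] by (simp add: mult.assoc)

lemma trilinear_bound: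
 assumes c: "continuous_on UNIV c"
 obtains C where "C >= 0" "!!f g. f : L2 M ==> g : L2 M ==>
   cmod (LINT x|M. of_real (c x) * (f x * g x)) <= C * (L2_nrm M f * L2_nrm M g)"
proof -
 obtain B where B: "B > 0" "!!u. u : L2 M ==> L2_nrm M (%x. of_real (c x) * u x) <= B * L2_nrm M u"
  using L2_nrm_continuous_mult[OF c] by metis
 show ?thesis
 proof (rule that[of B])
  fix f g assume f: "f : L2 M" and g: "g : L2 M"
  have "cmod (LINT x|M. (of_real (c x) * f x) * g x) <= L2_nrm M (%x. of_real (c x) * f x) * L2_nrm M g"
   by (rule L2_Cauchy_Schwarz[OF L2_continuous_mult[OF c f] g])
  also have "... <= B * L2_nrm M f * L2_nrm M g" by (intro mult_right_mono B f) simp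
  finally show "cmod (LINT x|M. of_real (c x) * (f x * g x)) <= B * (L2_nrm M f * L2_nrm M g)"
   by (simp add: mult.assoc)
 qed (use B in simp)
qed

lemma BF_eq:
 assumes chi: "continuous_on UNIV chi" and w: "has_weak_deriv D i f fi" "has_weak_deriv D j f fj" "has_weak_deriv D i g gi" "has_weak_deriv D j g gj"
 shows "BF chi i j f g = (LINT x|M. of_real (chi x) * (fi x * cnj (gj x))) - (LINT x|M. of_real (chi x) * (fj x * cnj (gi x)))"
proof -
 note L = w[THEN weak_deriv_L2(2)]
 note i = trilinear_int[OF chi L(1) L2_cnj[OF L(4)]] trilinear_int[OF chi L(2) L2_cnj[OF L(3)]]
 have L': "wderiv D b h : borel_measurable M" if "has_weak_deriv D b h v" for b h v
  using L2_measurable weak_deriv_L2(2)[of b h "wderiv D b h"] someI[of "has_weak_deriv D b h", OF that] by (simp add: wderiv_def)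
 have m: "(%x. complex_of_real (chi x)) : borel_measurable M" by (rule L2_measurable[OF L2_test[OF chi]])
 have cm: "(%x. cnj (h x)) : borel_measurable M" if "h : borel_measurable M" for h
  using that by (auto simp: borel_measurable_complex_iff)
 have "BF chi i j f g = (LINT x|M. of_real (chi x) * (fi x * cnj (gj x)) - of_real (chi x) * (fj x * cnj (gi x)))"
  unfolding BF_def
 proof (rule integral_cong_AE)
  show "AE x in M. of_real (chi x) * (wderiv D i f x * cnj (wderiv D j g x) - wderiv D j f x * cnj (wderiv D i g x))
   = of_real (chi x) * (fi x * cnj (gj x)) - of_real (chi x) * (fj x * cnj (gi x))"
   using wderiv_AE[OF w(1)] wderiv_AE[OF w(2)] wderiv_AE[OF w(3)] wderiv_AE[OF w(4)]
   by eventually_elim (simp add: right_diff_distrib)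
 qed (intro borel_measurable_diff borel_measurable_times m cm L' L2_measurable L w; rule w)+
 thus ?thesis using i by simp
qed

lemma BF_add_left:
 assumes chi: "continuous_on UNIV chi" and "f : H1 D" "f' : H1 D" "g : H1 D" and ij: "i : Basis" "j : Basis"
 shows "BF chi i j (%x. f x + f' x) g = BF chi i j f g + BF chi i j f' g"
proof -
 note w = H1_wderiv[OF assms(2)] H1_wderiv[OF assms(3)] H1_wderiv[OF assms(4)]
 note L = w[THEN weak_deriv_L2(2)]
 show ?thesis
  unfolding BF_eq[OF chi weak_deriv_add[OF w(1,2) ij(1)] weak_deriv_add[OF w(1,2) ij(2)] w(3) w(3), OF ij(1) ij(1) ij(2) ij(2) ij]
   BF_eq[OF chi w(1) w(1) w(3) w(3), OF ij ij] BF_eq[OF chi w(2) w(2) w(3) w(3), OF ij ij]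
  using trilinear_int[OF chi L(1) L2_cnj[OF L(3)]] trilinear_int[OF chi L(2) L2_cnj[OF L(3)]] ij
  by (simp add: distrib_right distrib_left)
qed

lemma BF_antisym: "BF chi i j g f = - cnj (BF chi i j f g)"
proof -
 have "cnj (BF chi i j f g) = (LINT x|M. cnj (of_real (chi x) *
   (wderiv D i f x * cnj (wderiv D j g x) - wderiv D j f x * cnj (wderiv D i g x))))"
  unfolding BF_def
  using integral_bounded_linear'[OF bounded_linear_cnj bounded_linear_cnj, of M "%x. of_real (chi x) *
   (wderiv D i f x * cnj (wderiv D j g x) - wderiv D j f x * cnj (wderiv D i g x))"] by simp
 also have "... = (LINT x|M. - (of_real (chi x) *
   (wderiv D i g x * cnj (wderiv D j f x) - wderiv D j g x * cnj (wderiv D i f x))))"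
  by (intro Bochner_Integration.integral_cong refl) (simp add: algebra_simps)
 also have "... = - BF chi i j g f" by (simp add: BF_def)
 finally show ?thesis by simp
qed

lemma BF_add_right:
 assumes "continuous_on UNIV chi" "f : H1 D" "f' : H1 D" "g : H1 D" "i : Basis" "j : Basis"
 shows "BF chi i j g (%x. f x + f' x) = BF chi i j g f + BF chi i j g f'"
 unfolding BF_antisym[of chi i j g] BF_add_left[OF assms] by simp

definition S20 where "S20 = {u : H2 D. u : H10}"

text \<open>A predicate on operators rather than on single functions, because the constant has to be
  uniform in \<open>u\<close>. \<open>W\<close> is the H1 or the H2 norm, according to the order of
  \<open>T\<close>.\<close>

definition ctrl :: "(('a => complex) => real) => (('a => complex) => 'a => complex) => bool" where
 "ctrl W T \<longleftrightarrow> (EX C>=0. ALL u:S20. T u : L2 M & L2_nrm M (T u) <= C * W u)"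

text \<open>The meaning of lower order in the second order estimate: one factor is of first order,
  so only one power of the H2 norm appears.\<close>

definition bnd :: "(('a => complex) => complex) => bool" where
 "bnd F \<longleftrightarrow> (EX C>=0. ALL u:S20. cmod (F u) <= C * (H1_nrm D u * H2_nrm D u))"

lemma ctrl_L2: "ctrl W T ==> u : S20 ==> T u : L2 M"
 by (auto simp: ctrl_def)

lemma ctrl_add: assumes "ctrl W T" "ctrl W T'" shows "ctrl W (%u x. T u x + T' u x)"
proof -
 obtain C C' where C: "C >= 0" "!!u. u : S20 ==> T u : L2 M & L2_nrm M (T u) <= C * W u"
  "C' >= 0" "!!u. u : S20 ==> T' u : L2 M & L2_nrm M (T' u) <= C' * W u"
  using assms by (auto simp: ctrl_def)
 show ?thesis
  unfolding ctrl_def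
 proof (intro exI[of _ "C + C'"] conjI ballI)
  fix u assume u: "u : S20"
  show "(%x. T u x + T' u x) : L2 M" using C(2,4)[OF u] by (simp add: L2_add)
  show "L2_nrm M (%x. T u x + T' u x) <= (C + C') * W u"
   using L2_triangle[of "T u" M "T' u"] C(2,4)[OF u] by (simp add: distrib_right)
 qed (use C in simp)
qed

lemma ctrl_zero: "ctrl W (%u x. 0)"
 by (auto simp: ctrl_def intro!: exI[of _ 0])

lemma ctrl_sum: "(!!i. i : I ==> ctrl W (T i)) ==> ctrl W (%u x. SUM i:I. T i u x)"
 by (induction I rule: infinite_finite_induct) (auto intro: ctrl_add ctrl_zero)

lemma ctrl_cont_mult:
 assumes c: "continuous_on UNIV c" and T: "ctrl W T" shows "ctrl W (%u x. of_real (c x) * T u x)"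
proof -
 obtain B where B: "B > 0" "!!u. u : L2 M ==> L2_nrm M (%x. of_real (c x) * u x) <= B * L2_nrm M u"
  using L2_nrm_continuous_mult[OF c] by metis
 obtain C where C: "C >= 0" "!!u. u : S20 ==> T u : L2 M & L2_nrm M (T u) <= C * W u"
  using T by (auto simp: ctrl_def)
 show ?thesis
  unfolding ctrl_def
 proof (intro exI[of _ "B * C"] conjI ballI)
  fix u assume u: "u : S20"
  show "(%x. of_real (c x) * T u x) : L2 M" using C(2)[OF u] L2_continuous_mult[OF c] by blast
  have "L2_nrm M (%x. of_real (c x) * T u x) <= B * L2_nrm M (T u)" using B C(2)[OF u] by blast
  also have "... <= B * (C * W u)" using B C(2)[OF u] by (intro mult_left_mono) auto
  finally show "L2_nrm M (%x. of_real (c x) * T u x) <= B * C * W u" by (simp add: mult.assoc)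
 qed (use B C in simp)
qed

lemma ctrl_minus: "ctrl W T ==> ctrl W (%u x. - T u x)"
 using ctrl_cont_mult[of "%x. -1" W T] by simp

lemma ctrl_cnj: "ctrl W T ==> ctrl W (%u x. cnj (T u x))"
 unfolding ctrl_def by (auto intro: L2_cnj)

lemma ctrl_mono:
 assumes "ctrl W T" "!!u. W u <= W' u" shows "ctrl W' T"
proof -
 obtain C where C: "C >= 0" "!!u. u : S20 ==> T u : L2 M & L2_nrm M (T u) <= C * W u"
  using assms(1) by (auto simp: ctrl_def)
 have "C * W u <= C * W' u" for u by (intro mult_left_mono assms C)
 thus ?thesis unfolding ctrl_def using C by (meson order_trans)
qed

lemma bnd_add: assumes "bnd F" "bnd G" shows "bnd (%u. F u + G u)"
proof -
 obtain C C' where C: "C >= 0" "!!u. u : S20 ==> cmod (F u) <= C * (H1_nrm D u * H2_nrm D u)"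
  "C' >= 0" "!!u. u : S20 ==> cmod (G u) <= C' * (H1_nrm D u * H2_nrm D u)"
  using assms by (auto simp: bnd_def)
 show ?thesis
  unfolding bnd_def
 proof (intro exI[of _ "C + C'"] conjI ballI)
  fix u assume u: "u : S20"
  show "cmod (F u + G u) <= (C + C') * (H1_nrm D u * H2_nrm D u)"
   using norm_triangle_ineq[of "F u" "G u"] C(2,4)[OF u] by (simp add: distrib_right)
 qed (use C in simp)
qed

lemma bnd_minus: "bnd F ==> bnd (%u. - F u)" by (simp add: bnd_def)

lemma bnd_diff: "bnd F ==> bnd G ==> bnd (%u. F u - G u)"
 using bnd_add[OF _ bnd_minus, of F G] by simp

lemma bnd_zero: "bnd (%u. 0)"
 by (auto simp: bnd_def intro!: exI[of _ 0])

lemma bnd_sum: "(!!i. i : I ==> bnd (F i)) ==> bnd (%u. SUM i:I. F i u)"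
 by (induction I rule: infinite_finite_induct) (auto intro: bnd_add bnd_zero)

lemma bnd_cong: "bnd F ==> (!!u. u : S20 ==> cmod (F u) = cmod (G u)) ==> bnd G"
 by (simp add: bnd_def)

lemma bnd_trilinear:
 assumes c: "continuous_on UNIV c" and T: "ctrl (H1_nrm D) T" and T': "ctrl (H2_nrm D) T'"
 shows "bnd (%u. LINT x|M. of_real (c x) * (T u x * T' u x))"
proof -
 obtain B where B: "B >= 0" "!!f g. f : L2 M ==> g : L2 M ==>
   cmod (LINT x|M. of_real (c x) * (f x * g x)) <= B * (L2_nrm M f * L2_nrm M g)"
  by (rule trilinear_bound[OF c]) blast
 obtain C where C: "C >= 0" "!!u. u : S20 ==> T u : L2 M & L2_nrm M (T u) <= C * H1_nrm D u"
  using T by (auto simp: ctrl_def)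
 obtain C' where C': "C' >= 0" "!!u. u : S20 ==> T' u : L2 M & L2_nrm M (T' u) <= C' * H2_nrm D u"
  using T' by (auto simp: ctrl_def)
 show ?thesis
  unfolding bnd_def
 proof (intro exI[of _ "B * (C * C')"] conjI ballI)
  fix u assume u: "u : S20"
  have "cmod (LINT x|M. of_real (c x) * (T u x * T' u x)) <= B * (L2_nrm M (T u) * L2_nrm M (T' u))"
   using B C(2)[OF u] C'(2)[OF u] by blast
  also have "... <= B * ((C * H1_nrm D u) * (C' * H2_nrm D u))"
   using B C(2)[OF u] C'(2)[OF u] C(1) by (intro mult_left_mono mult_mono) auto
  finally show "cmod (LINT x|M. of_real (c x) * (T u x * T' u x)) <= B * (C * C') * (H1_nrm D u * H2_nrm D u)"
   by (simp add: mult_ac)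
 qed (use B C C' in simp)
qed

end

context c2_domain begin

text \<open>The null Lagrangian property holds for \<open>chi * T u\<close>, which has zero boundary
  values. By the product rule \<open>BF\<close> differs from that vanishing integral only by terms
  in which the derivative falls on \<open>chi\<close>, and there \<open>T u\<close> is left
  undifferentiated.\<close>

lemma bnd_BF_H10:
 assumes chi: "test_function UNIV chi" and i: "i : Basis" and j: "j : Basis"
  and T: "ctrl (H1_nrm D) T" "!!u. u : S20 ==> T u : H1 D" "!!u. u : S20 ==> (%x. of_real (chi x) * T u x) : H10"
  and T': "!!u b. u : S20 ==> b : Basis ==> has_weak_deriv D b (T' u) (G b u)" "!!b. b : Basis ==> ctrl (H2_nrm D) (G b)"
 shows "bnd (%u. BF chi i j (T u) (T' u))"
proof (rule bnd_cong)
 note c = test_pd_cont[OF chi]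
 let ?R = "%u. (LINT x|M. of_real (pd j chi x) * (T u x * cnj (G i u x))) - (LINT x|M. of_real (pd i chi x) * (T u x * cnj (G j u x)))"
 let ?F = "%u x. of_real (chi x) * T u x"
 let ?c = "%u x. cnj (T' u x)"
 show "bnd (%u. ?R u)"
  by (intro bnd_diff bnd_trilinear c i j T ctrl_cnj T')
 fix u assume u: "u : S20"
 note Tu = T(2)[OF u]
 note w = H1_wderiv[OF Tu]
 note wF = weak_deriv_mult_C1[OF w test_Ck[OF chi]]
 note wG = weak_deriv_cnj[OF T'(1)[OF u]]
 have cT: "?c u : H1 D" by (rule H1I[OF wG])
 have nl: "(LINT x|M. wderiv D i (?F u) x * wderiv D j (?c u) x)
  = (LINT x|M. wderiv D j (?F u) x * wderiv D i (?c u) x)"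
  by (rule null_Lagrangian[OF T(3)[OF u] cT i j])
 note L = wderiv_L2[OF Tu] weak_deriv_L2(2)[OF wG] H1_L2[OF Tu]
 note cchi = test_cont[OF chi]
 have e: "(LINT x|M. wderiv D k (?F u) x * wderiv D l (?c u) x)
   = (LINT x|M. of_real (chi x) * (wderiv D k (T u) x * cnj (G l u x))) + (LINT x|M. of_real (pd k chi x) * (T u x * cnj (G l u x)))"
  if k: "k : Basis" and l: "l : Basis" for k l
 proof -
  have "(LINT x|M. wderiv D k (?F u) x * wderiv D l (?c u) x)
   = (LINT x|M. of_real (chi x) * (wderiv D k (T u) x * cnj (G l u x)) + of_real (pd k chi x) * (T u x * cnj (G l u x)))"
  proof (rule integral_cong_AE)
   show "AE x in M. wderiv D k (?F u) x * wderiv D l (?c u) x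
     = of_real (chi x) * (wderiv D k (T u) x * cnj (G l u x)) + of_real (pd k chi x) * (T u x * cnj (G l u x))"
    using wderiv_AE[OF wF[OF k k]] wderiv_AE[OF wG[OF l]] by eventually_elim (simp add: algebra_simps)
  qed (intro borel_measurable_add borel_measurable_times L2_measurable[OF wderiv_L2[OF H10_H1[OF T(3)[OF u]] k]]
     L2_measurable[OF wderiv_L2[OF cT l]] L2_measurable[OF L(1)[OF k]] L2_measurable[OF L(2)[OF l]] L2_measurable[OF L(3)]
     L2_measurable[OF L2_test[OF cchi]] L2_measurable[OF L2_test[OF c[OF k]]])+
  thus ?thesis
   using trilinear_int[OF cchi L(1)[OF k] L(2)[OF l]] trilinear_int[OF c[OF k] L(3) L(2)[OF l]] by simp
 qed
 have "BF chi i j (T u) (T' u) = (LINT x|M. of_real (chi x) * (wderiv D i (T u) x * cnj (G j u x)))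
   - (LINT x|M. of_real (chi x) * (wderiv D j (T u) x * cnj (G i u x)))"
  by (rule BF_eq[OF cchi w[OF i] w[OF j] T'(1)[OF u i] T'(1)[OF u j]])
 moreover have lin: "q - p = b" if "b = x - y" "x + p = y + q" for q p b x y :: complex
 proof -
  have "q = x + p - y" using that(2) by simp
  thus ?thesis using that(1) by simp
 qed
 ultimately have "?R u = BF chi i j (T u) (T' u)"
  using nl unfolding e[OF i j] e[OF j i] by blast
 thus "cmod (?R u) = cmod (BF chi i j (T u) (T' u))" by simp
qed

text \<open>On the support of \<open>chi\<close> the gradient of \<open>u\<close> is \<open>a q\<close> up to a field \<open>p\<close> with zero boundary values.
 The terms with \<open>p\<close> are of lower order by the null Lagrangian property, and the leading part of
 the remaining term is antisymmetric in \<open>i, j\<close>.\<close>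

lemma bnd_BF_local:
 fixes a :: "'a => 'a => real" and d :: 'a
 assumes chi: "test_function UNIV chi" and a: "!!i. i : Basis ==> Ck 1 (a i)"
  and p: "!!u i. u : S20 ==> i : Basis ==> (%x. of_real (chi x) *
    (wderiv D i u x - of_real (a i x) * (SUM k:Basis. of_real (d \<bullet> k) * wderiv D k u x))) : H10"
 shows "bnd (%u. SUM i:Basis. SUM j:Basis. BF chi i j (wderiv D i u) (wderiv D j u))"
proof -
 define q where "q u x = (SUM k:Basis. of_real (d \<bullet> k) * wderiv D k u x)" for u x
 define qd where "qd b u x = (SUM k:Basis. of_real (d \<bullet> k) * wderiv D b (wderiv D k u) x)" for b u x
 define aq where "aq i u x = of_real (a i x) * q u x" for i u x
 define aqd where "aqd i b u x = of_real (a i x) * qd b u x + of_real (pd b (a i) x) * q u x" for i b u x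
 define pp where "pp i u x = wderiv D i u x - aq i u x" for i u x
 note cchi = test_cont[OF chi]
 have uH1: "wderiv D b u : H1 D" if "u : S20" "b : Basis" for u b
  using that H2_wderiv by (simp add: S20_def)
 have wq: "has_weak_deriv D b (q u) (qd b u)" if "u : S20" "b : Basis" for u b
  unfolding q_def[abs_def] qd_def[abs_def] using that
  by (intro weak_deriv_sum weak_deriv_cmult H1_wderiv uH1)
 have waq: "has_weak_deriv D b (aq i u) (aqd i b u)" if "u : S20" "b : Basis" "i : Basis" for u b i
  unfolding aq_def[abs_def] aqd_def[abs_def] using that by (intro weak_deriv_mult_C1 wq a)
 have aqH1: "aq i u : H1 D" if "u : S20" "i : Basis" for u i by (rule H1I[OF waq]) (use that in auto)
 have ppH1: "pp i u : H1 D" if "u : S20" "i : Basis" for u i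
  unfolding pp_def[abs_def] by (intro H1_diff uH1 aqH1 that)
 have pp10: "(%x. of_real (chi x) * pp i u x) : H10" if "u : S20" "i : Basis" for u i
  using p[OF that] by (simp add: pp_def aq_def q_def)
 have c1: "ctrl (H1_nrm D) (%u. wderiv D b u)" if "b : Basis" for b
  unfolding ctrl_def
  by (rule exI[of _ 1]) (use that wderiv_le_H1_nrm wderiv_L2 H2_H1 in "auto simp: S20_def")
 have c2: "ctrl (H2_nrm D) (%u. wderiv D c (wderiv D b u))" if "b : Basis" "c : Basis" for b c
  unfolding ctrl_def
  by (rule exI[of _ 1]) (use that wderiv2_le_H2_nrm[OF that] wderiv_L2[OF uH1] in "auto")
 have cq: "ctrl (H1_nrm D) q"
  unfolding q_def[abs_def] by (intro ctrl_sum ctrl_cont_mult c1 continuous_on_const)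
 have cqd: "ctrl (H2_nrm D) (qd b)" if "b : Basis" for b
  unfolding qd_def[abs_def] by (intro ctrl_sum ctrl_cont_mult c2 continuous_on_const that)
 have cq2: "ctrl (H2_nrm D) q" by (rule ctrl_mono[OF cq H1_le_H2_nrm])
 have caqd: "ctrl (H2_nrm D) (aqd i b)" if "i : Basis" "b : Basis" for i b
  unfolding aqd_def[abs_def] using that
  by (intro ctrl_add ctrl_cont_mult cqd cq2 Ck1_continuous[OF a] Ck1_pd[OF a])
 have cpp: "ctrl (H1_nrm D) (pp i)" if "i : Basis" for i
 proof -
  have "ctrl (H1_nrm D) (%u x. wderiv D i u x + - (of_real (a i x) * q u x))"
   by (intro ctrl_add ctrl_minus ctrl_cont_mult c1 cq Ck1_continuous[OF a] that)
  thus ?thesis by (simp add: pp_def[abs_def] aq_def)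
 qed
 define lead where "lead i j u = (LINT x|M. of_real (chi x * (a i x * a j x)) * (qd i u x * cnj (qd j u x)))
   - (LINT x|M. of_real (chi x * (a i x * a j x)) * (qd j u x * cnj (qd i u x)))" for i j u
 have t1: "bnd (%u. BF chi i j (pp i u) (wderiv D j u))" if "i : Basis" "j : Basis" for i j
  by (rule bnd_BF_H10[OF chi that cpp[OF that(1)] ppH1 pp10, where G="%b u. wderiv D b (wderiv D j u)"])
    (use that c2 H1_wderiv[OF uH1] in auto)
 have t2: "bnd (%u. BF chi i j (aq i u) (pp j u))" if "i : Basis" "j : Basis" for i j
 proof (rule bnd_cong)
  show "bnd (%u. BF chi i j (pp j u) (aq i u))"
   by (rule bnd_BF_H10[OF chi that cpp[OF that(2)] ppH1 pp10, where G="%b u. aqd i b u"])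
     (use that caqd waq in auto)
  show "cmod (BF chi i j (pp j u) (aq i u)) = cmod (BF chi i j (aq i u) (pp j u))" for u
   unfolding BF_antisym[of chi i j "aq i u"] by simp
 qed
 \<comment> \<open>Each derivative of \<open>aq\<close> is \<open>a\<close> times a derivative of
   \<open>q\<close> plus a term with \<open>q\<close> itself. Products of the former make up
   \<open>lead\<close>; each of the five remaining products contains an undifferentiated
   \<open>q\<close>.\<close>
 have t3: "bnd (%u. BF chi i j (aq i u) (aq j u) - lead i j u)" if i: "i : Basis" and j: "j : Basis" for i j
 proof (rule bnd_cong)
  note ca = Ck1_continuous[OF a] Ck1_pd[OF a]
  let ?I = "%c f g. LINT x|M. of_real (c x) * (f x * g x)"
  let ?c1 = "%x. chi x * (a i x * pd j (a j) x)" and ?c2 = "%x. chi x * (pd i (a i) x * a j x)"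
  let ?c3 = "%x. chi x * (pd i (a i) x * pd j (a j) x - pd j (a i) x * pd i (a j) x)"
  let ?c4 = "%x. chi x * (a i x * pd i (a j) x)" and ?c5 = "%x. chi x * (pd j (a i) x * a j x)"
  let ?E = "%u. ?I ?c1 (%x. cnj (q u x)) (qd i u) + ?I ?c2 (q u) (%x. cnj (qd j u x)) + ?I ?c3 (q u) (%x. cnj (q u x)) - ?I ?c4 (%x. cnj (q u x)) (qd j u) - ?I ?c5 (q u) (%x. cnj (qd i u x))"
  have cc: "continuous_on UNIV ?c1" "continuous_on UNIV ?c2" "continuous_on UNIV ?c3" "continuous_on UNIV ?c4" "continuous_on UNIV ?c5"
   "continuous_on UNIV (%x. chi x * (a i x * a j x))"
   by (intro continuous_intros cchi ca i j)+
  show "bnd (%u. ?E u)"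
   by (intro bnd_add bnd_diff bnd_trilinear cc ctrl_cnj cq cqd cq2 i j)
  fix u assume u: "u : S20"
  note Lq = ctrl_L2[OF cq u] ctrl_L2[OF cqd[OF i] u] ctrl_L2[OF cqd[OF j] u]
  note Lc = Lq[THEN L2_cnj]
  have laq: "aqd k b u : L2 M" if "k : Basis" "b : Basis" for k b by (rule ctrl_L2[OF caqd[OF that] u])
  have "BF chi i j (aq i u) (aq j u) = ?I chi (aqd i i u) (%x. cnj (aqd j j u x)) - ?I chi (aqd i j u) (%x. cnj (aqd j i u x))"
   by (rule BF_eq[OF cchi waq[OF u i i] waq[OF u j i] waq[OF u i j] waq[OF u j j]])
  also have "... = (LINT x|M. of_real (chi x) * (aqd i i u x * cnj (aqd j j u x)) - of_real (chi x) * (aqd i j u x * cnj (aqd j i u x)))"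
   using trilinear_int[OF cchi laq[OF i i] L2_cnj[OF laq[OF j j]]] trilinear_int[OF cchi laq[OF i j] L2_cnj[OF laq[OF j i]]]
   by simp
  also have "... = (LINT x|M. (of_real (chi x * (a i x * a j x)) * (qd i u x * cnj (qd j u x)) - of_real (chi x * (a i x * a j x)) * (qd j u x * cnj (qd i u x)))
    + (of_real (?c1 x) * (cnj (q u x) * qd i u x) + of_real (?c2 x) * (q u x * cnj (qd j u x)) + of_real (?c3 x) * (q u x * cnj (q u x))
    - of_real (?c4 x) * (cnj (q u x) * qd j u x) - of_real (?c5 x) * (q u x * cnj (qd i u x))))"
   by (intro Bochner_Integration.integral_cong refl) (simp add: aqd_def algebra_simps)
  also have "... = lead i j u + (?E u)"
  proof -
   note int = trilinear_int[OF cc(1) Lc(1) Lq(2)] trilinear_int[OF cc(2) Lq(1) Lc(3)] trilinear_int[OF cc(3) Lq(1) Lc(1)]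
    trilinear_int[OF cc(4) Lc(1) Lq(3)] trilinear_int[OF cc(5) Lq(1) Lc(2)]
    trilinear_int[OF cc(6) Lq(2) Lc(3)] trilinear_int[OF cc(6) Lq(3) Lc(2)]
   have gen: "(LINT x|M. (f6 x - f7 x) + (f1 x + f2 x + f3 x - f4 x - f5 x))
     = ((LINT x|M. f6 x) - (LINT x|M. f7 x)) + ((LINT x|M. f1 x) + (LINT x|M. f2 x) + (LINT x|M. f3 x) - (LINT x|M. f4 x) - (LINT x|M. f5 x))"
    if "integrable M f1" "integrable M f2" "integrable M f3" "integrable M f4" "integrable M f5" "integrable M f6" "integrable M f7"
    for f1 f2 f3 f4 f5 f6 f7 :: "'a => complex"
    using that by simp
   show ?thesis unfolding lead_def by (rule gen[OF int])
  qed
  finally show "cmod (?E u) = cmod (BF chi i j (aq i u) (aq j u) - lead i j u)"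
   by simp
 qed
 have anti: "lead j i u = - lead i j u" for i j u
  unfolding lead_def by (simp add: mult.commute[of "a j _"])
 let ?R = "%i j u. BF chi i j (pp i u) (wderiv D j u) + (BF chi i j (aq i u) (pp j u) + (BF chi i j (aq i u) (aq j u) - lead i j u))"
 have lead0: "(SUM i:Basis. SUM j:Basis. lead i j u) = 0" for u
 proof -
  have "(SUM i:Basis. SUM j:Basis. lead i j u) = (SUM i:Basis. SUM j:Basis. lead j i u)" by (rule sum.swap)
  also have "... = (SUM i:Basis. SUM j:Basis. - lead i j u)" by (intro sum.cong refl anti)
  also have "... = - (SUM i:Basis. SUM j:Basis. lead i j u)" by (simp add: sum_negf)
  finally show ?thesis by simp
 qed
 show ?thesis
 proof (rule bnd_cong)
  show "bnd (%u. SUM i:Basis. SUM j:Basis. ?R i j u)"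
   by (intro bnd_sum bnd_add t1 t2 t3)
  fix u assume u: "u : S20"
  have "BF chi i j (wderiv D i u) (wderiv D j u) = BF chi i j (pp i u) (wderiv D j u) + (BF chi i j (aq i u) (pp j u) + BF chi i j (aq i u) (aq j u))"
   if i: "i : Basis" and j: "j : Basis" for i j
  proof -
   have e: "wderiv D k u = (%x. pp k u x + aq k u x)" for k by (simp add: pp_def)
   have "BF chi i j (wderiv D i u) (wderiv D j u) = BF chi i j (pp i u) (wderiv D j u) + BF chi i j (aq i u) (wderiv D j u)"
    by (subst e[of i], rule BF_add_left[OF cchi ppH1[OF u i] aqH1[OF u i] uH1[OF u j] i j])
   also have "BF chi i j (aq i u) (wderiv D j u) = BF chi i j (aq i u) (pp j u) + BF chi i j (aq i u) (aq j u)"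
    by (subst e[of j], rule BF_add_right[OF cchi ppH1[OF u j] aqH1[OF u j] aqH1[OF u i] i j])
   finally show ?thesis .
  qed
  hence "(SUM i:Basis. SUM j:Basis. BF chi i j (wderiv D i u) (wderiv D j u)) =
    (SUM i:Basis. SUM j:Basis. (?R i j u) + lead i j u)"
   by (intro sum.cong refl) simp
  also have "... = (SUM i:Basis. SUM j:Basis. ?R i j u)"
   using lead0[of u] by (simp only: sum.distrib) simp
  finally show "cmod (SUM i:Basis. SUM j:Basis. ?R i j u)
    = cmod (SUM i:Basis. SUM j:Basis. BF chi i j (wderiv D i u) (wderiv D j u))" by simp
 qed
qed

text \<open>Cut off inside \<open>D\<close>, the whole gradient has zero boundary values, so with
  \<open>a = 0\<close> it plays the role of the field \<open>p\<close>.\<close>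

lemma bnd_BF_interior:
 assumes chi: "test_function D chi"
 shows "bnd (%u. SUM i:Basis. SUM j:Basis. BF chi i j (wderiv D i u) (wderiv D j u))"
proof (rule bnd_BF_local[OF test_mono[OF chi subset_UNIV], where a="%i x. 0" and d=0])
 show "Ck 1 (%x. 0::real)" by (rule Ck_const)
 fix u i assume "u : S20" "(i::'a) : Basis"
 hence "wderiv D i u : H1 D" using H2_wderiv by (simp add: S20_def)
 from H10_mult_test[OF this chi]
 show "(%x. of_real (chi x) * (wderiv D i u x - of_real 0 * (SUM k:Basis. of_real (0 \<bullet> k) * wderiv D k u x))) : H10"
  by simp
qed

text \<open>The derivative \<open>\<partial>\<^sub>b zeta\<close> of the cutoff is proportional to \<open>\<partial>\<^sub>b h\<close>, so the terms of an integration by parts in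
 direction \<open>b\<close> containing it can be turned into derivatives of \<open>zeta\<close> in the directions \<open>i\<close> and \<open>j\<close>.\<close>

lemma tangential_H10:
 assumes P: "graph_patch D x0 e gam r" and u: "u : H2 D" "u : H10" and chi: "test_function (ball x0 r) chi"
  and i: "i : Basis" and j: "j : Basis"
 shows "(%x. of_real (chi x) * (of_real (pd j (graph_patch.h e gam) x) * wderiv D i u x
  - of_real (pd i (graph_patch.h e gam) x) * wderiv D j u x)) : H10"
proof -
 interpret graph_patch D x0 e gam r by (rule P)
 define ui where "ui = wderiv D i u"
 define uj where "uj = wderiv D j u"
 have u1: "ui : H1 D" "uj : H1 D" using H2_wderiv[OF u(1)] i j by (auto simp: ui_def uj_def)
 note uL = H1_L2[OF u1(1)] H1_L2[OF u1(2)]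
 define t where "t x = of_real (pd j h x) * ui x - of_real (pd i h x) * uj x" for x
 define tb where "tb b x = (of_real (pd j h x) * wderiv D b ui x + of_real (pd b (pd j h) x) * ui x)
   - (of_real (pd i h x) * wderiv D b uj x + of_real (pd b (pd i h) x) * uj x)" for b x
 have t: "has_weak_deriv D b t (tb b)" if "b : Basis" for b
  unfolding t_def[abs_def] tb_def[abs_def]
  by (intro weak_deriv_diff weak_deriv_mult_C1 H1_wderiv u1 Ck1_pd_h that i j)
 have "(%x. of_real (chi x) * t x) : H10"
 proof (rule H10_mult_testI[OF t test_smooth[OF chi]])
  fix b :: 'a and phi :: "'a => real" assume b: "b : Basis" and phi: "test_function UNIV phi"
  note tL = weak_deriv_L2[OF t[OF b]]
  define Phi where "Phi x = chi x * phi x" for x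
  have Phit: "test_function (ball x0 r) Phi"
   unfolding Phi_def[abs_def] by (rule test_mult[OF chi test_smooth[OF phi]])
  have Phi: "Ck 1 Phi" "bounded {x. Phi x ~= 0}" "closure {x. Phi x ~= 0} <= ball x0 r"
   using test_Ck[OF Phit] test_bounded[OF Phit] test_support[OF Phit] by auto
  \<comment> \<open>Chosen such that \<open>pd b (zeta d) x * pd j h x * Phi x\<close> equals
    \<open>pd j (zeta d) x * psi x\<close>, and likewise for \<open>i\<close>, because the gradient
    of \<open>zeta d\<close> is a multiple of that of \<open>h\<close>.\<close>
  define psi where "psi x = pd b h x * Phi x" for x
  have psis: "{x. psi x ~= 0} <= {x. Phi x ~= 0}" by (auto simp: psi_def)
  have psi: "Ck 1 psi" "bounded {x. psi x ~= 0}" "closure {x. psi x ~= 0} <= ball x0 r"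
   unfolding psi_def[abs_def] using Ck_mult[OF Ck1_pd_h[OF b] Phi(1)] bounded_subset[OF Phi(2) psis] closure_mono[OF psis] Phi(3)
   by (auto simp: psi_def[abs_def])
  have int: "integrable M (%x. f x * of_real (F x))" "integrable M (%x. f x * of_real (pd c F x))"
   if "f : L2 M" "Ck 1 F" "c : Basis" for f F c
   by (intro L2_mult_int L2_test Ck1_continuous Ck1_pd that)+
  let ?A = "%x. t x * of_real (pd b Phi x) + tb b x * of_real (Phi x)"
  let ?B = "%x. ui x * of_real (pd j psi x) - uj x * of_real (pd i psi x)"
  have key: "(LINT x|M. of_real (zeta d x) * (?A x - ?B x)) = 0" if d: "d > 0" for d
  proof -
   have zs: "{x. zeta d x * f x ~= 0} <= {x. f x ~= 0}" for f by auto
   have z: "Ck 1 (%x. zeta d x * F x)" "bounded {x. zeta d x * F x ~= 0}" "closure {x. zeta d x * F x ~= 0} <= D"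
    if "Ck 1 F" "bounded {x. F x ~= 0}" "closure {x. F x ~= 0} <= ball x0 r" for F
    by (rule Ck_mult[OF Ck_zeta that(1)], rule bounded_subset[OF that(2) zs], rule zeta_support[OF d that(3)])
   note zPhi = z[OF Phi] and zpsi = z[OF psi]
   have pd: "pd c (%x. zeta d x * F x) x = zeta d x * pd c F x + pd c (zeta d) x * F x" if "Ck 1 F" for c x F
    by (rule pd_mult[OF Ck1_diff[OF Ck_zeta] Ck1_diff[OF that]])
   have w: "(LINT x|M. f x * of_real (pd c (%x. zeta d x * F x) x)) = - (LINT x|M. g x * of_real (zeta d x * F x))"
    if "has_weak_deriv D c f g" "c : Basis" "Ck 1 F" "bounded {x. F x ~= 0}" "closure {x. F x ~= 0} <= ball x0 r" for c f g F
    by (rule weak_derivD_C1[OF that(1) z[OF that(3-5)] that(2)])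
   \<comment> \<open>Symmetry of the second weak derivatives: the terms in which the derivative has
     been moved from \<open>zeta d * psi\<close> onto \<open>ui\<close> and \<open>uj\<close>
     cancel.\<close>
   have "(LINT x|M. wderiv D j ui x * of_real (zeta d x * psi x)) = (LINT x|M. wderiv D i uj x * of_real (zeta d x * psi x))"
    by (subst (1 2) mult.commute, rule L2_mult_cong_AE)
      (use wderiv_commute[OF u(1) i j] in "auto simp: ui_def uj_def intro!: wderiv_L2 H2_wderiv u i j L2_test Ck1_continuous[OF zpsi(1)] simp del: of_real_mult")
   hence "(LINT x|M. (t x * of_real (pd b (%x. zeta d x * Phi x) x) + tb b x * of_real (zeta d x * Phi x))
    - (ui x * of_real (pd j (%x. zeta d x * psi x) x) - uj x * of_real (pd i (%x. zeta d x * psi x) x))) = 0"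
    using int[OF tL(1) zPhi(1) b] int[OF tL(2) zPhi(1) b] int[OF uL(1) zpsi(1) j] int[OF uL(2) zpsi(1) i]
     w[OF t[OF b] b Phi] w[OF H1_wderiv[OF u1(1) j] j psi] w[OF H1_wderiv[OF u1(2) i] i psi]
    by (simp del: of_real_mult)
   moreover have "(t x * of_real (pd b (%x. zeta d x * Phi x) x) + tb b x * of_real (zeta d x * Phi x))
    - (ui x * of_real (pd j (%x. zeta d x * psi x) x) - uj x * of_real (pd i (%x. zeta d x * psi x) x))
    = of_real (zeta d x) * (?A x - ?B x)" for x
   proof -
    obtain c where "!!k. pd k (zeta d) x = c * pd k h x" using pd_zeta by blast
    thus ?thesis unfolding pd[OF Phi(1)] pd[OF psi(1)] by (simp add: t_def psi_def algebra_simps)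
   qed
   ultimately show ?thesis by simp
  qed
  define d where "d n = inverse (real (Suc n))" for n
  have d: "d n > 0" "d ----> 0" for n unfolding d_def using LIMSEQ_inverse_real_of_nat by auto
  have i2: "integrable M ?A" "integrable M ?B"
   by (rule Bochner_Integration.integrable_add[OF int(2)[OF tL(1) Phi(1) b] int(1)[OF tL(2) Phi(1) b]],
    rule Bochner_Integration.integrable_diff[OF int(2)[OF uL(1) psi(1) j] int(2)[OF uL(2) psi(1) i]])
  have "?A x - ?B x = 0" if "x ~: ball x0 r" for x
  proof -
   have "x ~: closure {x. Phi x ~= 0}" "x ~: closure {x. psi x ~= 0}" using that Phi(3) psi(3) by blast+
   hence "pd c Phi x = 0" "pd c psi x = 0" "Phi x = 0" for c
    using pd_outside_support[of x Phi] pd_outside_support[of x psi] closure_subset[of "{x. Phi x ~= 0}"] by auto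
   thus ?thesis by simp
  qed
  from zeta_limit[OF Bochner_Integration.integrable_diff[OF i2] this d] have "(LINT x|M. ?A x - ?B x) = 0"
   by (simp add: key[OF d(1)] LIMSEQ_const_iff)
  \<comment> \<open>The zero boundary values of \<open>u\<close> enter here, through the null
    Lagrangian property for \<open>u\<close> and \<open>psi\<close>.\<close>
  moreover have "(LINT x|M. ?B x) = 0"
  proof -
   have psiC: "Ck 1 (%x. complex_of_real (psi x))" by (rule Ck_linear_comp[OF bounded_linear_of_real psi(1)])
   note psiw = weak_deriv_C1[OF psiC, unfolded pd_of_real[OF Ck1_diff[OF psi(1)]]]
   have "(LINT x|M. f x * of_real (pd c psi x)) = (LINT x|M. f x * wderiv D c (%x. of_real (psi x)) x)"
    if "f : L2 M" "c : Basis" for f c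
    by (rule L2_mult_cong_AE[OF that(1)])
      (use wderiv_AE[OF psiw[OF that(2)]] in "auto intro!: that wderiv_L2 H1_C1 psiC L2_test Ck1_pd psi elim: eventually_mono")
   from this[OF uL(1) j] this[OF uL(2) i] show ?thesis
    using null_Lagrangian[OF u(2) H1_C1[OF psiC] i j] int(2)[OF uL(1) psi(1) j] int(2)[OF uL(2) psi(1) i]
    by (simp add: ui_def uj_def)
  qed
  ultimately have "(LINT x|M. ?A x) = 0" using i2 by simp
  thus "(LINT x|M. t x * of_real (pd b (%x. chi x * phi x) x)) = - (LINT x|M. tb b x * of_real (chi x * phi x))"
   using int(2)[OF tL(1) Phi(1) b] int(1)[OF tL(2) Phi(1) b]
   by (simp add: Phi_def[abs_def] add_eq_0_iff2)
 qed
 thus ?thesis by (simp add: t_def ui_def uj_def)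
qed

text \<open>As \<open>e\<close> has inner product 1 with the gradient of \<open>h\<close>, the
  derivative \<open>wderiv D i u\<close> minus \<open>pd i h\<close> times the derivative along
  \<open>e\<close> is the sum over \<open>j\<close> of \<open>e \<bullet> j\<close> times the
  combinations in \<open>tangential_H10\<close>. So \<open>a\<close> is the gradient of
  \<open>h\<close> and \<open>d\<close> is \<open>e\<close>.\<close>

lemma bnd_BF_boundary:
 assumes P: "graph_patch D x0 e gam r" and chi: "test_function (ball x0 (r/2)) chi"
 shows "bnd (%u. SUM i:Basis. SUM j:Basis. BF chi i j (wderiv D i u) (wderiv D j u))"
proof -
 interpret graph_patch D x0 e gam r by (rule P)
 have chir: "test_function (ball x0 r) chi" by (rule test_mono[OF chi]) (use r in auto)
 show ?thesis
 proof (rule bnd_BF_local[OF test_mono[OF chi subset_UNIV], where a="%i. pd i h" and d=e])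
  show "Ck 1 (pd i h)" if "i : Basis" for i by (rule Ck1_pd_h[OF that])
  fix u i assume u: "u : S20" and i: "(i::'a) : Basis"
  have u': "u : H2 D" "u : H10" using u by (auto simp: S20_def)
  let ?C = "%j x. of_real (pd j h x) * wderiv D i u x - of_real (pd i h x) * wderiv D j u x"
  let ?E = "%x. wderiv D i u x - of_real (pd i h x) * (SUM k:Basis. of_real (e \<bullet> k) * wderiv D k u x)"
  have "(%x. SUM j:Basis. of_real (e \<bullet> j) * (of_real (chi x) *
    ?C j x)) : H10"
   by (intro H10_sum H10_cmult tangential_H10[OF P u' chir i])
  also have "(%x. SUM j:Basis. of_real (e \<bullet> j) * (of_real (chi x) *
    ?C j x)) =
    (%x. of_real (chi x) * ?E x)"
  proof
   fix x
   have "(SUM j:Basis. complex_of_real (e \<bullet> j) * of_real (pd j h x)) = 1"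
    using arg_cong[OF sum_e_pd_h[of x], of of_real] by simp
   hence "wderiv D i u x = (SUM j:Basis. of_real (e \<bullet> j) * of_real (pd j h x)) * wderiv D i u x" by simp
   hence "wderiv D i u x - of_real (pd i h x) * (SUM k:Basis. of_real (e \<bullet> k) * wderiv D k u x)
     = (SUM j:Basis. of_real (e \<bullet> j) * ?C j x)"
    by (simp add: right_diff_distrib sum_subtractf sum_distrib_right sum_distrib_left mult_ac)
   thus "(SUM j:Basis. of_real (e \<bullet> j) * (of_real (chi x) *
    ?C j x)) =
    of_real (chi x) * ?E x"
    by (simp add: sum_distrib_left mult.left_commute[of "of_real (chi x)"])
  qed
  finally show "(%x. of_real (chi x) * ?E x) : H10" .
 qed
qed

lemma laplacian_L2: "u : H2 D ==> laplacian D u : L2 M"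
 unfolding laplacian_def[abs_def] by (intro L2_sum wderiv_L2 H2_wderiv)

text \<open>The weights add up to 1 on \<open>D\<close>, and symmetry of the second derivatives
  turns the mixed products into squared moduli.\<close>

lemma BF_sum_hessian:
 assumes u: "u : H2 D" and chic: "!!l. l < N ==> continuous_on UNIV (chi l)" and one: "!!x. x : D ==> (SUM l<N. chi l x) = (1::real)"
 shows "(SUM l<N. SUM i:Basis. SUM j:Basis. BF (chi l) i j (wderiv D i u) (wderiv D j u))
  = of_real ((L2_nrm M (laplacian D u))^2 - (SUM b:Basis. SUM c:Basis. (L2_nrm M (wderiv D c (wderiv D b u)))^2))"
proof -
 let ?U = "%i j x. wderiv D j (wderiv D i u) x"
 have UL: "?U i j : L2 M" if "i : Basis" "j : Basis" for i j by (intro wderiv_L2 H2_wderiv u that)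
 let ?W = "%i j x. ?U i i x * cnj (?U j j x) - ?U i j x * cnj (?U j i x)"
 let ?I = "%i j. LINT x|M. ?U i i x * cnj (?U j j x)"
 let ?S = "SUM i:Basis. SUM j:Basis. SUM l<N. BF (chi l) i j (wderiv D i u) (wderiv D j u)"
 have i0: "integrable M (%x. ?U i j x * cnj (?U k l x))" if "i : Basis" "j : Basis" "k : Basis" "l : Basis" for i j k l
  by (intro L2_mult_int L2_cnj UL that)
 have "(SUM l<N. BF (chi l) i j (wderiv D i u) (wderiv D j u)) = ?I i j - (LINT x|M. (cmod (?U i j x))^2)"
  if i: "i : Basis" and j: "j : Basis" for i j
 proof -
  have "integrable M (%x. of_real (chi l x) * (?W i j x))" if "l < N" for l
   using trilinear_int[OF chic[OF that] UL[OF i i] L2_cnj[OF UL[OF j j]]]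
    trilinear_int[OF chic[OF that] UL[OF i j] L2_cnj[OF UL[OF j i]]]
   by (simp add: right_diff_distrib)
  hence "(SUM l<N. BF (chi l) i j (wderiv D i u) (wderiv D j u)) = (LINT x|M. (SUM l<N. of_real (chi l x) * (?W i j x)))"
   unfolding BF_def by (subst Bochner_Integration.integral_sum) auto
  also have "... = (LINT x|M. ?W i j x)"
  proof (intro Bochner_Integration.integral_cong refl)
   fix x assume "x : space M"
   hence "(SUM l<N. of_real (chi l x)) = (1::complex)" using one[of x] by (simp flip: of_real_sum)
   thus "(SUM l<N. of_real (chi l x) * (?W i j x)) = ?W i j x"
    by (simp flip: sum_distrib_right)
  qed
  also have "... = ?I i j - (LINT x|M. ?U i j x * cnj (?U j i x))"
   using i0 i j by simp
  also have "(LINT x|M. ?U i j x * cnj (?U j i x)) = (LINT x|M. of_real ((cmod (?U i j x))^2))"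
  proof (rule integral_cong_AE)
   show "AE x in M. ?U i j x * cnj (?U j i x) = of_real ((cmod (?U i j x))^2)"
    using wderiv_commute[OF u i j] by eventually_elim (metis complex_norm_square)
  qed (use i0[OF i j j i] UL[OF i j, THEN L2_measurable] in measurable)
  finally show ?thesis by (simp only: integral_complex_of_real)
 qed
 hence "?S
   = (SUM i:Basis. SUM j:Basis. ?I i j) - (SUM i:Basis. SUM j:Basis. of_real (LINT x|M. (cmod (?U i j x))^2))"
  by (simp add: sum_subtractf)
 also have "(SUM i:Basis. SUM j:Basis. ?I i j) = (LINT x|M. of_real ((cmod (laplacian D u x))^2))"
 proof -
  have "(LINT x|M. of_real ((cmod (laplacian D u x))^2)) = (LINT x|M. (SUM i:Basis. SUM j:Basis. ?U i i x * cnj (?U j j x)))"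
  proof (intro Bochner_Integration.integral_cong refl)
   fix x
   have "of_real ((cmod (laplacian D u x))^2) = laplacian D u x * cnj (laplacian D u x)" by (rule complex_norm_square)
   also have "... = (SUM i:Basis. ?U i i x) * (SUM j:Basis. cnj (?U j j x))"
    by (simp add: laplacian_def)
   finally show "of_real ((cmod (laplacian D u x))^2) = (SUM i:Basis. SUM j:Basis. ?U i i x * cnj (?U j j x))"
    by (simp add: sum_product)
  qed
  also have "... = (SUM i:Basis. SUM j:Basis. ?I i j)"
   using i0 by (subst Bochner_Integration.integral_sum, force intro!: Bochner_Integration.integrable_sum)
     (intro sum.cong refl Bochner_Integration.integral_sum, auto)
  finally show ?thesis by simp
 qed
 finally have "?S
   = of_real ((L2_nrm M (laplacian D u))^2 - (SUM b:Basis. SUM c:Basis. (L2_nrm M (wderiv D c (wderiv D b u)))^2))"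
  unfolding integral_complex_of_real by (simp add: L2_nrm_power2)
 moreover have "(SUM l<N. SUM i:Basis. SUM j:Basis. BF (chi l) i j (wderiv D i u) (wderiv D j u))
   = ?S"
  by (subst sum.swap, intro sum.cong refl, rule sum.swap)
 ultimately show ?thesis by simp
qed

text \<open>The localized forms add up to the exact difference of Laplacian and Hessian norms, and
  each of them is of lower order. The error is linear in the H2 norm, hence can be absorbed by the
  square on the left.\<close>

theorem H2_a_priori:
 obtains C where "C >= 0" "!!u. u : H2 D ==> u : H10 ==>
   (H2_nrm D u)^2 <= (H1_nrm D u)^2 + (L2_nrm M (laplacian D u))^2 + C * (H1_nrm D u * H2_nrm D u)"
proof -
 obtain N chi where "pou N chi" by (rule partition_of_unity)
 note chi = pouD[OF this]
 have "bnd (%u. SUM i:Basis. SUM j:Basis. BF (chi l) i j (wderiv D i u) (wderiv D j u))" if "l < N" for l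
  using chi(4)[OF that] bnd_BF_interior bnd_BF_boundary unfolding localized_def by blast
 hence "bnd (%u. SUM l<N. SUM i:Basis. SUM j:Basis. BF (chi l) i j (wderiv D i u) (wderiv D j u))"
  by (rule bnd_sum) simp
 then obtain C where C: "C >= 0" "!!u. u : S20 ==>
   cmod (SUM l<N. SUM i:Basis. SUM j:Basis. BF (chi l) i j (wderiv D i u) (wderiv D j u)) <= C * (H1_nrm D u * H2_nrm D u)"
  by (auto simp: bnd_def)
 show ?thesis
 proof (rule that[OF C(1)])
  fix u assume u: "u : H2 D" "u : H10"
  define Q where "Q = (SUM b:Basis. SUM c:Basis. (L2_nrm M (wderiv D c (wderiv D b u)))^2)"
  have one: "(SUM i<N. chi i x) = 1" if "x : D" for x using chi(3) that closure_subset by blast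
  have "cmod (of_real ((L2_nrm M (laplacian D u))^2 - Q)) <= C * (H1_nrm D u * H2_nrm D u)"
   using C(2)[of u] u BF_sum_hessian[OF u(1) test_cont[OF chi(1)] one] by (simp add: S20_def Q_def)
  hence "\<bar>(L2_nrm M (laplacian D u))^2 - Q\<bar> <= C * (H1_nrm D u * H2_nrm D u)" unfolding norm_of_real .
  thus "(H2_nrm D u)^2 <= (H1_nrm D u)^2 + (L2_nrm M (laplacian D u))^2 + C * (H1_nrm D u * H2_nrm D u)"
   unfolding H2_nrm_power2 Q_def[symmetric] by linarith
 qed
qed

end

subsection \<open>Translation estimate, Poincare inequality\<close>

text \<open>The translation is carried out in \<open>N\<close> steps so short that the uniform first
  order expansion applies. Each costs its length times the gradient norms plus a small error, and by
  translation invariance the costs add up.\<close>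

lemma L2_nrm_translate_C1:
 fixes G :: "'a::euclidean_space => complex"
 assumes G: "Ck 1 G" "bounded {x. G x ~= 0}"
 shows "L2_nrm lborel (%x. G (x - z) - G x) <= norm z * (SUM b:Basis. L2_nrm lborel (pd b G))"
proof (rule field_le_epsilon)
 let ?L = "%h x. SUM b:Basis. of_real (h \<bullet> b) * pd b G x"
 fix eps :: real assume eps: "eps > 0"
 obtain R where R: "R >= 0" "!!x. G x ~= 0 ==> norm x <= R" using G(2) by (auto simp: bounded_pos intro: less_imp_le)
 define B where "B = cball (0::'a) (R + norm z)"
 define m where "m = sqrt (measure lborel B)"
 have m: "m >= 0" by (simp add: m_def)
 \<comment> \<open>Makes the accumulated error \<open>norm z * (2 * e * m)\<close> at most
   \<open>eps\<close>; the factor 2 there comes from estimating real and imaginary part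
   separately.\<close>
 define e where "e = eps / ((norm z + 1) * (m + 1)) / 2"
 have e: "e > 0" using eps m by (simp add: e_def add_nonneg_pos)
 have Gc: "continuous_on UNIV G" "!!b. b : Basis ==> continuous_on UNIV (pd b G)"
  using Ck1_continuous[OF G(1)] Ck1_pd[OF G(1)] by auto
 have GL: "G : L2 lborel" by (rule L2_continuous_bsupp[OF Gc(1) G(2)])
 have pL: "pd b G : L2 lborel" if "b : Basis" for b
  by (rule L2_continuous_bsupp[OF Gc(2)[OF that] bsupp_pd[OF G(2)]])
 have "EX d>0. ALL x h. norm h < d --> \<bar>T (G (x + h) - G x - ?L h x)\<bar> <= e * norm h"
  if T: "bounded_linear T" for T :: "complex => real"
 proof -
  have TG: "Ck 1 (%x. T (G x))" "bounded {x. T (G x) ~= 0}"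
   by (rule Ck_linear_comp[OF T G(1)], rule bounded_subset[OF G(2)]) (use linear_0[OF bounded_linear.linear[OF T]] in auto)
  obtain d where d: "d > 0" "!!x h. norm h < d ==> \<bar>T (G (x + h)) - T (G x) - (SUM b:Basis. (h \<bullet> b) * pd b (%x. T (G x)) x)\<bar> <= e * norm h"
   using uniform_expansion[OF TG e] by metis
  have "T (?L h x) = (SUM b:Basis. (h \<bullet> b) * pd b (%x. T (G x)) x)" for h x
   by (simp add: linear_sum[OF bounded_linear.linear[OF T]] linear_scale[OF bounded_linear.linear[OF T]] pd_linear_comp[OF T Ck1_diff[OF G(1)]] flip: scaleR_conv_of_real)
  thus ?thesis using d linear_diff[OF bounded_linear.linear[OF T]] by (intro exI[of _ d]) simp
 qed
 from this[OF bounded_linear_Re] this[OF bounded_linear_Im] obtain d d' where d: "d > 0" "d' > 0"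
  "!!x h. norm h < d ==> \<bar>Re (G (x + h) - G x - ?L h x)\<bar> <= e * norm h"
  "!!x h. norm h < d' ==> \<bar>Im (G (x + h) - G x - ?L h x)\<bar> <= e * norm h"
  by blast
 obtain N where N: "norm z / min d d' < real N" using reals_Archimedean2 by blast
 have N0: "N > 0"
 proof -
  have "0 <= norm z / min d d'" using d by simp
  hence "0 < real N" using N by linarith
  thus ?thesis by simp
 qed
 define h where "h = - (1 / real N) *\<^sub>R z"
 have nh: "norm h = norm z / real N" using N0 by (simp add: h_def)
 have "min d d' > 0" using d by simp
 hence "norm z < min d d' * real N" using N by (simp only: pos_divide_less_eq mult.commute)
 hence "norm h < min d d'" using N0 by (simp only: nh pos_divide_less_eq of_nat_0_less_iff)
 hence hd: "norm h < d" "norm h < d'" by simp_all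
 have hz: "norm h <= norm z"
 proof -
  have "norm z * 1 <= norm z * real N" using N0 by (intro mult_left_mono) auto
  thus ?thesis using N0 by (simp add: nh pos_divide_le_eq)
 qed
 define E where "E x = G (x + h) - G x - ?L h x" for x
 define L where "L x = ?L h x" for x
 have tL: "(%x. G (x + h)) : L2 lborel" using L2_translate[OF GL, of "-h"] by simp
 have LL: "L : L2 lborel" unfolding L_def[abs_def] by (intro L2_sum L2_cmult pL)
 have EL: "E : L2 lborel" unfolding E_def[abs_def] L_def[symmetric] by (intro L2_diff tL GL LL)
 have Eb: "cmod (E x) <= 2 * e * norm h * indicator B x" for x
 proof (cases "x : B")
  case True
  thus ?thesis using d(3)[OF hd(1), of x] d(4)[OF hd(2), of x] cmod_le[of "E x"] by (simp add: E_def)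
 next
  case False
  have x: "norm x > R + norm z" using False by (simp add: B_def)
  hence xR: "~ norm x <= R" using norm_ge_zero[of z] by linarith
  have "norm (x + h) >= norm x - norm h" using norm_triangle_ineq2[of x "- h"] by simp
  hence xh: "~ norm (x + h) <= R" using x hz by linarith
  have "closure {x. G x ~= 0} <= cball 0 R" by (rule closure_minimal) (use R in auto)
  hence "x ~: closure {x. G x ~= 0}" using xR by auto
  moreover have "G x = 0" "G (x + h) = 0" using R(2)[of x] R(2)[of "x + h"] xR xh by blast+
  ultimately have "E x = 0" using pd_outside_support[of x G] by (simp add: E_def)
  thus ?thesis using False by simp
 qed
 have En: "L2_nrm lborel E <= 2 * e * norm h * m"
 proof -
  have fin: "emeasure lborel B < \<infinity>" unfolding B_def by (rule emeasure_lborel_cball_finite)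
  have "L2_nrm lborel E <= sqrt (LINT x|lborel. (2 * e * norm h)^2 * indicator B x)"
   unfolding L2_nrm_def
  proof (intro real_sqrt_le_mono integral_mono L2_integrable EL)
   show "integrable lborel (%x. (2 * e * norm h)^2 * indicator B x :: real)"
    using fin by (intro integrable_mult_right integrable_real_indicator) (auto simp: B_def)
   fix x
   have "(cmod (E x))^2 <= (2 * e * norm h * indicator B x)^2" by (intro power_mono Eb) simp
   also have "... = (2 * e * norm h)^2 * indicator B x" by (simp add: indicator_def)
   finally show "(cmod (E x))^2 <= (2 * e * norm h)^2 * indicator B x" .
  qed
  also have "... = 2 * e * norm h * m" using e by (simp add: m_def real_sqrt_mult B_def)
  finally show ?thesis .
 qed
 let ?P = "SUM b:Basis. L2_nrm lborel (pd b G)"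
 have Ln: "L2_nrm lborel L <= norm h * ?P"
 proof -
  have "L2_nrm lborel L <= (SUM b:Basis. L2_nrm lborel (%x. of_real (h \<bullet> b) * pd b G x))"
   unfolding L_def[abs_def] by (rule L2_triangle_sum) (intro L2_cmult pL)
  also have "... <= (SUM b:Basis. norm h * L2_nrm lborel (pd b G))"
   by (intro sum_mono) (simp add: L2_nrm_cmult Basis_le_norm mult_right_mono)
  finally show ?thesis by (simp add: sum_distrib_left)
 qed
 have step: "L2_nrm lborel (%x. G (x + h) - G x) <= norm h * (2 * e * m + ?P)"
  using L2_triangle[OF EL LL] En Ln by (simp add: E_def L_def algebra_simps)
 have "L2_nrm lborel (%x. G (x + real k *\<^sub>R h) - G x) <= real k * (norm h * (2 * e * m + ?P))" for k
 proof (induction k)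
  case 0 thus ?case by simp
 next
  case (Suc k)
  have T: "(%x. G (x + real j *\<^sub>R h)) : L2 lborel" for j using L2_translate[OF GL, of "- (real j *\<^sub>R h)"] by simp
  have D: "(%x. G (x + h) - G x) : L2 lborel" by (rule L2_diff[OF tL GL])
  have "L2_nrm lborel (%x. G (x + real (Suc k) *\<^sub>R h) - G (x + real k *\<^sub>R h)) = L2_nrm lborel (%x. G (x + h) - G x)"
   using L2_nrm_translate[OF D, of "- (real k *\<^sub>R h)"] by (simp add: algebra_simps)
  thus ?case
   using L2_triangle_diff[OF T[of "Suc k"] T[of k] GL] Suc step by (simp add: algebra_simps)
 qed
 from this[of N] have "L2_nrm lborel (%x. G (x - z) - G x) <= norm z * (2 * e * m + ?P)"
  using N0 by (simp add: h_def)
 moreover have "norm z * (2 * e * m) <= eps"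
 proof -
  have "norm z * (2 * e * m) = eps * (norm z / (norm z + 1)) * (m / (m + 1))" by (simp add: e_def)
  also have "... <= eps * 1 * 1" using eps m by (intro mult_mono) (auto simp: divide_le_eq_1 add_nonneg_pos)
  finally show ?thesis by simp
 qed
 ultimately show "L2_nrm lborel (%x. G (x - z) - G x) <= norm z * ?P + eps" by (simp add: distrib_left)
qed

context bdd_open begin

definition grad_nrm where "grad_nrm v = (SUM b:Basis. L2_nrm M (wderiv D b v))"

text \<open>Zero boundary values admit test functions that reach across the boundary, so mollifying
  the extension by zero commutes with differentiation everywhere and not only inside
  \<open>D\<close>. The estimate for C1 functions then passes to the limit.\<close>

lemma H10_translate:
 assumes v: "v : H10"
 shows "L2_nrm lborel (%x. ext v (x - z) - ext v x) <= norm z * grad_nrm v"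
proof -
 define r where "r n = inverse (real (Suc n))" for n
 have r: "r n > 0" for n by (simp add: r_def)
 have r0: "r ----> 0" unfolding r_def by (rule LIMSEQ_inverse_real_of_nat)
 have "EX rho. mollifier (0::'a) (r n) rho" for n using mollifier_exists[OF r] by metis
 then obtain rho where rho: "!!n. mollifier (0::'a) (r n) (rho n)" by metis
 have lim: "(%n. norm (0::'a) + r n) ----> 0" using r0 by simp
 note H1 = H10_H1[OF v]
 note vL = H1_L2[OF H1] and wL = wderiv_L2[OF H1]
 define G where "G n = conv (ext v) (rho n)" for n
 have sm: "smooth (rho n)" for n by (rule mollifier_smooth[OF rho])
 have Gs: "smooth (G n)" for n unfolding G_def by (rule smooth_conv[OF ext_integrable[OF vL] sm mollifier_bounded[OF rho]])
 have Gb: "bounded {x. G n x ~= 0}" for n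
 proof -
  obtain R where R: "!!x. x : D ==> norm x <= R" using bounded_D by (auto simp: bounded_iff)
  have "norm x <= R + r n" if "G n x ~= 0" for x
  proof -
   obtain y where y: "ext v y ~= 0" "rho n (x - y) ~= 0" using \<open>G n x ~= 0\<close> unfolding G_def by (elim conv_nonzeroD)
   have "norm y <= R" using R ext_outside[OF vL] y(1) by blast
   moreover have "norm (x - y) < r n" using mollifier_support[OF rho y(2)] by simp
   ultimately show ?thesis using norm_triangle_sub[of x y] by linarith
  qed
  thus ?thesis by (auto simp: bounded_iff)
 qed
 have pd: "pd b (G n) = conv (ext (wderiv D b v)) (rho n)" if b: "b : Basis" for b n
 proof
  fix x
  have t: "test_function UNIV (%y. rho n (x - y))" by (rule test_reflect[OF rho subset_UNIV])
  have "pd b (G n) x = conv (ext v) (pd b (rho n)) x"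
   unfolding G_def by (rule pd_conv[OF ext_integrable[OF vL] smooth_imp_Ck[OF sm] mollifier_bounded[OF rho] b])
  also have "... = conv (ext (wderiv D b v)) (rho n) x"
   using H10D[OF v b t]
   by (simp add: conv_ext[OF vL Ck1_pd[OF smooth_imp_Ck[OF sm] b]] conv_ext[OF wL[OF b] mollifier_cont[OF rho]] pd_reflect[OF sm])
  finally show "pd b (G n) x = conv (ext (wderiv D b v)) (rho n) x" .
 qed
 have GL: "G n : L2 lborel" for n unfolding G_def by (rule L2_conv[OF rho ext_L2[OF vL] ext_bounded[OF vL]])
 have Glim: "(%n. L2_nrm lborel (%x. G n x - ext v x)) ----> 0"
  unfolding G_def by (rule L2_mollifier_tendsto[OF rho lim ext_L2[OF vL] ext_bounded[OF vL]])
 have "(%n. L2_nrm lborel (pd b (G n))) ----> L2_nrm M (wderiv D b v)" if b: "b : Basis" for b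
  unfolding pd[OF b] ext_nrm[OF wL[OF b], symmetric]
  by (rule L2_tendsto_nrm[OF L2_conv[OF rho ext_L2[OF wL[OF b]] ext_bounded[OF wL[OF b]]] ext_L2[OF wL[OF b]]
     L2_mollifier_tendsto[OF rho lim ext_L2[OF wL[OF b]] ext_bounded[OF wL[OF b]]]])
 hence R: "(%n. norm z * (SUM b:Basis. L2_nrm lborel (pd b (G n)))) ----> norm z * grad_nrm v"
  unfolding grad_nrm_def by (intro tendsto_mult tendsto_const tendsto_sum)
 note tr = L2_translate
 have "(%n. L2_nrm lborel (%x. G n (x - z) - G n x)) ----> L2_nrm lborel (%x. ext v (x - z) - ext v x)"
 proof (rule L2_tendsto_nrm)
  show "(%x. G n (x - z) - G n x) : L2 lborel" for n by (intro L2_diff tr GL)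
  show "(%x. ext v (x - z) - ext v x) : L2 lborel" by (intro L2_diff tr ext_L2 vL)
  have "(%n. 2 * L2_nrm lborel (%x. G n x - ext v x)) ----> 0"
   using tendsto_mult_right_zero[OF Glim] by blast
  thus "(%n. L2_nrm lborel (%x. G n (x - z) - G n x - (ext v (x - z) - ext v x))) ----> 0"
  proof (rule tendsto_0_dominated)
   fix n
   have d: "(%x. G n x - ext v x) : L2 lborel" by (intro L2_diff GL ext_L2 vL)
   show "L2_nrm lborel (%x. G n (x - z) - G n x - (ext v (x - z) - ext v x)) <= 2 * L2_nrm lborel (%x. G n x - ext v x)"
    using L2_triangle_minus[OF tr[OF d, of z] d] L2_nrm_translate[OF d, of z] by (simp add: algebra_simps)
  qed simp
 qed
 from LIMSEQ_le[OF this R] show ?thesis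
  using L2_nrm_translate_C1[OF smooth_imp_Ck[OF Gs] Gb] by blast
qed

text \<open>\<open>D\<close> lies in the ball of radius \<open>R\<close>, so a translation by length
  \<open>3 * R\<close> moves it off itself, and on \<open>D\<close> the translation difference is
  just \<open>- ext v\<close>.\<close>

lemma Poincare:
 obtains C where "C > 0" "!!v. v : H10 ==> L2_nrm M v <= C * grad_nrm v"
proof -
 obtain R where R: "R > 0" "!!x. x : D ==> norm x <= R" using bounded_D by (auto simp: bounded_pos)
 obtain b :: 'a where b: "b : Basis" using nonempty_Basis by blast
 define z where "z = (3 * R) *\<^sub>R b"
 have z: "norm z = 3 * R" using R b by (simp add: z_def)
 show ?thesis
 proof (rule that[of "3 * R"])
  fix v assume v: "v : H10"
  note vL = H1_L2[OF H10_H1[OF v]]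
  note eL = ext_L2[OF vL]
  have pt: "cmod (ext v x) <= cmod (ext v (x - z) - ext v x)" for x
  proof (cases "x : D")
   case True
   have "norm (x - z) >= norm z - norm x" using norm_triangle_ineq3[of z x] by (simp add: norm_minus_commute)
   hence "~ norm (x - z) <= R" using R(1) z R(2)[OF True] by linarith
   hence "x - z ~: D" using R(2)[of "x - z"] by blast
   thus ?thesis using ext_outside[OF vL] by simp
  qed (simp add: ext_outside[OF vL])
  have "L2_nrm M v = L2_nrm lborel (ext v)" by (simp add: ext_nrm[OF vL])
  also have "... <= L2_nrm lborel (%x. ext v (x - z) - ext v x)"
   unfolding L2_nrm_def by (intro real_sqrt_le_mono integral_mono L2_integrable L2_diff L2_translate eL power_mono pt) simp
  also have "... <= norm z * grad_nrm v" by (rule H10_translate[OF v])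
  finally show "L2_nrm M v <= 3 * R * grad_nrm v" by (simp add: z)
 qed (use R in simp)
qed

text \<open>At a fixed scale \<open>r\<close> the mollifications are integrals of \<open>v n\<close>
  against fixed functions, so they tend to 0 pointwise and, being bounded, in L2. The translation
  estimate bounds the mollification error by \<open>r * C\<close> for all \<open>n\<close> at
  once.\<close>

lemma Rellich:
 assumes v: "!!n::nat. v n : H10" and bd: "!!n. L2_nrm M (v n) <= C" "!!n. grad_nrm (v n) <= C"
  and weak: "!!g. g : L2 M ==> (%n. LINT x|M. v n x * g x) ----> 0"
 shows "(%n. L2_nrm M (v n)) ----> 0"
proof (rule LIMSEQ_I)
 fix eps :: real assume eps: "eps > 0"
 have C: "C >= 0" using bd(1)[of 0] L2_nrm_nonneg order_trans by blast
 define r where "r = eps / (2 * (C + 1))"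
 have r: "r > 0" using eps C by (simp add: r_def)
 have rC: "r * C <= eps / 2"
 proof -
  have "r * C = (eps / 2) * (C / (C + 1))" by (simp add: r_def)
  also have "... <= (eps / 2) * 1" using eps C by (intro mult_left_mono) auto
  finally show ?thesis by simp
 qed
 obtain rho :: "'a => real" where rho: "mollifier 0 r rho" using mollifier_exists[OF r] by metis
 note rhoc = mollifier_cont[OF rho]
 have vL: "v n : L2 M" for n by (rule H1_L2[OF H10_H1[OF v]])
 let ?c = "%n. conv (ext (v n)) rho"
 have cL: "?c n : L2 M" for n by (rule L2_M_lborel[OF L2_conv[OF rho ext_L2[OF vL] ext_bounded[OF vL]]])
 obtain B where B: "B > 0" "!!x. norm (rho x) <= B" using bounded_support_bounded[OF rhoc mollifier_bounded[OF rho]] by metis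
 have rhoL: "(%y. of_real (rho (x - y))) : L2 M" "L2_nrm M (%y. of_real (rho (x - y))) <= B * vol" for x
 proof -
  have c: "continuous_on UNIV (%y. rho (x - y))" by (intro continuous_on_compose2[OF rhoc] continuous_intros) auto
  show "(%y. of_real (rho (x - y))) : L2 M" by (rule L2_test[OF c])
  show "L2_nrm M (%y. of_real (rho (x - y))) <= B * vol"
   using B by (intro L2_nrm_bounded L2_measurable[OF L2_test[OF c]]) auto
 qed
 have cdiff: "(%n. L2_nrm M (%x. ?c n x - 0)) ----> 0"
 proof (rule L2_dominated_convergence[where w="%x. C * (B * vol)"])
  interpret finite_measure M by (rule finite_measure_M)
  show "integrable M (%x. (C * (B * vol))^2)" by simp
  show "AE x in M. (%n. ?c n x) ----> 0"
   using weak[OF rhoL(1)] by (simp add: conv_ext[OF vL rhoc])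
  show "AE x in M. cmod (?c n x) <= C * (B * vol)" for n
  proof (rule AE_I2)
   fix x
   have "cmod (?c n x) <= L2_nrm M (v n) * L2_nrm M (%y. of_real (rho (x - y)))"
    unfolding conv_ext[OF vL rhoc] by (rule L2_Cauchy_Schwarz[OF vL rhoL(1)])
   also have "... <= C * (B * vol)" by (intro mult_mono bd rhoL C) auto
   finally show "cmod (?c n x) <= C * (B * vol)" .
  qed
 qed (use cL in "auto dest: L2_measurable")
 obtain N where N: "!!n. n >= N ==> L2_nrm M (?c n) < eps / 2"
  using LIMSEQ_D[OF cdiff, of "eps/2"] eps by auto
 have "L2_nrm M (v n) < eps" if "n >= N" for n
 proof -
  note eL = ext_L2[OF vL[of n]]
  have d: "(%x. ?c n x - ext (v n) x) : L2 lborel" "L2_nrm lborel (%x. ?c n x - ext (v n) x) <= r * C"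
  proof -
   have tr: "L2_nrm lborel (%x. ext (v n) (x - z) - ext (v n) x) <= r * C" if "z : ball 0 r" for z
   proof -
    have "norm z * grad_nrm (v n) <= r * C"
     using that bd(2)[of n] r C by (intro mult_mono) (auto simp: grad_nrm_def sum_nonneg)
    thus ?thesis using H10_translate[OF v, of n z] by linarith
   qed
   have rC0: "0 <= r * C" using r C by simp
   show "(%x. ?c n x - ext (v n) x) : L2 lborel" by (rule L2_conv_diff[OF rho eL ext_integrable[OF vL] rC0 tr])
   show "L2_nrm lborel (%x. ?c n x - ext (v n) x) <= r * C" by (rule L2_nrm_conv_diff[OF rho eL ext_integrable[OF vL] rC0 tr])
  qed
  have "L2_nrm M (v n) = L2_nrm M (ext (v n))"
   using ext_nrm[OF vL] L2_nrm_M_eq[OF eL ext_outside[OF vL]] by simp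
  also have "... <= L2_nrm M (%x. ext (v n) x - ?c n x) + L2_nrm M (?c n)"
   using L2_triangle[OF L2_diff[OF L2_M_lborel[OF eL] cL[of n]] cL[of n]] by simp
  also have "L2_nrm M (%x. ext (v n) x - ?c n x) <= r * C"
   using L2_nrm_M_le[OF d(1)] d(2) L2_nrm_minus_commute[of M "ext (v n)" "?c n"] by linarith
  finally show ?thesis using N[OF that] rC by linarith
 qed
 thus "EX no. ALL n>=no. norm (L2_nrm M (v n) - 0) < eps" by auto
qed

lemma H10_cnj: assumes v: "v : H10" shows "(%x. cnj (v x)) : H10"
proof (rule H10I[OF weak_deriv_cnj[OF H1_wderiv[OF H10_H1[OF v]]]])
 fix b :: 'a and phi :: "'a => real" assume b: "b : Basis" and phi: "test_function UNIV phi"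
 have "(LINT x|M. cnj (w x) * of_real (c x)) = cnj (LINT x|M. w x * of_real (c x))" for w c
  using integral_bounded_linear'[OF bounded_linear_cnj bounded_linear_cnj, of M "%x. w x * of_real (c x)"] by simp
 thus "(LINT x|M. cnj (v x) * of_real (pd b phi x)) = - (LINT x|M. cnj (wderiv D b v x) * of_real (phi x))"
  using H10D[OF v b phi] by simp
qed

end

context c2_domain begin

text \<open>Integration by parts in each direction against the conjugate of \<open>u\<close>, which
  again has zero boundary values, followed by Cauchy-Schwarz.\<close>

lemma gradient_le_laplacian:
 assumes u: "u : H2 D" "u : H10"
 shows "(SUM b:Basis. (L2_nrm M (wderiv D b u))^2) <= L2_nrm M (laplacian D u) * L2_nrm M u"
proof -
 note uL = H1_L2[OF H2_H1[OF u(1)]]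
 note wL = wderiv_L2[OF H2_H1[OF u(1)]] and w2L = wderiv_L2[OF H2_wderiv[OF u(1)]]
 have "of_real ((L2_nrm M (wderiv D b u))^2) = - (LINT x|M. cnj (u x) * wderiv D b (wderiv D b u) x)" if b: "b : Basis" for b
 proof -
  have "complex_of_real ((L2_nrm M (wderiv D b u))^2) = (LINT x|M. of_real ((cmod (wderiv D b u x))^2))"
   unfolding L2_nrm_power2 integral_complex_of_real ..
  also have "... = (LINT x|M. wderiv D b (%x. cnj (u x)) x * wderiv D b u x)"
  proof (rule integral_cong_AE)
   show "AE x in M. of_real ((cmod (wderiv D b u x))^2) = wderiv D b (%x. cnj (u x)) x * wderiv D b u x"
    using wderiv_cnj[OF H2_H1[OF u(1)] b] by eventually_elim (simp only: complex_norm_square, rule mult.commute)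
   show "(%x. wderiv D b (%x. cnj (u x)) x * wderiv D b u x) : borel_measurable M"
    by (intro borel_measurable_times L2_measurable wL b wderiv_L2 H1_cnj H2_H1 u)
   show "(%x. complex_of_real ((cmod (wderiv D b u x))^2)) : borel_measurable M"
    using L2_measurable[OF wL[OF b]] by measurable
  qed
  also have "... = - (LINT x|M. cnj (u x) * wderiv D b (wderiv D b u) x)"
   using H10_ibp[OF H10_cnj[OF u(2)] H2_wderiv[OF u(1) b] b] by simp
  finally show ?thesis .
 qed
 hence "of_real (SUM b:Basis. (L2_nrm M (wderiv D b u))^2) = (SUM b:Basis. - (LINT x|M. cnj (u x) * wderiv D b (wderiv D b u) x))"
  by (simp del: of_real_power)
 also have "... = - (LINT x|M. cnj (u x) * laplacian D u x)"
  unfolding laplacian_def sum_distrib_left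
  by (subst Bochner_Integration.integral_sum) (auto simp: sum_negf intro!: L2_mult_int L2_cnj uL w2L)
 finally have "cmod (of_real (SUM b:Basis. (L2_nrm M (wderiv D b u))^2)) = cmod (- (LINT x|M. cnj (u x) * laplacian D u x))"
  by (rule arg_cong)
 hence "\<bar>SUM b:Basis. (L2_nrm M (wderiv D b u))^2\<bar> = cmod (LINT x|M. cnj (u x) * laplacian D u x)"
  unfolding norm_of_real norm_minus_cancel .
 also have "... <= L2_nrm M u * L2_nrm M (laplacian D u)"
  using L2_Cauchy_Schwarz[OF L2_cnj[OF uL] laplacian_L2[OF u(1)]] by simp
 finally show ?thesis by (simp add: mult.commute)
qed

end

subsection \<open>Weak sequential compactness in Hilbert spaces\<close>

text \<open>Elements are functions, not classes of functions, so \<open>nrm\<close> need not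
  separate them. A real-valued \<open>ip\<close> already yields the parallelogram law and
  orthogonality, although \<open>S\<close> is closed under complex scalars.\<close>

locale semi_hilbert =
 fixes S :: "('x => complex) set" and ip :: "('x => complex) => ('x => complex) => real" and nrm :: "('x => complex) => real"
 assumes S_add: "u : S ==> v : S ==> (%x. u x + v x) : S"
  and S_scale: "u : S ==> (%x. c * u x) : S"
  and ip_add: "u : S ==> v : S ==> w : S ==> ip (%x. u x + v x) w = ip u w + ip v w"
  and ip_scale: "u : S ==> w : S ==> ip (%x. of_real t * u x) w = t * ip u w"
  and ip_sym: "ip u v = ip v u"
  and ip_nrm: "u : S ==> ip u u = (nrm u)^2" and nrm_nonneg: "nrm u >= 0"
  and Cauchy_Schwarz: "u : S ==> v : S ==> \<bar>ip u v\<bar> <= nrm u * nrm v"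
  and complete: "(!!n::nat. f n : S) ==> (!!e. e > 0 ==> EX N. ALL m>=N. ALL n>=N. nrm (%x. f m x - f n x) < e) ==>
    EX u:S. (%n. nrm (%x. f n x - u x)) ----> 0"
begin

lemma S_diff: "u : S ==> v : S ==> (%x. u x - v x) : S"
 using S_add[OF _ S_scale[of v "-1"], of u] by simp

definition mid :: "('x => complex) => ('x => complex) => 'x => complex" where
 "mid u v = (%x. of_real (1/2) * (u x + v x))"

text \<open>Dyadic convex combinations of the tail from \<open>N\<close> on; midpoints are what the
  parallelogram law works with.\<close>

inductive_set tail_hull :: "(nat => 'x => complex) => nat => ('x => complex) set" for y N where
 base: "m >= N ==> y m : tail_hull y N"
| mid: "u : tail_hull y N ==> v : tail_hull y N ==> mid u v : tail_hull y N"

lemma tail_hull_antimono: "N <= N' ==> tail_hull y N' <= tail_hull y N"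
proof
 fix u assume "N <= N'" "u : tail_hull y N'"
 from this(2,1) show "u : tail_hull y N"
  by (induction rule: tail_hull.induct) (auto intro: tail_hull.intros)
qed

lemma mid_S: "u : S ==> v : S ==> mid u v : S"
 unfolding mid_def by (intro S_scale S_add)

lemma tail_hull_S: "(!!m. y m : S) ==> u : tail_hull y N ==> u : S"
 by (rotate_tac, induction rule: tail_hull.induct) (auto intro: mid_S)

lemma parallelogram:
 assumes "u : S" "v : S"
 shows "(nrm (%x. u x - v x))^2 = 2 * (nrm u)^2 + 2 * (nrm v)^2 - 4 * (nrm (mid u v))^2"
proof -
 have expand: "(nrm (%x. u x + v x))^2 = (nrm u)^2 + 2 * ip u v + (nrm v)^2" if "u : S" "v : S" for u v
 proof -
  have "(nrm (%x. u x + v x))^2 = ip u (%x. u x + v x) + ip v (%x. u x + v x)"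
   using ip_nrm[OF S_add[OF that]] ip_add[OF that S_add[OF that]] by simp
  also have "... = (ip u u + ip v u) + (ip u v + ip v v)"
   using ip_add[OF that that(1)] ip_add[OF that that(2)] ip_sym[of u "%x. u x + v x"] ip_sym[of v "%x. u x + v x"] by simp
  finally show ?thesis using ip_nrm[OF that(1)] ip_nrm[OF that(2)] ip_sym[of u v] by simp
 qed
 have sc: "(nrm (%x. of_real t * w x))^2 = t^2 * (nrm w)^2" if "w : S" for t w
  using ip_nrm[OF S_scale[OF that]] ip_scale[OF that S_scale[OF that], of t "of_real t"]
   ip_scale[OF that that, of t] ip_sym[of w "%x. of_real t * w x"] ip_nrm[OF that] by (simp add: power2_eq_square)
 have m: "(nrm (mid u v))^2 = (1/4) * (nrm (%x. u x + v x))^2"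
  unfolding mid_def sc[OF S_add[OF assms]] by (simp add: power2_eq_square)
 have v': "(%x. of_real (-1) * v x) : S" by (rule S_scale[OF assms(2)])
 have "(nrm (%x. u x - v x))^2 = (nrm u)^2 - 2 * ip u v + (nrm v)^2"
  using expand[OF assms(1) v'] sc[OF assms(2), of "-1"] ip_scale[OF assms(2,1), of "-1"]
  by (simp add: ip_sym[of u "%x. - v x"] ip_sym[of v u])
 thus ?thesis using m expand[OF assms] by simp
qed

lemma nrm_mid_le:
 assumes "u : S" "v : S" "nrm u <= C" "nrm v <= C" shows "nrm (mid u v) <= C"
proof -
 have "(nrm u)^2 <= C^2" "(nrm v)^2 <= C^2" using assms nrm_nonneg by (auto intro: power_mono)
 hence "(nrm (mid u v))^2 <= C^2"
  using parallelogram[OF assms(1,2)] zero_le_power2[of "nrm (%x. u x - v x)"] by linarith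
 moreover have "C >= 0" using assms(3) nrm_nonneg order_trans by blast
 ultimately show ?thesis by (rule power2_le_imp_le)
qed

lemma tail_hull_nrm:
 assumes y: "!!m. y m : S" "!!m. nrm (y m) <= C" and u: "u : tail_hull y N" shows "nrm u <= C"
 using u
proof (induction rule: tail_hull.induct)
 case (mid u v)
 thus ?case using tail_hull_S[OF y(1)] by (intro nrm_mid_le) auto
qed (use y in simp)

text \<open>Elements of nearly minimal norm in the midpoint hulls of the tails converge strongly.\<close>

lemma strong_limit_of_hulls:
 assumes y: "!!m. y m : S" "!!m. nrm (y m) <= C"
 obtains w u where "!!N. w N : tail_hull y N" "u : S" "(%N. nrm (%x. w N x - u x)) ----> 0"
proof -
 define d where "d N = (INF u\<in>tail_hull y N. (nrm u)^2)" for N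
 have ne: "tail_hull y N ~= {}" for N using tail_hull.base[of N N y] by blast
 have bdd: "bdd_below ((%u. (nrm u)^2) ` tail_hull y N)" for N by (rule bdd_belowI2[of _ 0]) simp
 have d_le: "d N <= (nrm u)^2" if "u : tail_hull y N" for u N unfolding d_def by (rule cINF_lower[OF bdd that])
 have mono: "incseq d"
  unfolding d_def by (intro monoI cINF_superset_mono ne bdd tail_hull_antimono) auto
 have dC: "d N <= C^2" for N
 proof -
  have "d N <= (nrm (y N))^2" by (rule d_le[OF tail_hull.base]) simp
  also have "... <= C^2" by (intro power_mono y nrm_nonneg)
  finally show ?thesis .
 qed
 obtain L where L: "d ----> L" by (rule incseq_convergent[OF mono, of "C^2"]) (use dC in blast)+
 have "EX w:tail_hull y N. (nrm w)^2 < d N + inverse (real (Suc N))" for N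
  using cINF_less_iff[OF ne bdd, of N "d N + inverse (real (Suc N))"] by (simp add: d_def)
 then obtain w where w: "!!N. w N : tail_hull y N" "!!N. (nrm (w N))^2 < d N + inverse (real (Suc N))" by metis
 have wS: "w N : S" for N by (rule tail_hull_S[OF y(1) w(1)])
 \<comment> \<open>The midpoint lies in the larger hull with index \<open>N\<close>, so its squared
   norm is at least \<open>d N\<close>; the parallelogram law turns nearly minimal norms into small
   distance.\<close>
 have est: "(nrm (%x. w M x - w N x))^2 <= 2 * (d M - d N) + 4 * inverse (real (Suc N))" if "N <= M" for M N
 proof -
  have "mid (w M) (w N) : tail_hull y N"
   using w(1)[of M] w(1)[of N] tail_hull_antimono[OF that] by (intro tail_hull.mid) auto
  hence "d N <= (nrm (mid (w M) (w N)))^2" by (rule d_le)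
  moreover have "inverse (real (Suc M)) <= inverse (real (Suc N))" using that by simp
  ultimately show ?thesis
   using parallelogram[OF wS[of M] wS[of N]] w(2)[of M] w(2)[of N] by argo
 qed
 have Cauchy: "EX K. ALL m>=K. ALL n>=K. nrm (%x. w m x - w n x) < e" if e: "e > 0" for e
 proof -
  have "(%N. 2 * (L - d N) + 4 * inverse (real (Suc N))) ----> 2 * (L - L) + 4 * 0"
   by (intro tendsto_intros L LIMSEQ_inverse_real_of_nat)
  hence "\<forall>\<^sub>F N in sequentially. 2 * (L - d N) + 4 * inverse (real (Suc N)) < e^2"
   by (rule order_tendstoD) (use e in simp)
  then obtain K where K: "!!N. N >= K ==> 2 * (L - d N) + 4 * inverse (real (Suc N)) < e^2"
   by (auto simp: eventually_sequentially)
  have dL: "d N <= L" for N by (rule incseq_le[OF mono L])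
  have *: "nrm (%x. w m x - w n x) < e" if "n <= m" "n >= K" for m n
  proof -
   have "(nrm (%x. w m x - w n x))^2 < e^2" using est[OF that(1)] K[OF that(2)] dL[of m] by argo
   thus ?thesis by (rule power2_less_imp_less) (use e in simp)
  qed
  have sym: "nrm (%x. w m x - w n x) = nrm (%x. w n x - w m x)" for m n
  proof -
   have "(nrm (%x. w m x - w n x))^2 = (nrm (%x. w n x - w m x))^2"
    unfolding parallelogram[OF wS[of m] wS[of n]] parallelogram[OF wS[of n] wS[of m]]
    by (simp add: mid_def add.commute)
   thus ?thesis using nrm_nonneg by (simp add: power2_eq_iff_nonneg)
  qed
  show ?thesis
  proof (intro exI[of _ K] allI impI)
   fix m n assume "K <= m" "K <= n"
   thus "nrm (%x. w m x - w n x) < e" using *[of n m] *[of m n] sym[of m n] by (cases "n <= m") auto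
  qed
 qed
 from complete[of w, OF wS this] that w(1) show ?thesis by blast
qed

text \<open>Discs are convex: a map compatible with midpoints keeps the whole hull of a late tail in
  the disc in which it keeps the tail.\<close>

lemma hull_limit:
 fixes f :: "('x => complex) => complex"
 assumes y: "!!m. y m : S" and f: "!!u v. u : S ==> v : S ==> f (mid u v) = (f u + f v) / 2"
  and lim: "(%m. f (y m)) ----> c" and w: "!!N. w N : tail_hull y N"
 shows "(%N. f (w N)) ----> c"
proof (rule LIMSEQ_I)
 fix e :: real assume e: "e > 0"
 obtain K where K: "!!m. m >= K ==> norm (f (y m) - c) < e" using LIMSEQ_D[OF lim e] by auto
 have "cmod (f u - c) < e" if "u : tail_hull y K" for u
  using that
 proof (induction rule: tail_hull.induct)
  case (mid u v)
  have "f (mid u v) - c = ((f u - c) + (f v - c)) / 2"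
   using f tail_hull_S[OF y] mid.hyps by (simp add: field_simps)
  hence "cmod (f (mid u v) - c) <= (cmod (f u - c) + cmod (f v - c)) / 2"
   using norm_triangle_ineq[of "f u - c" "f v - c"] by (simp only: norm_divide norm_numeral divide_right_mono)
  thus ?case using mid.IH by argo
 qed (use K in simp)
 thus "EX no. ALL n>=no. norm (f (w n) - c) < e"
  using w tail_hull_antimono by (intro exI[of _ K]) blast
qed

text \<open>A diagonal subsequence makes the inner products with every \<open>x k\<close> converge.
  If \<open>l\<close> failed to converge to \<open>l u\<close>, a further subsequence would have a
  hull limit \<open>u'\<close> with another value of \<open>l\<close>, yet with the same inner
  products with all \<open>x k\<close>. Then \<open>u - u'\<close> is orthogonal to all hulls, hence
  to their limits \<open>u\<close> and \<open>u'\<close> and so to itself; it has norm 0, and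
  \<open>l\<close> cannot tell \<open>u\<close> from \<open>u'\<close>.\<close>

theorem weak_compactness:
 assumes x: "!!m::nat. x m : S" "!!m. nrm (x m) <= C"
 obtains r u where "strict_mono r" "u : S"
  "!!l K. (!!u v. u : S ==> v : S ==> l (%x. u x + v x) = l u + l v) ==>
    (!!u c. u : S ==> l (%x. c * u x) = c * l u) ==>
    (!!u. u : S ==> cmod (l u) <= K * nrm u) ==> (%m. l (x (r m))) ----> l u"
proof -
 define P where "P n s \<longleftrightarrow> convergent (%m. ip (x (s m)) (x n))" for n and s :: "nat => nat"
 have C0: "C >= 0" using x(2)[of 0] nrm_nonneg order_trans by blast
 interpret subseqs P
 proof
  fix n and s :: "nat => nat" assume "strict_mono s"
  have "\<bar>ip (x (s m)) (x n)\<bar> <= C * C" for m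
   using Cauchy_Schwarz[OF x(1) x(1), of "s m" n] mult_mono[OF x(2) x(2) C0 nrm_nonneg, of "s m" n] by linarith
  hence "bounded (range (%m. ip (x (s m)) (x n)))" by (auto simp: bounded_iff)
  from bounded_imp_convergent_subsequence[OF this] obtain L r where "strict_mono r" "((%m. ip (x (s m)) (x n)) \<circ> r) ----> L" by auto
  thus "EX r'. strict_mono r' & P n (s \<circ> r')" by (auto simp: P_def o_def convergent_def)
 qed
 define r where "r = diagseq"
 have r: "strict_mono r" unfolding r_def by (rule subseq_diagseq)
 \<comment> \<open>From index \<open>Suc k\<close> on the diagonal sequence is a subsequence of the
   \<open>k\<close>-th one; the shift is undone below, as it does not affect convergence.\<close>
 have "P k (r \<circ> (+) (Suc k))" for k
  unfolding r_def
 proof (rule diagseq_holds)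
  fix r s :: "nat => nat" and n assume "strict_mono r" "P n s"
  thus "P n (s \<circ> r)" using convergent_subseq_convergent[of "%m. ip (x (s m)) (x n)" r] by (simp add: P_def o_def)
 qed
 hence "convergent (%m. ip (x (r (Suc k + m))) (x k))" for k by (simp add: P_def o_def)
 hence "convergent (%m. ip (x (r (m + Suc k))) (x k))" for k by (subst add.commute)
 hence conv: "convergent (%m. ip (x (r m)) (x k))" for k
  using convergent_ignore_initial_segment[of "%m. ip (x (r m)) (x k)" "Suc k"] by simp
 define c where "c k = lim (%m. ip (x (r m)) (x k))" for k
 have c: "(%m. ip (x (r m)) (x k)) ----> c k" for k using conv by (simp add: c_def convergent_LIMSEQ_iff)
 have ip_mid: "ip (mid u v) z = (ip u z + ip v z) / 2" if "u : S" "v : S" "z : S" for u v z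
  unfolding mid_def using ip_scale[OF S_add[OF that(1,2)] that(3), of "1/2"] ip_add[OF that] by simp
 have ip_diff: "ip (%x. u x - v x) z = ip u z - ip v z" if "u : S" "v : S" "z : S" for u v z
  using ip_add[OF that(1) S_scale[OF that(2), of "-1"] that(3)] ip_scale[OF that(2,3), of "-1"] by simp
 have strong: "(%N. ip (w N) z) ----> ip u z"
  if "!!N. w N : S" "u : S" "(%N. nrm (%x. w N x - u x)) ----> 0" "z : S" for w u z
 proof -
  have "(%N. nrm (%x. w N x - u x) * nrm z) ----> 0" using tendsto_mult_left_zero[OF that(3)] by blast
  hence "(%N. ip (w N) z - ip u z) ----> 0"
   by (rule Lim_null_comparison[rotated])
     (use Cauchy_Schwarz[OF S_diff[OF that(1,2)] that(4)] in "simp add: ip_diff[OF that(1,2,4)]")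
  thus ?thesis by (rule LIM_zero_cancel)
 qed
 have main: "EX w u. (ALL N. w N : tail_hull (x \<circ> r \<circ> s) N) & u : S & (%N. nrm (%x. w N x - u x)) ----> 0 & (ALL k. ip u (x k) = c k)"
  if s: "strict_mono s" for s :: "nat => nat"
 proof -
  obtain w u where w: "!!N. w N : tail_hull (x \<circ> r \<circ> s) N" "u : S" "(%N. nrm (%x. w N x - u x)) ----> 0"
   by (rule strong_limit_of_hulls[of "x \<circ> r \<circ> s" C]) (use x in auto)
  have wS: "w N : S" for N by (rule tail_hull_S[OF _ w(1)]) (simp add: x)
  have "ip u (x k) = c k" for k
  proof -
   have "(%m. ip (x (r (s m))) (x k)) ----> c k" using LIMSEQ_subseq_LIMSEQ[OF c s] by (simp add: o_def)
   hence lim: "(%m. complex_of_real (ip ((x \<circ> r \<circ> s) m) (x k))) ----> of_real (c k)" by (simp add: o_def tendsto_of_real)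
   have "(%N. complex_of_real (ip (w N) (x k))) ----> of_real (c k)"
    by (rule hull_limit[of "x \<circ> r \<circ> s" "%u. complex_of_real (ip u (x k))", OF _ _ lim w(1)]) (simp_all add: x ip_mid)
   hence "(%N. ip (w N) (x k)) ----> c k" by (simp add: tendsto_of_real_iff)
   thus ?thesis by (rule LIMSEQ_unique[OF strong[OF wS w(2,3) x(1)]])
  qed
  thus ?thesis using w by (intro exI[of _ w] exI[of _ u]) simp
 qed
 have strict_id: "strict_mono (%n::nat. n)" by (simp add: strict_mono_def)
 from main[OF strict_id] obtain w u where w: "!!N. w N : tail_hull (x \<circ> r \<circ> (%n. n)) N" and u: "u : S" "(%N. nrm (%x. w N x - u x)) ----> 0" "!!k. ip u (x k) = c k"
  by (elim exE conjE) (rule that, (erule spec | assumption)+)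
 show ?thesis
 proof (rule that[OF r u(1)])
  fix l K
  assume add: "!!u v. u : S ==> v : S ==> l (%x. u x + v x) = l u + l v"
   and scale: "!!u c. u : S ==> l (%x. c * u x) = c * l u"
   and bd: "!!u. u : S ==> cmod (l u) <= K * nrm u"
  have diff: "l (%x. u x - v x) = l u - l v" if "u : S" "v : S" for u v
   using add[OF that(1) S_scale[OF that(2), of "-1"]] scale[OF that(2), of "-1"] by simp
  have lmid: "l (mid u v) = (l u + l v) / 2" if "u : S" "v : S" for u v
   unfolding mid_def using scale[OF S_add[OF that], of "of_real (1/2)"] add[OF that] by simp
  show "(%m. l (x (r m))) ----> l u"
  proof (rule ccontr)
   assume "~ (%m. l (x (r m))) ----> l u"
   then obtain e where e: "e > 0" "!!N. EX m>=N. cmod (l (x (r m)) - l u) >= e"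
    unfolding lim_sequentially dist_norm by (meson not_less)
   define B where "B = {m. cmod (l (x (r m)) - l u) >= e}"
   have "infinite B" using e(2) by (auto simp: B_def infinite_nat_iff_unbounded_le)
   hence s: "strict_mono (enumerate B)" "!!m. enumerate B m : B"
    by (auto intro: strict_mono_enumerate enumerate_in_set)
   define s where "s = enumerate B"
   have "cmod (l (x (r (s m)))) <= \<bar>K\<bar> * C" for m
   proof -
    have "cmod (l (x (r (s m)))) <= K * nrm (x (r (s m)))" by (rule bd[OF x(1)])
    also have "... <= \<bar>K\<bar> * C" by (intro mult_mono x nrm_nonneg) auto
    finally show ?thesis .
   qed
   hence "bounded (range (%m. l (x (r (s m)))))" by (auto simp: bounded_iff)
   from bounded_imp_convergent_subsequence[OF this] obtain c' t
    where t: "strict_mono t" "(%m. l (x (r (s (t m))))) ----> c'" by (auto simp: o_def)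
   have st: "strict_mono (s \<circ> t)" unfolding s_def by (rule strict_mono_o[OF s(1) t(1)])
   from main[OF st] obtain w' u' where w': "!!N. w' N : tail_hull (x \<circ> r \<circ> (s \<circ> t)) N" and u': "u' : S" "(%N. nrm (%x. w' N x - u' x)) ----> 0" "!!k. ip u' (x k) = c k"
    by (elim exE conjE) (rule that, (erule spec | assumption)+)
   have wS: "w N : S" for N by (rule tail_hull_S[OF _ w]) (simp add: x)
   have w'S: "w' N : S" for N by (rule tail_hull_S[OF _ w']) (simp add: x)
   have lw': "(%N. l (w' N)) ----> c'"
    by (rule hull_limit[OF _ _ _ w']) (use t in "simp_all add: x lmid o_def")
   have "(%N. l (w' N) - l u') ----> 0"
   proof (rule Lim_null_comparison[of _ "%N. K * nrm (%x. w' N x - u' x)"])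
    show "\<forall>\<^sub>F N in sequentially. norm (l (w' N) - l u') <= K * nrm (%x. w' N x - u' x)"
     using bd[OF S_diff[OF w'S u'(1)]] by (simp add: diff[OF w'S u'(1)])
    show "(%N. K * nrm (%x. w' N x - u' x)) ----> 0" using tendsto_mult_right_zero[OF u'(2)] by blast
   qed
   hence lu': "l u' = c'" by (rule LIMSEQ_unique[OF LIM_zero_cancel lw'])
   define z where "z x = u x - u' x" for x
   have zS: "z : S" unfolding z_def by (rule S_diff[OF u(1) u'(1)])
   have zx: "ip z (x k) = 0" for k unfolding z_def ip_diff[OF u(1) u'(1) x(1)] u(3) u'(3) by simp
   have zh: "ip v z = 0" if v: "v : tail_hull (x \<circ> q) N" for v q N
    using v
   proof (induction rule: tail_hull.induct)
    case (base m) thus ?case using zx ip_sym by simp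
   next
    case (mid a b)
    have "a : S" "b : S" using tail_hull_S[of "x \<circ> q"] mid.hyps x(1) by auto
    thus ?case using ip_mid[of a b z] zS mid.IH by simp
   qed
   have "ip u z = 0"
    using strong[OF wS u(1,2) zS] zh[OF w[unfolded comp_assoc]] by (simp add: LIMSEQ_const_iff)
   moreover have "ip u' z = 0"
    using strong[OF w'S u'(1,2) zS] zh[OF w'[unfolded comp_assoc]] by (simp add: LIMSEQ_const_iff)
   ultimately have "ip z z = 0" using ip_diff[OF u(1) u'(1) zS] by (simp add: z_def[abs_def])
   hence "nrm z = 0" using ip_nrm[OF zS] by simp
   hence "l u = l u'" using bd[OF zS] diff[OF u(1) u'(1)] by (simp add: z_def[abs_def])
   moreover have "cmod (c' - l u) >= e"
   proof (rule tendsto_lowerbound[of "%m. cmod (l (x (r (s (t m)))) - l u)"])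
    show "(%m. cmod (l (x (r (s (t m)))) - l u)) ----> cmod (c' - l u)" by (intro tendsto_intros t)
    show "\<forall>\<^sub>F m in sequentially. e <= cmod (l (x (r (s (t m)))) - l u)"
     using s(2) by (simp add: s_def B_def)
   qed simp
   ultimately show False using e(1) lu' by simp
  qed
 qed
qed

end

subsection \<open>Borel sets are Hausdorff measurable\<close>

lemma hausdorff_outer_mono: "s > 0 ==> A <= B ==> hausdorff_outer s A <= hausdorff_outer s B"
 using outer_measure_space_hausdorff_outer[of s, where 'a='a] unfolding outer_measure_space_def increasing_def by blast

lemma hausdorff_outer_empty: "s > 0 ==> hausdorff_outer s {} = 0"
 using outer_measure_space_hausdorff_outer[of s, where 'a='a] unfolding outer_measure_space_def positive_def by blast

lemma hausdorff_outer_UN: "s > 0 ==> hausdorff_outer s (UN i. A i :: 'a::metric_space set) <= (\<Sum>i. hausdorff_outer s (A i))"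
proof -
 assume s: "s > 0"
 \<comment> \<open>\<open>countably_subadditive\<close> speaks of disjoint families, hence the
   detour over \<open>disjointed\<close>.\<close>
 have "hausdorff_outer s (UN i. disjointed A i) <= (\<Sum>i. hausdorff_outer s (disjointed A i))"
  using outer_measure_space_hausdorff_outer[OF s, where 'a='a] disjoint_family_disjointed[of A]
  unfolding outer_measure_space_def countably_subadditive_def by blast
 also have "... <= (\<Sum>i. hausdorff_outer s (A i))"
  by (intro suminf_le summableI hausdorff_outer_mono[OF s] disjointed_subset)
 finally show "hausdorff_outer s (UN i. A i) <= (\<Sum>i. hausdorff_outer s (A i))" by (simp add: UN_disjointed_eq)
qed

lemma hausdorff_outer_Un:
 assumes s: "s > 0"
 shows "hausdorff_outer s (A \<union> B :: 'a::metric_space set) <= hausdorff_outer s A + hausdorff_outer s B"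
proof -
 have "hausdorff_outer s (UN i. binaryset A B i) <= (\<Sum>i. hausdorff_outer s (binaryset A B i))"
  by (rule hausdorff_outer_UN[OF s])
 also have "... = hausdorff_outer s A + hausdorff_outer s B"
  by (rule suminf_binaryset_eq) (rule hausdorff_outer_empty[OF s])
 finally show ?thesis by (simp add: UN_binaryset_eq)
qed

lemma hausdorff_premeasure_antimono: "del <= del' ==> hausdorff_premeasure s del' A <= hausdorff_premeasure s del A"
 unfolding hausdorff_premeasure_def by (intro INF_superset_mono) (blast intro: order_trans, simp)

lemma hausdorff_premeasure_le_outer: "del > 0 ==> hausdorff_premeasure s del A <= hausdorff_outer s A"
 unfolding hausdorff_outer_def by (rule SUP_upper) simp

text \<open>A covering set of diameter at most \<open>del\<close> cannot meet both \<open>A\<close>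
  and \<open>B\<close>, so a cover of the union splits into covers of the two. Sets that miss a part
  are replaced by the empty set, which costs nothing because \<open>s > 0\<close>.\<close>

lemma hausdorff_premeasure_separated:
 fixes A B :: "'a::metric_space set"
 assumes s: "s > 0" and sep: "!!x y. x : A ==> y : B ==> del < dist x y"
 shows "hausdorff_premeasure s del A + hausdorff_premeasure s del B <= hausdorff_premeasure s del (A \<union> B)"
proof -
 define f where "f = (%U::'a set. ennreal (unit_ball_vol (real s) * (diameter U / 2) ^ s))"
 define Cov where "Cov = (%(A::'a set). {U :: nat => 'a set. A <= (UN i. U i) & (ALL i. bounded (U i) & diameter (U i) <= del)})"
 have pre: "hausdorff_premeasure s del A = (INF U\<in>Cov A. \<Sum>i. f (U i))" for A
  by (simp add: hausdorff_premeasure_def f_def Cov_def)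
 have f0: "f {} = 0" using s by (simp add: f_def power_0_left)
 have "hausdorff_premeasure s del A + hausdorff_premeasure s del B <= (\<Sum>i. f (U i))" if U: "U : Cov (A \<union> B)" for U
 proof -
  have Ui: "bounded (U i)" "diameter (U i) <= del" for i using U by (auto simp: Cov_def)
  have d0: "del >= 0" using Ui[of 0] diameter_ge_0 order_trans by blast
  define V where "V C i = (if U i \<inter> C = {} then {} else U i)" for C i
  have V: "V C : Cov C" if "C <= A \<union> B" for C
  proof -
   have "x : (UN i. V C i)" if "x : C" for x
   proof -
    have "x : (UN i. U i)" using U \<open>x : C\<close> \<open>C <= A \<union> B\<close> unfolding Cov_def by blast
    then obtain i where "x : U i" by blast
    hence "x : V C i" using \<open>x : C\<close> by (auto simp: V_def)
    thus ?thesis by blast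
   qed
   thus ?thesis using Ui d0 by (auto simp: Cov_def V_def)
  qed
  have "hausdorff_premeasure s del A + hausdorff_premeasure s del B <= (\<Sum>i. f (V A i)) + (\<Sum>i. f (V B i))"
   unfolding pre by (intro add_mono INF_lower V) auto
  also have "... = (\<Sum>i. f (V A i) + f (V B i))" by (intro suminf_add summableI)
  also have "... <= (\<Sum>i. f (U i))"
  proof (intro suminf_le summableI)
   fix i
   have "U i \<inter> A = {} \<or> U i \<inter> B = {}"
   proof (rule ccontr)
    assume "~ ?thesis"
    then obtain x y where xy: "x : U i" "x : A" "y : U i" "y : B" by blast
    thus False using diameter_bounded_bound[OF Ui(1) xy(1,3)] sep[OF xy(2,4)] Ui(2)[of i] by linarith
   qed
   thus "f (V A i) + f (V B i) <= f (U i)" by (auto simp: V_def f0)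
  qed
  finally show ?thesis .
 qed
 thus ?thesis unfolding pre[of "A \<union> B"] by (intro INF_greatest)
qed

lemma hausdorff_outer_separated:
 fixes A B :: "'a::metric_space set"
 assumes s: "s > 0" and e: "e > 0" and sep: "!!x y. x : A ==> y : B ==> e <= dist x y"
 shows "hausdorff_outer s A + hausdorff_outer s B <= hausdorff_outer s (A \<union> B)"
proof -
 have le: "hausdorff_premeasure s d A + hausdorff_premeasure s d' B <= hausdorff_outer s (A \<union> B)" if d: "d > 0" "d' > 0" for d d'
 proof -
  define c where "c = min (min d d') (e / 2)"
  have c: "c > 0" "c <= d" "c <= d'" "c < e" using d e by (auto simp: c_def)
  have "hausdorff_premeasure s d A + hausdorff_premeasure s d' B <= hausdorff_premeasure s c A + hausdorff_premeasure s c B"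
   using c by (intro add_mono hausdorff_premeasure_antimono)
  also have "... <= hausdorff_premeasure s c (A \<union> B)"
   using sep c by (intro hausdorff_premeasure_separated s) (auto intro: less_le_trans)
  also have "... <= hausdorff_outer s (A \<union> B)" by (rule hausdorff_premeasure_le_outer[OF c(1)])
  finally show ?thesis .
 qed
 have ne: "{0::real<..} ~= {}" using gt_ex by auto
 have "hausdorff_outer s A + hausdorff_premeasure s d' B <= hausdorff_outer s (A \<union> B)" if "d' > 0" for d'
  unfolding hausdorff_outer_def[of s A] ennreal_SUP_add_left[OF ne, symmetric]
  using le that by (intro SUP_least) auto
 thus ?thesis
  unfolding hausdorff_outer_def[of s B] add.commute[of "hausdorff_outer s A"] ennreal_SUP_add_left[OF ne, symmetric]
  by (intro SUP_least) auto
qed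

lemma suminf_even_odd_bound:
 fixes f :: "nat => ennreal"
 assumes "!!N. (SUM k<N. f (2 * k)) <= c" "!!N. (SUM k<N. f (2 * k + 1)) <= c"
 shows "(\<Sum>k. f k) <= 2 * c"
proof (subst suminf_eq_SUP, rule SUP_least)
 fix N
 have "(SUM k<N. f k) <= (SUM k<2*N. f k)" by (rule sum_mono2) auto
 also have "... = (SUM k<N. f (2 * k)) + (SUM k<N. f (2 * k + 1))"
  by (induction N) (auto simp: algebra_simps)
 also have "... <= 2 * c" using add_mono[OF assms] by (simp add: mult_2)
 finally show "(SUM k<N. f k) <= 2 * c" .
qed

text \<open>Caratheodory's criterion: \<open>A - F\<close> is exhausted by sets at positive distance from \<open>F\<close>, the error
 being a tail of a convergent series over shells, of which those of equal parity are separated.\<close>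

lemma closed_lambda_system:
 fixes F :: "'a::metric_space set"
 assumes s: "s > 0" and F: "closed F"
 shows "F : lambda_system UNIV UNIV (hausdorff_outer s)"
proof (cases "F = {}")
 case True
 thus ?thesis using hausdorff_outer_empty[OF s, where 'a='a] by (auto simp: lambda_system_def)
next
 case F0: False
 let ?H = "hausdorff_outer s"
 have "?H (F \<inter> A) + ?H (A - F) <= ?H A" for A
 proof (cases "?H A = top")
  case fin: False
  define g where "g x = infdist x F" for x
  have glip: "g x <= g y + dist x y" for x y unfolding g_def by (rule infdist_triangle)
  define q where "q k = 1 / real (Suc k)" for k
  have q: "q k > 0" "q (Suc k) < q k" for k by (auto simp: q_def field_simps)
  have qm: "q l <= q k" if "k <= l" for k l using that by (auto simp: q_def field_simps)
  define R where "R k = {x:A. q (Suc k) <= g x & g x < q k}" for k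
  define An where "An n = {x:A. q n <= g x}" for n
  have Rfin: "?H (R k) <= ?H A" for k by (rule hausdorff_outer_mono[OF s]) (auto simp: R_def)
  let ?R = "%N p. \<Union>k<N. R (2 * k + p)"
  have shells: "(SUM k<N. ?H (R (2 * k + p))) <= ?H (?R N p)" for N p
  proof (induction N)
   case (Suc N)
   have "?H (?R N p) + ?H (R (2 * N + p)) <= ?H (?R N p \<union> R (2 * N + p))"
   proof (cases N)
    case (Suc N')
    show ?thesis
    proof (rule hausdorff_outer_separated[OF s])
     show "q (2 * N + p - 1) - q (2 * N + p) > 0" using q(2)[of "2 * N + p - 1"] Suc by simp
     fix x y assume x: "x : ?R N p" and y: "y : R (2 * N + p)"
     then obtain k where k: "k < N" "x : R (2 * k + p)" by auto
     have "q (2 * N + p - 1) <= q (Suc (2 * k + p))" using k by (intro qm) auto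
     also have "... <= g x" using k by (auto simp: R_def)
     finally show "q (2 * N + p - 1) - q (2 * N + p) <= dist x y" using y glip[of x y] by (auto simp: R_def)
    qed
   qed (simp add: hausdorff_outer_empty[OF s])
   hence "(SUM k<N. ?H (R (2 * k + p))) + ?H (R (2 * N + p)) <= ?H (?R N p \<union> R (2 * N + p))"
    by (rule order_trans[OF add_right_mono[OF Suc.IH]])
   moreover have "(\<Union>k<Suc N. R (2 * k + p)) = ?R N p \<union> R (2 * N + p)" by (auto simp: less_Suc_eq)
   ultimately show ?case by (simp only: sum.lessThan_Suc)
  qed simp
  have "(SUM k<N. ?H (R (2 * k + p))) <= ?H A" for N p
   by (rule order_trans[OF shells hausdorff_outer_mono[OF s]]) (auto simp: R_def)
  note b = this
  have "(\<Sum>k. ?H (R k)) <= 2 * ?H A"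
  proof (rule suminf_even_odd_bound)
   fix N
   show "(SUM k<N. ?H (R (2 * k))) <= ?H A" using b[of 0 N] by (simp only: add_0_right)
   show "(SUM k<N. ?H (R (2 * k + 1))) <= ?H A" by (rule b)
  qed
  also have "... < top" using fin by (simp add: ennreal_mult_less_top less_top)
  finally have sfin: "(\<Sum>k. ?H (R k)) ~= top" by simp
  define a where "a k = enn2real (?H (R k))" for k
  have a: "?H (R k) = ennreal (a k)" for k
   using Rfin[of k] fin by (auto simp: a_def less_top order.strict_trans1)
  have a0: "a k >= 0" for k by (simp add: a_def)
  have sa: "summable a" using sfin unfolding a by (rule summable_suminf_not_top[OF a0])
  have "(%n. ?H A + ennreal (\<Sum>k. a (k + n))) ----> ?H A + ennreal 0"
   by (intro tendsto_add tendsto_const tendsto_ennrealI suminf_exist_split2[OF sa])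
  moreover have "?H (F \<inter> A) + ?H (A - F) <= ?H A + ennreal (\<Sum>k. a (k + n))" for n
  proof -
   have "A - F <= An n \<union> (UN k. R (k + n))"
   proof
    fix x assume x: "x : A - F"
    hence gx: "g x > 0" using F F0 in_closed_iff_infdist_zero[of F x] infdist_nonneg[of x F] by (auto simp: g_def less_le)
    show "x : An n \<union> (UN k. R (k + n))"
    proof (cases "q n <= g x")
     case False
     obtain m where m: "q m < g x" using gx reals_Archimedean[of "g x"] by (auto simp: q_def inverse_eq_divide)
     define j where "j = (LEAST j. q j <= g x)"
     have j: "q j <= g x" unfolding j_def by (rule LeastI[of _ m]) (use m in simp)
     have "j > n" using j False qm[of j n] by (cases "j > n") auto
     moreover have "~ q (j - 1) <= g x" using not_less_Least[of "j - 1" "%j. q j <= g x"] \<open>j > n\<close> by (auto simp: j_def)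
     ultimately have "x : R ((j - 1 - n) + n)" using x j by (auto simp: R_def)
     thus ?thesis by blast
    qed (use x in "auto simp: An_def")
   qed
   hence "?H (A - F) <= ?H (An n \<union> (UN k. R (k + n)))" by (rule hausdorff_outer_mono[OF s])
   also have "... <= ?H (An n) + (\<Sum>k. ?H (R (k + n)))"
    by (rule order_trans[OF hausdorff_outer_Un[OF s] add_left_mono[OF hausdorff_outer_UN[OF s]]])
   also have "(\<Sum>k. ?H (R (k + n))) = ennreal (\<Sum>k. a (k + n))"
    unfolding a using sa by (intro suminf_ennreal2 a0) (simp add: summable_iff_shift)
   finally have 1: "?H (A - F) <= ?H (An n) + ennreal (\<Sum>k. a (k + n))" .
   have "?H (F \<inter> A) + ?H (An n) <= ?H ((F \<inter> A) \<union> An n)"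
   proof (rule hausdorff_outer_separated[OF s q(1)[of n]])
    fix x y assume "x : F \<inter> A" "y : An n"
    thus "q n <= dist x y" using infdist_le[of x F y] by (auto simp: An_def g_def dist_commute)
   qed
   also have "... <= ?H A" by (rule hausdorff_outer_mono[OF s]) (auto simp: An_def)
   finally have 2: "?H (F \<inter> A) + ?H (An n) <= ?H A" .
   have "?H (F \<inter> A) + ?H (A - F) <= ?H (F \<inter> A) + (?H (An n) + ennreal (\<Sum>k. a (k + n)))" by (rule add_left_mono[OF 1])
   also have "... <= ?H A + ennreal (\<Sum>k. a (k + n))" unfolding add.assoc[symmetric] by (rule add_right_mono[OF 2])
   finally show ?thesis .
  qed
  ultimately have "?H (F \<inter> A) + ?H (A - F) <= ?H A + ennreal 0" by (intro LIMSEQ_le_const) auto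
  thus ?thesis by simp
 qed simp
 moreover have "?H A <= ?H (F \<inter> A) + ?H (A - F)" for A
  using hausdorff_outer_Un[OF s, of "F \<inter> A" "A - F"] by (simp add: Un_commute Int_commute Diff_Int_distrib2 Un_Diff_Int)
 moreover have "(UNIV - F) \<inter> A = A - F" for A by auto
 ultimately show ?thesis by (auto simp: lambda_system_def intro: antisym)
qed

lemma space_hausdorff_measure [simp]: "space (hausdorff_measure s) = UNIV"
 by (simp add: hausdorff_measure_def space_measure_of_conv)

lemma borel_hausdorff_measure:
 assumes s: "s > 0"
 shows "sets (borel :: 'a::metric_space measure) <= sets (hausdorff_measure s)"
proof -
 have "sigma_sets UNIV (Collect closed) <= sets (hausdorff_measure s :: 'a measure)"
  using sets.sigma_sets_subset[of "Collect closed" "hausdorff_measure s :: 'a measure"] closed_lambda_system[OF s]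
  by (auto simp: sets_hausdorff_measure[OF s])
 thus ?thesis unfolding borel_eq_closed by simp
qed

subsection \<open>Comparing integrals by level sets\<close>

text \<open>Layer cake in discrete form: rounding down to multiples of \<open>1 / Suc n\<close>
  gives a sum of indicators of superlevel sets, for which the comparison is assumed; refining the
  grid and Fatou's lemma give the integrals. Integrals over the surface are thereby reduced to sets,
  where covering arguments apply.\<close>

lemma nn_integral_le_level_sets:
 fixes f :: "'a => real" and g :: "'b => real"
 assumes f: "f : borel_measurable M" "!!x. f x >= 0" and g: "g : borel_measurable N" "!!x. g x >= 0"
  and le: "!!t. t > 0 ==> a * emeasure M {x:space M. t <= f x} <= c * emeasure N {x:space N. t <= g x}"
 shows "a * nn_integral M f <= c * nn_integral N g"
proof -
 define fl :: "nat => real => real" where "fl n y = real_of_int \<lfloor>y * real (Suc n)\<rfloor> / real (Suc n)" for n y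
 have fl_le: "fl n y <= y" for n y by (simp add: fl_def pos_divide_le_eq)
 have fl_ge: "y - 1 / real (Suc n) <= fl n y" for n y
 proof -
  have "y * real (Suc n) - 1 <= real_of_int \<lfloor>y * real (Suc n)\<rfloor>" by linarith
  hence "(y * real (Suc n) - 1) / real (Suc n) <= fl n y" unfolding fl_def by (intro divide_right_mono) auto
  thus ?thesis by (simp add: diff_divide_distrib)
 qed
 have fl_lim: "(%n. fl n y) ----> y" for y
 proof (rule tendsto_sandwich[of "%n. y - 1 / real (Suc n)"])
  have "(%n. y - 1 / real (Suc n)) ----> y - 0"
   using LIMSEQ_inverse_real_of_nat by (intro tendsto_diff tendsto_const) (simp add: inverse_eq_divide)
  thus "(%n. y - 1 / real (Suc n)) ----> y" by simp
 qed (auto simp: fl_le fl_ge[simplified])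
 have fl_sum: "ennreal (fl n y) = (\<Sum>j. ennreal (1 / real (Suc n)) * indicator {y. real (Suc j) / real (Suc n) <= y} y)" if y: "y >= 0" for n y
 proof -
  define m where "m = nat \<lfloor>y * real (Suc n)\<rfloor>"
  have fm: "\<lfloor>y * real (Suc n)\<rfloor> = int m" using y by (simp add: m_def)
  have iff: "real (Suc j) / real (Suc n) <= y \<longleftrightarrow> j < m" for j
  proof -
   have "real (Suc j) / real (Suc n) <= y \<longleftrightarrow> real_of_int (int (Suc j)) <= y * real (Suc n)"
    unfolding of_int_of_nat_eq by (rule pos_divide_le_eq) simp
   also have "... \<longleftrightarrow> int (Suc j) <= int m" unfolding fm[symmetric] by (rule le_floor_iff[symmetric])
   finally show ?thesis by auto
  qed
  have "(\<Sum>j. ennreal (1 / real (Suc n)) * indicator {y. real (Suc j) / real (Suc n) <= y} y)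
    = (SUM j<m. ennreal (1 / real (Suc n)))"
   unfolding indicator_def mem_Collect_eq iff by (subst suminf_finite[of "{..<m}"]) auto
  also have "... = ennreal (real m * (1 / real (Suc n)))" by (subst sum_ennreal) auto
  also have "real m * (1 / real (Suc n)) = fl n y" by (simp only: fl_def fm of_int_of_nat_eq mult_1_right times_divide_eq_right)
  finally show ?thesis by simp
 qed
 have flm: "fl n : borel_measurable borel" for n unfolding fl_def by measurable
 have int: "nn_integral K (%x. fl n (k x)) = (\<Sum>j. ennreal (1 / real (Suc n)) * emeasure K {x:space K. real (Suc j) / real (Suc n) <= k x})"
  if k: "k : borel_measurable K" "!!x. k x >= 0" for n and k :: "'c => real" and K
 proof -
  have m: "{x:space K. t <= k x} : sets K" for t using k(1) by measurable
  have "nn_integral K (%x. fl n (k x)) = nn_integral K (%x. (\<Sum>j. ennreal (1 / real (Suc n)) * indicator {x:space K. real (Suc j) / real (Suc n) <= k x} x))"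
   by (intro nn_integral_cong) (simp add: fl_sum[OF k(2)] indicator_def)
  also have "... = (\<Sum>j. \<integral>\<^sup>+x. ennreal (1 / real (Suc n)) * indicator {x:space K. real (Suc j) / real (Suc n) <= k x} x \<partial>K)"
   using m by (intro nn_integral_suminf) auto
  finally show ?thesis using m by (simp add: nn_integral_cmult_indicator)
 qed
 have step: "a * nn_integral M (%x. fl n (f x)) <= c * nn_integral N g" for n
 proof -
  have "a * nn_integral M (%x. fl n (f x)) <= c * nn_integral N (%x. fl n (g x))"
   unfolding int[OF f] int[OF g] ennreal_suminf_cmult[symmetric]
  proof (intro suminf_le summableI)
   fix j
   show "a * (ennreal (1 / real (Suc n)) * emeasure M {x : space M. real (Suc j) / real (Suc n) <= f x})
    <= c * (ennreal (1 / real (Suc n)) * emeasure N {x : space N. real (Suc j) / real (Suc n) <= g x})"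
    using mult_left_mono[OF le[of "real (Suc j) / real (Suc n)"], of "ennreal (1 / real (Suc n))"] by (simp add: mult_ac)
  qed
  also have "... <= c * nn_integral N g" by (intro mult_left_mono nn_integral_mono ennreal_leI fl_le) simp
  finally show ?thesis .
 qed
 have "a * nn_integral M f = a * nn_integral M (%x. liminf (%n. ennreal (fl n (f x))))"
  using lim_imp_Liminf[OF trivial_limit_sequentially tendsto_ennrealI[OF fl_lim]] by simp
 also have "... <= a * liminf (%n. \<integral>\<^sup>+x. fl n (f x) \<partial>M)"
  using flm f(1) by (intro mult_left_mono nn_integral_liminf) auto
 also have "... <= c * nn_integral N g"
 proof -
  have "a * (INF m\<in>{n..}. \<integral>\<^sup>+x. fl m (f x) \<partial>M) <= c * nn_integral N g" for n
  proof -
   have "(INF m\<in>{n..}. \<integral>\<^sup>+x. fl m (f x) \<partial>M) <= nn_integral M (%x. fl n (f x))" by (rule INF_lower) simp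
   thus ?thesis by (rule order_trans[OF mult_left_mono step[of n]]) simp
  qed
  thus ?thesis unfolding liminf_SUP_INF SUP_mult_left_ennreal by (intro SUP_least) auto
 qed
 finally show ?thesis .
qed

subsection \<open>Surface measure of pieces of a graph\<close>

lemma le_mult_INF_ennreal:
 fixes x :: ennreal
 assumes k: "k > 0" and le: "!!U. U : S ==> x <= ennreal k * g U"
 shows "x <= ennreal k * (INF U\<in>S. g U)"
proof -
 have k1: "ennreal (1 / k) * ennreal k = 1" "ennreal k * ennreal (1 / k) = 1"
  using k by (simp_all flip: ennreal_mult)
 have "ennreal (1 / k) * x <= (INF U\<in>S. g U)"
 proof (rule INF_greatest)
  fix U assume "U : S"
  hence "ennreal (1 / k) * x <= ennreal (1 / k) * (ennreal k * g U)" by (intro mult_left_mono le) auto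
  also have "... = g U" unfolding mult.assoc[symmetric] k1 by simp
  finally show "ennreal (1 / k) * x <= g U" .
 qed
 hence "ennreal k * (ennreal (1 / k) * x) <= ennreal k * (INF U\<in>S. g U)" by (rule mult_left_mono) simp
 thus ?thesis unfolding mult.assoc[symmetric] k1 by simp
qed

locale surface_patch = graph_patch +
 assumes dim: "DIM('a) >= 2"
begin

abbreviation hm :: "'a set => ennreal" where "hm \<equiv> hausdorff_outer (DIM('a) - 1)"

lemma dim_pos: "DIM('a) - 1 > 0" using dim by simp

lemma power_dim: "(t::real) ^ DIM('a) = t * t ^ (DIM('a) - 1)"
 using dim by (metis One_nat_def Suc_diff_1 dim_pos not_one_le_zero power_Suc zero_less_diff less_trans zero_less_one DIM_positive)

text \<open>Projection onto the graph along \<open>e\<close> and not orthogonally, so that a point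
  below the graph is described by its depth \<open>- h y\<close> and its foot.\<close>

definition foot where "foot y = y - h y *\<^sub>R e"

definition Z where "Z = {y. h y = 0}"

definition strip where "strip a b A = {y. a < - h y & - h y < b & foot y : A}"

lemma h_foot: "h (foot y) = 0"
 using h_translate[of y "- h y"] by (simp add: foot_def)

lemma foot_Z: "foot y : Z" by (simp add: Z_def h_foot)

lemma dist_foot: "dist y (foot y) = \<bar>h y\<bar>"
 by (simp add: foot_def dist_norm norm_e)

lemma continuous_h: "continuous_on UNIV h" by (rule Ck1_continuous[OF Ck1_h])

lemma continuous_foot: "continuous_on UNIV foot"
 unfolding foot_def[abs_def] by (intro continuous_intros continuous_h)

lemma closed_Z: "closed Z"
 unfolding Z_def by (intro closed_Collect_eq continuous_h continuous_on_const)

lemma strip_borel: "closed A ==> strip a b A : sets borel"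
proof -
 assume A: "closed A"
 have "strip a b A = {y. a < - h y} \<inter> {y. - h y < b} \<inter> foot -` A" by (auto simp: strip_def)
 moreover have "closed (foot -` A)" by (rule closed_vimage[OF A continuous_foot])
 moreover have "open {y. a < - h y}" "open {y. - h y < b}"
  by (intro open_Collect_less continuous_h continuous_on_minus continuous_on_const)+
 ultimately show ?thesis by simp
qed

lemma strip_lborel: "closed A ==> strip a b A : sets lborel" by (simp add: strip_borel)

lemma strip_mono: "A <= B ==> strip a b A <= strip a b B" by (auto simp: strip_def)

text \<open>The strip is covered by a stack of balls of radius \<open>2 * d\<close>, centred at
  spacing \<open>d\<close> along \<open>- e\<close> below one point of \<open>B\<close>: one
  \<open>d\<close> for the distance of the foot, one for rounding the depth. The stack has at most
  \<open>(b - a) / d + 1\<close> balls.\<close>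

lemma strip_thin:
 assumes d: "d > 0" and ab: "a < b" and B: "!!x y. x : B ==> y : B ==> dist x y <= d"
 shows "emeasure lborel (strip a b B) <= ennreal (unit_ball_vol (real DIM('a)) * 2 ^ DIM('a) * d ^ (DIM('a) - 1) * (b - a + d))"
proof (cases "B = {}")
 case False
 then obtain p where p: "p : B" by blast
 define N where "N = nat \<lfloor>(b - a) / d\<rfloor> + 1"
 have q0: "(b - a) / d >= 0" using d ab by simp
 have N: "real N <= (b - a) / d + 1" using q0 by (simp add: N_def)
 define c where "c j = p - (a + real j * d) *\<^sub>R e" for j :: nat
 have sub: "strip a b B <= (\<Union>j<N. cball (c j) (2 * d))"
 proof
  fix y assume y: "y : strip a b B"
  define j where "j = nat \<lfloor>(- h y - a) / d\<rfloor>"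
  have t0: "(- h y - a) / d >= 0" using y d by (auto simp: strip_def)
  have "(- h y - a) / d <= (b - a) / d" using y d by (intro divide_right_mono) (auto simp: strip_def)
  hence "\<lfloor>(- h y - a) / d\<rfloor> <= \<lfloor>(b - a) / d\<rfloor>" by (rule floor_mono)
  hence jN: "j < N" by (simp add: N_def j_def)
  have j1: "real j <= (- h y - a) / d" "(- h y - a) / d < real j + 1" using t0 by (simp_all add: j_def)
  hence j2: "real j * d <= - h y - a" "- h y - a < real j * d + d"
   using d by (simp_all add: pos_le_divide_eq pos_divide_less_eq distrib_right)
  have "y - c j = (foot y - p) + (h y + (a + real j * d)) *\<^sub>R e" by (simp add: foot_def c_def algebra_simps)
  hence "norm (y - c j) <= norm (foot y - p) + \<bar>h y + (a + real j * d)\<bar>"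
   using norm_triangle_ineq[of "foot y - p" "(h y + (a + real j * d)) *\<^sub>R e"] norm_e by simp
  also have "... <= d + d" using B[of "foot y" p] y p j2 by (intro add_mono) (auto simp: strip_def dist_norm)
  finally have "y : cball (c j) (2 * d)" by (simp add: dist_norm norm_minus_commute)
  thus "y : (\<Union>j<N. cball (c j) (2 * d))" using jN by blast
 qed
 let ?V = "unit_ball_vol (real DIM('a))"
 have V: "?V >= 0" by simp
 have "emeasure lborel (strip a b B) <= emeasure lborel (\<Union>j<N. cball (c j) (2 * d))"
  by (rule emeasure_mono[OF sub]) auto
 also have "... <= (SUM j<N. emeasure lborel (cball (c j) (2 * d)))" by (rule emeasure_subadditive_finite) auto
 also have "... = ennreal (real N * (?V * (2 * d) ^ DIM('a)))"
  using d by (simp add: emeasure_cball ennreal_mult ennreal_of_nat_eq_real_of_nat)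
 also have "... <= ennreal (?V * 2 ^ DIM('a) * d ^ (DIM('a) - 1) * (b - a + d))"
 proof (rule ennreal_leI)
  have "real N * d <= b - a + d" using mult_right_mono[OF N, of d] d by (simp add: distrib_right)
  hence "(?V * 2 ^ DIM('a) * d ^ (DIM('a) - 1)) * (real N * d) <= (?V * 2 ^ DIM('a) * d ^ (DIM('a) - 1)) * (b - a + d)"
   using d V by (intro mult_left_mono) auto
  thus "real N * (?V * (2 * d) ^ DIM('a)) <= ?V * 2 ^ DIM('a) * d ^ (DIM('a) - 1) * (b - a + d)"
   by (simp add: power_mult_distrib power_dim[of d] mult_ac)
 qed
 finally show ?thesis .
qed (simp add: strip_def)

lemma strip_finite:
 assumes "bounded B" "a < b" shows "emeasure lborel (strip a b B) < \<infinity>"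
proof -
 obtain d where d: "d > 0" "!!x y. x : B ==> y : B ==> dist x y <= d"
 proof (rule that[of "diameter B + 1"])
  show "diameter B + 1 > 0" using diameter_ge_0[OF assms(1)] by simp
  show "dist x y <= diameter B + 1" if "x : B" "y : B" for x y using diameter_bounded_bound[OF assms(1) that] by simp
 qed
 from strip_thin[OF d(1) assms(2), of B] d(2) show ?thesis by (auto simp: order.strict_trans1)
qed

text \<open>The first two factors come from \<open>strip_thin\<close>; the next 2 bounds
  \<open>b - a + d\<close> by \<open>2 * (b - a)\<close> when \<open>d <= b - a\<close>; the rest
  converts a power of the diameter into the weight of the Hausdorff premeasure.\<close>

definition lower_const where
 "lower_const = unit_ball_vol (real DIM('a)) * 2 ^ DIM('a) * 2 * 2 ^ (DIM('a) - 1) / unit_ball_vol (real (DIM('a) - 1))"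

lemma lower_const_pos: "lower_const > 0" by (simp add: lower_const_def)

text \<open>The strip over a covering set of diameter at most \<open>b - a\<close> has volume at
  most a constant times \<open>b - a\<close> times the weight of that set, and these bounds add up.
  Covering sets are replaced by their closures, of equal diameter, to keep the strips Borel.\<close>

lemma strip_le_hausdorff:
 assumes A: "closed A" and ab: "a < b"
 shows "emeasure lborel (strip a b A) <= ennreal (lower_const * (b - a)) * hm A"
proof -
 let ?s = "DIM('a) - 1"
 define f where "f U = ennreal (unit_ball_vol (real ?s) * (diameter U / 2) ^ ?s)" for U :: "'a set"
 define Cov where "Cov = {U :: nat => 'a set. A <= (UN i. U i) & (ALL i. bounded (U i) & diameter (U i) <= b - a)}"
 have small: "emeasure lborel (strip a b (A \<inter> closure U)) <= ennreal (lower_const * (b - a)) * f U"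
  if U: "bounded U" "diameter U <= b - a" for U
 proof -
  define c where "c = unit_ball_vol (real DIM('a)) * 2 ^ DIM('a)"
  define t where "t = diameter U"
  have t: "t >= 0" unfolding t_def by (rule diameter_ge_0[OF U(1)])
  have c: "c > 0" by (simp add: c_def)
  \<comment> \<open>The diameter may be 0, while \<open>strip_thin\<close> asks for a positive
    bound; the bound is approached from above.\<close>
  define d where "d k = t + 1 / real (Suc k)" for k
  have dl: "d ----> t"
  proof -
   have "(%k. t + 1 / real (Suc k)) ----> t + 0"
    using LIMSEQ_inverse_real_of_nat by (intro tendsto_add tendsto_const) (simp add: inverse_eq_divide)
   thus ?thesis by (simp add: d_def[abs_def])
  qed
  have "emeasure lborel (strip a b (A \<inter> closure U)) <= ennreal (c * d k ^ ?s * (b - a + d k))" for k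
   unfolding c_def
  proof (rule strip_thin[OF _ ab])
   show "d k > 0" using t by (simp add: d_def add_nonneg_pos)
   fix x y assume "x : A \<inter> closure U" "y : A \<inter> closure U"
   hence "dist x y <= diameter (closure U)" using U(1) by (intro diameter_bounded_bound) auto
   also have "... <= d k" using U(1) by (simp add: diameter_closure d_def t_def)
   finally show "dist x y <= d k" .
  qed
  moreover have "(%k. ennreal (c * d k ^ ?s * (b - a + d k))) ----> ennreal (c * t ^ ?s * (b - a + t))"
   by (intro tendsto_ennrealI tendsto_intros dl)
  ultimately have "emeasure lborel (strip a b (A \<inter> closure U)) <= ennreal (c * t ^ ?s * (b - a + t))"
   by (intro LIMSEQ_le_const) auto
  also have "... <= ennreal (c * t ^ ?s * (2 * (b - a)))"
   using c t U(2) by (intro ennreal_leI mult_left_mono) (auto simp: t_def)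
  also have "c * t ^ ?s * (2 * (b - a)) = lower_const * (b - a) * (unit_ball_vol (real ?s) * (t / 2) ^ ?s)"
  proof -
   have w: "unit_ball_vol (real ?s) ~= 0" using unit_ball_vol_pos[of "real ?s"] by linarith
   show ?thesis unfolding lower_const_def c_def using w by (simp add: power_divide)
  qed
  also have "ennreal ... = ennreal (lower_const * (b - a)) * f U"
   unfolding f_def t_def using lower_const_pos ab by (intro ennreal_mult) (auto simp: diameter_ge_0[OF U(1)])
  finally show ?thesis .
 qed
 have "emeasure lborel (strip a b A) <= ennreal (lower_const * (b - a)) * (\<Sum>i. f (U i))" if U: "U : Cov" for U
 proof -
  have "x : (UN i. A \<inter> closure (U i))" if "x : A" for x
  proof -
   have "x : (UN i. U i)" using U that unfolding Cov_def by blast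
   thus ?thesis using that closure_subset by fastforce
  qed
  hence "strip a b A <= (UN i. strip a b (A \<inter> closure (U i)))" unfolding strip_def by blast
  hence "emeasure lborel (strip a b A) <= emeasure lborel (UN i. strip a b (A \<inter> closure (U i)))"
   by (intro emeasure_mono sets.countable_UN) (auto intro!: strip_borel closed_Int A)
  also have "... <= (\<Sum>i. emeasure lborel (strip a b (A \<inter> closure (U i))))"
   by (rule emeasure_subadditive_countably) (auto intro!: strip_borel closed_Int A)
  also have "... <= (\<Sum>i. ennreal (lower_const * (b - a)) * f (U i))"
   using U by (intro suminf_le summableI small) (auto simp: Cov_def)
  finally show ?thesis by simp
 qed
 hence "emeasure lborel (strip a b A) <= ennreal (lower_const * (b - a)) * (INF U\<in>Cov. \<Sum>i. f (U i))"
  using lower_const_pos ab by (intro le_mult_INF_ennreal) auto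
 also have "... = ennreal (lower_const * (b - a)) * hausdorff_premeasure ?s (b - a) A"
  by (simp add: hausdorff_premeasure_def f_def Cov_def)
 also have "... <= ennreal (lower_const * (b - a)) * hm A"
  using ab by (intro mult_left_mono hausdorff_premeasure_le_outer) auto
 finally show ?thesis .
qed

text \<open>The volume of a ball of radius \<open>rho / (1 + Lip)\<close> without the power of
  \<open>rho\<close>, times the 1/4 from counting: a stack holds at least
  \<open>(b - a) / (4 * rho)\<close> such balls.\<close>

definition ball_const where "ball_const = unit_ball_vol (real DIM('a)) * (1 / (1 + Lip)) ^ DIM('a) / 4"

lemma ball_const_pos: "ball_const > 0" using Lip_pos by (simp add: ball_const_def)

text \<open>The strip over a ball contains a stack of disjoint balls of comparable radius.\<close>

lemma strip_over_ball:
 assumes p: "p : Z" "p : cball x0 (3/4 * r)" and ab: "0 <= a" "a < b" "b <= r / 8" and rho: "0 < rho" "rho <= (b - a) / 4"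
 shows "ennreal (ball_const * (b - a) * rho ^ (DIM('a) - 1)) <= emeasure lborel (strip a b (Z \<inter> cball p rho))"
proof -
 \<comment> \<open>Since \<open>h\<close> changes by at most \<open>Lip\<close> times the distance,
   over a ball of radius \<open>c * rho\<close> both the depth and the foot stay within
   \<open>rho\<close> of their values at the centre.\<close>
 define c where "c = 1 / (1 + Lip)"
 have c: "0 < c" "c <= 1" "(1 + Lip) * c = 1" using Lip_pos by (auto simp: c_def)
 let ?v = "unit_ball_vol (real DIM('a)) * (c * rho) ^ DIM('a)"
 have Lc: "Lip * c <= 1" using c by (simp add: distrib_right)
 define N where "N = nat \<lfloor>(b - a) / (2 * rho)\<rfloor>"
 have q0: "(b - a) / (2 * rho) >= 2" using rho by (simp add: field_simps)
 have N: "real N <= (b - a) / (2 * rho)" "(b - a) / (2 * rho) < real N + 1" using q0 by (simp_all add: N_def)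
 have N1: "real N * (2 * rho) <= b - a" using N(1) rho by (simp add: pos_le_divide_eq)
 have N2: "(b - a) / (4 * rho) <= real N"
 proof -
  have "(b - a) / (4 * rho) = (b - a) / (2 * rho) / 2" by simp
  thus ?thesis using N(2) q0 by linarith
 qed
 \<comment> \<open>Centres at depths \<open>a + rho\<close>, \<open>a + 3 * rho\<close> and so on.
   Depths within one ball deviate by less than \<open>rho\<close>, so different balls are
   disjoint.\<close>
 define t where "t j = a + (2 * real j + 1) * rho" for j :: nat
 define z where "z j = p - t j *\<^sub>R e" for j
 have hz: "h (z j) = - t j" for j using h_translate[of p "- t j"] p(1) by (simp add: z_def Z_def)
 have tj: "0 <= t j" "a + rho <= t j" "t j + rho <= b" if "j < N" for j
 proof -
  have "real j + 1 <= real N" using that by linarith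
  hence "(real j + 1) * (2 * rho) <= real N * (2 * rho)" using rho by (intro mult_right_mono) auto
  thus "t j + rho <= b" using N1 by (simp add: t_def algebra_simps)
  show "a + rho <= t j" using rho by (simp add: t_def algebra_simps)
  thus "0 <= t j" using ab rho by linarith
 qed
 have in_ball: "ball (z j) (c * rho) <= ball x0 r" "z j : ball x0 r" if "j < N" for j
 proof -
  have "dist x0 (z j) <= dist x0 p + dist p (z j)" by (rule dist_triangle)
  also have "dist p (z j) = t j" using tj[OF that] norm_e by (simp add: z_def dist_norm)
  finally have zj: "dist x0 (z j) <= 3/4 * r + r / 8" using p(2) tj(3)[OF that] rho(1) ab by simp
  thus "z j : ball x0 r" using r by simp
  have "c * rho <= 1 * rho" using c rho by (intro mult_right_mono) auto
  also have "... <= r / 32" using rho ab by argo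
  finally have "c * rho <= r / 32" .
  show "ball (z j) (c * rho) <= ball x0 r"
  proof
   fix y assume "y : ball (z j) (c * rho)"
   hence "dist x0 y < (3/4 * r + r / 8) + r / 32" using dist_triangle[of x0 y "z j"] zj \<open>c * rho <= r / 32\<close> by simp
   thus "y : ball x0 r" using r by simp
  qed
 qed
 have hy: "\<bar>h y + t j\<bar> < rho" "foot y : cball p rho" if j: "j < N" and y: "y : ball (z j) (c * rho)" for j y
 proof -
  have d: "dist y (z j) < c * rho" using y by (simp add: dist_commute)
  have "\<bar>h y - h (z j)\<bar> <= Lip * dist y (z j)" by (rule h_Lipschitz) (use in_ball[OF j] y in auto)
  hence l: "\<bar>h y + t j\<bar> <= Lip * dist y (z j)" by (simp add: hz)
  also have "... < Lip * (c * rho)" using d Lip_pos by simp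
  also have "... <= 1 * rho" using mult_right_mono[OF Lc, of rho] rho by simp
  finally show "\<bar>h y + t j\<bar> < rho" by simp
  have "foot y - p = (y - z j) - (h y + t j) *\<^sub>R e" by (simp add: foot_def z_def algebra_simps)
  hence "norm (foot y - p) <= norm (y - z j) + \<bar>h y + t j\<bar>"
   using norm_triangle_ineq4[of "y - z j" "(h y + t j) *\<^sub>R e"] norm_e by simp
  also have "... <= (1 + Lip) * dist y (z j)" using l by (simp add: dist_norm distrib_right)
  also have "... <= (1 + Lip) * (c * rho)" using d Lip_pos by (intro mult_left_mono) auto
  also have "... = rho" using c(3) by (simp add: mult.assoc[symmetric])
  finally show "foot y : cball p rho" by (simp add: dist_norm norm_minus_commute)
 qed
 have sub: "(\<Union>j<N. ball (z j) (c * rho)) <= strip a b (Z \<inter> cball p rho)"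
 proof
  fix y assume "y : (\<Union>j<N. ball (z j) (c * rho))"
  then obtain j where j: "j < N" "y : ball (z j) (c * rho)" by blast
  show "y : strip a b (Z \<inter> cball p rho)"
   using hy[OF j] tj[OF j(1)] foot_Z[of y] by (auto simp: strip_def abs_less_iff)
 qed
 have disj: "disjoint_family_on (%j. ball (z j) (c * rho)) {..<N}"
  unfolding disjoint_family_on_def
 proof (intro ballI impI)
  fix i j assume ij: "i : {..<N}" "j : {..<N}" "i ~= j"
  show "ball (z i) (c * rho) \<inter> ball (z j) (c * rho) = {}"
  proof (rule ccontr)
   assume "ball (z i) (c * rho) \<inter> ball (z j) (c * rho) ~= {}"
   then obtain y where y: "y : ball (z i) (c * rho)" "y : ball (z j) (c * rho)" by blast
   have "\<bar>h y + t i\<bar> < rho" "\<bar>h y + t j\<bar> < rho" using hy(1)[OF _ y(1)] hy(1)[OF _ y(2)] ij by auto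
   hence "\<bar>t i - t j\<bar> < 2 * rho" by linarith
   moreover have "t i - t j = (2 * rho) * (real i - real j)" by (simp add: t_def algebra_simps)
   ultimately have "(2 * rho) * \<bar>real i - real j\<bar> < (2 * rho) * 1" using rho(1) by (simp add: abs_mult)
   hence "\<bar>real i - real j\<bar> < 1" using rho(1) by (simp only: mult_less_cancel_left_pos)
   thus False using ij(3) by linarith
  qed
 qed
 have "ennreal (ball_const * (b - a) * rho ^ (DIM('a) - 1)) <= ennreal (real N * ?v)"
 proof (rule ennreal_leI)
  have "ball_const * (b - a) * rho ^ (DIM('a) - 1) = ?v * ((b - a) / (4 * rho))"
   using rho by (simp add: ball_const_def c_def[symmetric] power_mult_distrib power_dim[of rho])
  also have "... <= ?v * real N"
   using N2 c rho by (intro mult_left_mono) auto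
  finally show "ball_const * (b - a) * rho ^ (DIM('a) - 1) <= real N * ?v"
   by (simp add: mult.commute)
 qed
 also have "... = (SUM j<N. emeasure lborel (ball (z j) (c * rho)))"
  using c rho by (simp add: emeasure_ball ennreal_mult ennreal_of_nat_eq_real_of_nat)
 also have "... = emeasure lborel (\<Union>j<N. ball (z j) (c * rho))"
  by (rule sum_emeasure[OF _ disj]) auto
 also have "... <= emeasure lborel (strip a b (Z \<inter> cball p rho))"
  by (rule emeasure_mono[OF sub]) (intro strip_lborel closed_Int closed_Z closed_cball)
 finally show ?thesis .
qed

text \<open>The 5 is the enlargement factor of the Vitali covering lemma: the disjoint balls have
  radius \<open>rho\<close>, the covering ones \<open>5 * rho\<close>.\<close>

definition upper_const where "upper_const = unit_ball_vol (real (DIM('a) - 1)) * 5 ^ (DIM('a) - 1) / ball_const"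

lemma upper_const_pos: "upper_const > 0" using ball_const_pos by (simp add: upper_const_def)

text \<open>A Vitali covering of the surface piece by balls whose strips are disjoint.\<close>

lemma premeasure_le_strip:
 assumes A: "A <= Z \<inter> cball x0 (3/4 * r)" "A ~= {}" and ab: "0 <= a" "a < b" "b <= r / 8" and rho: "0 < rho" "rho <= (b - a) / 4"
 shows "ennreal (b - a) * hausdorff_premeasure (DIM('a) - 1) (10 * rho) A
  <= ennreal upper_const * emeasure lborel (strip a b (Z \<inter> {x. infdist x A <= rho}))"
proof -
 let ?s = "DIM('a) - 1"
 obtain C where C: "countable C" "C <= A" "pairwise (%i j. disjnt (cball i rho) (cball j rho)) C"
  "A <= (UN i:C. cball i (5 * rho))"
 proof (rule Vitali_covering_lemma_cballs[where S=A and K=A and a="%x. x" and r="%x. rho" and B=rho])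
  show "A <= (UN i:A. cball i rho)" using rho by force
 qed (use rho that in auto)
 \<comment> \<open>Covers are sequences of sets, so the countable family is indexed by naturals; the
   remaining indices get the empty set, whose weight is 0 because
   \<open>DIM('a) - 1 > 0\<close>.\<close>
 define I where "I = to_nat_on C ` C"
 define P where "P = from_nat_into C"
 have P: "P i : C" if "i : I" for i using that C(1) by (auto simp: I_def P_def)
 have Pinj: "i = j" if "i : I" "j : I" "P i = P j" for i j using that C(1) by (auto simp: I_def P_def)
 define U where "U i = (if i : I then cball (P i) (5 * rho) else {})" for i
 define E where "E i = (if i : I then strip a b (Z \<inter> cball (P i) rho) else {})" for i
 let ?v = "%i. unit_ball_vol (real ?s) * (diameter (U i) / 2) ^ ?s"
 have E: "E i : sets lborel" for i by (auto simp: E_def intro!: strip_borel closed_Int closed_Z)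
 have cover: "A <= (UN i. U i)"
 proof
  fix x assume "x : A"
  then obtain p where p: "p : C" "x : cball p (5 * rho)" using C(4) by blast
  hence "x : U (to_nat_on C p)" using C(1) by (auto simp: U_def I_def P_def)
  thus "x : (UN i. U i)" by blast
 qed
 have "hausdorff_premeasure ?s (10 * rho) A <= (\<Sum>i. ennreal (?v i))"
  unfolding hausdorff_premeasure_def using cover rho by (intro INF_lower) (auto simp: U_def)
 hence "ennreal (b - a) * hausdorff_premeasure ?s (10 * rho) A
   <= ennreal (b - a) * (\<Sum>i. ennreal (?v i))" by (rule mult_left_mono) simp
 also have "... = (\<Sum>i. ennreal (b - a) * ennreal (?v i))" by simp
 also have "... <= (\<Sum>i. ennreal upper_const * emeasure lborel (E i))"
 proof (intro suminf_le summableI)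
  fix i
  show "ennreal (b - a) * ennreal (?v i) <= ennreal upper_const * emeasure lborel (E i)"
  proof (cases "i : I")
   case True
   have Pi: "P i : Z" "P i : cball x0 (3/4 * r)" using P[OF True] C(2) A by auto
   have bc: "ball_const ~= 0" using ball_const_pos by simp
   have "ennreal (b - a) * ennreal (?v i)
     = ennreal (upper_const * (ball_const * (b - a) * rho ^ ?s))"
    using True rho ab bc by (simp add: U_def upper_const_def power_mult_distrib mult_ac flip: ennreal_mult)
   also have "... = ennreal upper_const * ennreal (ball_const * (b - a) * rho ^ ?s)"
    using upper_const_pos ball_const_pos ab rho by (intro ennreal_mult) auto
   also have "... <= ennreal upper_const * emeasure lborel (E i)"
    using True strip_over_ball[OF Pi ab rho] by (intro mult_left_mono) (auto simp: E_def)
   finally show ?thesis .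
  qed (use dim in "simp add: U_def power_0_left")
 qed
 also have "... = ennreal upper_const * emeasure lborel (UN i. E i)"
 proof -
  have "disjoint_family E"
   unfolding disjoint_family_on_def
  proof (intro ballI impI)
   fix i j :: nat assume ij: "i ~= j"
   show "E i \<inter> E j = {}"
   proof (rule ccontr)
    assume "E i \<inter> E j ~= {}"
    then obtain y where y: "y : E i" "y : E j" by blast
    hence I: "i : I" "j : I" "foot y : cball (P i) rho" "foot y : cball (P j) rho"
     by (auto simp: E_def strip_def split: if_splits)
    have "P i ~= P j" using Pinj[OF I(1,2)] ij by blast
    hence "disjnt (cball (P i) rho) (cball (P j) rho)" using C(3) P[OF I(1)] P[OF I(2)] unfolding pairwise_def by blast
    thus False using I(3,4) unfolding disjnt_def by blast
   qed
  qed
  thus ?thesis using E by (simp add: suminf_emeasure image_subset_iff)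
 qed
 also have "... <= ennreal upper_const * emeasure lborel (strip a b (Z \<inter> {x. infdist x A <= rho}))"
 proof (intro mult_left_mono emeasure_mono)
  have "cball (P i) rho <= {x. infdist x A <= rho}" if "i : I" for i
  proof
   fix x assume "x : cball (P i) rho"
   thus "x : {x. infdist x A <= rho}"
    using infdist_le[of "P i" A x] P[OF that] C(2) by (auto simp: dist_commute)
  qed
  thus "(UN i. E i) <= strip a b (Z \<inter> {x. infdist x A <= rho})"
   unfolding E_def strip_def by (fastforce split: if_splits)
  have "closed {x. infdist x A <= rho}" by (intro closed_Collect_le continuous_intros)
  thus "strip a b (Z \<inter> {x. infdist x A <= rho}) : sets lborel" by (intro strip_lborel closed_Int closed_Z)
 qed simp
 finally show ?thesis .
qed

text \<open>The balls in \<open>premeasure_le_strip\<close> stick out of \<open>A\<close> by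
  \<open>rho\<close>. As \<open>rho\<close> tends to 0 the closed neighbourhoods decrease to the
  compact set \<open>A\<close>, and since their strips have finite volume, the volumes
  converge.\<close>

lemma hausdorff_le_strip:
 assumes A: "compact A" "A <= Z \<inter> cball x0 (3/4 * r)" and ab: "0 <= a" "a < b" "b <= r / 8"
 shows "ennreal (b - a) * hm A <= ennreal upper_const * emeasure lborel (strip a b A)"
proof (cases "A = {}")
 case True
 thus ?thesis using hausdorff_outer_empty[OF dim_pos, where 'a='a] by simp
next
 case False
 let ?s = "DIM('a) - 1"
 define rho where "rho k = (b - a) / 4 / real (Suc k)" for k
 have rho: "rho k > 0" "rho k <= (b - a) / 4" for k
  using ab divide_left_mono[of 1 "real (Suc k)" "(b - a) / 4"] by (auto simp: rho_def)
 have rhomono: "rho l <= rho k" if "k <= l" for k l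
  unfolding rho_def using that ab by (intro divide_left_mono) auto
 have rho0: "rho ----> 0"
 proof -
  have "(%k. (b - a) / 4 * inverse (real (Suc k))) ----> (b - a) / 4 * 0"
   by (intro tendsto_mult tendsto_const LIMSEQ_inverse_real_of_nat)
  moreover have "rho = (%k. (b - a) / 4 * inverse (real (Suc k)))" by (intro ext) (simp only: rho_def divide_inverse)
  ultimately show ?thesis by (simp only: mult_zero_right)
 qed
 define B where "B k = Z \<inter> {x. infdist x A <= rho k}" for k
 have B: "closed (B k)" for k
  unfolding B_def by (intro closed_Int closed_Z closed_Collect_le continuous_intros)
 have Bb: "bounded (B k)" for k
 proof -
  obtain R where R: "!!x. x : A ==> norm x <= R" using compact_imp_bounded[OF A(1)] by (auto simp: bounded_iff)
  have "norm x <= R + rho k" if "x : B k" for x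
  proof -
   obtain y where y: "y : A" "infdist x A = dist x y" using infdist_attains_inf[OF compact_imp_closed[OF A(1)] False] by metis
   have "norm x <= norm y + dist x y" using norm_triangle_sub[of x y] by (simp add: dist_norm)
   thus ?thesis using R[OF y(1)] that y(2) by (simp add: B_def)
  qed
  thus ?thesis by (auto simp: bounded_iff)
 qed
 have INT: "(INT k. strip a b (B k)) = strip a b A"
 proof -
  have "(INT k. B k) = A"
  proof
   show "A <= (INT k. B k)" using A(2) rho(1) by (auto simp: B_def intro: less_imp_le)
   show "(INT k. B k) <= A"
   proof
    fix x assume x: "x : (INT k. B k)"
    have "infdist x A <= 0" by (rule LIMSEQ_le_const[OF rho0]) (use x in "auto simp: B_def")
    thus "x : A" using in_closed_iff_infdist_zero[OF compact_imp_closed[OF A(1)] False] infdist_nonneg[of x A] by simp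
   qed
  qed
  thus ?thesis unfolding strip_def by blast
 qed
 have lim: "(%k. emeasure lborel (strip a b (B k))) ----> emeasure lborel (strip a b A)"
  unfolding INT[symmetric]
 proof (rule Lim_emeasure_decseq)
  show "range (%k. strip a b (B k)) <= sets lborel" using strip_lborel[OF B] by blast
  show "decseq (%k. strip a b (B k))"
   unfolding decseq_def by (intro allI impI strip_mono) (use rhomono in "fastforce simp: B_def")
  show "emeasure lborel (strip a b (B i)) ~= \<infinity>" for i using strip_finite[OF Bb ab(2), of i] by simp
 qed
 have lim': "(%k. ennreal upper_const * emeasure lborel (strip a b (B k))) ----> ennreal upper_const * emeasure lborel (strip a b A)"
  by (rule tendsto_mult_ennreal[OF tendsto_const lim]) (use upper_const_pos in auto)
 have "ennreal (b - a) * hausdorff_premeasure ?s del A <= ennreal upper_const * emeasure lborel (strip a b A)" if del: "del > 0" for del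
 proof (rule LIMSEQ_le_const[OF lim'])
  have "\<forall>\<^sub>F k in sequentially. rho k < del / 10" by (rule order_tendstoD(2)[OF rho0]) (use del in simp)
  then obtain K where K: "!!k. k >= K ==> rho k < del / 10" by (auto simp: eventually_sequentially)
  have "ennreal (b - a) * hausdorff_premeasure ?s del A <= ennreal upper_const * emeasure lborel (strip a b (B k))" if "k >= K" for k
  proof -
   have "hausdorff_premeasure ?s del A <= hausdorff_premeasure ?s (10 * rho k) A"
    using K[OF that] by (intro hausdorff_premeasure_antimono) simp
   hence "ennreal (b - a) * hausdorff_premeasure ?s del A <= ennreal (b - a) * hausdorff_premeasure ?s (10 * rho k) A"
    by (rule mult_left_mono) simp
   also have "... <= ennreal upper_const * emeasure lborel (strip a b (B k))"
    unfolding B_def by (rule premeasure_le_strip[OF A(2) False ab rho])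
   finally show ?thesis .
  qed
  thus "EX N. ALL k>=N. ennreal (b - a) * hausdorff_premeasure ?s del A <= ennreal upper_const * emeasure lborel (strip a b (B k))"
   by blast
 qed
 thus ?thesis
  unfolding hausdorff_outer_def SUP_mult_left_ennreal by (intro SUP_least) auto
qed

end

subsection \<open>Surface integrals as limits of integrals over layers\<close>

lemma space_surface_measure [simp]: "space (surface_measure D) = frontier D"
 by (simp add: surface_measure_def space_restrict_space)

lemma borel_measurable_surface:
 fixes f :: "'a::euclidean_space => 'b::topological_space"
 assumes dim: "DIM('a) >= 2" and f: "f : borel_measurable borel" shows "f : borel_measurable (surface_measure D)"
proof -
 have "f : borel_measurable (hausdorff_measure (DIM('a) - 1))"
  using borel_hausdorff_measure[of "DIM('a) - 1", where 'a='a] dim f by (auto simp: measurable_def)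
 thus ?thesis unfolding surface_measure_def by (rule measurable_restrict_space1)
qed

lemma
 fixes A D :: "'a::euclidean_space set"
 assumes dim: "DIM('a) >= 2" and A: "A : sets borel" "A <= frontier D"
 shows sets_surface_measure: "A : sets (surface_measure D)"
  and emeasure_surface_measure: "emeasure (surface_measure D) A = hausdorff_outer (DIM('a) - 1) A"
proof -
 have s: "DIM('a) - 1 > 0" using dim by simp
 have fr: "frontier D : sets (hausdorff_measure (DIM('a) - 1))" "A : sets (hausdorff_measure (DIM('a) - 1))"
  using borel_hausdorff_measure[OF s] A by auto
 show "A : sets (surface_measure D)"
  unfolding surface_measure_def using fr A by (subst sets_restrict_space_iff) auto
 show "emeasure (surface_measure D) A = hausdorff_outer (DIM('a) - 1) A"
  unfolding surface_measure_def using fr A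
  by (simp add: emeasure_restrict_space emeasure_hausdorff_measure[OF s] sets_hausdorff_measure[OF s, symmetric] del: One_nat_def)
qed

context surface_patch begin

abbreviation sg where "sg \<equiv> surface_measure D"

lemma frontier_iff: assumes y: "y : ball x0 r" shows "y : frontier D \<longleftrightarrow> h y = 0"
proof
 assume "y : frontier D"
 hence c: "y : closure D" "y ~: D" using open_D by (auto simp: frontier_def interior_open)
 have "~ h y > 0"
 proof
  assume "h y > 0"
  have "open (ball x0 r \<inter> {y. h y > 0})" by (intro open_Int open_ball open_Collect_less continuous_h continuous_on_const)
  moreover have "ball x0 r \<inter> {y. h y > 0} \<inter> D = {}" using D_iff by force
  ultimately show False using c(1) y \<open>h y > 0\<close> open_Int_closure_eq_empty by blast
 qed
 thus "h y = 0" using c(2) D_iff[OF y] by linarith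
next
 assume hy: "h y = 0"
 have "y : closure D"
  unfolding closure_approachable
 proof (intro allI impI)
  fix eps :: real assume eps: "eps > 0"
  define t where "t = min (eps / 2) ((r - dist x0 y) / 2)"
  have t: "t > 0" "t < eps" "t < r - dist x0 y" using eps y by (auto simp: t_def min_less_iff_disj)
  have d: "dist (y + (- t) *\<^sub>R e) y = t" using t norm_e by (simp add: dist_norm)
  have "dist x0 (y + (- t) *\<^sub>R e) < r" using dist_triangle[of x0 "y + (- t) *\<^sub>R e" y] d t by (simp add: dist_commute)
  hence "y + (- t) *\<^sub>R e : D" using D_iff[of "y + (- t) *\<^sub>R e"] h_translate[of y "- t"] hy t by simp
  thus "EX x:D. dist x y < eps" using d t by (intro bexI[of _ "y + (- t) *\<^sub>R e"]) auto
 qed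
 moreover have "y ~: D" using D_iff[OF y] hy by simp
 ultimately show "y : frontier D" using open_D by (simp add: frontier_def interior_open)
qed

text \<open>Points of the half ball at depth below \<open>r / 8\<close> have their feet within
  \<open>3/4 * r\<close> of \<open>x0\<close>, still well inside the patch.\<close>

definition Gam where "Gam = Z \<inter> cball x0 (3/4 * r)"

lemma compact_Gam: "compact Gam" unfolding Gam_def using closed_Z by (intro closed_Int_compact) auto

lemma Gam_frontier: "Gam <= frontier D" using frontier_iff r by (auto simp: Gam_def Z_def)

lemma hm_Gam_finite: "hm Gam < \<infinity>"
proof -
 have le: "ennreal (r / 8 - 0) * hm Gam <= ennreal upper_const * emeasure lborel (strip 0 (r / 8) Gam)"
  by (rule hausdorff_le_strip[OF compact_Gam]) (use r in "auto simp: Gam_def")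
 have "emeasure lborel (strip 0 (r / 8) Gam) < \<infinity>"
  using r by (intro strip_finite compact_imp_bounded compact_Gam) auto
 hence "ennreal upper_const * emeasure lborel (strip 0 (r / 8) Gam) < top"
  by (simp add: ennreal_mult_less_top)
 from order.strict_trans1[OF le this] show ?thesis using r by (auto simp: ennreal_mult_less_top)
qed

context
 fixes F :: "'a => real"
 assumes F: "continuous_on UNIV F" "!!x. 0 <= F x" and supp: "!!x. F x ~= 0 ==> x : cball x0 (r / 2)"
begin

lemma F_measurable: "F : borel_measurable borel" by (rule borel_measurable_continuous_onI[OF F(1)])

lemma level_set_compact: "compact {x:Gam. t <= F x}"
proof -
 have "{x:Gam. t <= F x} = Gam \<inter> {x. t <= F x}" by auto
 moreover have "closed {x. t <= F x}" by (intro closed_Collect_le F continuous_on_const)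
 ultimately show ?thesis using compact_Gam by (simp add: compact_Int_closed)
qed

lemma level_set_surface: "t > 0 ==> emeasure sg {x : space sg. t <= F x} = hm {x:Gam. t <= F x}"
proof -
 assume t: "t > 0"
 have "{x : space sg. t <= F x} = {x:Gam. t <= F x}"
 proof -
  have "x : Gam" if "x : frontier D" "t <= F x" for x
  proof -
   have "x : cball x0 (r / 2)" using supp[of x] that t by auto
   thus ?thesis using frontier_iff[of x] that(1) r by (auto simp: Gam_def Z_def)
  qed
  thus ?thesis using Gam_frontier by auto
 qed
 thus ?thesis
  using emeasure_surface_measure[OF dim, of "{x:Gam. t <= F x}" D] Gam_frontier
   borel_closed[OF compact_imp_closed[OF level_set_compact]] by auto
qed

text \<open>Constant along \<open>e\<close> through the layer, so that its superlevel sets for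
  positive levels are strips over superlevel sets of \<open>F\<close> on the graph.\<close>

definition lift where "lift a b y = indicator (strip a b Z) y * F (foot y)"

lemma lift_measurable: "lift a b : borel_measurable borel"
 unfolding lift_def[abs_def]
 using strip_borel[OF closed_Z, of a b] borel_measurable_continuous_onI[OF continuous_on_compose2[OF F(1) continuous_foot]]
 by (intro borel_measurable_times borel_measurable_indicator) auto

lemma lift_nonneg: "0 <= lift a b y" using F(2) by (simp add: lift_def)

lemma lift_level: "t > 0 ==> {y : space lborel. t <= lift a b y} = strip a b {x:Gam. t <= F x}"
proof -
 assume t: "t > 0"
 have "foot y : Gam" if "t <= F (foot y)" for y
  using supp[of "foot y"] that t foot_Z[of y] r by (auto simp: Gam_def)
 thus ?thesis using t foot_Z by (auto simp: lift_def strip_def indicator_def split: if_splits)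
qed

lemma surface_le_lift:
 assumes ab: "0 <= a" "a < b" "b <= r / 8"
 shows "ennreal (b - a) * nn_integral sg F <= ennreal upper_const * nn_integral lborel (lift a b)"
proof (rule nn_integral_le_level_sets)
 show "F : borel_measurable sg" by (rule borel_measurable_surface[OF dim F_measurable])
 show "lift a b : borel_measurable lborel" using lift_measurable by simp
 show "ennreal (b - a) * emeasure sg {x : space sg. t <= F x} <= ennreal upper_const * emeasure lborel {y : space lborel. t <= lift a b y}"
  if "t > 0" for t
  unfolding level_set_surface[OF that] lift_level[OF that]
  by (rule hausdorff_le_strip[OF level_set_compact _ ab]) (auto simp: Gam_def)
qed (simp_all add: F(2) lift_nonneg)

lemma lift_le_surface:
 assumes ab: "a < b"
 shows "nn_integral lborel (lift a b) <= ennreal (lower_const * (b - a)) * nn_integral sg F"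
proof -
 have "1 * nn_integral lborel (lift a b) <= ennreal (lower_const * (b - a)) * nn_integral sg F"
 proof (rule nn_integral_le_level_sets)
  show "F : borel_measurable sg" by (rule borel_measurable_surface[OF dim F_measurable])
  show "lift a b : borel_measurable lborel" using lift_measurable by simp
  show "1 * emeasure lborel {y : space lborel. t <= lift a b y} <= ennreal (lower_const * (b - a)) * emeasure sg {x : space sg. t <= F x}"
   if "t > 0" for t
   unfolding level_set_surface[OF that] lift_level[OF that]
   using strip_le_hausdorff[OF compact_imp_closed[OF level_set_compact] ab] by simp
 qed (simp_all add: F(2) lift_nonneg)
 thus ?thesis by simp
qed

lemma F_integrable_surface: "integrable sg F"
proof (rule integrableI_nonneg)
 show "F : borel_measurable sg" by (rule borel_measurable_surface[OF dim F_measurable])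
 have "compact (F ` cball x0 (r / 2))" by (intro compact_continuous_image continuous_on_subset[OF F(1)]) auto
 then obtain K where K: "K > 0" "!!x. x : cball x0 (r / 2) ==> \<bar>F x\<bar> <= K"
  using compact_imp_bounded[of "F ` cball x0 (r / 2)"] by (auto simp: bounded_pos)
 have Gamb: "Gam : sets borel" by (rule borel_closed[OF compact_imp_closed[OF compact_Gam]])
 have "nn_integral sg F <= nn_integral sg (%x. ennreal K * indicator Gam x)"
 proof (rule nn_integral_mono)
  fix x assume x: "x : space sg"
  show "ennreal (F x) <= ennreal K * indicator Gam x"
  proof (cases "F x = 0")
   case False
   hence "x : cball x0 (r / 2)" by (rule supp)
   hence "x : Gam" using frontier_iff[of x] x r by (auto simp: Gam_def Z_def)
   thus ?thesis using K(2)[OF \<open>x : cball x0 (r / 2)\<close>] by (auto intro: ennreal_leI)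
  qed simp
 qed
 also have "... = ennreal K * hm Gam"
  using sets_surface_measure[OF dim Gamb Gam_frontier] emeasure_surface_measure[OF dim Gamb Gam_frontier] by (simp add: nn_integral_cmult_indicator)
 also have "... < \<infinity>" using hm_Gam_finite by (simp add: ennreal_mult_less_top)
 finally show "nn_integral sg F < \<infinity>" .
qed (simp add: F)

lemma layer_integrable: "integrable lborel (%y. indicator (strip a b Z) y * F y)"
proof -
 have "bounded {x. F x ~= 0}" by (rule bounded_subset[of "cball x0 (r / 2)"]) (use supp in auto)
 hence "integrable lborel F" by (rule integrable_bsupp[OF F(1)])
 hence "integrable lborel (%y. indicator (strip a b Z) y *\<^sub>R F y)"
  by (intro integrable_mult_indicator strip_lborel closed_Z)
 thus ?thesis by simp
qed

text \<open>For \<open>lift\<close> both inequalities hold without error. In a thin layer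
  \<open>F\<close> differs from its value at the foot by at most \<open>om\<close>, and the layer
  over \<open>Gam\<close> has volume at most a constant times \<open>b - a\<close>; after division
  by \<open>b - a\<close> the error is at most \<open>eps\<close>.\<close>

lemma layer_comparison:
 assumes eps: "eps > 0"
 shows "EX d0>0. ALL a b. 0 <= a & a < b & b < d0 -->
   (LINT x|sg. F x) <= upper_const / (b - a) * (LINT y|lborel. indicator (strip a b Z) y * F y) + eps &
   1 / (b - a) * (LINT y|lborel. indicator (strip a b Z) y * F y) <= lower_const * (LINT x|sg. F x) + eps"
proof -
 define H where "H = enn2real (hm Gam)"
 have H: "hm Gam = ennreal H" "H >= 0" using hm_Gam_finite by (auto simp: H_def)
 note uc = upper_const_pos and lc = lower_const_pos
 \<comment> \<open>Small enough for the error with and without the factor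
   \<open>upper_const\<close>; \<open>H + 1\<close> guards against \<open>H = 0\<close>.\<close>
 define om where "om = eps / ((upper_const + 1) * lower_const * (H + 1))"
 have den: "(upper_const + 1) * lower_const * (H + 1) > 0" using uc lc H by (intro mult_pos_pos) auto
 have om: "om > 0" using den eps by (simp add: om_def)
 have ome: "(upper_const + 1) * (lower_const * (om * H)) <= eps"
 proof -
  have "(upper_const + 1) * (lower_const * (om * H)) <= (upper_const + 1) * (lower_const * (om * (H + 1)))"
   using uc lc om by (intro mult_left_mono) auto
  also have "... = (upper_const + 1) * lower_const * (H + 1) * om" by (simp only: mult_ac)
  also have "... = eps" unfolding om_def using less_imp_neq[OF den] by simp
  finally show ?thesis .
 qed
 have lw: "lower_const * (om * H) >= 0" using lc om H by simp
 have w1: "lower_const * (om * H) <= eps"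
  using ome lw mult_nonneg_nonneg[OF less_imp_le[OF uc] lw] by (simp add: distrib_right)
 have w2: "upper_const * (lower_const * (om * H)) <= eps" using ome lw by (simp add: distrib_right)
 have "bounded {x. F x ~= 0}" by (rule bounded_subset[of "cball x0 (r / 2)"]) (use supp in auto)
 from bsupp_uniformly_continuous[OF F(1) this om]
 obtain del where del: "del > 0" "!!x y. dist x y < del ==> \<bar>F x - F y\<bar> < om"
  unfolding dist_real_def by blast
 show ?thesis
 proof (intro exI[of _ "min del (r / 8)"] conjI allI impI)
  show "min del (r / 8) > 0" using del r by simp
  fix a b assume "0 <= a & a < b & b < min del (r / 8)"
  hence ab: "0 <= a" "a < b" "b < del" "b < r / 8" by auto
  let ?W = "%y. indicator (strip a b Z) y * F y"
  let ?S = "strip a b Gam"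
  have Sb: "?S : sets lborel" by (rule strip_lborel[OF compact_imp_closed[OF compact_Gam]])
  have near: "dist y (foot y) < del" "dist y (foot y) < r / 8" if "y : strip a b Z" for y
   using that ab by (auto simp: dist_foot strip_def)
  have pt: "lift a b y <= ?W y + om * indicator ?S y" "?W y <= lift a b y + om * indicator ?S y" for y
  proof -
   show "lift a b y <= ?W y + om * indicator ?S y"
   proof (cases "y : strip a b Z & F (foot y) ~= 0")
    case True
    hence y: "y : strip a b Z" "foot y : cball x0 (r / 2)" using supp by auto
    hence "y : ?S" using r by (auto simp: Gam_def strip_def)
    thus ?thesis using y(1) del(2)[OF near(1)[OF y(1)]] by (simp add: lift_def)
   qed (use F(2) om in "auto simp: lift_def indicator_def")
   show "?W y <= lift a b y + om * indicator ?S y"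
   proof (cases "y : strip a b Z & F y ~= 0")
    case True
    hence y: "y : strip a b Z" "y : cball x0 (r / 2)" using supp by auto
    have "dist x0 (foot y) <= 3/4 * r" using dist_triangle[of x0 "foot y" y] y(2) near(2)[OF y(1)] r by simp
    hence "y : ?S" using y(1) by (auto simp: Gam_def strip_def)
    thus ?thesis using y(1) del(2)[OF near(1)[OF y(1)]] by (simp add: lift_def)
   qed (use F(2) om in "auto simp: lift_def indicator_def")
  qed
  have SH: "emeasure lborel ?S <= ennreal (lower_const * (b - a) * H)"
   using strip_le_hausdorff[OF compact_imp_closed[OF compact_Gam] ab(2)] H lc ab by (simp add: ennreal_mult)
  have Sfin: "emeasure lborel ?S < \<infinity>" using SH by (auto simp: order.strict_trans1)
  define s where "s = measure lborel ?S"
  have s: "s <= lower_const * (b - a) * H"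
   using SH Sfin lc ab H by (simp add: s_def emeasure_eq_ennreal_measure)
  have Si: "integrable lborel (%y. om * indicator ?S y :: real)"
   using Sfin Sb by (intro integrable_mult_right integrable_real_indicator) auto
  define X where "X = (LINT x|sg. F x)"
  have X: "nn_integral sg F = ennreal X" "X >= 0"
   unfolding X_def by (rule nn_integral_eq_integral[OF F_integrable_surface]) (simp_all add: F)
  have li: "integrable lborel (lift a b)"
  proof (rule integrableI_nonneg)
   show "lift a b : borel_measurable lborel" using lift_measurable by simp
   show "nn_integral lborel (lift a b) < \<infinity>"
    using lift_le_surface[OF ab(2)] by (auto simp: X order.strict_trans1 ennreal_mult_less_top)
  qed (simp add: lift_nonneg)
  define Y where "Y = (LINT y|lborel. lift a b y)"
  have Y: "nn_integral lborel (lift a b) = ennreal Y" "Y >= 0"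
   unfolding Y_def by (rule nn_integral_eq_integral[OF li]) (simp_all add: lift_nonneg)
  define W where "W = (LINT y|lborel. ?W y)"
  have Wi: "integrable lborel ?W" by (rule layer_integrable)
  have YW: "Y <= W + om * s"
  proof -
   have "Y <= (LINT y|lborel. ?W y + om * indicator ?S y)"
    unfolding Y_def by (intro integral_mono li Bochner_Integration.integrable_add Wi Si pt)
   also have "... = W + om * s" using Wi Si Sb by (simp add: W_def s_def)
   finally show ?thesis .
  qed
  have WY: "W <= Y + om * s"
  proof -
   have "W <= (LINT y|lborel. lift a b y + om * indicator ?S y)"
    unfolding W_def by (intro integral_mono li Bochner_Integration.integrable_add Wi Si pt)
   also have "... = Y + om * s" using li Si Sb by (simp add: Y_def s_def)
   finally show ?thesis .
  qed
  have ba: "b - a > 0" using ab by simp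
  have sw: "om * s <= (b - a) * (lower_const * (om * H))"
   using mult_left_mono[OF s, of om] om by (simp add: mult_ac)
  have XY: "(b - a) * X <= upper_const * Y"
  proof -
   have "ennreal ((b - a) * X) <= ennreal (upper_const * Y)"
    using surface_le_lift[OF ab(1,2)] ab X Y uc by (simp add: ennreal_mult)
   thus ?thesis using uc Y(2) by (subst (asm) ennreal_le_iff) auto
  qed
  have YX: "Y <= lower_const * (b - a) * X"
  proof -
   have "ennreal Y <= ennreal (lower_const * (b - a) * X)"
    using lift_le_surface[OF ab(2)] ab X Y lc by (simp add: ennreal_mult)
   thus ?thesis using lc ba X(2) by (subst (asm) ennreal_le_iff) auto
  qed
  have "(b - a) * X <= upper_const * W + upper_const * ((b - a) * (lower_const * (om * H)))"
  proof -
   have "upper_const * Y <= upper_const * (W + (b - a) * (lower_const * (om * H)))"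
    using YW sw uc by (intro mult_left_mono) auto
   thus ?thesis using XY by (simp add: distrib_left)
  qed
  also have "... <= upper_const * W + (b - a) * eps"
   using mult_left_mono[OF w2, of "b - a"] ba by (simp add: mult_ac)
  finally have "X <= (upper_const * W + (b - a) * eps) / (b - a)" using ba by (simp add: pos_le_divide_eq mult.commute)
  also have "... = upper_const / (b - a) * W + eps" using ba by (simp add: add_divide_distrib)
  finally show "(LINT x|sg. F x) <= upper_const / (b - a) * (LINT y|lborel. ?W y) + eps" by (simp add: X_def W_def)
  have "(b - a) * (lower_const * (om * H)) <= (b - a) * eps" using w1 ba by (intro mult_left_mono) auto
  moreover have "Y <= (b - a) * (lower_const * X)" using YX by (simp only: mult_ac)
  ultimately have "W <= (b - a) * (lower_const * X) + (b - a) * eps" using WY sw by linarith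
  hence "W / (b - a) <= ((b - a) * (lower_const * X) + (b - a) * eps) / (b - a)" using ba by (intro divide_right_mono) auto
  also have "... = lower_const * X + eps" using ba by (simp add: add_divide_distrib)
  finally show "1 / (b - a) * (LINT y|lborel. ?W y) <= lower_const * (LINT x|sg. F x) + eps" by (simp add: X_def W_def)
 qed
qed

end

section \<open>Surface integrals against integrals of gradients\<close>

lemma support_in_D:
 assumes F: "closure {x. F x ~= 0} <= ball x0 (r / 2)" and x: "zeta d x ~= 0" "pd b F x ~= 0" and d: "d > 0"
 shows "x : D"
proof -
 have "x : closure {x. F x ~= 0}" using x(2) pd_outside_support by blast
 hence xb: "x : ball x0 r" using F r by auto
 have "~ (- h x / d - 1 <= 0)" using x(1) step1_simps(1) by (auto simp: zeta_def)
 hence "h x < 0" using d by (simp add: field_simps)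
 thus ?thesis using D_iff[OF xb] by simp
qed

lemma tent_support: "d > 0 ==> tent (- h x / d - 1) ~= 0 ==> x : strip d (2 * d) Z"
proof -
 assume d: "d > 0" and t: "tent (- h x / d - 1) ~= 0"
 have "~ (- h x / d - 1 <= 0)" "~ (- h x / d - 1 >= 1)" using t step1_simps(3,4) by auto
 thus ?thesis using d foot_Z by (simp add: strip_def field_simps)
qed

lemma tent_ge_1: "d > 0 ==> x : strip (5/4 * d) (7/4 * d) Z ==> 1 <= tent (- h x / d - 1)"
 by (rule tent_bounds(3)) (auto simp: strip_def field_simps)

text \<open>The partial derivatives of \<open>zeta d * F\<close> have integral 0, which expresses
  the layer integral of \<open>F * tent * pd b h\<close> by that of \<open>zeta d * pd b F\<close>.
  Contracting with \<open>e\<close> removes \<open>h\<close>, and \<open>tent\<close> is at least 1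
  on the middle half of the layer; so the layer mean of \<open>F\<close>, and with it the surface
  integral, is bounded by the gradient.\<close>

lemma surface_le_gradient:
 fixes F :: "'a => real"
 assumes F: "Ck 1 F" "!!x. 0 <= F x" and supp: "closure {x. F x ~= 0} <= ball x0 (r / 2)"
 shows "(LINT x|sg. F x) <= 2 * upper_const * (SUM b:Basis. LINT x|M. \<bar>pd b F x\<bar>)"
proof (rule field_le_epsilon)
 fix eps :: real assume eps: "eps > 0"
 have supp': "x : cball x0 (r / 2)" if "F x ~= 0" for x
  using that supp closure_subset[of "{x. F x ~= 0}"] by force
 have Fb: "bounded {x. F x ~= 0}" by (rule bounded_subset[of "cball x0 (r / 2)"]) (use supp' in auto)
 note Fc = Ck1_continuous[OF F(1)]
 obtain d0 where d0: "d0 > 0" "!!a b. 0 <= a ==> a < b ==> b < d0 ==>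
   (LINT x|sg. F x) <= upper_const / (b - a) * (LINT y|lborel. indicator (strip a b Z) y * F y) + eps"
  using layer_comparison[OF Fc F(2) supp' eps] by blast
 define d where "d = d0 / 2"
 have d: "d > 0" "7/4 * d < d0" using d0(1) by (simp_all add: d_def)
 \<comment> \<open>Depths at which the argument \<open>- h x / d - 1\<close> of \<open>tent\<close>
   lies between 1/4 and 3/4. This strip has width \<open>d / 2\<close>, whence the factor 2 in the
   result.\<close>
 let ?S = "strip (5/4 * d) (7/4 * d) Z"
 let ?t = "%x. tent (- h x / d - 1)"
 let ?zF = "%b. LINT x|lborel. zeta d x * pd b F x"
 let ?I = "LINT y|lborel. indicator ?S y * F y"
 let ?P = "SUM b:Basis. LINT x|M. \<bar>pd b F x\<bar>"
 let ?pF = "%b. LINT x|M. \<bar>pd b F x\<bar>"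
 let ?k = "%b x. F x * ?t x * pd b h x"
 have ct: "continuous_on UNIV ?t"
  by (rule continuous_on_compose2[OF continuous_tent]) (use d in "auto intro!: continuous_intros continuous_h")
 have bs: "bounded {x. F x * g x ~= 0}" for g by (rule bounded_subset[OF Fb]) auto
 have ti: "integrable lborel (%x. F x * ?t x)"
  by (rule integrable_bsupp[OF continuous_on_mult[OF Fc ct] bs])
 have zc: "Ck 1 (%x. zeta d x * F x)" by (rule Ck_mult[OF Ck_zeta F(1)])
 have pdi: "integrable lborel (%x. zeta d x * pd b F x)" if b: "b : Basis" for b
  by (rule integrable_bsupp)
    (auto intro!: continuous_on_mult Ck1_continuous[OF Ck_zeta] Ck1_pd[OF F(1) b] bounded_subset[OF bsupp_pd[OF Fb, of b]])
 have ibp: "?zF b = (1 / d) * (LINT x|lborel. F x * ?t x * pd b h x)" if b: "b : Basis" for b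
 proof -
  have "bounded {x. zeta d x * F x ~= 0}" by (rule bounded_subset[OF Fb]) auto
  from integral_pd_eq_0_real[OF zc this b]
  have "0 = (LINT x|lborel. pd b (%x. zeta d x * F x) x)" by simp
  also have "... = (LINT x|lborel. zeta d x * pd b F x - (1 / d) * ?k b x)"
   unfolding pd_mult[OF Ck1_diff[OF Ck_zeta] Ck1_diff[OF F(1)]] pd_zeta
   by (simp add: mult_ac)
  also have "... = ?zF b - (LINT x|lborel. (1 / d) * ?k b x)"
  proof (rule Bochner_Integration.integral_diff[OF pdi[OF b]])
   have "integrable lborel (%x. F x * (?t x * pd b h x))"
    by (rule integrable_bsupp[OF _ bs]) (intro continuous_on_mult Fc ct Ck1_pd[OF Ck1_h b])
   thus "integrable lborel (%x. (1 / d) * ?k b x)" by (simp add: mult.assoc)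
  qed
  finally show ?thesis by simp
 qed
 have bound: "\<bar>?zF b\<bar> <= ?pF b" if b: "b : Basis" for b
 proof -
  have pm: "pd b F : borel_measurable borel" by (rule borel_measurable_continuous_onI[OF Ck1_pd[OF F(1) b]])
  have pi: "integrable lborel (pd b F)" by (rule integrable_bsupp[OF Ck1_pd[OF F(1) b] bsupp_pd[OF Fb]])
  have "\<bar>?zF b\<bar> <= (LINT x|lborel. indicator D x * \<bar>pd b F x\<bar>)"
   unfolding real_norm_def[symmetric]
  proof (rule Bochner_Integration.integral_norm_bound_integral[OF pdi[OF b]])
   have "integrable lborel (%x. indicator D x *\<^sub>R norm (pd b F x))"
    by (intro integrable_mult_indicator integrable_norm pi D_sets)
   thus "integrable lborel (%x. indicator D x * norm (pd b F x))" by simp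
   show "norm (zeta d x * pd b F x) <= indicator D x * norm (pd b F x)" for x
    using support_in_D[OF supp _ _ d(1), of x b] zeta_bounds[of d x]
    by (cases "zeta d x = 0 \<or> pd b F x = 0") (auto simp: abs_mult mult_left_le_one_le)
  qed
  also have "... = (LINT x|lebesgue. indicator D x *\<^sub>R \<bar>pd b F x\<bar>)"
   using pm D_sets by (simp add: integral_completion)
  also have "... = ?pF b"
   using D_sets by (simp add: integral_restrict_space)
  finally show ?thesis .
 qed
 have "?I <= (LINT x|lborel. F x * ?t x)"
 proof (rule integral_mono[OF layer_integrable[OF Fc F(2) supp'] ti])
  show "indicator ?S x * F x <= F x * ?t x" for x
   using tent_ge_1[OF d(1), of x] mult_left_mono[of 1 "?t x" "F x"] F(2)[of x] tent_bounds(1) by (cases "x : ?S") auto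
 qed
 also have "... = (LINT x|lborel. (SUM b:Basis. (e \<bullet> b) * ?k b x))"
 proof (rule Bochner_Integration.integral_cong[OF refl])
  fix x
  have "(SUM b:Basis. (e \<bullet> b) * ?k b x) = (F x * ?t x) * (SUM b:Basis. (e \<bullet> b) * pd b h x)"
   by (simp add: sum_distrib_left mult_ac)
  thus "F x * ?t x = (SUM b:Basis. (e \<bullet> b) * ?k b x)" by (simp add: sum_e_pd_h)
 qed
 also have "... = (SUM b:Basis. (e \<bullet> b) * (d * ?zF b))"
 proof -
  have "integrable lborel (%x. F x * ?t x * pd b h x)" if "b : Basis" for b
  proof -
   have "integrable lborel (%x. F x * (?t x * pd b h x))"
    by (rule integrable_bsupp[OF _ bs]) (intro continuous_on_mult Fc ct Ck1_pd[OF Ck1_h that])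
   thus ?thesis by (simp add: mult.assoc)
  qed
  thus ?thesis using d by (simp add: ibp)
 qed
 also have "... <= (SUM b:Basis. d * ?pF b)"
 proof (rule sum_mono)
  fix b :: 'a assume b: "b : Basis"
  have "(e \<bullet> b) * (d * ?zF b) <= \<bar>e \<bullet> b\<bar> * (d * \<bar>?zF b\<bar>)"
   using abs_ge_self[of "(e \<bullet> b) * (d * ?zF b)"] d by (simp add: abs_mult)
  also have "... <= 1 * (d * ?pF b)"
   using Basis_le_norm[OF b, of e] norm_e d bound[OF b] by (intro mult_mono) auto
  finally show "(e \<bullet> b) * (d * ?zF b) <= d * ?pF b" by simp
 qed
 finally have L: "?I <= d * ?P" by (simp add: sum_distrib_left)
 have "(LINT x|sg. F x) <= upper_const / (7/4 * d - 5/4 * d) * ?I + eps"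
  by (rule d0(2)) (use d in auto)
 also have "7/4 * d - 5/4 * d = d / 2" by simp
 also have "upper_const / (d / 2) * ?I <= upper_const / (d / 2) * (d * ?P)"
  using L upper_const_pos d by (intro mult_left_mono) auto
 also have "... = 2 * upper_const * ?P" using d by simp
 finally show "(LINT x|sg. F x) <= 2 * upper_const * ?P + eps" by simp
qed

text \<open>The integral over \<open>D\<close> is the limit of those with the cutoff
  \<open>zeta\<close>. Integration by parts leaves the layer where the gradient of
  \<open>zeta\<close> lives, of size \<open>1 / d\<close> on a layer of width \<open>d\<close>, and
  the layer mean of \<open>cmod (F x)\<close> is controlled by the surface integral. This replaces
  the boundary term of the divergence theorem.\<close>

lemma integral_pd_le_surface:
 obtains C where "C >= 0" "!!F b. Ck 1 F ==> closure {x. F x ~= (0::complex)} <= ball x0 (r / 2) ==> b : Basis ==>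
  cmod (LINT x|M. pd b F x) <= C * (LINT x|sg. cmod (F x))"
proof -
 obtain B where B: "B > 0" "!!b x. b : Basis ==> x : cball x0 r ==> \<bar>pd b h x\<bar> <= B" using pd_h_bounded by metis
 show ?thesis
 proof (rule that[of "2 * B * lower_const"])
  show "2 * B * lower_const >= 0" using B lower_const_pos by simp
  fix F :: "'a => complex" and b :: 'a
  assume F: "Ck 1 F" and supp: "closure {x. F x ~= 0} <= ball x0 (r / 2)" and b: "b : Basis"
  have supp': "x : cball x0 (r / 2)" if "cmod (F x) ~= 0" for x
   using that supp closure_subset[of "{x. F x ~= 0}"] by force
  have Fb: "bounded {x. F x ~= 0}" by (rule bounded_subset[of "cball x0 (r / 2)"]) (use supp' in auto)
  note Fc = Ck1_continuous[OF F] and pc = Ck1_pd[OF F b]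
  have Fn: "continuous_on UNIV (%x. cmod (F x))" by (intro continuous_on_norm Fc)
  show "cmod (LINT x|M. pd b F x) <= 2 * B * lower_const * (LINT x|sg. cmod (F x))"
  proof (rule field_le_epsilon)
   fix eps :: real assume eps: "eps > 0"
   define eps' where "eps' = eps / (2 * B)"
   have eps': "eps' > 0" "2 * B * eps' = eps" using eps B by (simp_all add: eps'_def)
   obtain d0 where d0: "d0 > 0" "!!a b. 0 <= a ==> a < b ==> b < d0 ==>
     1 / (b - a) * (LINT y|lborel. indicator (strip a b Z) y * cmod (F y)) <= lower_const * (LINT x|sg. cmod (F x)) + eps'"
    using layer_comparison[OF Fn norm_ge_zero supp' eps'(1)] by blast
   define d where "d n = d0 / 3 / real (Suc n)" for n
   have d: "d n > 0" "2 * d n < d0" for n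
   proof -
    show "d n > 0" using d0 by (simp add: d_def)
    have "d n <= d0 / 3" unfolding d_def using d0 divide_left_mono[of 1 "real (Suc n)" "d0 / 3"] by simp
    thus "2 * d n < d0" using d0 by linarith
   qed
   let ?zF = "%n. LINT x|M. of_real (zeta (d n) x) * pd b F x"
   let ?st = "%n x. indicator (strip (d n) (2 * d n) Z) x * cmod (F x)"
   let ?dz = "%n x. of_real (pd b (zeta (d n)) x) * F x"
   have dlim: "d ----> 0"
   proof -
    have "(%n. d0 / 3 * inverse (real (Suc n))) ----> d0 / 3 * 0"
     by (intro tendsto_mult tendsto_const LIMSEQ_inverse_real_of_nat)
    moreover have "d = (%n. d0 / 3 * inverse (real (Suc n)))" by (intro ext) (simp only: d_def divide_inverse)
    ultimately show ?thesis by (simp only: mult_zero_right)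
   qed
   have pi: "integrable M (pd b F)"
    using L2_mult_int[OF L2_continuous[OF pc] one_L2] by simp
   have p0: "pd b F x = 0" if "x ~: ball x0 r" for x
    using that supp pd_outside_support[of x F b] r by force
   have lim: "(%n. cmod (?zF n)) ----> cmod (LINT x|M. pd b F x)"
    by (intro tendsto_norm zeta_limit[OF pi p0 d(1) dlim])
   have "cmod (?zF n) <= 2 * B * lower_const * (LINT x|sg. cmod (F x)) + eps" for n
   proof -
    note dn = d(1)[of n]
    have zC: "Ck 1 (%x. complex_of_real (zeta (d n) x))" by (rule Ck_linear_comp[OF bounded_linear_of_real Ck_zeta])
    have c: "continuous_on UNIV (%x. of_real (zeta (d n) x) * pd b F x)"
     by (intro continuous_on_mult Ck1_continuous[OF zC] pc)
    have zb: "bounded {x. of_real (zeta (d n) x) * F x ~= 0}" by (rule bounded_subset[OF Fb]) auto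
    have i1: "integrable lborel (%x. of_real (zeta (d n) x) * pd b F x)"
     by (rule integrable_bsupp[OF c]) (auto intro!: bounded_subset[OF bsupp_pd[OF Fb, of b]])
    have i2: "integrable lborel (%x. ?dz n x)"
     by (rule integrable_bsupp)
       (auto intro!: continuous_on_mult continuous_on_of_real Ck1_pd[OF Ck_zeta b] Fc bounded_subset[OF Fb])
    have "?zF n = (LINT x|lborel. of_real (zeta (d n) x) * pd b F x)"
    proof (rule integral_M_lborel[OF continuous_measurable_M[OF c] borel_measurable_continuous_onI[OF c]])
     fix x assume "x ~: D"
     thus "of_real (zeta (d n) x) * pd b F x = 0" using support_in_D[OF supp _ _ dn, of x b] by auto
    qed simp
    moreover have "0 = (LINT x|lborel. of_real (zeta (d n) x) * pd b F x + ?dz n x)"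
     using integral_pd_eq_0[OF Ck_mult[OF zC F] zb b]
     by (simp add: pd_mult[OF Ck1_diff[OF zC] Ck1_diff[OF F]] pd_of_real[OF Ck1_diff[OF Ck_zeta]])
    moreover have "... = (LINT x|lborel. of_real (zeta (d n) x) * pd b F x) + (LINT x|lborel. ?dz n x)"
     by (rule Bochner_Integration.integral_add[OF i1 i2])
    ultimately have eq: "?zF n = - (LINT x|lborel. ?dz n x)"
     by (simp add: eq_neg_iff_add_eq_0)
    have "cmod (?zF n) <= (LINT x|lborel. (2 * B / d n) * ?st n x)"
     unfolding eq norm_minus_cancel
    proof (rule Bochner_Integration.integral_norm_bound_integral[OF i2])
     show "integrable lborel (%x. (2 * B / d n) * ?st n x)"
      by (intro integrable_mult_right layer_integrable[OF Fn norm_ge_zero supp'])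
     fix x
     show "cmod (?dz n x) <= (2 * B / d n) * ?st n x"
     proof (cases "F x = 0 \<or> tent (- h x / d n - 1) = 0")
      case False
      hence x: "x : strip (d n) (2 * d n) Z" "x : cball x0 r" using tent_support[OF dn] supp'[of x] r by auto
      have "\<bar>pd b (zeta (d n)) x\<bar> = (1 / d n) * (tent (- h x / d n - 1) * \<bar>pd b h x\<bar>)"
       using dn tent_bounds(1)[of "- h x / d n - 1"] by (simp add: pd_zeta abs_mult)
      also have "... <= (1 / d n) * (2 * B)"
       using dn tent_bounds(1,2) B(2)[OF b x(2)] by (intro mult_left_mono mult_mono) auto
      finally have "\<bar>pd b (zeta (d n)) x\<bar> <= 2 * B / d n" by simp
      hence "\<bar>pd b (zeta (d n)) x\<bar> * cmod (F x) <= 2 * B / d n * cmod (F x)" by (rule mult_right_mono) simp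
      thus ?thesis using x(1) by (simp add: norm_mult)
     qed (use B dn in "auto simp: pd_zeta")
    qed
    also have "... = 2 * B * (1 / (2 * d n - d n) * (LINT x|lborel. indicator (strip (d n) (2 * d n) Z) x * cmod (F x)))" by simp
    also have "... <= 2 * B * (lower_const * (LINT x|sg. cmod (F x)) + eps')"
     using B dn d(2)[of n] by (intro mult_left_mono d0(2)) auto
    finally show ?thesis using eps'(2) by (simp add: distrib_left mult_ac)
   qed
   thus "cmod (LINT x|M. pd b F x) <= 2 * B * lower_const * (LINT x|sg. cmod (F x)) + eps"
    by (intro LIMSEQ_le_const2[OF lim]) auto
  qed
 qed
qed

end

subsection \<open>Traces\<close>

lemma norm_square_Ck1:
 fixes w :: "'a::euclidean_space => complex"
 assumes w: "Ck 1 w"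
 shows "Ck 1 (%x. (cmod (w x))^2)" "\<bar>pd b (%x. (cmod (w x))^2) x\<bar> <= 4 * (cmod (w x) * cmod (pd b w x))"
proof -
 have R: "Ck 1 (%x. Re (w x))" "Ck 1 (%x. Im (w x))"
  by (rule Ck_linear_comp[OF bounded_linear_Re w], rule Ck_linear_comp[OF bounded_linear_Im w])
 have eq: "(%x. (cmod (w x))^2) = (%x. Re (w x) * Re (w x) + Im (w x) * Im (w x))"
  by (rule ext) (simp add: cmod_power2 flip: power2_eq_square)
 show "Ck 1 (%x. (cmod (w x))^2)" unfolding eq by (intro Ck_add Ck_mult R)
 note d = Ck1_diff[OF R(1)] Ck1_diff[OF R(2)]
 have "pd b (%x. (cmod (w x))^2) x = 2 * (Re (w x) * Re (pd b w x)) + 2 * (Im (w x) * Im (pd b w x))"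
  unfolding eq
  by (subst pd_add[OF Ck1_diff[OF Ck_mult[OF R(1) R(1)]] Ck1_diff[OF Ck_mult[OF R(2) R(2)]]])
    (simp add: pd_mult[OF d(1,1)] pd_mult[OF d(2,2)] pd_linear_comp[OF bounded_linear_Re Ck1_diff[OF w]]
     pd_linear_comp[OF bounded_linear_Im Ck1_diff[OF w]])
 moreover have "\<bar>Re (w x) * Re (pd b w x)\<bar> <= cmod (w x) * cmod (pd b w x)" "\<bar>Im (w x) * Im (pd b w x)\<bar> <= cmod (w x) * cmod (pd b w x)"
  unfolding abs_mult by (intro mult_mono abs_Re_le_cmod abs_Im_le_cmod; simp)+
 ultimately show "\<bar>pd b (%x. (cmod (w x))^2) x\<bar> <= 4 * (cmod (w x) * cmod (pd b w x))" by linarith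
qed

context surface_patch begin

text \<open>\<open>surface_le_gradient\<close> is applied to \<open>chi\<close> times the squared
  modulus of \<open>w\<close>; the square is differentiable, and its gradient is bounded by products
  of \<open>w\<close> with its derivatives, to which Cauchy-Schwarz applies.\<close>

lemma local_trace_inequality:
 assumes chi: "test_function (ball x0 (r / 2)) chi" "!!x. 0 <= chi x"
 obtains C where "C >= 0" "!!w :: 'a => complex. Ck 1 w ==> (LINT x|sg. chi x * (cmod (w x))^2) <= C * (H1_nrm D w)^2"
proof -
 note chic = test_cont[OF chi(1)]
 obtain B0 where B0: "B0 > 0" "!!x. x : D ==> norm (chi x) <= B0" using continuous_bounded_on_D[OF chic] by metis
 have "EX B>0. ALL x:D. norm (pd b chi x) <= B" if "b : Basis" for b
  using continuous_bounded_on_D[OF test_pd_cont[OF chi(1) that]] by metis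
 then obtain B1 where B1: "!!b x. b : Basis ==> x : D ==> norm (pd b chi x) <= B1 b" "!!b. b : Basis ==> B1 b > 0" by metis
 show ?thesis
 proof (rule that[of "2 * upper_const * (SUM b:Basis. B1 b + B0 * 4)"])
  show "0 <= 2 * upper_const * (SUM b:Basis. B1 b + B0 * 4)"
   using upper_const_pos B0(1) B1(2) by (intro mult_nonneg_nonneg sum_nonneg add_nonneg_nonneg) (auto intro: less_imp_le)
  fix w :: "'a => complex" assume w: "Ck 1 w"
  let ?F = "%x. chi x * (cmod (w x))^2"
  note W = norm_square_Ck1[OF w]
  have F: "Ck 1 ?F" by (rule Ck_mult[OF test_Ck[OF chi(1)] W(1)])
  have supp: "closure {x. chi x * (cmod (w x))^2 ~= 0} <= ball x0 (r / 2)"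
   by (rule order_trans[OF closure_mono test_support[OF chi(1)]]) auto
  have wL: "w : L2 M" by (rule L2_continuous[OF Ck1_continuous[OF w]])
  have "(LINT x|M. \<bar>pd b ?F x\<bar>) <= (B1 b + B0 * 4) * (H1_nrm D w)^2" if b: "b : Basis" for b
  proof -
   have pL: "pd b w : L2 M" by (rule L2_continuous[OF Ck1_pd[OF w b]])
   let ?G = "%x. B1 b * (cmod (w x))^2 + B0 * 4 * (cmod (w x) * cmod (pd b w x))"
   note iw = L2_integrable[OF wL] and ip = L2_mult_int_norm[OF wL pL]
   have "(LINT x|M. \<bar>pd b ?F x\<bar>) <= (LINT x|M. ?G x)"
   proof (rule integral_mono_AE)
    have "integrable M (%x. complex_of_real (pd b ?F x) * 1)"
     by (intro L2_mult_int L2_test one_L2 Ck1_pd[OF F b])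
    hence "integrable M (%x. norm (complex_of_real (pd b ?F x) * 1))" by (rule integrable_norm)
    thus "integrable M (%x. \<bar>pd b ?F x\<bar>)" by simp
    show "integrable M (%x. ?G x)" using iw ip by simp
    show "AE x in M. \<bar>pd b ?F x\<bar> <= ?G x"
    proof (rule AE_M_I)
     fix x assume x: "x : D"
     have "\<bar>pd b ?F x\<bar> <= \<bar>chi x\<bar> * \<bar>pd b (%x. (cmod (w x))^2) x\<bar> + \<bar>pd b chi x\<bar> * (cmod (w x))^2"
      unfolding pd_mult[OF test_diff[OF chi(1)] Ck1_diff[OF W(1)]]
      by (rule order_trans[OF abs_triangle_ineq]) (simp add: abs_mult)
     also have "... <= B0 * (4 * (cmod (w x) * cmod (pd b w x))) + B1 b * (cmod (w x))^2"
      using B0(1) B0(2)[OF x] B1(1)[OF b x] W(2)[of x b] by (intro add_mono mult_mono) auto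
     finally show "\<bar>pd b ?F x\<bar> <= ?G x" by simp
    qed
   qed
   also have "... = B1 b * (L2_nrm M w)^2 + B0 * 4 * (LINT x|M. cmod (w x) * cmod (pd b w x))"
    using iw ip by (simp add: L2_nrm_power2)
   also have "... <= B1 b * (H1_nrm D w)^2 + B0 * 4 * (H1_nrm D w)^2"
   proof (intro add_mono mult_left_mono)
    show "(L2_nrm M w)^2 <= (H1_nrm D w)^2" by (intro power_mono L2_le_H1_nrm) simp
    have "(LINT x|M. cmod (w x) * cmod (pd b w x)) <= L2_nrm M w * L2_nrm M (pd b w)" by (rule L2_Cauchy_Schwarz_norm[OF wL pL])
    also have "L2_nrm M (pd b w) = L2_nrm M (wderiv D b w)" by (rule wderiv_nrm[OF weak_deriv_C1[OF w b], symmetric])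
    also have "L2_nrm M w * L2_nrm M (wderiv D b w) <= H1_nrm D w * H1_nrm D w"
     by (intro mult_mono L2_le_H1_nrm wderiv_le_H1_nrm b) auto
    finally show "(LINT x|M. cmod (w x) * cmod (pd b w x)) <= (H1_nrm D w)^2" by (simp add: power2_eq_square)
   qed (use B0 B1(2)[OF b] in auto)
   finally show ?thesis by (simp add: distrib_right)
  qed
  hence "2 * upper_const * (SUM b:Basis. LINT x|M. \<bar>pd b ?F x\<bar>)
    <= 2 * upper_const * (SUM b:Basis. (B1 b + B0 * 4) * (H1_nrm D w)^2)"
   using upper_const_pos by (intro mult_left_mono sum_mono) auto
  thus "(LINT x|sg. chi x * (cmod (w x))^2) <= 2 * upper_const * (SUM b:Basis. B1 b + B0 * 4) * (H1_nrm D w)^2"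
   using surface_le_gradient[OF F _ supp] chi(2) by (simp add: sum_distrib_right mult.assoc)
 qed
qed

end

section \<open>Traces on the whole boundary\<close>

locale surface_domain = c2_domain +
 assumes dim: "DIM('a) >= 2"
begin

abbreviation sg where "sg \<equiv> surface_measure D"

lemma surface_pouD:
 assumes "pou N chi" "i < N"
 shows "test_function D (chi i) \<or> (EX x0 e gam r. surface_patch D x0 e gam r & test_function (ball x0 (r/2)) (chi i))"
 using pouD(4)[OF assms] surface_patch.intro[OF _ surface_patch_axioms.intro[OF dim]] unfolding localized_def by blast

lemma continuous_measurable_sg:
 fixes g :: "'a => 'b::topological_space"
 assumes "continuous_on UNIV g" shows "g : borel_measurable sg"
 by (rule borel_measurable_surface[OF dim borel_measurable_continuous_onI[OF assms]])

text \<open>Finiteness is what \<open>L2_complete\<close> asks for on the boundary. Locally it holds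
  because a layer over a bounded piece of graph has finite volume; compactness enters through the
  finite partition of unity.\<close>

lemma finite_measure_sg: "finite_measure sg"
proof
 obtain N chi where "pou N chi" by (rule partition_of_unity)
 note chi = pouD(1,2,3)[OF this] surface_pouD[OF this]
 have fin: "nn_integral sg (%x. ennreal (chi i x)) < \<infinity>" if i: "i < N" for i
  using chi(4)[OF i]
 proof (elim disjE exE conjE)
  assume t: "test_function D (chi i)"
  have "nn_integral sg (%x. ennreal (chi i x)) = nn_integral sg (%x. 0)"
  proof (rule nn_integral_cong)
   fix x assume "x : space sg"
   hence "x ~: D" using open_D by (simp add: frontier_def interior_open)
   thus "ennreal (chi i x) = 0" using test_outside[OF t] by simp
  qed
  thus ?thesis by simp
 next
  fix x0 e gam r assume "surface_patch D x0 e gam r" and t: "test_function (ball x0 (r/2)) (chi i)"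
  then interpret P: surface_patch D x0 e gam r by simp
  have "x : cball x0 (r / 2)" if "chi i x ~= 0" for x using that test_outside[OF t, of x] by force
  from P.F_integrable_surface[OF test_cont[OF t] chi(2)[OF i] this]
  have I: "integrable sg (chi i)" .
  have "nn_integral sg (%x. ennreal (chi i x)) = ennreal (LINT x|sg. chi i x)"
   by (rule nn_integral_eq_integral[OF I]) (use chi(2)[OF i] in simp)
  thus ?thesis by simp
 qed
 have "emeasure sg (space sg) = nn_integral sg (%x. 1)" by simp
 also have "... = nn_integral sg (%x. (SUM i<N. ennreal (chi i x)))"
 proof (rule nn_integral_cong)
  fix x assume "x : space sg"
  hence "(SUM i<N. chi i x) = 1" by (intro chi(3)) (simp add: frontier_def)
  thus "1 = (SUM i<N. ennreal (chi i x))" using chi(2) by (subst sum_ennreal) auto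
 qed
 also have "... = (SUM i<N. \<integral>\<^sup>+x. ennreal (chi i x) \<partial>sg)"
  by (rule nn_integral_sum) (use continuous_measurable_sg[OF test_cont[OF chi(1)]] in auto)
 also have "... < \<infinity>" using fin by (simp add: ennreal_sum_less_top)
 finally show "emeasure sg (space sg) ~= \<infinity>" by simp
qed

lemma continuous_bounded_on_frontier:
 fixes g :: "'a => 'b::real_normed_vector"
 assumes "continuous_on UNIV g"
 obtains B where "B >= 0" "!!x. x : frontier D ==> norm (g x) <= B"
proof -
 have "compact (g ` frontier D)"
  using assms bounded_D by (intro compact_continuous_image compact_frontier_bounded) (auto intro: continuous_on_subset)
 then obtain B where "!!y. y : g ` frontier D ==> norm y <= B" using compact_imp_bounded bounded_iff by metis
 thus ?thesis using norm_ge_zero order_trans by (intro that[of "max B 0"]) (auto simp: le_max_iff_disj)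
qed

lemma L2_sg_one: "(%x. 1) : L2 sg"
proof -
 interpret finite_measure sg by (rule finite_measure_sg)
 show ?thesis by (simp add: L2_def)
qed

lemma L2_sg_continuous: "continuous_on UNIV w ==> w : L2 sg"
proof -
 assume w: "continuous_on UNIV w"
 obtain B where "B >= 0" "!!x. x : frontier D ==> norm (w x) <= B" using continuous_bounded_on_frontier[OF w] by metis
 hence "AE x in sg. cmod (w x) <= B" by (intro AE_I2) simp
 from L2_bounded_mult[OF continuous_measurable_sg[OF w] this L2_sg_one] show "w : L2 sg" by simp
qed

lemma trace_inequality:
 obtains C where "C >= 0" "!!w :: 'a => complex. Ck 1 w ==> L2_nrm sg w <= C * H1_nrm D w"
proof -
 obtain N chi where "pou N chi" by (rule partition_of_unity)
 note chi = pouD(1,2,3)[OF this] surface_pouD[OF this]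
 have "EX C>=0. ALL w :: 'a => complex. Ck 1 w --> (LINT x|sg. chi i x * (cmod (w x))^2) <= C * (H1_nrm D w)^2" if i: "i < N" for i
  using chi(4)[OF i]
 proof (elim disjE exE conjE)
  assume t: "test_function D (chi i)"
  have "(LINT x|sg. chi i x * (cmod (w x))^2) = (LINT x|sg. 0)" for w :: "'a => complex"
  proof (rule Bochner_Integration.integral_cong[OF refl])
   fix x assume "x : space sg"
   hence "x ~: D" using open_D by (simp add: frontier_def interior_open)
   thus "chi i x * (cmod (w x))^2 = 0" using test_outside[OF t] by simp
  qed
  thus ?thesis by (intro exI[of _ 0]) simp
 next
  fix x0 e gam r assume "surface_patch D x0 e gam r" and t: "test_function (ball x0 (r/2)) (chi i)"
  then interpret P: surface_patch D x0 e gam r by simp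
  show ?thesis by (rule P.local_trace_inequality[OF t chi(2)[OF i]]) blast
 qed
 then obtain C where C: "!!i. i < N ==> C i >= 0"
  "!!i w. i < N ==> Ck 1 (w :: 'a => complex) ==> (LINT x|sg. chi i x * (cmod (w x))^2) <= C i * (H1_nrm D w)^2" by metis
 have S: "(SUM i<N. C i) >= 0" by (rule sum_nonneg) (use C(1) in simp)
 show ?thesis
 proof (rule that[of "sqrt (SUM i<N. C i)"])
  fix w :: "'a => complex" assume w: "Ck 1 w"
  note wL = L2_sg_continuous[OF Ck1_continuous[OF w]]
  have int: "integrable sg (%x. chi i x * (cmod (w x))^2)" if i: "i < N" for i
  proof -
   have c: "continuous_on UNIV (%x. of_real (chi i x) * w x)"
    by (intro continuous_on_mult continuous_on_of_real test_cont[OF chi(1)[OF i]] Ck1_continuous[OF w])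
   from integrable_norm[OF L2_mult_int[OF L2_sg_continuous[OF c] wL]]
   show ?thesis using chi(2)[OF i] by (simp add: norm_mult power2_eq_square mult.assoc)
  qed
  have "(L2_nrm sg w)^2 = (LINT x|sg. (SUM i<N. chi i x * (cmod (w x))^2))"
   unfolding L2_nrm_power2
  proof (rule Bochner_Integration.integral_cong[OF refl])
   fix x assume "x : space sg"
   hence "(SUM i<N. chi i x) = 1" by (intro chi(3)) (simp add: frontier_def)
   thus "(cmod (w x))^2 = (SUM i<N. chi i x * (cmod (w x))^2)" by (simp flip: sum_distrib_right)
  qed
  also have "... = (SUM i<N. LINT x|sg. chi i x * (cmod (w x))^2)" using int by (intro Bochner_Integration.integral_sum) auto
  also have "... <= (SUM i<N. C i * (H1_nrm D w)^2)" using C(2)[OF _ w] by (intro sum_mono) auto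
  also have "... = (sqrt (SUM i<N. C i) * H1_nrm D w)^2" using S by (simp add: power_mult_distrib sum_distrib_right)
  finally show "L2_nrm sg w <= sqrt (SUM i<N. C i) * H1_nrm D w" by (rule power2_le_imp_le) (simp add: S)
 qed (simp add: S)
qed

definition trace_const where "trace_const = (SOME C. C >= 0 & (ALL w :: 'a => complex. Ck 1 w --> L2_nrm sg w <= C * H1_nrm D w))"

lemma trace_const: "trace_const >= 0" "Ck 1 w ==> L2_nrm sg w <= trace_const * H1_nrm D w"
proof -
 have "EX C>=0. ALL w :: 'a => complex. Ck 1 w --> L2_nrm sg w <= C * H1_nrm D w" by (rule trace_inequality) blast
 from someI_ex[OF this] show "trace_const >= 0" "Ck 1 w ==> L2_nrm sg w <= trace_const * H1_nrm D w"
  unfolding trace_const_def by blast+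
qed

lemma H1_nrm_le: "H1_nrm D f <= L2_nrm M f + (SUM b:Basis. L2_nrm M (wderiv D b f))"
proof -
 have "H1_nrm D f <= sqrt ((L2_nrm M f)^2) + sqrt (SUM b:Basis. (L2_nrm M (wderiv D b f))^2)"
  unfolding H1_nrm_def by (rule sqrt_add_le_add_sqrt) (auto intro: sum_nonneg)
 also have "sqrt (SUM b:Basis. (L2_nrm M (wderiv D b f))^2) <= (SUM b:Basis. L2_nrm M (wderiv D b f))"
  using L2_set_le_sum[of Basis "%b. L2_nrm M (wderiv D b f)"] by (simp add: L2_set_def)
 finally show ?thesis by simp
qed

text \<open>Smooth functions that converge in H1 have boundary restrictions that are Cauchy in L2 by
  the trace inequality.\<close>

lemma has_trace_exists:
 assumes u: "u : H1 D" shows "EX g. has_trace D u g"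
proof -
 obtain w where w: "!!n::nat. smooth (w n)" "(%n. H1_nrm D (%x. w n x - u x)) ----> 0"
  using H1_smooth_dense[OF u] by metis
 note lim = H1_tendsto_components[OF w(1) u w(2)]
 note w1 = smooth_imp_Ck[OF w(1), where k=1]
 define a where "a n = L2_nrm M (%x. w n x - u x) + (SUM b:Basis. L2_nrm M (%x. pd b (w n) x - wderiv D b u x))" for n
 have a: "a ----> 0"
 proof -
  have "a ----> 0 + (SUM b:(Basis::'a set). 0)" unfolding a_def[abs_def] by (intro tendsto_add tendsto_sum lim)
  thus ?thesis by simp
 qed
 have wL: "w n : L2 M" "pd b (w n) : L2 M" if "b : Basis" for n b
  using L2_continuous[OF Ck1_continuous[OF w1]] L2_continuous[OF Ck1_pd[OF w1 that]] by auto
 have diff: "L2_nrm sg (%x. w m x - w n x) <= trace_const * (a m + a n)" for m n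
 proof -
  have "L2_nrm sg (%x. w m x - w n x) <= trace_const * H1_nrm D (%x. w m x - w n x)"
   by (intro trace_const Ck_diff w1)
  also have "... <= trace_const * (a m + a n)"
  proof (rule mult_left_mono[OF _ trace_const(1)])
   obtain b0 :: 'a where b0: "b0 : Basis" using nonempty_Basis by blast
   have 1: "L2_nrm M (%x. w m x - w n x) <= L2_nrm M (%x. w m x - u x) + L2_nrm M (%x. w n x - u x)"
    using L2_triangle_diff[OF wL(1)[OF b0, of m] H1_L2[OF u] wL(1)[OF b0, of n]] L2_nrm_minus_commute[of M u "w n"] by simp
   have 2: "L2_nrm M (wderiv D b (%x. w m x - w n x)) <= L2_nrm M (%x. pd b (w m) x - wderiv D b u x) + L2_nrm M (%x. pd b (w n) x - wderiv D b u x)"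
    if b: "b : Basis" for b
   proof -
    have "L2_nrm M (wderiv D b (%x. w m x - w n x)) = L2_nrm M (%x. pd b (w m) x - pd b (w n) x)"
     by (intro wderiv_nrm weak_deriv_diff weak_deriv_C1 w1 b)
    thus ?thesis
     using L2_triangle_diff[OF wL(2)[OF b, of m] wderiv_L2[OF u b] wL(2)[OF b, of n]] L2_nrm_minus_commute[of M "wderiv D b u" "pd b (w n)"] by simp
   qed
   show "H1_nrm D (%x. w m x - w n x) <= a m + a n"
    using H1_nrm_le[of "%x. w m x - w n x"] 1 sum_mono[OF 2, of Basis "%b. b"] by (simp add: a_def sum.distrib)
  qed
  finally show ?thesis .
 qed
 have wS: "w n : L2 sg" for n by (rule L2_sg_continuous[OF Ck1_continuous[OF w1]])
 have Cauchy: "EX K. ALL m>=K. ALL n>=K. L2_nrm sg (%x. w m x - w n x) < e" if e: "e > 0" for e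
 proof -
  have "(%n. trace_const * a n) ----> trace_const * 0" by (intro tendsto_mult tendsto_const a)
  hence "\<forall>\<^sub>F n in sequentially. trace_const * a n < e / 2" by (rule order_tendstoD) (use e in simp)
  then obtain K where K: "!!n. n >= K ==> trace_const * a n < e / 2" by (auto simp: eventually_sequentially)
  have "L2_nrm sg (%x. w m x - w n x) < e" if "m >= K" "n >= K" for m n
   using diff[of m n] K[OF that(1)] K[OF that(2)] by (simp add: distrib_left)
  thus ?thesis by blast
 qed
 obtain g where "g : L2 sg" "(%n. L2_nrm sg (%x. w n x - g x)) ----> 0"
  by (rule L2_complete[OF finite_measure_sg wS Cauchy])
 thus ?thesis using w u unfolding has_trace_def by blast
qed

lemma has_trace_trace: "u : H1 D ==> has_trace D u (trace D u)"
 unfolding trace_def by (rule someI_ex[OF has_trace_exists])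

lemma has_trace_L2: "has_trace D u g ==> g : L2 sg" and has_trace_H1: "has_trace D u g ==> u : H1 D"
 by (auto simp: has_trace_def)

lemma has_trace_lincomb:
 assumes u: "has_trace D u g" and v: "has_trace D v f"
 shows "has_trace D (%x. a * u x + c * v x) (%x. a * g x + c * f x)"
proof -
 obtain w where w: "!!n::nat. smooth (w n)" "(%n. H1_nrm D (%x. w n x - u x)) ----> 0" "(%n. L2_nrm sg (%x. w n x - g x)) ----> 0"
  using u unfolding has_trace_def by blast
 obtain z where z: "!!n::nat. smooth (z n)" "(%n. H1_nrm D (%x. z n x - v x)) ----> 0" "(%n. L2_nrm sg (%x. z n x - f x)) ----> 0"
  using v unfolding has_trace_def by blast
 note uH = has_trace_H1[OF u] and vH = has_trace_H1[OF v] and gL = has_trace_L2[OF u] and fL = has_trace_L2[OF v]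
 note lw = H1_tendsto_components[OF w(1) uH w(2)] and lz = H1_tendsto_components[OF z(1) vH z(2)]
 note w1 = smooth_imp_Ck[OF w(1), where k=1] and z1 = smooth_imp_Ck[OF z(1), where k=1]
 let ?d = "%n x. a * (w n x - u x) + c * (z n x - v x)"
 have comb: "(%n. L2_nrm K (%x. a * (p n x - p' x) + c * (q n x - q' x))) ----> 0"
  if "!!n::nat. p n : L2 K" "p' : L2 K" "!!n. q n : L2 K" "q' : L2 K"
   "(%n. L2_nrm K (%x. p n x - p' x)) ----> 0" "(%n. L2_nrm K (%x. q n x - q' x)) ----> 0" for K :: "'a measure" and p p' q q'
 proof (rule tendsto_0_dominated)
  have "(%n. cmod a * L2_nrm K (%x. p n x - p' x) + cmod c * L2_nrm K (%x. q n x - q' x)) ----> cmod a * 0 + cmod c * 0"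
   by (intro tendsto_intros that)
  thus "(%n. cmod a * L2_nrm K (%x. p n x - p' x) + cmod c * L2_nrm K (%x. q n x - q' x)) ----> 0" by simp
  show "L2_nrm K (%x. a * (p n x - p' x) + c * (q n x - q' x)) <= cmod a * L2_nrm K (%x. p n x - p' x) + cmod c * L2_nrm K (%x. q n x - q' x)" for n
   using L2_triangle[OF L2_cmult[OF L2_diff[OF that(1,2)], of a] L2_cmult[OF L2_diff[OF that(3,4)], of c], of n n] by (simp add: L2_nrm_cmult)
 qed simp
 have wL: "w n : L2 M" "z n : L2 M" "w n : L2 sg" "z n : L2 sg" for n
  using L2_continuous L2_sg_continuous Ck1_continuous[OF w1] Ck1_continuous[OF z1] by auto
 have pL: "pd b (w n) : L2 M" "pd b (z n) : L2 M" if "b : Basis" for n b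
  using L2_continuous Ck1_pd[OF w1 that] Ck1_pd[OF z1 that] by auto
 have "(%n. H1_nrm D (?d n)) ----> 0"
 proof (rule H1_nrm_tendsto_0)
  show "(%n. L2_nrm M (?d n)) ----> 0"
   by (rule comb[OF wL(1) H1_L2[OF uH] wL(2) H1_L2[OF vH] lw(1) lz(1)])
  fix b :: 'a assume b: "b : Basis"
  have "L2_nrm M (wderiv D b (?d n))
   = L2_nrm M (%x. a * (pd b (w n) x - wderiv D b u x) + c * (pd b (z n) x - wderiv D b v x))" for n
   by (intro wderiv_nrm weak_deriv_add weak_deriv_cmult weak_deriv_diff weak_deriv_C1 H1_wderiv uH vH w1 z1 b)
  thus "(%n. L2_nrm M (wderiv D b (?d n))) ----> 0"
   using comb[OF pL(1)[OF b] wderiv_L2[OF uH b] pL(2)[OF b] wderiv_L2[OF vH b] lw(2)[OF b] lz(2)[OF b]] by simp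
 qed
 moreover have "(%n. L2_nrm sg (%x. a * (w n x - g x) + c * (z n x - f x))) ----> 0"
  by (rule comb[OF wL(3) gL wL(4) fL w(3) z(3)])
 moreover have "smooth (%x. a * w n x + c * z n x)" for n
  using w(1)[of n] z(1)[of n] unfolding smooth_def by (intro allI Ck_add Ck_mult Ck_const) auto
 ultimately show ?thesis
  unfolding has_trace_def
  by (intro conjI H1_add H1_cmult uH vH L2_add L2_cmult gL fL exI[of _ "%n x. a * w n x + c * z n x"])
    (simp_all add: algebra_simps)
qed

lemma has_trace_nrm:
 assumes t: "has_trace D u g" shows "L2_nrm sg g <= trace_const * H1_nrm D u"
proof -
 obtain w where w: "!!n::nat. smooth (w n)" "(%n. H1_nrm D (%x. w n x - u x)) ----> 0" "(%n. L2_nrm sg (%x. w n x - g x)) ----> 0"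
  using t unfolding has_trace_def by blast
 note uH = has_trace_H1[OF t]
 note lim = H1_tendsto_components[OF w(1) uH w(2)]
 note w1 = smooth_imp_Ck[OF w(1), where k=1]
 have "(%n. H1_nrm D (w n)) ----> H1_nrm D u"
  unfolding H1_nrm_def wderiv_nrm[OF weak_deriv_C1[OF w1]]
 proof (intro tendsto_real_sqrt tendsto_add tendsto_sum tendsto_power)
  show "(%n. L2_nrm M (w n)) ----> L2_nrm M u"
   by (rule L2_tendsto_nrm[OF L2_continuous[OF Ck1_continuous[OF w1]] H1_L2[OF uH] lim(1)])
  fix b :: 'a assume b: "b : Basis"
  have "(%n. L2_nrm M (pd b (w n))) ----> L2_nrm M (wderiv D b u)"
   by (rule L2_tendsto_nrm[OF L2_continuous[OF Ck1_pd[OF w1 b]] wderiv_L2[OF uH b] lim(2)[OF b]])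
  thus "(%n. L2_nrm M (wderiv D b (w n))) ----> L2_nrm M (wderiv D b u)"
   by (simp add: wderiv_nrm[OF weak_deriv_C1[OF w1 b]])
 qed
 hence R: "(%n. trace_const * H1_nrm D (w n)) ----> trace_const * H1_nrm D u" by (intro tendsto_mult tendsto_const)
 have L: "(%n. L2_nrm sg (w n)) ----> L2_nrm sg g"
  by (rule L2_tendsto_nrm[OF L2_sg_continuous[OF Ck1_continuous[OF w1]] has_trace_L2[OF t] w(3)])
 show ?thesis by (rule LIMSEQ_le[OF L R]) (use trace_const(2)[OF w1] in blast)
qed

lemma has_trace_unique:
 assumes "has_trace D u g" "has_trace D v f" and eq: "AE x in M. u x = v x"
 shows "AE x in sg. g x = f x"
proof -
 have t: "has_trace D (%x. u x - v x) (%x. g x - f x)"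
  using has_trace_lincomb[OF assms(1,2), of 1 "-1"] by simp
 note uH = has_trace_H1[OF assms(1)] and vH = has_trace_H1[OF assms(2)]
 have "AE x in M. u x - v x = 0" using eq by simp
 hence z: "L2_nrm M (%x. u x - v x) = 0" by (simp add: L2_nrm_eq_0_iff L2_diff H1_L2 uH vH)
 have "L2_nrm M (wderiv D b (%x. u x - v x)) = 0" if b: "b : Basis" for b
 proof -
  have "AE x in M. wderiv D b v x = wderiv D b u x"
   by (rule H1_cong_AE(2)[OF uH eq L2_measurable[OF H1_L2[OF vH]] b])
  hence "AE x in M. wderiv D b (%x. u x - v x) x = 0"
   using wderiv_diff[OF uH vH b] by eventually_elim simp
  thus ?thesis by (simp add: L2_nrm_eq_0_iff wderiv_L2 H1_diff uH vH b)
 qed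
 hence "H1_nrm D (%x. u x - v x) = 0" using z by (simp add: H1_nrm_def)
 hence "L2_nrm sg (%x. g x - f x) <= 0" using has_trace_nrm[OF t] by simp
 hence "L2_nrm sg (%x. g x - f x) = 0" by (simp add: antisym)
 hence "AE x in sg. g x - f x = 0" by (simp add: L2_nrm_eq_0_iff L2_diff has_trace_L2[OF assms(1)] has_trace_L2[OF assms(2)])
 thus ?thesis by simp
qed

lemma trace_L2: "u : H1 D ==> trace D u : L2 sg" by (rule has_trace_L2[OF has_trace_trace])

lemma trace_nrm: "u : H1 D ==> L2_nrm sg (trace D u) <= trace_const * H1_nrm D u" by (rule has_trace_nrm[OF has_trace_trace])

lemma trace_lincomb:
 assumes u: "u : H1 D" and v: "v : H1 D" and w: "w : H1 D" and eq: "AE x in M. w x = a * u x + c * v x"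
 shows "AE x in sg. trace D w x = a * trace D u x + c * trace D v x"
 by (rule has_trace_unique[OF has_trace_trace[OF w] has_trace_lincomb[OF has_trace_trace[OF u] has_trace_trace[OF v]] eq])

text \<open>Take smooth \<open>w n\<close> tending to \<open>u\<close> whose boundary values tend to
  0. By \<open>integral_pd_le_surface\<close> the boundary contribution to integration by parts
  against functions reaching across the boundary vanishes in the limit. This is done for each
  function of the partition of unity, and the pieces are added.\<close>

lemma trace_0_H10:
 assumes u: "u : H1 D" and 0: "AE x in sg. trace D u x = 0"
 shows "u : H10"
proof -
 note uL = H1_L2[OF u]
 obtain w where w: "!!n::nat. smooth (w n)" "(%n. H1_nrm D (%x. w n x - u x)) ----> 0" "(%n. L2_nrm sg (%x. w n x - trace D u x)) ----> 0"
  using has_trace_trace[OF u] unfolding has_trace_def by blast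
 note lim = H1_tendsto_components[OF w(1) u w(2)]
 note w1 = smooth_imp_Ck[OF w(1), where k=1]
 have wS: "w n : L2 sg" for n by (rule L2_sg_continuous[OF Ck1_continuous[OF w1]])
 have w0: "(%n. L2_nrm sg (w n)) ----> 0"
 proof -
  have "L2_nrm sg (trace D u) = 0" using 0 by (simp add: L2_nrm_eq_0_iff trace_L2[OF u])
  thus ?thesis using L2_tendsto_nrm[OF wS trace_L2[OF u] w(3)] by simp
 qed
 obtain N chi where "pou N chi" by (rule partition_of_unity)
 note chi = pouD(1,2,3)[OF this] surface_pouD[OF this]
 have "(%x. of_real (chi i x) * u x) : H10" if i: "i < N" for i
  using chi(4)[OF i]
 proof (elim disjE exE conjE)
  assume "test_function D (chi i)"
  thus ?thesis by (rule H10_mult_test[OF u])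
 next
  fix x0 e gam r assume "surface_patch D x0 e gam r" and t: "test_function (ball x0 (r/2)) (chi i)"
  then interpret P: surface_patch D x0 e gam r by simp
  obtain C where C: "C >= 0" "!!F b. Ck 1 F ==> closure {x. F x ~= (0::complex)} <= ball x0 (r / 2) ==> b : Basis ==>
   cmod (LINT x|M. pd b F x) <= C * (LINT x|sg. cmod (F x))" by (rule P.integral_pd_le_surface) blast
  show ?thesis
  proof (rule H10_mult_testI[OF H1_wderiv[OF u] test_smooth[OF t]])
   fix b :: 'a and phi :: "'a => real" assume b: "b : Basis" and phi: "test_function UNIV phi"
   define psi where "psi x = chi i x * phi x" for x
   have psi: "test_function (ball x0 (r/2)) psi" unfolding psi_def[abs_def] by (rule test_mult[OF t test_smooth[OF phi]])
   let ?A = "%n. (LINT x|M. w n x * of_real (pd b psi x)) + (LINT x|M. pd b (w n) x * of_real (psi x))"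
   let ?B = "(LINT x|M. u x * of_real (pd b psi x)) + (LINT x|M. wderiv D b u x * of_real (psi x))"
   note psic = test_cont[OF psi] test_pd_cont[OF psi b]
   have psiC: "Ck 1 (%x. complex_of_real (psi x))" by (rule Ck_linear_comp[OF bounded_linear_of_real test_Ck[OF psi]])
   note wc = L2_continuous[OF Ck1_continuous[OF w1]] L2_continuous[OF Ck1_pd[OF w1 b]]
   note psiL = L2_test[OF psic(1)] L2_test[OF psic(2)]
   have "(%n. ?A n)
    ----> ?B"
    by (intro tendsto_add L2_tendsto_integral[OF wc(1) uL lim(1) psiL(2)] L2_tendsto_integral[OF wc(2) wderiv_L2[OF u b] lim(2)[OF b] psiL(1)])
   moreover have "(%n. ?A n) ----> 0"
   proof (rule tendsto_norm_zero_cancel, rule tendsto_0_dominated)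
    define K where "K = C * L2_nrm sg (%x. of_real (psi x))"
    have "(%n. K * L2_nrm sg (w n)) ----> K * 0" by (intro tendsto_mult tendsto_const w0)
    thus "(%n. K * L2_nrm sg (w n)) ----> 0" by simp
    fix n
    have F: "Ck 1 (%x. w n x * of_real (psi x))" by (rule Ck_mult[OF w1 psiC])
    have "?A n
     = (LINT x|M. pd b (%x. w n x * of_real (psi x)) x)"
     unfolding pd_mult[OF Ck1_diff[OF w1] Ck1_diff[OF psiC]] pd_of_real[OF test_diff[OF psi]]
     by (rule integrable_M_split(1)[OF wc(1) psiL(2) wc(2) psiL(1), symmetric])
    also have "cmod ... <= C * (LINT x|sg. cmod (w n x * of_real (psi x)))"
     by (rule C(2)[OF F _ b], rule order_trans[OF closure_mono test_support[OF psi]]) auto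
    also have "... <= C * (L2_nrm sg (w n) * L2_nrm sg (%x. of_real (psi x)))"
     unfolding norm_mult
     by (intro mult_left_mono C(1) L2_Cauchy_Schwarz_norm wS L2_sg_continuous continuous_on_of_real psic)
    finally show "cmod (?A n) <= K * L2_nrm sg (w n)"
     by (simp add: K_def mult_ac)
   qed simp
   ultimately have "?B = 0"
    by (rule LIMSEQ_unique)
   thus "(LINT x|M. u x * of_real (pd b (%x. chi i x * phi x) x)) = - (LINT x|M. wderiv D b u x * of_real (chi i x * phi x))"
    unfolding psi_def[symmetric] by (simp add: eq_neg_iff_add_eq_0 psi_def[abs_def])
  qed
 qed
 hence s: "(%x. SUM i<N. of_real (chi i x) * u x) : H10" by (intro H10_sum) simp
 define v where "v x = (SUM i<N. of_real (chi i x) * u x)" for x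
 have v: "v : H10" using s by (simp add: v_def[abs_def])
 have eq: "AE x in M. v x = u x"
 proof (rule AE_M_I)
  fix x assume "x : D"
  hence "(SUM i<N. chi i x) = 1" using chi(3) closure_subset by blast
  thus "v x = u x" by (simp add: v_def sum_distrib_right[symmetric] of_real_sum[symmetric] del: of_real_sum)
 qed
 have wd: "has_weak_deriv D b u (wderiv D b v)" if b: "b : Basis" for b
  by (rule weak_deriv_cong[OF H1_wderiv[OF H10_H1[OF v] b] eq _ L2_measurable[OF uL] L2_measurable[OF wderiv_L2[OF H10_H1[OF v] b]] b]) simp
 show ?thesis
 proof (rule H10I[OF wd])
  fix b :: 'a and phi :: "'a => real" assume b: "b : Basis" and phi: "test_function UNIV phi"
  have "(LINT x|M. u x * of_real (pd b phi x)) = (LINT x|M. v x * of_real (pd b phi x))"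
   by (rule integral_cong_AE)
     (use eq in "auto intro!: borel_measurable_times L2_measurable[OF uL] L2_measurable[OF H1_L2[OF H10_H1[OF v]]]
      L2_measurable[OF L2_test[OF test_pd_cont[OF phi b]]] elim: eventually_mono")
  thus "(LINT x|M. u x * of_real (pd b phi x)) = - (LINT x|M. wderiv D b v x * of_real (phi x))"
   using H10D[OF v b phi] by simp
 qed
qed

end

subsection \<open>The outward normal\<close>

context graph_patch begin

definition grad where "grad x = (SUM b:Basis. pd b h x *\<^sub>R b)"

lemma frechet_h: "frechet_derivative h (at x) z = z \<bullet> grad x"
 using pd_basis[of 0 h x z] Ck1_h by (simp add: grad_def inner_sum_right mult.commute)

lemma GDERIV_h: "GDERIV h x :> grad x"
proof -
 have "h differentiable (at x)" by (rule Ck1_diff[OF Ck1_h])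
 hence "(h has_derivative frechet_derivative h (at x)) (at x)" by (simp add: frechet_derivative_works)
 moreover have "frechet_derivative h (at x) = (%z. z \<bullet> grad x)" by (rule ext) (rule frechet_h)
 ultimately show ?thesis by (simp add: gderiv_def)
qed

lemma e_grad: "e \<bullet> grad x = 1"
 using sum_e_pd_h[of x] by (simp add: grad_def inner_sum_right mult.commute)

lemma grad_nonzero: "grad x ~= 0" using e_grad[of x] by auto

lemma continuous_grad: "continuous_on UNIV grad"
 unfolding grad_def[abs_def] by (intro continuous_intros Ck1_pd[OF Ck1_h])

lemma derivative_along: "((%t. h (x + t *\<^sub>R z)) has_real_derivative z \<bullet> grad x) (at 0)"
 using has_real_derivative_along[of h x z 0, OF Ck1_diff[OF Ck1_h]] frechet_h[of x z] by simp

lemma C2_graph_near_point: assumes x: "x : ball x0 r" shows "C2_graph_near D x e gam"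
 unfolding C2_graph_near_def
proof (intro conjI norm_e gam exI[of _ "r - dist x0 x"])
 show "r - dist x0 x > 0" using x by simp
 have "ball x (r - dist x0 x) <= ball x0 r"
 proof
  fix y assume "y : ball x (r - dist x0 x)"
  thus "y : ball x0 r" using dist_triangle[of x0 y x] by simp
 qed
 thus "D \<inter> ball x (r - dist x0 x) = {y : ball x (r - dist x0 x). height_above_graph e gam y < 0}"
  using D_patch by blast
qed

end

context surface_patch begin

text \<open>If the unit normals \<open>s\<close> and \<open>s'\<close> of two charts differed, a
  small step along \<open>s' - s\<close> would lower one height function and raise the other: the
  point reached would lie inside \<open>D\<close> by one chart and outside by the other.\<close>

lemma sgn_grad_unique:
 assumes P: "surface_patch D x0' e' gam' r'" and x: "x : ball x0 r" "x : ball x0' r'" "x : frontier D"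
 shows "sgn (graph_patch.grad e' gam' x) = sgn (grad x)"
proof (rule ccontr)
 interpret P: surface_patch D x0' e' gam' r' by (rule P)
 assume ne: "sgn (P.grad x) ~= sgn (grad x)"
 define s where "s = sgn (grad x)" define s' where "s' = sgn (P.grad x)"
 have n: "norm s = 1" "norm s' = 1" using grad_nonzero P.grad_nonzero by (auto simp: s_def s'_def norm_sgn)
 hence "(norm (s' - s))^2 = 2 - 2 * (s \<bullet> s')"
  by (simp add: power2_norm_eq_inner inner_diff_left inner_diff_right inner_commute norm_eq_1)
 moreover have "(norm (s' - s))^2 > 0" using ne by (simp add: s_def s'_def)
 ultimately have ss: "s \<bullet> s' < 1" by linarith
 have g: "grad x = norm (grad x) *\<^sub>R s" "P.grad x = norm (P.grad x) *\<^sub>R s'"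
  using grad_nonzero P.grad_nonzero by (simp_all add: s_def s'_def sgn_div_norm)
 have s1: "s \<bullet> s = 1" "s' \<bullet> s' = 1" using n by (simp_all add: norm_eq_1)
 have "(s' - s) \<bullet> grad x = norm (grad x) * (s \<bullet> s' - 1)"
  by (subst g(1)) (simp add: inner_diff_left inner_diff_right s1 inner_commute)
 also have "... < 0" using ss grad_nonzero by (intro mult_pos_neg) auto
 finally obtain d where d: "d > 0" "!!t. 0 < t ==> t < d ==> h (x + t *\<^sub>R (s' - s)) < h x"
  using DERIV_neg_dec_right[OF derivative_along[of x "s' - s"]] by auto
 have "(s' - s) \<bullet> P.grad x = norm (P.grad x) * (1 - s \<bullet> s')"
  by (subst g(2)) (simp add: inner_diff_left inner_diff_right s1 inner_commute)
 also have "... > 0" using ss P.grad_nonzero by (intro mult_pos_pos) auto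
 finally obtain d' where d': "d' > 0" "!!t. 0 < t ==> t < d' ==> P.h x < P.h (x + t *\<^sub>R (s' - s))"
  using DERIV_pos_inc_right[OF P.derivative_along[of x "s' - s"]] by auto
 have "open (ball x0 r \<inter> ball x0' r')" by auto
 then obtain rho where rho: "rho > 0" "ball x rho <= ball x0 r \<inter> ball x0' r'" using x openE by (metis IntI)
 define t where "t = Min {d / 2, d' / 2, rho / 4}"
 have t: "0 < t" "t < d" "t < d'" "t <= rho / 4" using d(1) d'(1) rho(1) by (auto simp: t_def min_less_iff_disj)
 define y where "y = x + t *\<^sub>R (s' - s)"
 have "norm (s' - s) <= 2" using norm_triangle_ineq4[of s' s] n by simp
 hence "t * norm (s' - s) <= rho / 4 * 2" using t rho(1) by (intro mult_mono) auto
 hence "dist x y < rho" using t(1) rho(1) by (simp add: y_def dist_norm)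
 hence y: "y : ball x0 r" "y : ball x0' r'" using rho(2) by auto
 have "h x = 0" "P.h x = 0" using frontier_iff[OF x(1)] P.frontier_iff[OF x(2)] x(3) by auto
 hence "h y < 0" "P.h y > 0" using d(2)[OF t(1,2)] d'(2)[OF t(1,3)] by (auto simp: y_def)
 thus False using D_iff[OF y(1)] P.D_iff[OF y(2)] by simp
qed

text \<open>The definite description ranges over all charts near \<open>x\<close> and denotes
  because they agree on the normalized gradient. Using one chart for all nearby boundary points then
  gives continuity of the normal.\<close>

lemma outward_normal_eq:
 assumes x: "x : ball x0 r" "x : frontier D" shows "outward_normal D x = sgn (grad x)"
 unfolding outward_normal_def
proof (rule the_equality)
 show "EX e gam v. C2_graph_near D x e gam & (GDERIV (height_above_graph e gam) x :> v) & sgn (grad x) = sgn v"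
  using C2_graph_near_point[OF x(1)] GDERIV_h[of x] unfolding h_def by blast
 fix nu assume "EX e gam v. C2_graph_near D x e gam & (GDERIV (height_above_graph e gam) x :> v) & nu = sgn v"
 then obtain e' gam' v where 1: "C2_graph_near D x e' gam'" "GDERIV (height_above_graph e' gam') x :> v" "nu = sgn v" by blast
 from 1(1) obtain r' where r': "r' > 0" "norm e' = 1" "Ck 2 gam'" "D \<inter> ball x r' = {y : ball x r'. height_above_graph e' gam' y < 0}"
  by (auto simp: C2_graph_near_def)
 have P: "surface_patch D x e' gam' r'" using r' open_D bounded_D dim by unfold_locales auto
 interpret P: surface_patch D x e' gam' r' by (rule P)
 have "(%z. z \<bullet> v) = (%z. z \<bullet> P.grad x)"
  using has_derivative_unique[OF 1(2)[unfolded gderiv_def] P.GDERIV_h[of x, unfolded gderiv_def P.h_def]] .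
 hence "z \<bullet> (v - P.grad x) = 0" for z by (metis inner_diff_right right_minus_eq)
 hence "v = P.grad x" using inner_eq_zero_iff[of "v - P.grad x"] by simp
 thus "nu = sgn (grad x)" using sgn_grad_unique[OF P x(1) _ x(2)] 1(3) r'(1) by simp
qed

end

context surface_domain begin

lemma patch_at: "x : frontier D ==> EX e gam r. surface_patch D x e gam r"
 using patch_exists[of x] dim by (metis surface_patch.intro surface_patch_axioms.intro)

lemma norm_outward_normal: "x : frontier D ==> norm (outward_normal D x) = 1"
proof -
 assume x: "x : frontier D"
 obtain e gam r where "surface_patch D x e gam r" using patch_at[OF x] by blast
 then interpret P: surface_patch D x e gam r by simp
 show ?thesis using P.outward_normal_eq[of x] x P.r P.grad_nonzero by (simp add: norm_sgn)
qed

lemma continuous_outward_normal: "continuous_on (frontier D) (outward_normal D)"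
 unfolding continuous_on_eq_continuous_within
proof
 fix x assume x: "x : frontier D"
 obtain e gam r where "surface_patch D x e gam r" using patch_at[OF x] by blast
 then interpret P: surface_patch D x e gam r by simp
 have "isCont P.grad x" using P.continuous_grad by (simp add: continuous_on_eq_continuous_at)
 hence "continuous (at x within frontier D) P.grad" by (rule continuous_at_imp_continuous_at_within)
 hence "continuous (at x within frontier D) (%y. sgn (P.grad y))"
  unfolding continuous_within by (rule tendsto_sgn) (rule P.grad_nonzero)
 thus "continuous (at x within frontier D) (outward_normal D)"
  by (rule continuous_transform_within[OF _ P.r x]) (use P.outward_normal_eq in "auto simp: dist_commute")
qed

lemma outward_normal_measurable: "(%x. complex_of_real (outward_normal D x \<bullet> b)) : borel_measurable sg"
proof -
 have "(%x. indicator (frontier D) x *\<^sub>R outward_normal D x) : borel_measurable borel"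
  by (rule borel_measurable_continuous_on_indicator[OF _ continuous_outward_normal]) simp
 hence "(%x. indicator (frontier D) x *\<^sub>R outward_normal D x) : borel_measurable sg"
  by (rule borel_measurable_surface[OF dim])
 hence "outward_normal D : borel_measurable sg"
  by (rule measurable_cong[THEN iffD1, rotated]) simp
 thus ?thesis by measurable
qed

lemma outward_normal_bound: "b : Basis ==> AE x in sg. cmod (complex_of_real (outward_normal D x \<bullet> b)) <= 1"
proof (rule AE_I2)
 fix x assume "b : Basis" "x : space sg"
 thus "cmod (complex_of_real (outward_normal D x \<bullet> b)) <= 1"
  using Basis_le_norm[of b "outward_normal D x"] norm_outward_normal[of x] by simp
qed

lemma normal_deriv_L2: assumes u: "u : H2 D" shows "normal_deriv D u : L2 sg"
 unfolding normal_deriv_def[abs_def]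
 by (intro L2_sum L2_bounded_mult[OF outward_normal_measurable outward_normal_bound] trace_L2 H2_wderiv u)

lemma H1_wderiv_le_H2_nrm: assumes b: "b : Basis" shows "H1_nrm D (wderiv D b u) <= H2_nrm D u"
proof (rule power2_le_imp_le)
 have "(SUM c:Basis. (L2_nrm M (wderiv D c (wderiv D b u)))^2) <= (SUM b:Basis. SUM c:Basis. (L2_nrm M (wderiv D c (wderiv D b u)))^2)"
  by (rule member_le_sum[OF b]) (auto intro: sum_nonneg)
 moreover have "(L2_nrm M (wderiv D b u))^2 <= (H1_nrm D u)^2" by (intro power_mono wderiv_le_H1_nrm b) simp
 ultimately show "(H1_nrm D (wderiv D b u))^2 <= (H2_nrm D u)^2"
  unfolding H2_nrm_power2 H1_nrm_power2[of "wderiv D b u"] by linarith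
qed simp

lemma normal_deriv_nrm:
 assumes u: "u : H2 D" shows "L2_nrm sg (normal_deriv D u) <= real DIM('a) * trace_const * H2_nrm D u"
proof -
 note L = L2_bounded_mult[OF outward_normal_measurable outward_normal_bound trace_L2[OF H2_wderiv[OF u]]]
 let ?f = "%b x.  of_real (outward_normal D x \<bullet> b) * trace D (wderiv D b u) x"
 have "L2_nrm sg (normal_deriv D u) <= (SUM b:Basis. L2_nrm sg (?f b))"
  unfolding normal_deriv_def[abs_def] by (rule L2_triangle_sum) (rule L)
 also have "... <= (SUM b:(Basis::'a set). trace_const * H2_nrm D u)"
 proof (rule sum_mono)
  fix b :: 'a assume b: "b : Basis"
  have "L2_nrm sg (?f b) <= 1 * L2_nrm sg (trace D (wderiv D b u))"
   by (rule L2_nrm_bounded_mult[OF outward_normal_measurable outward_normal_bound[OF b] trace_L2[OF H2_wderiv[OF u b]]]) simp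
  also have "... <= trace_const * H1_nrm D (wderiv D b u)" using trace_nrm[OF H2_wderiv[OF u b]] by simp
  also have "... <= trace_const * H2_nrm D u" by (intro mult_left_mono H1_wderiv_le_H2_nrm b trace_const)
  finally show "L2_nrm sg (?f b) <= trace_const * H2_nrm D u" .
 qed
 finally show ?thesis by simp
qed

end

subsection \<open>The Hilbert space structure of \<open>H2\<close>\<close>

text \<open>Multi-indices as lists, outermost derivative first, which makes the squared H2 norm one
  sum over a finite index set.\<close>

definition jet :: "'a::euclidean_space set => 'a list => ('a => complex) => 'a => complex" where
 "jet D bs u = foldr (wderiv D) bs u"

definition jets2 :: "'a::euclidean_space list set" where
 "jets2 = {bs. set bs <= Basis & length bs <= 2}"

lemma jet_simps [simp]: "jet D [] u = u" "jet D (b # bs) u = wderiv D b (jet D bs u)"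
 by (simp_all add: jet_def)

lemma finite_jets2: "finite jets2"
 unfolding jets2_def by (rule finite_lists_length_le) simp

lemma jets2_eq: "jets2 = insert [] ((%b. [b]) ` Basis \<union> (%(b, c). [c, b]) ` (Basis \<times> Basis))"
proof (rule set_eqI)
 fix bs :: "'a list"
 show "bs : jets2 \<longleftrightarrow> bs : insert [] ((%b. [b]) ` Basis \<union> (%(b, c). [c, b]) ` (Basis \<times> Basis))"
  by (cases bs rule: remdups_adj.cases) (auto simp: jets2_def)
qed

lemma sum_jets2:
 "(SUM bs:jets2. f bs) = f [] + (SUM b:Basis. f [b]) + (SUM b:Basis. SUM c:Basis. f [c, b] :: real)"
proof -
 have "(SUM bs:jets2. f bs) = f [] + (SUM bs:(%b. [b]) ` Basis \<union> (%(b, c). [c, b]) ` (Basis \<times> Basis). f bs)"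
  unfolding jets2_eq by (rule sum.insert) auto
 also have "(SUM bs:(%b. [b]) ` Basis \<union> (%(b, c). [c, b]) ` (Basis \<times> Basis). f bs)
   = (SUM bs:(%b. [b]) ` Basis. f bs) + (SUM bs:(%(b, c). [c, b]) ` (Basis \<times> Basis). f bs)"
  by (rule sum.union_disjoint) auto
 also have "(SUM bs:(%b. [b]) ` Basis. f bs) = (SUM b:Basis. f [b])" by (subst sum.reindex) (auto simp: inj_on_def)
 also have "(SUM bs:(%(b, c). [c, b]) ` (Basis \<times> Basis). f bs) = (SUM b:Basis. SUM c:Basis. f [c, b])"
  by (subst sum.reindex) (auto simp: inj_on_def sum.cartesian_product case_prod_unfold)
 finally show ?thesis by simp
qed

lemma jets2_cases:
 assumes "bs : jets2"
 obtains "bs = []" | b where "b : Basis" "bs = [b]" | b c where "b : Basis" "c : Basis" "bs = [c, b]"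
 using assms unfolding jets2_eq by auto

context bdd_open begin

lemma H2_nrm_jets: "(H2_nrm D u)^2 = (SUM bs:jets2. (L2_nrm M (jet D bs u))^2)"
 by (simp add: sum_jets2 H2_nrm_power2 H1_nrm_power2)

lemma H2_nrm_L2_set: "H2_nrm D u = L2_set (%bs. L2_nrm M (jet D bs u)) jets2"
 unfolding L2_set_def H2_nrm_jets[symmetric] by simp

lemma jet_L2: "u : H2 D ==> bs : jets2 ==> jet D bs u : L2 M"
 by (erule jets2_cases) (auto intro: H1_L2 H2_H1 wderiv_L2 H2_wderiv)

lemma wderiv_lincomb:
 assumes "u : H1 D" "v : H1 D" "b : Basis"
 shows "AE x in M. wderiv D b (%x. a * u x + c * v x) x = a * wderiv D b u x + c * wderiv D b v x"
 by (rule wderiv_AE[OF weak_deriv_add[OF weak_deriv_cmult[OF H1_wderiv] weak_deriv_cmult[OF H1_wderiv]]]) (rule assms)+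

lemma H1_lincomb: "u : H1 D ==> v : H1 D ==> (%x. a * u x + c * v x) : H1 D"
 by (intro H1_add H1_cmult)

lemma H2_lincomb:
 assumes u: "u : H2 D" and v: "v : H2 D" shows "(%x. a * u x + c * v x) : H2 D"
 unfolding H2_def
proof (intro CollectI conjI ballI)
 show w: "(%x. a * u x + c * v x) : H1 D" by (intro H1_lincomb H2_H1 u v)
 fix b :: 'a assume b: "b : Basis"
 show "wderiv D b (%x. a * u x + c * v x) : H1 D"
 proof (rule H1_cong_AE(1)[OF H1_lincomb[OF H2_wderiv[OF u b] H2_wderiv[OF v b]]])
  show "AE x in M. a * wderiv D b u x + c * wderiv D b v x = wderiv D b (%x. a * u x + c * v x) x"
   using wderiv_lincomb[OF H2_H1[OF u] H2_H1[OF v] b, of a c] by eventually_elim simp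
  show "wderiv D b (%x. a * u x + c * v x) : borel_measurable M" by (rule L2_measurable[OF wderiv_L2[OF w b]])
 qed
qed

lemma wderiv2_lincomb:
 assumes u: "u : H2 D" and v: "v : H2 D" and b: "b : Basis" and d: "d : Basis"
 shows "AE x in M. wderiv D d (wderiv D b (%x. a * u x + c * v x)) x
   = a * wderiv D d (wderiv D b u) x + c * wderiv D d (wderiv D b v) x"
proof -
 have "AE x in M. wderiv D d (wderiv D b (%x. a * u x + c * v x)) x = wderiv D d (%x. a * wderiv D b u x + c * wderiv D b v x) x"
 proof (rule H1_cong_AE(2)[OF H1_lincomb[OF H2_wderiv[OF u b] H2_wderiv[OF v b]] _ _ d])
  show "AE x in M. a * wderiv D b u x + c * wderiv D b v x = wderiv D b (%x. a * u x + c * v x) x"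
   using wderiv_lincomb[OF H2_H1[OF u] H2_H1[OF v] b, of a c] by eventually_elim simp
  show "wderiv D b (%x. a * u x + c * v x) : borel_measurable M"
   by (rule L2_measurable[OF wderiv_L2[OF H1_lincomb[OF H2_H1[OF u] H2_H1[OF v]] b]])
 qed
 with wderiv_lincomb[OF H2_wderiv[OF u b] H2_wderiv[OF v b] d, of a c] show ?thesis by eventually_elim simp
qed

lemma jet_lincomb:
 assumes u: "u : H2 D" and v: "v : H2 D" and bs: "bs : jets2"
 shows "AE x in M. jet D bs (%x. a * u x + c * v x) x = a * jet D bs u x + c * jet D bs v x"
 using bs
proof (cases rule: jets2_cases)
 case 2 thus ?thesis using wderiv_lincomb[OF H2_H1[OF u] H2_H1[OF v]] by simp
next
 case 3 thus ?thesis using wderiv2_lincomb[OF u v] by simp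
qed simp

lemma laplacian_lincomb:
 assumes u: "u : H2 D" and v: "v : H2 D"
 shows "AE x in M. laplacian D (%x. a * u x + c * v x) x = a * laplacian D u x + c * laplacian D v x"
proof -
 have "AE x in M. ALL b:Basis. wderiv D b (wderiv D b (%x. a * u x + c * v x)) x
   = a * wderiv D b (wderiv D b u) x + c * wderiv D b (wderiv D b v) x"
  by (intro AE_finite_allI wderiv2_lincomb u v) auto
 thus ?thesis by eventually_elim (simp add: laplacian_def sum_distrib_left sum.distrib)
qed

lemma L2_lincomb: "u : L2 N ==> v : L2 N ==> (%x. a * u x + c * v x) : L2 N"
 by (intro L2_add L2_cmult)

definition H2_ip :: "('a => complex) => ('a => complex) => real" where
 "H2_ip u v = (SUM bs:jets2. Re (LINT x|M. jet D bs u x * cnj (jet D bs v x)))"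

lemma integral_lincomb_AE:
 assumes L: "w : L2 N" "u : L2 N" "v : L2 N" "g : L2 N" and eq: "AE x in N. w x = a * u x + c * v x"
 shows "(LINT x|N. w x * g x) = a * (LINT x|N. u x * g x) + c * (LINT x|N. v x * g x)"
proof -
 have "(LINT x|N. w x * g x) = (LINT x|N. (a * u x + c * v x) * g x)"
  by (rule integral_cong_AE)
    (use eq in "auto intro!: borel_measurable_times L2_measurable[OF L(1)] L2_measurable[OF L(4)] L2_measurable[OF L2_lincomb[OF L(2,3)]] elim: eventually_mono")
 also have "... = (LINT x|N. a * (u x * g x) + c * (v x * g x))" by (simp add: distrib_right mult.assoc)
 also have "... = a * (LINT x|N. u x * g x) + c * (LINT x|N. v x * g x)"
  using L2_mult_int[OF L(2,4)] L2_mult_int[OF L(3,4)] by simp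
 finally show ?thesis .
qed

lemma H2_ip_lincomb:
 assumes u: "u : H2 D" and v: "v : H2 D" and w: "w : H2 D"
 shows "H2_ip (%x. of_real s * u x + of_real t * v x) w = s * H2_ip u w + t * H2_ip v w"
proof -
 have "(LINT x|M. jet D bs (%x. of_real s * u x + of_real t * v x) x * cnj (jet D bs w x))
   = of_real s * (LINT x|M. jet D bs u x * cnj (jet D bs w x)) + of_real t * (LINT x|M. jet D bs v x * cnj (jet D bs w x))"
  if bs: "bs : jets2" for bs
  by (intro integral_lincomb_AE jet_L2 L2_cnj H2_lincomb u v w bs jet_lincomb)
 thus ?thesis by (simp add: H2_ip_def sum_distrib_left sum.distrib)
qed

lemma H2_complete:
 assumes f: "!!n::nat. f n : H2 D"
  and Cauchy: "!!e. e > 0 ==> EX N. ALL m>=N. ALL n>=N. H2_nrm D (%x. f m x - f n x) < e"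
 shows "EX u:H2 D. (%n. H2_nrm D (%x. f n x - u x)) ----> 0"
proof -
 have diff: "AE x in M. jet D bs (%x. p x - q x) x = jet D bs p x - jet D bs q x"
  if "p : H2 D" "q : H2 D" "bs : jets2" for p q bs
  using jet_lincomb[OF that, of 1 "-1"] by simp
 have diffH: "(%x. p x - q x) : H2 D" if "p : H2 D" "q : H2 D" for p q
  using H2_lincomb[OF that, of 1 "-1"] by simp
 have diffn: "L2_nrm M (jet D bs (%x. p x - q x)) = L2_nrm M (%x. jet D bs p x - jet D bs q x)"
  if "p : H2 D" "q : H2 D" "bs : jets2" for p q bs
  by (rule L2_nrm_cong_AE[OF diff[OF that]])
    (intro L2_measurable[OF jet_L2] L2_measurable[OF L2_diff[OF jet_L2 jet_L2]] diffH that)+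
 have "ALL bs:jets2. EX g. g : L2 M & (%n. L2_nrm M (%x. jet D bs (f n) x - g x)) ----> 0"
 proof
  fix bs :: "'a list" assume bs: "bs : jets2"
  have C: "EX N. ALL m>=N. ALL n>=N. L2_nrm M (%x. jet D bs (f m) x - jet D bs (f n) x) < e" if e: "e > 0" for e
  proof -
   obtain N where N: "!!m n. m >= N ==> n >= N ==> H2_nrm D (%x. f m x - f n x) < e" using Cauchy[OF e] by blast
   have "L2_nrm M (%x. jet D bs (f m) x - jet D bs (f n) x) <= H2_nrm D (%x. f m x - f n x)" for m n
    unfolding diffn[OF f f bs, symmetric] H2_nrm_L2_set by (rule member_le_L2_set[OF finite_jets2 bs])
   thus ?thesis using N by (meson le_less_trans)
  qed
  show "EX g. g : L2 M & (%n. L2_nrm M (%x. jet D bs (f n) x - g x)) ----> 0"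
   by (rule L2_complete[OF finite_measure_M jet_L2[OF f bs] C]) (assumption, intro exI conjI)
 qed
 from bchoice[OF this] obtain g where
  g0: "ALL bs:jets2. g bs : L2 M & (%n. L2_nrm M (%x. jet D bs (f n) x - g bs x)) ----> 0" ..
 hence g: "!!bs. bs : jets2 ==> g bs : L2 M"
  "!!bs. bs : jets2 ==> (%n. L2_nrm M (%x. jet D bs (f n) x - g bs x)) ----> 0" by simp_all
 have j: "[] : (jets2 :: 'a list set)" "!!b. b : Basis ==> [b] : (jets2 :: 'a list set)" "!!b c. b : Basis ==> c : Basis ==> [c, b] : (jets2 :: 'a list set)"
  by (auto simp: jets2_def)
 define u where "u = g []"
 have d1: "has_weak_deriv D b u (g [b])" if b: "b : Basis" for b
  unfolding u_def
  by (rule weak_deriv_closed[OF _ g(1)[OF j(1)] g(1)[OF j(2)[OF b]] g(2)[OF j(1)] g(2)[OF j(2)[OF b]] b])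
    (use H1_wderiv[OF H2_H1[OF f] b] in simp)
 have d2: "has_weak_deriv D c (g [b]) (g [c, b])" if b: "b : Basis" and c: "c : Basis" for b c
  by (rule weak_deriv_closed[OF _ g(1)[OF j(2)[OF b]] g(1)[OF j(3)[OF b c]] g(2)[OF j(2)[OF b]] g(2)[OF j(3)[OF b c]] c])
    (use H1_wderiv[OF H2_wderiv[OF f b] c] in simp)
 have u1: "u : H1 D" by (rule H1I[OF d1])
 have gH: "g [b] : H1 D" if "b : Basis" for b by (rule H1I[OF d2[OF that]])
 have w1: "AE x in M. wderiv D b u x = g [b] x" if "b : Basis" for b by (rule wderiv_AE[OF d1[OF that]])
 note wm = L2_measurable[OF wderiv_L2[OF u1]]
 \<comment> \<open>\<open>wderiv D b u\<close> and the limit \<open>g [b]\<close> agree only almost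
   everywhere, so second derivatives have to be compared through \<open>H1_cong_AE\<close>.\<close>
 have w1': "AE x in M. g [b] x = wderiv D b u x" if "b : Basis" for b using w1[OF that] by eventually_elim simp
 have u2: "u : H2 D"
  unfolding H2_def using u1 H1_cong_AE(1)[OF gH w1' wm] by blast
 have w2: "AE x in M. wderiv D c (wderiv D b u) x = g [c, b] x" if b: "b : Basis" and c: "c : Basis" for b c
  using H1_cong_AE(2)[OF gH[OF b] w1'[OF b] wm[OF b] c] wderiv_AE[OF d2[OF b c]] by eventually_elim simp
 have ju: "AE x in M. jet D bs u x = g bs x" if bs: "bs : jets2" for bs
  using bs by (cases rule: jets2_cases) (use w1 w2 in "auto simp: u_def")
 have "(%n. L2_nrm M (jet D bs (%x. f n x - u x))) ----> 0" if bs: "bs : jets2" for bs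
 proof -
  have "L2_nrm M (jet D bs (%x. f n x - u x)) = L2_nrm M (%x. jet D bs (f n) x - g bs x)" for n
   unfolding diffn[OF f u2 bs]
   by (rule L2_nrm_cong_AE)
     (use ju[OF bs] in "auto intro!: L2_measurable[OF L2_diff[OF jet_L2[OF f bs] jet_L2[OF u2 bs]]] L2_measurable[OF L2_diff[OF jet_L2[OF f bs] g(1)[OF bs]]] elim: eventually_mono")
  thus ?thesis using g(2)[OF bs] by simp
 qed
 hence "(%n. sqrt (SUM bs:jets2. (L2_nrm M (jet D bs (%x. f n x - u x)))^2)) ----> sqrt (SUM bs:(jets2::'a list set). 0^2)"
  by (intro tendsto_real_sqrt tendsto_sum tendsto_power)
 hence "(%n. H2_nrm D (%x. f n x - u x)) ----> 0" by (simp add: H2_nrm_L2_set L2_set_def)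
 with u2 show ?thesis by blast
qed

lemma semi_hilbert_H2: "semi_hilbert (H2 D) H2_ip (H2_nrm D)"
proof
 fix u v w :: "'a => complex" and c :: complex and t :: real
 let ?J = "%bs. LINT x|M. jet D bs u x * cnj (jet D bs v x)"
 show "(%x. u x + v x) : H2 D" if "u : H2 D" "v : H2 D" using H2_lincomb[OF that, of 1 1] by simp
 show "(%x. c * u x) : H2 D" if "u : H2 D" using H2_lincomb[OF that that, of c 0] by simp
 show "H2_ip (%x. u x + v x) w = H2_ip u w + H2_ip v w" if "u : H2 D" "v : H2 D" "w : H2 D"
  using H2_ip_lincomb[OF that, of 1 1] by simp
 show "H2_ip (%x. of_real t * u x) w = t * H2_ip u w" if "u : H2 D" "w : H2 D"
  using H2_ip_lincomb[OF that(1,1,2), of t 0] by simp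
 show "H2_ip u v = H2_ip v u"
  unfolding H2_ip_def
 proof (rule sum.cong[OF refl])
  fix bs :: "'a list"
  have "(LINT x|M. jet D bs v x * cnj (jet D bs u x)) = cnj (?J bs)"
   using integral_bounded_linear'[OF bounded_linear_cnj bounded_linear_cnj, of M "%x. jet D bs u x * cnj (jet D bs v x)"] by (simp add: mult.commute)
  thus "Re (?J bs) = Re (LINT x|M. jet D bs v x * cnj (jet D bs u x))" by simp
 qed
 show "H2_ip u u = (H2_nrm D u)^2"
  unfolding H2_ip_def H2_nrm_jets
 proof (rule sum.cong[OF refl])
  fix bs :: "'a list"
  have "(LINT x|M. jet D bs u x * cnj (jet D bs u x)) = of_real ((L2_nrm M (jet D bs u))^2)"
   unfolding L2_nrm_power2 complex_norm_square[symmetric] integral_complex_of_real ..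
  thus "Re (LINT x|M. jet D bs u x * cnj (jet D bs u x)) = (L2_nrm M (jet D bs u))^2" by simp
 qed
 show "0 <= H2_nrm D u" by simp
 show "\<bar>H2_ip u v\<bar> <= H2_nrm D u * H2_nrm D v" if u: "u : H2 D" and v: "v : H2 D"
 proof -
  have "\<bar>H2_ip u v\<bar> <= (SUM bs:jets2. \<bar>Re (?J bs)\<bar>)" unfolding H2_ip_def by (rule sum_abs)
  also have "... <= (SUM bs:jets2. \<bar>L2_nrm M (jet D bs u)\<bar> * \<bar>L2_nrm M (jet D bs v)\<bar>)"
  proof (rule sum_mono)
   fix bs :: "'a list" assume bs: "bs : jets2"
   have "\<bar>Re (?J bs)\<bar> <= cmod (?J bs)" by (rule abs_Re_le_cmod)
   also have "... <= L2_nrm M (jet D bs u) * L2_nrm M (jet D bs v)"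
    using L2_Cauchy_Schwarz[OF jet_L2[OF u bs] L2_cnj[OF jet_L2[OF v bs]]] by simp
   finally show "\<bar>Re (?J bs)\<bar> <= \<bar>L2_nrm M (jet D bs u)\<bar> * \<bar>L2_nrm M (jet D bs v)\<bar>" by simp
  qed
  also have "... <= H2_nrm D u * H2_nrm D v" unfolding H2_nrm_L2_set by (rule L2_set_mult_ineq)
  finally show ?thesis .
 qed
 show "EX u:H2 D. (%n. H2_nrm D (%x. f n x - u x)) ----> 0"
  if "!!n::nat. f n : H2 D" "!!e. e > 0 ==> EX N. ALL m>=N. ALL n>=N. H2_nrm D (%x. f m x - f n x) < e" for f
  by (rule H2_complete[OF that])
qed

end

subsection \<open>Weighted norms and essential bounds\<close>

lemma
 assumes W: "W : borel_measurable N" "AE x in N. 0 <= W x & W x <= B" and f: "f : L2 N"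
 shows weighted_integrable: "integrable N (%x. W x * (cmod (f x))^2)"
  and weighted_lower: "AE x in N. c <= W x ==> c * (L2_nrm N f)^2 <= (LINT x|N. W x * (cmod (f x))^2)"
  and weighted_nonneg: "0 <= (LINT x|N. W x * (cmod (f x))^2)"
proof -
 show i: "integrable N (%x. W x * (cmod (f x))^2)"
 proof (rule Bochner_Integration.integrable_bound[of _ "%x. B * (cmod (f x))^2"])
  show "integrable N (%x. B * (cmod (f x))^2)" using L2_integrable[OF f] by simp
  show "(%x. W x * (cmod (f x))^2) : borel_measurable N" using W(1) L2_measurable[OF f] by measurable
  show "AE x in N. norm (W x * (cmod (f x))^2) <= norm (B * (cmod (f x))^2)"
   using W(2) by eventually_elim (auto simp: abs_mult intro!: mult_right_mono)
 qed
 show "0 <= (LINT x|N. W x * (cmod (f x))^2)"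
  by (rule integral_nonneg_AE) (use W(2) in "auto elim: eventually_mono")
 assume c: "AE x in N. c <= W x"
 have "c * (L2_nrm N f)^2 = (LINT x|N. c * (cmod (f x))^2)" by (simp add: L2_nrm_power2)
 also have "... <= (LINT x|N. W x * (cmod (f x))^2)"
  by (rule integral_mono_AE) (use L2_integrable[OF f] i c in "auto elim!: eventually_mono intro!: mult_right_mono")
 finally show "c * (L2_nrm N f)^2 <= (LINT x|N. W x * (cmod (f x))^2)" .
qed

lemma Linf_nrm_less_AE:
 assumes f: "f : borel_measurable N" and less: "Linf_nrm N f < ereal B"
 shows "AE x in N. \<bar>f x\<bar> <= B"
proof -
 have "AE x in N. ereal \<bar>f x\<bar> <= Linf_nrm N f" unfolding Linf_nrm_def by (rule esssup_AE)
 thus ?thesis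
 proof eventually_elim
  case (elim x)
  hence "ereal \<bar>f x\<bar> < ereal B" using less by (rule le_less_trans)
  thus ?case by simp
 qed
qed

lemma essinf_greater_AE:
 assumes greater: "ereal a < essinf N f"
 obtains c where "a < c" "AE x in N. c <= f x"
proof -
 obtain c where c: "ereal a < ereal c" "ereal c < essinf N f" using ereal_dense2[OF greater] by blast
 have "AE x in N. - ereal (f x) <= esssup N (%x. - ereal (f x))" by (rule esssup_AE)
 hence "AE x in N. c <= f x"
 proof eventually_elim
  case (elim x)
  hence "essinf N f <= ereal (f x)" unfolding essinf_def by (simp add: ereal_uminus_le_reorder)
  hence "ereal c < ereal (f x)" using c(2) by (rule less_le_trans[rotated])
  thus ?case by simp
 qed
 with c(1) show ?thesis by (intro that[of c]) auto
qed

context surface_domain begin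

subsection \<open>Functionals on \<open>H2\<close>\<close>

text \<open>\<open>H2_functional\<close> demands exact linearity, while \<open>T\<close> is linear
  only almost everywhere; pairing with \<open>p\<close> removes the difference. Derivatives, traces
  and normal derivatives all pass to the weak limit in this form.\<close>

lemma weak_limit_integral:
 assumes w: "H2_weakly_converges D v u"
  and T: "!!f. f : H2 D ==> T f : L2 N" "!!f. f : H2 D ==> L2_nrm N (T f) <= C * H2_nrm D f"
  and lin: "!!f g a c. f : H2 D ==> g : H2 D ==> AE x in N. T (%x. a * f x + c * g x) x = a * T f x + c * T g x"
  and p: "p : L2 N"
 shows "(%m. LINT x|N. T (v m) x * p x) ----> (LINT x|N. T u x * p x)"
proof -
 have lc: "(LINT x|N. T (%x. a * f x + c * g x) x * p x) = a * (LINT x|N. T f x * p x) + c * (LINT x|N. T g x * p x)"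
  if "f : H2 D" "g : H2 D" for f g a c
  by (intro integral_lincomb_AE T H2_lincomb p lin that)
 have "H2_functional D (%f. LINT x|N. T f x * p x)"
  unfolding H2_functional_def
 proof (intro conjI ballI allI exI[of _ "C * L2_nrm N p"])
  fix f g assume f: "f : H2 D" and g: "g : H2 D"
  show "(LINT x|N. T (%x. f x + g x) x * p x) = (LINT x|N. T f x * p x) + (LINT x|N. T g x * p x)"
   using lc[OF f g, of 1 1] by simp
 next
  fix f c assume f: "f : H2 D"
  show "(LINT x|N. T (%x. c * f x) x * p x) = c * (LINT x|N. T f x * p x)"
   using lc[OF f f, of c 0] by simp
  have "cmod (LINT x|N. T f x * p x) <= L2_nrm N (T f) * L2_nrm N p" by (rule L2_Cauchy_Schwarz[OF T(1)[OF f] p])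
  also have "... <= (C * H2_nrm D f) * L2_nrm N p" by (intro mult_right_mono T f) simp
  finally show "cmod (LINT x|N. T f x * p x) <= C * L2_nrm N p * H2_nrm D f" by (simp add: mult_ac)
 qed
 thus ?thesis using w unfolding H2_weakly_converges_def by blast
qed

lemma weak_limit:
 assumes w: "H2_weakly_converges D v u"
 shows weak_limit_id: "p : L2 M ==> (%m. LINT x|M. v m x * p x) ----> (LINT x|M. u x * p x)"
  and weak_limit_wderiv: "p : L2 M ==> b : Basis ==> (%m. LINT x|M. wderiv D b (v m) x * p x) ----> (LINT x|M. wderiv D b u x * p x)"
  and weak_limit_laplacian: "p : L2 M ==> (%m. LINT x|M. laplacian D (v m) x * p x) ----> (LINT x|M. laplacian D u x * p x)"
  and weak_limit_trace: "q : L2 sg ==> (%m. LINT x|sg. trace D (v m) x * q x) ----> (LINT x|sg. trace D u x * q x)"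
  and weak_limit_normal_deriv: "q : L2 sg ==> (%m. LINT x|sg. normal_deriv D (v m) x * q x) ----> (LINT x|sg. normal_deriv D u x * q x)"
proof -
 have H1: "H1_nrm D f <= 1 * H2_nrm D f" for f using H1_le_H2_nrm by simp
 show "(%m. LINT x|M. v m x * p x) ----> (LINT x|M. u x * p x)" if p: "p : L2 M"
  by (rule weak_limit_integral[OF w, where T="%f. f" and C=1])
    (use p H1_L2[OF H2_H1] order_trans[OF L2_le_H1_nrm H1] in auto)
 show "(%m. LINT x|M. wderiv D b (v m) x * p x) ----> (LINT x|M. wderiv D b u x * p x)" if p: "p : L2 M" and b: "b : Basis"
  by (rule weak_limit_integral[OF w, where T="wderiv D b" and C=1])
    (use p wderiv_L2[OF H2_H1 b] order_trans[OF wderiv_le_H1_nrm[OF b] H1] wderiv_lincomb[OF H2_H1 H2_H1 b] in auto)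
 show "(%m. LINT x|M. laplacian D (v m) x * p x) ----> (LINT x|M. laplacian D u x * p x)" if p: "p : L2 M"
 proof (rule weak_limit_integral[OF w, where C="real DIM('a)"])
  fix f assume f: "f : H2 D"
  show "laplacian D f : L2 M" by (rule laplacian_L2[OF f])
  have "L2_nrm M (laplacian D f) <= (SUM b:Basis. L2_nrm M (wderiv D b (wderiv D b f)))"
   unfolding laplacian_def[abs_def] by (rule L2_triangle_sum) (rule wderiv_L2[OF H2_wderiv[OF f]])
  also have "... <= (SUM b:(Basis::'a set). H2_nrm D f)" by (intro sum_mono wderiv2_le_H2_nrm)
  finally show "L2_nrm M (laplacian D f) <= real DIM('a) * H2_nrm D f" by simp
 qed (use p laplacian_lincomb in auto)
 show "(%m. LINT x|sg. trace D (v m) x * q x) ----> (LINT x|sg. trace D u x * q x)" if q: "q : L2 sg"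
 proof (rule weak_limit_integral[OF w, where C=trace_const])
  fix f assume f: "f : H2 D"
  show "trace D f : L2 sg" by (rule trace_L2[OF H2_H1[OF f]])
  have "L2_nrm sg (trace D f) <= trace_const * H1_nrm D f" by (rule trace_nrm[OF H2_H1[OF f]])
  also have "... <= trace_const * H2_nrm D f" by (intro mult_left_mono H1_le_H2_nrm trace_const)
  finally show "L2_nrm sg (trace D f) <= trace_const * H2_nrm D f" .
 next
  fix f g a c assume f: "f : H2 D" and g: "g : H2 D"
  show "AE x in sg. trace D (%x. a * f x + c * g x) x = a * trace D f x + c * trace D g x"
   by (rule trace_lincomb[OF H2_H1[OF f] H2_H1[OF g] H2_H1[OF H2_lincomb[OF f g]]]) simp
 qed (rule q)
 show "(%m. LINT x|sg. normal_deriv D (v m) x * q x) ----> (LINT x|sg. normal_deriv D u x * q x)" if q: "q : L2 sg"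
 proof (rule weak_limit_integral[OF w normal_deriv_L2 normal_deriv_nrm])
  fix f g a c assume f: "f : H2 D" and g: "g : H2 D"
  have "AE x in sg. ALL b:Basis. trace D (wderiv D b (%x. a * f x + c * g x)) x = a * trace D (wderiv D b f) x + c * trace D (wderiv D b g) x"
   by (intro AE_finite_allI trace_lincomb H2_wderiv H2_lincomb f g wderiv_lincomb H2_H1) auto
  thus "AE x in sg. normal_deriv D (%x. a * f x + c * g x) x = a * normal_deriv D f x + c * normal_deriv D g x"
  proof eventually_elim
   case (elim x)
   thus ?case
    unfolding normal_deriv_def sum_distrib_left sum.distrib[symmetric] by (intro sum.cong) (auto simp: algebra_simps)
  qed
 qed (use q in auto)
qed

lemma H2_cap_H10_H10: "u : H2_cap_H10 D ==> u : H10" and H2_cap_H10_H2: "u : H2_cap_H10 D ==> u : H2 D"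
 unfolding H2_cap_H10_def using trace_0_H10[OF H2_H1] by auto

subsection \<open>The sesquilinear forms\<close>

context
 fixes n :: "'a => real" and c0 c1 :: real
 assumes n: "n : borel_measurable M" and c0: "c0 > 0" and n_bounds: "AE x in M. c0 <= 1 / (n x - 1) & 1 / (n x - 1) <= c1"
begin

lemma weight_measurable: "(%x. 1 / (n x - 1)) : borel_measurable M" using n by measurable

lemma weight_bounds: "AE x in M. 0 <= 1 / (n x - 1) & 1 / (n x - 1) <= c1"
 using n_bounds by eventually_elim (intro conjI order_trans[OF less_imp_le[OF c0]], auto)

lemma weight_mult_L2: assumes p: "p : L2 M" shows "(%x. of_real (1 / (n x - 1)) * p x) : L2 M"
proof (rule L2_bounded_mult[OF _ _ p])
 show "(%x. complex_of_real (1 / (n x - 1))) : borel_measurable M" using weight_measurable by measurable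
 show "AE x in M. cmod (of_real (1 / (n x - 1))) <= c1"
  using weight_bounds by eventually_elim (simp only: norm_of_real abs_of_nonneg)
qed

text \<open>Separates the powers of \<open>k\<close> from integrals that are linear in
  \<open>u\<close> against fixed L2 functions, so that \<open>k m\<close> may converge while
  \<open>u m\<close> converges weakly.\<close>

lemma form_A0_expand:
 assumes u: "u : H2 D" and phi: "phi : H2 D"
 defines "p1 \<equiv> %x. of_real (1 / (n x - 1)) * cnj (laplacian D phi x)"
  and "p2 \<equiv> %x. of_real (1 / (n x - 1)) * cnj (phi x)"
 shows "form_A0 D n k u phi = (LINT x|M. laplacian D u x * p1 x)
   + of_real (k^2) * ((LINT x|M. laplacian D u x * p2 x) + (LINT x|M. u x * p1 x))
   + of_real (k ^ 4) * ((LINT x|M. u x * p2 x) + (LINT x|M. u x * cnj (phi x)))"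
proof -
 note uL = H1_L2[OF H2_H1[OF u]] laplacian_L2[OF u] and phiL = L2_cnj[OF H1_L2[OF H2_H1[OF phi]]] L2_cnj[OF laplacian_L2[OF phi]]
 have pL: "p1 : L2 M" "p2 : L2 M" unfolding p1_def p2_def by (intro weight_mult_L2 phiL)+
 note i = L2_mult_int[OF uL(2) pL(1)] L2_mult_int[OF uL(2) pL(2)] L2_mult_int[OF uL(1) pL(1)]
  L2_mult_int[OF uL(1) pL(2)] L2_mult_int[OF uL(1) phiL(1)]
 have k: "of_real (k ^ 4) = of_real (k^2) * of_real (k^2)"
  unfolding of_real_mult[symmetric] by (simp add: power_add[symmetric])
 have "form_A0 D n k u phi = (LINT x|M. laplacian D u x * p1 x + of_real (k^2) * (laplacian D u x * p2 x + u x * p1 x)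
   + of_real (k ^ 4) * (u x * p2 x + u x * cnj (phi x)))"
  unfolding form_A0_def p1_def p2_def k by (intro Bochner_Integration.integral_cong refl) (simp add: algebra_simps del: of_real_power)
 thus ?thesis using i by simp
qed

lemma form_B_expand:
 assumes u: "u : H1 D" and phi: "phi : H1 D"
 shows "form_B D u phi = (SUM b:Basis. LINT x|M. wderiv D b u x * cnj (wderiv D b phi x))"
 unfolding form_B_def by (intro Bochner_Integration.integral_sum L2_mult_int L2_cnj wderiv_L2 u phi)

lemma forms_weak_limit:
 assumes w: "H2_weakly_converges D v u" and k: "k ----> k0" and phi: "phi : H2 D"
 shows "(%m. form_A0 D n (k m) (v m) phi - of_real ((k m)^2) * form_B D (v m) phi)
  ----> form_A0 D n k0 u phi - of_real (k0^2) * form_B D u phi"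
proof -
 have vu: "v m : H2 D" "u : H2 D" for m using w by (auto simp: H2_weakly_converges_def)
 note L = L2_cnj[OF H1_L2[OF H2_H1[OF phi]]]
 note p = weight_mult_L2[OF L2_cnj[OF laplacian_L2[OF phi]]] weight_mult_L2[OF L]
 show ?thesis
  unfolding form_A0_expand[OF vu(1) phi] form_A0_expand[OF vu(2) phi] form_B_expand[OF H2_H1[OF vu(1)] H2_H1[OF phi]]
   form_B_expand[OF H2_H1[OF vu(2)] H2_H1[OF phi]]
  by (intro tendsto_intros k weak_limit_id[OF w] weak_limit_laplacian[OF w] weak_limit_wderiv[OF w] p L L2_cnj wderiv_L2 H2_H1 phi)
qed

section \<open>Energy bounds and the limit of the eigenpairs\<close>

lemma eigenpair_energy:
 assumes adm: "admissible D \<eta>" and eig: "eigenpair D n \<eta> k u" and nrm: "H1_nrm D u = 1"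
 shows "c0 * (L2_nrm M (%x. laplacian D u x + of_real (k^2) * u x))^2 <= k^2"
  and "eps > 0 ==> AE x in sg. \<bar>\<eta> x\<bar> <= eps ==> (L2_nrm sg (normal_deriv D u))^2 <= eps"
proof -
 have k: "k > 0" and uc: "u : H2_cap_H10 D" and eq: "form_A D n \<eta> k u u - of_real (k^2) * form_B D u u = 0"
  using eig by (auto simp: eigenpair_def)
 note u = H2_cap_H10_H2[OF uc]
 have \<eta>m: "\<eta> : borel_measurable sg" using adm by (simp add: admissible_def Linf_def)
 obtain c where c: "0 < c" "AE x in sg. c <= \<eta> x"
  using essinf_greater_AE[of 0 sg \<eta>] adm by (auto simp: admissible_def zero_ereal_def)
 define U where "U x = laplacian D u x + of_real (k^2) * u x" for x
 have UL: "U : L2 M" unfolding U_def[abs_def] by (intro L2_add L2_cmult laplacian_L2 u H1_L2 H2_H1)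
 note nL = normal_deriv_L2[OF u]
 define I1 where "I1 = (LINT x|M. 1 / (n x - 1) * (cmod (U x))^2)"
 define I2 where "I2 = (LINT x|sg. 1 / \<eta> x * (cmod (normal_deriv D u x))^2)"
 define G where "G = (SUM b:Basis. (L2_nrm M (wderiv D b u))^2)"
 have G1: "G <= 1" using H1_nrm_power2[of u] zero_le_power2[of "L2_nrm M u"] unfolding G_def nrm power_one by linarith
 have W: "(%x. 1 / \<eta> x) : borel_measurable sg" "AE x in sg. 0 <= 1 / \<eta> x & 1 / \<eta> x <= 1 / c"
  using \<eta>m c(1) by (measurable, intro eventually_mono[OF c(2)]) (auto intro!: divide_left_mono)
 have A0: "form_A0 D n k u u = of_real (I1 + k ^ 4 * (L2_nrm M u)^2)"
 proof -
  have "form_A0 D n k u u = (LINT x|M. of_real (1 / (n x - 1) * (cmod (U x))^2 + k ^ 4 * (cmod (u x))^2))"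
   unfolding form_A0_def U_def
   by (intro Bochner_Integration.integral_cong refl) (simp add: complex_norm_square mult.assoc del: of_real_power)
  also have "... = of_real (LINT x|M. 1 / (n x - 1) * (cmod (U x))^2 + k ^ 4 * (cmod (u x))^2)"
   by (rule integral_complex_of_real)
  also have "(LINT x|M. 1 / (n x - 1) * (cmod (U x))^2 + k ^ 4 * (cmod (u x))^2) = I1 + k ^ 4 * (L2_nrm M u)^2"
   using weighted_integrable[OF weight_measurable weight_bounds UL] L2_integrable[OF H1_L2[OF H2_H1[OF u]]]
   by (simp add: I1_def L2_nrm_power2)
  finally show ?thesis .
 qed
 have Bd: "(LINT x|sg. of_real (k^2 / \<eta> x) * normal_deriv D u x * cnj (normal_deriv D u x)) = of_real (k^2 * I2)"
 proof -
  have "(LINT x|sg. of_real (k^2 / \<eta> x) * normal_deriv D u x * cnj (normal_deriv D u x))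
   = (LINT x|sg. of_real (k^2 * (1 / \<eta> x * (cmod (normal_deriv D u x))^2)))"
   by (intro Bochner_Integration.integral_cong refl) (simp add: complex_norm_square mult.assoc del: of_real_power)
  also have "... = complex_of_real (LINT x|sg. k^2 * (1 / \<eta> x * (cmod (normal_deriv D u x))^2))" by (rule integral_complex_of_real)
  also have "(LINT x|sg. k^2 * (1 / \<eta> x * (cmod (normal_deriv D u x))^2)) = k^2 * I2"
   unfolding I2_def by (rule integral_mult_right_zero)
  finally show ?thesis .
 qed
 have B: "form_B D u u = of_real G"
 proof -
  have "(LINT x|M. wderiv D b u x * cnj (wderiv D b u x)) = of_real ((L2_nrm M (wderiv D b u))^2)" for b
   unfolding L2_nrm_power2 complex_norm_square[symmetric] integral_complex_of_real ..
  thus ?thesis unfolding form_B_expand[OF H2_H1[OF u] H2_H1[OF u]] G_def by (simp del: of_real_power)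
 qed
 have "complex_of_real (I1 + k ^ 4 * (L2_nrm M u)^2 + k^2 * I2) = of_real (k^2 * G)"
  using eq unfolding form_A_def A0 Bd B by (simp only: of_real_add of_real_mult right_minus_eq)
 \<comment> \<open>All terms on the left are nonnegative and \<open>G <= 1\<close> by the
   normalization, so each is at most \<open>k^2\<close>. In the boundary term the factor
   \<open>k^2\<close> cancels, which makes the bound on the normal derivative independent of
   \<open>k\<close>.\<close>
 hence e: "I1 + k ^ 4 * (L2_nrm M u)^2 + k^2 * I2 = k^2 * G" by (simp only: of_real_eq_iff)
 have I1: "0 <= I1" unfolding I1_def by (rule weighted_nonneg[OF weight_measurable weight_bounds UL])
 have I2: "0 <= I2" unfolding I2_def by (rule weighted_nonneg[OF W nL])
 have u4: "0 <= k ^ 4 * (L2_nrm M u)^2" using k by simp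
 have kI2: "0 <= k^2 * I2" using I2 by simp
 have kG: "k^2 * G <= k^2" using G1 by (simp add: mult_left_le)
 have "c0 * (L2_nrm M U)^2 <= I1"
  unfolding I1_def by (rule weighted_lower[OF weight_measurable weight_bounds UL]) (use n_bounds in "auto elim: eventually_mono")
 also have "... <= k^2" using e kG u4 kI2 by linarith
 finally show "c0 * (L2_nrm M (%x. laplacian D u x + of_real (k^2) * u x))^2 <= k^2" by (simp add: U_def[abs_def])
 assume eps: "eps > 0" and le: "AE x in sg. \<bar>\<eta> x\<bar> <= eps"
 have "k^2 * I2 <= k^2 * 1" using e kG I1 u4 by linarith
 hence "I2 <= 1" using k by (simp only: mult_le_cancel_left_pos zero_less_power)
 have "AE x in sg. 1 / eps <= 1 / \<eta> x"
  using le c(2) by eventually_elim (use c(1) in "auto intro!: divide_left_mono")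
 hence "1 / eps * (L2_nrm sg (normal_deriv D u))^2 <= I2" unfolding I2_def by (rule weighted_lower[OF W nL])
 with \<open>I2 <= 1\<close> have "(L2_nrm sg (normal_deriv D u))^2 / eps <= 1" by simp
 thus "(L2_nrm sg (normal_deriv D u))^2 <= eps" using eps by (simp add: pos_divide_le_eq)
qed

text \<open>Kept explicit in \<open>k\<close> because it tends to 0 with \<open>k\<close>, which
  later excludes \<open>k0 = 0\<close>.\<close>

lemma laplacian_bound:
 assumes adm: "admissible D \<eta>" and eig: "eigenpair D n \<eta> k u" and nrm: "H1_nrm D u = 1"
 shows "L2_nrm M (laplacian D u) <= k / sqrt c0 + k^2"
proof -
 have k: "k > 0" and u: "u : H2 D" using eig H2_cap_H10_H2 by (auto simp: eigenpair_def)
 define U where "U x = laplacian D u x + of_real (k^2) * u x" for x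
 note uL = H1_L2[OF H2_H1[OF u]]
 have UL: "U : L2 M" unfolding U_def[abs_def] by (intro L2_add L2_cmult laplacian_L2 u uL)
 have "(L2_nrm M U)^2 <= (k / sqrt c0)^2"
  using eigenpair_energy(1)[OF adm eig nrm] c0 by (simp add: U_def[abs_def] power_divide pos_le_divide_eq mult.commute)
 hence 1: "L2_nrm M U <= k / sqrt c0" by (rule power2_le_imp_le) (use k c0 in simp)
 have "L2_nrm M (laplacian D u) = L2_nrm M (%x. U x - of_real (k^2) * u x)" by (simp add: U_def)
 also have "... <= L2_nrm M U + L2_nrm M (%x. of_real (k^2) * u x)"
  by (rule L2_triangle_minus[OF UL L2_cmult[OF uL]])
 also have "L2_nrm M (%x. of_real (k^2) * u x) = k^2 * L2_nrm M u" by (simp add: L2_nrm_cmult norm_power)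
 also have "... <= k^2 * 1" using L2_le_H1_nrm[of u] nrm by (intro mult_left_mono) auto
 finally show ?thesis using 1 by simp
qed

lemma eigenfunctions_converge:
 fixes \<eta> :: "nat => 'a => real" and k :: "nat => real"
 assumes adm: "!!m. admissible D (\<eta> m)" and lim: "(%m. Linf_nrm sg (\<eta> m)) ----> 0"
  and eig: "!!m. eigenpair D n (\<eta> m) (k m) (u m)" and nrm: "!!m. H1_nrm D (u m) = 1" and kb: "bounded (range k)"
 shows "EX r k0 u0. strict_mono r & (%m. k (r m)) ----> k0 &
      H2_weakly_converges D (%m. u (r m)) u0 & eigenpair0 D n k0 u0"
proof -
 have kpos: "k m > 0" and uc: "u m : H2_cap_H10 D" for m using eig[of m] by (auto simp: eigenpair_def)
 note u2 = H2_cap_H10_H2[OF uc] and u10 = H2_cap_H10_H10[OF uc]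
 obtain K where K: "!!m. k m <= K" using bounded_imp_bdd_above[OF kb] by (auto simp: bdd_above_def)
 have K0: "K > 0" using K[of 0] kpos[of 0] by linarith
 define Lam where "Lam = K / sqrt c0 + K^2"
 have Lam: "L2_nrm M (laplacian D (u m)) <= Lam" for m
 proof -
  have "k m / sqrt c0 + (k m)^2 <= Lam"
   unfolding Lam_def using K[of m] kpos[of m] c0 by (intro add_mono divide_right_mono power_mono) auto
  thus ?thesis using laplacian_bound[OF adm eig nrm, of m] by linarith
 qed
 obtain C where C: "C >= 0" "!!f. f : H2 D ==> f : H10 ==>
   (H2_nrm D f)^2 <= (H1_nrm D f)^2 + (L2_nrm M (laplacian D f))^2 + C * (H1_nrm D f * H2_nrm D f)"
  using H2_a_priori by blast
 \<comment> \<open>For an H2 norm \<open>X\<close> above 1 the constant part of the quadratic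
   inequality is at most \<open>(1 + Lam^2) * X\<close>, and dividing by \<open>X\<close> gives the
   bound.\<close>
 have H2b: "H2_nrm D (u m) <= 1 + Lam^2 + C" for m
 proof (cases "H2_nrm D (u m) <= 1")
  case False
  let ?X = "H2_nrm D (u m)"
  have "(L2_nrm M (laplacian D (u m)))^2 <= Lam^2" by (intro power_mono Lam) simp
  hence "?X * ?X <= 1 + Lam^2 + C * ?X" using C(2)[OF u2[of m] u10[of m]] nrm[of m] by (simp add: power2_eq_square)
  also have "... <= (1 + Lam^2) * ?X + C * ?X" using False mult_left_mono[of 1 ?X "1 + Lam^2"] by simp
  also have "... = (1 + Lam^2 + C) * ?X" by (simp add: distrib_right)
  finally show ?thesis using False by (intro mult_right_le_imp_le[of ?X ?X]) auto
 qed (use C(1) in "auto intro: add_nonneg_nonneg order_trans")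
 interpret H: semi_hilbert "H2 D" H2_ip "H2_nrm D" by (rule semi_hilbert_H2)
 obtain s u0 where s: "strict_mono s" and u0: "u0 : H2 D"
  and fs: "!!l. H2_functional D l ==> (%m. l (u (s m))) ----> l u0"
 proof (rule H.weak_compactness[where x=u, OF u2 H2b])
  fix s u0 assume su: "strict_mono s" "u0 : H2 D"
   and L: "!!l K. (!!u v. u : H2 D ==> v : H2 D ==> l (%x. u x + v x) = l u + l v) ==>
    (!!u c. u : H2 D ==> l (%x. c * u x) = c * l u) ==>
    (!!u. u : H2 D ==> cmod (l u) <= K * H2_nrm D u) ==> (%m. l (u (s m))) ----> l u0"
  show thesis
  proof (rule that[OF su])
   fix l assume l: "H2_functional D l"
   then obtain K where "ALL u:H2 D. cmod (l u) <= K * H2_nrm D u" unfolding H2_functional_def by blast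
   hence K: "!!u. u : H2 D ==> cmod (l u) <= K * H2_nrm D u" by blast
   show "(%m. l (u (s m))) ----> l u0" by (rule L[OF _ _ K]) (use l in "auto simp: H2_functional_def")
  qed
 qed
 have "bounded (range (k \<circ> s))" by (rule bounded_subset[OF kb]) auto
 from bounded_imp_convergent_subsequence[OF this] obtain k0 t where t: "strict_mono t" "((k \<circ> s) \<circ> t) ----> k0" by blast
 define r where "r = s \<circ> t"
 have r: "strict_mono r" unfolding r_def by (rule strict_mono_o[OF s t(1)])
 have kr: "(%m. k (r m)) ----> k0" using t(2) by (simp add: r_def o_def)
 have w: "H2_weakly_converges D (%m. u (r m)) u0"
  unfolding H2_weakly_converges_def
 proof (intro conjI allI impI u2 u0)
  fix l assume l: "H2_functional D l"
  have "(%m. l (u (s m))) ----> l u0" by (rule fs[OF l])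
  from LIMSEQ_subseq_LIMSEQ[OF this t(1)] show "(%m. l (u (r m))) ----> l u0" by (simp add: r_def o_def)
 qed
 \<comment> \<open>Pairing with the trace of the limit itself turns weak convergence into a
   statement about the norm of that trace.\<close>
 have tr0: "AE x in sg. trace D u0 x = 0"
 proof -
  note L = trace_L2[OF H2_H1[OF u0]]
  have "(%m. LINT x|sg. trace D (u (r m)) x * cnj (trace D u0 x)) ----> (LINT x|sg. trace D u0 x * cnj (trace D u0 x))"
   by (rule weak_limit_trace[OF w L2_cnj[OF L]])
  moreover have "(LINT x|sg. trace D (u (r m)) x * cnj (trace D u0 x)) = 0" for m
   using uc[of "r m"] by (intro integral_eq_zero_AE) (auto simp: H2_cap_H10_def elim: eventually_mono)
  moreover have "(LINT x|sg. trace D u0 x * cnj (trace D u0 x)) = of_real ((L2_nrm sg (trace D u0))^2)"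
   unfolding L2_nrm_power2 complex_norm_square[symmetric] integral_complex_of_real ..
  ultimately have "L2_nrm sg (trace D u0) = 0" by (simp add: LIMSEQ_const_iff)
  thus ?thesis by (simp add: L2_nrm_eq_0_iff[OF L])
 qed
 \<comment> \<open>The same pairing; here the normal derivatives of \<open>u m\<close> are not 0 but
   tend to 0 strongly, because their squared norms are bounded by the vanishing
   conductivities.\<close>
 have nd0: "AE x in sg. normal_deriv D u0 x = 0"
 proof -
  note L = normal_deriv_L2[OF u0]
  have "(%m. L2_nrm sg (normal_deriv D (u m))) ----> 0"
  proof (rule LIMSEQ_I)
   fix e :: real assume e: "e > 0"
   have "\<forall>\<^sub>F m in sequentially. Linf_nrm sg (\<eta> m) < ereal ((e / 2)^2)"
    by (rule order_tendstoD(2)[OF lim]) (use e in simp)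
   then obtain N where N: "!!m. m >= N ==> Linf_nrm sg (\<eta> m) < ereal ((e / 2)^2)" by (auto simp: eventually_sequentially)
   have "L2_nrm sg (normal_deriv D (u m)) < e" if "m >= N" for m
   proof -
    have "\<eta> m : borel_measurable sg" using adm[of m] by (simp add: admissible_def Linf_def)
    from Linf_nrm_less_AE[OF this N[OF that]]
    have "(L2_nrm sg (normal_deriv D (u m)))^2 <= (e / 2)^2" using e by (intro eigenpair_energy(2)[OF adm eig nrm]) auto
    hence "L2_nrm sg (normal_deriv D (u m)) <= e / 2" by (rule power2_le_imp_le) (use e in simp)
    thus ?thesis using e by linarith
   qed
   thus "EX no. ALL m>=no. norm (L2_nrm sg (normal_deriv D (u m)) - 0) < e" by auto
  qed
  from LIMSEQ_subseq_LIMSEQ[OF this r]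
  have "(%m. L2_nrm sg (normal_deriv D (u (r m))) * L2_nrm sg (normal_deriv D u0)) ----> 0 * L2_nrm sg (normal_deriv D u0)"
   by (intro tendsto_mult tendsto_const) (simp add: o_def)
  hence z: "(%m. L2_nrm sg (normal_deriv D (u (r m))) * L2_nrm sg (normal_deriv D u0)) ----> 0" by simp
  have "(%m. LINT x|sg. normal_deriv D (u (r m)) x * cnj (normal_deriv D u0 x)) ----> 0"
  proof (rule tendsto_norm_zero_cancel, rule tendsto_0_dominated[OF z])
   show "cmod (LINT x|sg. normal_deriv D (u (r m)) x * cnj (normal_deriv D u0 x))
    <= L2_nrm sg (normal_deriv D (u (r m))) * L2_nrm sg (normal_deriv D u0)" for m
    using L2_Cauchy_Schwarz[OF normal_deriv_L2[OF u2] L2_cnj[OF L], of "r m"] by simp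
  qed simp
  moreover have "(%m. LINT x|sg. normal_deriv D (u (r m)) x * cnj (normal_deriv D u0 x)) ----> (LINT x|sg. normal_deriv D u0 x * cnj (normal_deriv D u0 x))"
   by (rule weak_limit_normal_deriv[OF w L2_cnj[OF L]])
  moreover have "(LINT x|sg. normal_deriv D u0 x * cnj (normal_deriv D u0 x)) = of_real ((L2_nrm sg (normal_deriv D u0))^2)"
   unfolding L2_nrm_power2 complex_norm_square[symmetric] integral_complex_of_real ..
  ultimately have "complex_of_real ((L2_nrm sg (normal_deriv D u0))^2) = 0" by (intro LIMSEQ_unique) simp_all
  hence "L2_nrm sg (normal_deriv D u0) = 0" by simp
  thus ?thesis by (simp add: L2_nrm_eq_0_iff[OF L])
 qed
 have u00: "u0 : H20 D" using u0 tr0 nd0 by (simp add: H20_def)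
 define G where "G m = (SUM b:Basis. (L2_nrm M (wderiv D b (u (r m))))^2)" for m
 define a where "a m = L2_nrm M (u (r m))" for m
 have one: "(a m)^2 + G m = 1" for m using H1_nrm_power2[of "u (r m)"] nrm by (simp add: a_def G_def)
 have G0: "G m >= 0" for m by (simp add: G_def sum_nonneg)
 have a1: "0 <= a m" "a m <= 1" for m using L2_le_H1_nrm[of "u (r m)"] nrm by (simp_all add: a_def)
 have G_le: "G m <= L2_nrm M (laplacian D (u (r m))) * a m" for m
  unfolding G_def a_def by (rule gradient_le_laplacian[OF u2 u10])
 have contra: False if "a ----> 0" "G ----> 0"
 proof -
  have "(%m. (a m)^2 + G m) ----> 0^2 + 0" by (intro tendsto_intros that)
  thus False by (simp add: one LIMSEQ_const_iff)
 qed
 \<comment> \<open>Otherwise the Laplacians tend to 0 and with them the gradients; the Poincare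
   inequality then sends the L2 norms to 0 as well, against the normalization.\<close>
 have k0: "k0 > 0"
 proof (rule ccontr)
  assume "~ k0 > 0"
  moreover have "k0 >= 0" by (rule LIMSEQ_le_const[OF kr]) (use kpos less_imp_le in blast)
  ultimately have "k0 = 0" by simp
  with kr have k0: "(%m. k (r m)) ----> 0" by simp
  have "(%m. k (r m) / sqrt c0 + (k (r m))^2) ----> 0 / sqrt c0 + 0^2" by (intro tendsto_intros k0) (use c0 in simp)
  hence b: "(%m. k (r m) / sqrt c0 + (k (r m))^2) ----> 0" by simp
  have G: "G ----> 0"
  proof (rule tendsto_0_dominated[OF b G0])
   fix m
   have "G m <= L2_nrm M (laplacian D (u (r m))) * 1" using G_le[of m] a1(2)[of m] mult_left_mono[OF a1(2), of "L2_nrm M (laplacian D (u (r m)))" m] by simp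
   thus "G m <= k (r m) / sqrt c0 + (k (r m))^2" using laplacian_bound[OF adm eig nrm, of "r m"] by linarith
  qed
  obtain P where P: "P > 0" "!!v. v : H10 ==> L2_nrm M v <= P * grad_nrm v" using Poincare by blast
  have "(%m. P * (real DIM('a) * sqrt (G m))) ----> P * (real DIM('a) * sqrt 0)" by (intro tendsto_intros G)
  hence z: "(%m. P * (real DIM('a) * sqrt (G m))) ----> 0" by simp
  have "a ----> 0"
  proof (rule tendsto_0_dominated[OF z a1(1)])
   fix m
   have "L2_nrm M (wderiv D b (u (r m))) <= sqrt (G m)" if b: "b : Basis" for b
    unfolding G_def by (rule real_le_rsqrt) (rule member_le_sum[OF b], auto)
   hence "grad_nrm (u (r m)) <= (SUM b:(Basis::'a set). sqrt (G m))" unfolding grad_nrm_def by (rule sum_mono)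
   hence "P * grad_nrm (u (r m)) <= P * (real DIM('a) * sqrt (G m))" using P(1) by (intro mult_left_mono) auto
   thus "a m <= P * (real DIM('a) * sqrt (G m))" using P(2)[OF u10[of "r m"]] by (simp add: a_def)
  qed
  thus False using contra G by blast
 qed
 \<comment> \<open>A zero weak limit would give strong L2 convergence to 0 by
   \<open>Rellich\<close>, and the gradients would follow because the Laplacians are
   bounded.\<close>
 have nz: "~ (AE x in M. u0 x = 0)"
 proof
  assume z: "AE x in M. u0 x = 0"
  have "(%m. L2_nrm M (u (r m))) ----> 0"
  proof (rule Rellich[OF u10, where C="real DIM('a)"])
   have d: "1 <= real DIM('a)" using dim by simp
   show "L2_nrm M (u (r m)) <= real DIM('a)" for m by (rule order_trans[OF _ d]) (use a1(2)[of m] in "simp add: a_def")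
   have "L2_nrm M (wderiv D b (u (r m))) <= 1" if "b : Basis" for b m using wderiv_le_H1_nrm[OF that, of "u (r m)"] nrm by simp
   hence "grad_nrm (u (r m)) <= (SUM b:(Basis::'a set). 1)" for m unfolding grad_nrm_def by (intro sum_mono)
   thus "grad_nrm (u (r m)) <= real DIM('a)" for m by simp
   fix g assume "g : L2 M"
   from weak_limit_id[OF w this] have "(%m. LINT x|M. u (r m) x * g x) ----> (LINT x|M. u0 x * g x)" .
   also have "(LINT x|M. u0 x * g x) = 0" by (rule integral_eq_zero_AE) (use z in "auto elim: eventually_mono")
   finally show "(%m. LINT x|M. u (r m) x * g x) ----> 0" .
  qed
  hence a0: "a ----> 0" by (simp add: a_def[abs_def])
  have "(%m. Lam * a m) ----> Lam * 0" by (intro tendsto_intros a0)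
  hence b: "(%m. Lam * a m) ----> 0" by simp
  have "G ----> 0"
  proof (rule tendsto_0_dominated[OF b G0])
   show "G m <= Lam * a m" for m using G_le[of m] mult_right_mono[OF Lam a1(1), of "r m" m] by linarith
  qed
  with a0 show False by (rule contra)
 qed
 \<comment> \<open>A test function with vanishing normal derivative removes the boundary integral
   for every \<open>m\<close>, however large \<open>1 / \<eta> m x\<close> is.\<close>
 have eqn: "form_A0 D n k0 u0 phi - of_real (k0^2) * form_B D u0 phi = 0" if phi: "phi : H20 D" for phi
 proof -
  have phi2: "phi : H2 D" and phic: "phi : H2_cap_H10 D" and phin: "AE x in sg. normal_deriv D phi x = 0"
   using phi by (auto simp: H20_def H2_cap_H10_def)
  have "form_A0 D n (k m) (u m) phi - of_real ((k m)^2) * form_B D (u m) phi = 0" for m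
  proof -
   have "(LINT x|sg. of_real ((k m)^2 / \<eta> m x) * normal_deriv D (u m) x * cnj (normal_deriv D phi x)) = 0"
    by (rule integral_eq_zero_AE, rule eventually_mono[OF phin]) simp
   moreover have "form_A D n (\<eta> m) (k m) (u m) phi - of_real ((k m)^2) * form_B D (u m) phi = 0"
    using eig[of m] phic unfolding eigenpair_def by blast
   ultimately show ?thesis unfolding form_A_def by (simp only: add_0_right)
  qed
  thus ?thesis using forms_weak_limit[OF w kr phi2] by (simp add: LIMSEQ_const_iff)
 qed
 have "eigenpair0 D n k0 u0" using k0 u00 nz eqn by (simp add: eigenpair0_def)
 with r kr w show ?thesis by blast
qed

end

end

theorem theorem3p3:
  fixes D :: "'a::euclidean_space set"
    and n :: "'a \<Rightarrow> real"
    and \<eta> :: "nat \<Rightarrow> 'a \<Rightarrow> real"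
    and k :: "nat \<Rightarrow> real"
    and u :: "nat \<Rightarrow> 'a \<Rightarrow> complex"
  assumes "DIM('a) \<in> {2, 3}"
    and "open D" and "bounded D" and "simply_connected D" and "C2_boundary D"
    and "n \<in> Linf (lebesgue_on D)" and "essinf (lebesgue_on D) n > 1"
    and "\<And>m. admissible D (\<eta> m)"
    and "(\<lambda>m. Linf_nrm (surface_measure D) (\<eta> m)) \<longlonglongrightarrow> 0"
    and "\<And>m. eigenpair D n (\<eta> m) (k m) (u m)"
    and "\<And>m. H1_nrm D (u m) = 1"
    and "bounded (range k)"
  shows "\<exists>r k0 u0. strict_mono r \<and> (\<lambda>m. k (r m)) \<longlonglongrightarrow> k0 \<and>
           H2_weakly_converges D (\<lambda>m. u (r m)) u0 \<and> eigenpair0 D n k0 u0"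
proof -
 interpret surface_domain D using assms(1,2,3,5) by unfold_locales auto
 have n: "n : borel_measurable M" "Linf_nrm M n < \<infinity>" using assms(6) by (auto simp: Linf_def)
 obtain B where "Linf_nrm M n < ereal B" using n(2) less_PInf_Ex_of_nat by auto
 from Linf_nrm_less_AE[OF n(1) this] have B: "AE x in M. \<bar>n x\<bar> <= B" .
 obtain c where c: "1 < c" "AE x in M. c <= n x"
  using essinf_greater_AE[of 1 M n] assms(7) by (auto simp: one_ereal_def)
 \<comment> \<open>The denominator \<open>\<bar>B\<bar> + 1\<close> exceeds \<open>n x - 1\<close>
   and is positive for every real \<open>B\<close>, so the lower bound is a positive constant
   whatever \<open>B\<close> is.\<close>
 have "AE x in M. 1 / (\<bar>B\<bar> + 1) <= 1 / (n x - 1) & 1 / (n x - 1) <= 1 / (c - 1)"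
  using B c(2)
 proof eventually_elim
  case (elim x)
  thus ?case using c(1) by (intro conjI divide_left_mono mult_pos_pos) auto
 qed
 thus ?thesis
  by (rule eigenfunctions_converge[OF n(1) _ _ assms(8-12), rotated]) simp
qed

end
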